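(* Let $A=[a_{ij}]_{i,j\in I}$ be a symmetrizable generalized Cartan matrix symmetrized by $\{d_i\}_{i\in I}$, with a root datum $(Y,X,\langle\,,\rangle,\{\alpha_i^\vee\}_{i\in I},\{\alpha_i\}_{i\in I})$ of type $A$, and let integers $\epsilon_{ij}$ ($i,j\in I$) satisfy: $\epsilon_{ij}=\pm1$ and $\epsilon_{ji}=-\epsilon_{ij}$ if $i\ne j$ and $a_{ij}\ne0$, and $\epsilon_{ij}=0$ otherwise. Let $f_{i1},f_{i2}$, $g_i=f_{i1}^{-1}f_{i2}$, $\mathcal A_q$, $Q(\mathcal A_q)$, $\tilde s_i$ and $\gamma((f_{i1}+f_{i2})^\lambda)$ be as defined in the context. For $i\in I$ define the algebra automorphism $S_i$ of $Q(\mathcal A_q)$ by $$S_i=\tilde s_i\circ\gamma((f_{i1}+f_{i2})^{-\alpha_i^\vee})=\gamma((f_{i1}+f_{i2})^{\alpha_i^\vee})\circ\tilde s_i$$ (the two expressions coincide). Then an action of the Weyl group $W=W(A)$ on $Q(\mathcal A_q)$ is defined by $s_i(x)=S_i(x)$ for $i\in I$ and $x\in Q(\mathcal A_q)$. Explicitly, the following formulae define a representation of the Weyl group $W$ in algebra automorphisms of $Q(\mathcal A_q)$: $$s_i(g_j)=\begin{cases}\displaystyle g_j\left(\prod_{\nu=0}^{-a_{ij}-1}\frac{1+q_i^{2\nu}g_i}{1+q_i^{2\nu}q_i^{-2\alpha_i^\vee}g_i}\right)&\text{if }\epsilon_{ij}=+1,\\[3mm]\displaystyle q_i^{2(-a_{ij})\alpha_i^\vee}\left(\prod_{\nu=0}^{-a_{ij}-1}\frac{1+q_i^{2\nu}q_i^{-2\alpha_i^\vee}g_i}{1+q_i^{2\nu}g_i}\right)g_j&\text{if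 }\epsilon_{ij}=-1,\\[3mm] q_i^{-2\alpha_i^\vee}g_i&\text{if }i=j,\\[1mm] g_j&\text{if }a_{ij}=0,\end{cases}$$ $$s_i(q^\lambda)=q^{s_i(\lambda)}=q^{\lambda-\langle\lambda,\alpha_i\rangle\alpha_i^\vee}\quad(\lambda\in d^{-1}Y).$$
   Context: Generalized Cartan matrix (GCM): a matrix $A=[a_{ij}]_{i,j\in I}$ ($I$ finite) of integers with $a_{ii}=2$, $a_{ij}\le 0$ for $i\ne j$, and $a_{ij}=0\iff a_{ji}=0$. It is symmetrized by positive rationals $\{d_i\}$ if $d_ia_{ij}=d_ja_{ji}$ for all $i,j$. A root datum of type $A$: finitely generated free $\mathbb Z$-modules $X,Y$, a perfect bilinear pairing $\langle\,,\rangle:Y\times X\to\mathbb Z$, and families $\alpha_i^\vee\in Y$, $\alpha_i\in X$ with $\langle\alpha_i^\vee,\alpha_j\rangle=a_{ij}$. Let $d$ be the least common denominator of the $d_i$, $\mathbb F=\mathbb Q(q^{1/d})$ ($q^{1/d}$ an indeterminate), $q_i=q^{d_i}$; extend the pairing to $d^{-1}Y\times X\to d^{-1}\mathbb Z$. The Weyl group $W(A)$ is the group generated by $\{s_i\}_{i\in I}$ with relations $s_i^2=1$ and, for $i\neq j$: $s_is_j=s_js_i$ if $a_{ij}a_{ji}=0$; $s_is_js_i=s_js_is_j$ if $a_{ij}a_{ji}=1$; $(s_is_j)^2=(s_js_i)^2$ if $a_{ij}a_{ji}=2$; $(s_is_j)^3=(s_js_i)^3$ if $a_{ij}a_{ji}=3$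 (no relation if $a_{ij}a_{ji}\ge4$). It acts on $Y$ and $d^{-1}Y$ by $s_i(\lambda)=\lambda-\langle\lambda,\alpha_i\rangle\alpha_i^\vee$. $U_q^0=\bigoplus_{\lambda\in d^{-1}Y}\mathbb Fq^\lambda$ is the group algebra of $d^{-1}Y$. $\mathcal B_q$ is the $\mathbb F$-algebra generated by $f_i$ ($i\in I$) and $q^\lambda$ ($\lambda\in d^{-1}Y$) with relations: $q^0=1$, $q^\lambda q^\mu=q^{\lambda+\mu}$, $q^\lambda f_iq^{-\lambda}=q^{-\langle\lambda,\alpha_i\rangle}f_i$, $f_if_j=q_i^{-\epsilon_{ij}a_{ij}}f_jf_i$. Put $k_i=q^{d_i\alpha_i^\vee}\in\mathcal B_q$ and, in $\mathcal B_q\otimes\mathcal B_q$, $f_{i1}=f_i\otimes1$, $f_{i2}=k_i^{-1}\otimes f_i$. Let $\widetilde{\mathcal A}_{q,0}$ be the subalgebra of $\mathcal B_q\otimes\mathcal B_q$ generated by all $f_{i1},f_{i2}$, and $\widetilde{\mathcal A}_q=\widetilde{\mathcal A}_{q,0}\otimes U_q^0$ (so the $q^\lambda\in U_q^0$ commute with the $f_{i1},f_{i2}$). $\widetilde{\mathcal A}_q$ is an Ore domain with skew field of fractions $Q(\widetilde{\mathcal A}_q)$. Put $g_i=f_{i1}^{-1}f_{i2}\in Q(\widetilde{\mathcal A}_q)$ and let $\mathcal A_q$ be the subalgebra of $Q(\widetilde{\mathcal A}_q)$ generated by the $g_i$ ($i\in I$) and $q^\lambda$ ($\lambda\in d^{-1}Y$).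 It is the $\mathbb F$-algebra with these generators and relations $g_ig_j=q_i^{-2\epsilon_{ij}a_{ij}}g_jg_i$, $q^0=1$, $q^\lambda q^\mu=q^{\lambda+\mu}$, $q^\lambda g_i=g_iq^\lambda$; it is an Ore domain with skew field of fractions $Q(\mathcal A_q)\subset Q(\widetilde{\mathcal A}_q)$. $\tilde s_i$ is the algebra automorphism of $Q(\mathcal A_q)$ with $\tilde s_i(g_j)=g_j$ ($j\in I$) and $\tilde s_i(q^\lambda)=q^{s_i(\lambda)}$ ($\lambda\in d^{-1}Y$). For $\lambda\in Y$, write $q_i^\lambda=q^{d_i\lambda}\in U_q^0$ and $q_i^{m\lambda}=(q_i^\lambda)^m$. $\gamma((f_{i1}+f_{i2})^\lambda)$ (conjugation by the non-integral power) is the algebra automorphism of $Q(\mathcal A_q)$ determined by $q^\mu\mapsto q^\mu$ ($\mu\in d^{-1}Y$) and $g_j\mapsto\phi_{ij}(q_i^\lambda)$ ($j\in I$), where $\phi_{ij}(x)=g_j\prod_{\nu=0}^{-a_{ij}-1}\frac{1+q_i^{2\nu}g_i}{1+q_i^{2\nu}x^{-2}g_i}$ if $\epsilon_{ij}=+1$; $\phi_{ij}(x)=x^{2(-a_{ij})}\Big(\prod_{\nu=0}^{-a_{ij}-1}\frac{1+q_i^{2\nu}x^{-2}g_i}{1+q_i^{2\nu}g_i}\Big)g_j$ if $\epsilon_{ij}=-1$; $\phi_{ij}(x)=x^{-2}g_i$ if $i=j$; $\phi_{ij}(x)=g_j$ if $a_{ij}=0$. (All factors in a product commute, so the fractions are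 unambiguous.) *)

theory Defs
  imports
    Complex_Main
    "HOL-Computational_Algebra.Polynomial"
    "HOL-Computational_Algebra.Fraction_Field"
    "HOL-Algebra.QuotRing"
    "HOL-Algebra.Generated_Rings"
    "HOL-Algebra.Group_Action"
    "HOL-Algebra.Module"
begin

section \<open>Root data\<close>

definition zsmul :: "int \<Rightarrow> 'y \<Rightarrow> 'y::ab_group_add" where
  "zsmul n y = (\<Sum>k<nat n. y) - (\<Sum>k<nat (- n). y)"

lemma zsmul_diff: "zsmul (int a - int b) y = (\<Sum>k<a. y) - (\<Sum>k<b. y)"
proof -
  have add: "(\<Sum>k<m + n. y) = (\<Sum>k<m. y) + (\<Sum>k<n. y)" for m n :: nat
    by (induction n) (auto simp: algebra_simps)
  show ?thesis
  proof (cases "a \<le> b")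
    case True
    then obtain c where "b = a + c" using le_Suc_ex by blast
    then show ?thesis by (simp add: zsmul_def add)
  next
    case False
    then obtain c where "a = b + c" by (metis le_Suc_ex nat_le_linear)
    then show ?thesis by (simp add: zsmul_def add)
  qed
qed

interpretation zmod: Modules.module "zsmul :: int \<Rightarrow> 'y \<Rightarrow> 'y::ab_group_add"
proof
  have add: "(\<Sum>k<m + n. z) = (\<Sum>k<m. z) + (\<Sum>k<n. z)" for m n :: nat and z :: 'y
    by (induction n) (auto simp: algebra_simps)
  have mul: "(\<Sum>k<m * n. z) = (\<Sum>k<m. \<Sum>l<n. z)" for m n :: nat and z :: 'y
    by (induction m) (auto simp: add algebra_simps)
  fix a b :: int and x y :: 'y
  show "zsmul a (x + y) = zsmul a x + zsmul a y"
    by (simp add: zsmul_def sum.distrib algebra_simps)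
  obtain a1 a2 where a: "a = int a1 - int a2" by (rule int_diff_cases)
  obtain b1 b2 where b: "b = int b1 - int b2" by (rule int_diff_cases)
  have ab: "a + b = int (a1 + b1) - int (a2 + b2)" by (simp add: a b)
  show "zsmul (a + b) x = zsmul a x + zsmul b x"
    unfolding ab unfolding a b zsmul_diff by (simp add: add algebra_simps)
  have ab': "a * b = int (a1 * b1 + a2 * b2) - int (a1 * b2 + a2 * b1)"
    by (simp add: a b algebra_simps)
  show "zsmul a (zsmul b x) = zsmul (a * b) x"
    unfolding ab' unfolding a b zsmul_diff
    by (simp add: add mul sum_subtractf algebra_simps)
  show "zsmul 1 x = x" by (simp add: zsmul_def)
qed

definition fg_free :: "'y::ab_group_add itself \<Rightarrow> bool" where
  "fg_free _ \<longleftrightarrow> (\<exists>B :: 'y set. finite B \<and> \<not> zmod.dependent B \<and> zmod.span B = UNIV)"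

definition bilinear_form :: "('y::ab_group_add \<Rightarrow> 'x::ab_group_add \<Rightarrow> int) \<Rightarrow> bool" where
  "bilinear_form p \<longleftrightarrow> (\<forall>x. additive (\<lambda>y. p y x)) \<and> (\<forall>y. additive (p y))"

definition perfect_pairing :: "('y::ab_group_add \<Rightarrow> 'x::ab_group_add \<Rightarrow> int) \<Rightarrow> bool" where
  "perfect_pairing p \<longleftrightarrow> bilinear_form p \<and>
     bij_betw p UNIV {h. additive h} \<and>
     bij_betw (\<lambda>x y. p y x) UNIV {h. additive h}"

definition gcm :: "('i \<Rightarrow> 'i \<Rightarrow> int) \<Rightarrow> bool" where
  "gcm A \<longleftrightarrow> (\<forall>i. A i i = 2) \<and> (\<forall>i j. i \<noteq> j \<longrightarrow> A i j \<le> 0) \<and>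
     (\<forall>i j. A i j = 0 \<longleftrightarrow> A j i = 0)"

definition symmetrized_by :: "('i \<Rightarrow> 'i \<Rightarrow> int) \<Rightarrow> ('i \<Rightarrow> rat) \<Rightarrow> bool" where
  "symmetrized_by A d \<longleftrightarrow> (\<forall>i. 0 < d i) \<and>
     (\<forall>i j. d i * of_int (A i j) = d j * of_int (A j i))"

record ('i, 'y, 'x) weyl_data =
  cartan :: "'i \<Rightarrow> 'i \<Rightarrow> int"
  symm :: "'i \<Rightarrow> rat"
  pairing :: "'y \<Rightarrow> 'x \<Rightarrow> int"
  coroot :: "'i \<Rightarrow> 'y"
  sroot :: "'i \<Rightarrow> 'x"
  eps :: "'i \<Rightarrow> 'i \<Rightarrow> int"

definition root_datum :: "('i, 'y::ab_group_add, 'x::ab_group_add) weyl_data \<Rightarrow> bool" where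
  "root_datum D \<longleftrightarrow> fg_free TYPE('y) \<and> fg_free TYPE('x) \<and> perfect_pairing (pairing D) \<and>
     (\<forall>i j. pairing D (coroot D i) (sroot D j) = cartan D i j)"

definition sign_system :: "('i \<Rightarrow> 'i \<Rightarrow> int) \<Rightarrow> ('i \<Rightarrow> 'i \<Rightarrow> int) \<Rightarrow> bool" where
  "sign_system A e \<longleftrightarrow> (\<forall>i j.
     if i \<noteq> j \<and> A i j \<noteq> 0 then (e i j = 1 \<or> e i j = - 1) \<and> e j i = - e i j else e i j = 0)"

definition lcd :: "('i, 'y, 'x) weyl_data \<Rightarrow> nat" where
  "lcd D = (LEAST d. 0 < d \<and> (\<forall>i. of_nat d * symm D i \<in> \<int>))"

text \<open>
  With \<open>d = lcd D\<close>, the lattice \<open>d\<^sup>-\<^sup>1Y\<close> is represented by the type \<open>'y\<close> itself: an element \<open>\<mu>\<close> of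
  \<open>'y\<close>, used as an element of \<open>d\<^sup>-\<^sup>1Y\<close>, stands for \<open>\<mu>/d\<close>.  Thus the inclusion of \<open>Y\<close> into \<open>d\<^sup>-\<^sup>1Y\<close>
  is multiplication by \<open>d\<close>.  \<open>dpair\<close> is the extended pairing of \<open>d\<^sup>-\<^sup>1Y\<close> with \<open>X\<close>.  For
  \<open>r \<in> d\<^sup>-\<^sup>1\<int>\<close> and \<open>\<kappa> \<in> Y\<close>, \<open>dsmul D r \<kappa>\<close> is the element \<open>r\<kappa>\<close> of \<open>d\<^sup>-\<^sup>1Y\<close>; the floor only converts
  the integer \<open>d r\<close> from type \<open>rat\<close> to type \<open>int\<close>, both there and in \<open>qpow\<close>.
\<close>

definition dpair :: "('i, 'y, 'x) weyl_data \<Rightarrow> 'y \<Rightarrow> 'x \<Rightarrow> rat" where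
  "dpair D \<mu> x = of_int (pairing D \<mu> x) / of_nat (lcd D)"

definition dsmul :: "('i, 'y::ab_group_add, 'x) weyl_data \<Rightarrow> rat \<Rightarrow> 'y \<Rightarrow> 'y" where
  "dsmul D r \<kappa> = zsmul \<lfloor>of_nat (lcd D) * r\<rfloor> \<kappa>"

definition reflection :: "('i, 'y::ab_group_add, 'x) weyl_data \<Rightarrow> 'i \<Rightarrow> 'y \<Rightarrow> 'y" where
  "reflection D i \<kappa> = \<kappa> - dsmul D (dpair D \<kappa> (sroot D i)) (coroot D i)"

section \<open>The base field\<close>

text \<open>The field \<open>\<rat>(q\<^sup>1\<^sup>/\<^sup>d)\<close>, whose indeterminate \<open>qroot\<close> is \<open>q\<^sup>1\<^sup>/\<^sup>d\<close>.\<close>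

type_synonym qfield = "rat poly fract"

definition qroot :: qfield where
  "qroot = Fract [:0, 1:] 1"

text \<open>\<open>qpow D r\<close> is \<open>q\<^sup>r\<close> for \<open>r \<in> d\<^sup>-\<^sup>1\<int>\<close>.\<close>

definition qpow :: "('i, 'y, 'x) weyl_data \<Rightarrow> rat \<Rightarrow> qfield" where
  "qpow D r = qroot powi \<lfloor>of_nat (lcd D) * r\<rfloor>"

definition qi :: "('i, 'y, 'x) weyl_data \<Rightarrow> 'i \<Rightarrow> qfield" where
  "qi D i = qpow D (symm D i)"

section \<open>Associative algebras over a field\<close>

text \<open>The locale \<^locale>\<open>algebra\<close> of the library is restricted to commutative algebras.\<close>

definition assoc_algebra :: "('f::field, 'a) module \<Rightarrow> bool" where
  "assoc_algebra A \<longleftrightarrow> ring A \<and>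
     (\<forall>c. \<forall>x\<in>carrier A. c \<odot>\<^bsub>A\<^esub> x \<in> carrier A) \<and>
     (\<forall>x\<in>carrier A. 1 \<odot>\<^bsub>A\<^esub> x = x) \<and>
     (\<forall>b c. \<forall>x\<in>carrier A. (b * c) \<odot>\<^bsub>A\<^esub> x = b \<odot>\<^bsub>A\<^esub> (c \<odot>\<^bsub>A\<^esub> x)) \<and>
     (\<forall>b c. \<forall>x\<in>carrier A. (b + c) \<odot>\<^bsub>A\<^esub> x = b \<odot>\<^bsub>A\<^esub> x \<oplus>\<^bsub>A\<^esub> c \<odot>\<^bsub>A\<^esub> x) \<and>
     (\<forall>c. \<forall>x\<in>carrier A. \<forall>y\<in>carrier A. c \<odot>\<^bsub>A\<^esub> (x \<oplus>\<^bsub>A\<^esub> y) = c \<odot>\<^bsub>A\<^esub> x \<oplus>\<^bsub>A\<^esub> c \<odot>\<^bsub>A\<^esub> y) \<and>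
     (\<forall>c. \<forall>x\<in>carrier A. \<forall>y\<in>carrier A.
        c \<odot>\<^bsub>A\<^esub> (x \<otimes>\<^bsub>A\<^esub> y) = (c \<odot>\<^bsub>A\<^esub> x) \<otimes>\<^bsub>A\<^esub> y \<and> c \<odot>\<^bsub>A\<^esub> (x \<otimes>\<^bsub>A\<^esub> y) = x \<otimes>\<^bsub>A\<^esub> (c \<odot>\<^bsub>A\<^esub> y))"

definition alg_hom :: "('f, 'a) module \<Rightarrow> ('f, 'b) module \<Rightarrow> ('a \<Rightarrow> 'b) set" where
  "alg_hom A B = {h \<in> ring_hom A B. \<forall>c. \<forall>x\<in>carrier A. h (c \<odot>\<^bsub>A\<^esub> x) = c \<odot>\<^bsub>B\<^esub> h x}"

definition alg_aut :: "('f, 'a) module \<Rightarrow> ('a \<Rightarrow> 'a) set" where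
  "alg_aut A = alg_hom A A \<inter> Bij (carrier A)"

definition generated_subalgebra :: "('f, 'a) module \<Rightarrow> 'a set \<Rightarrow> ('f, 'a) module" where
  "generated_subalgebra A H =
     A\<lparr>carrier := generate_ring A (H \<union> {c \<odot>\<^bsub>A\<^esub> \<one>\<^bsub>A\<^esub> | c. True})\<rparr>"

definition quotient_algebra :: "('f, 'a) module \<Rightarrow> 'a set \<Rightarrow> ('f, 'a set) module" where
  "quotient_algebra A J =
     ring.extend (A Quot J) (module.fields (\<lambda>c X. \<Union>x\<in>X. J +>\<^bsub>A\<^esub> (c \<odot>\<^bsub>A\<^esub> x)))"

text \<open>The monoid algebra of \<open>M\<close>: finitely supported functions with convolution.\<close>

definition basis_vec :: "'m \<Rightarrow> 'm \<Rightarrow> 'f::field" where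
  "basis_vec m = (\<lambda>x. if x = m then 1 else 0)"

definition monoid_algebra :: "'m monoid \<Rightarrow> ('f::field, 'm \<Rightarrow> 'f) module" where
  "monoid_algebra M =
     \<lparr>carrier = {a. finite {m. a m \<noteq> 0} \<and> {m. a m \<noteq> 0} \<subseteq> carrier M},
      mult = (\<lambda>a b m. \<Sum>u\<in>{u. a u \<noteq> 0}. \<Sum>v\<in>{v. b v \<noteq> 0}. if u \<otimes>\<^bsub>M\<^esub> v = m then a u * b v else 0),
      one = basis_vec \<one>\<^bsub>M\<^esub>,
      zero = (\<lambda>m. 0),
      add = (\<lambda>a b m. a m + b m),
      smult = (\<lambda>c a m. c * a m)\<rparr>"

definition word_monoid :: "'g list monoid" where
  "word_monoid = \<lparr>carrier = UNIV, mult = (@), one = []\<rparr>"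

abbreviation free_algebra :: "('f::field, 'g list \<Rightarrow> 'f) module" where
  "free_algebra \<equiv> monoid_algebra word_monoid"

text \<open>The algebra with all elements of type \<open>'g\<close> as generators, and with relations \<open>l = r\<close> for
  \<open>(l, r) \<in> R\<close>.\<close>

definition relators :: "('f, 'a) module \<Rightarrow> ('a \<times> 'a) set \<Rightarrow> 'a set" where
  "relators A R = {l \<ominus>\<^bsub>A\<^esub> r | l r. (l, r) \<in> R}"

definition presented_algebra ::
  "(('g list \<Rightarrow> 'f::field) \<times> ('g list \<Rightarrow> 'f)) set \<Rightarrow> ('f, ('g list \<Rightarrow> 'f) set) module" where
  "presented_algebra R =
     quotient_algebra free_algebra (Idl\<^bsub>free_algebra\<^esub> (relators free_algebra R))"

text \<open>The tensor product over the base field, as the quotient of the algebra with basis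
  \<open>carrier A \<times> carrier B\<close> and product \<open>(a, b)(a', b') = (aa', bb')\<close> by bilinearity.  The subspace
  spanned by the bilinearity relators is already an ideal, as these relators are permuted by
  multiplication with basis elements.\<close>

abbreviation pair_algebra ::
  "('f::field, 'a) module \<Rightarrow> ('f, 'b) module \<Rightarrow> ('f, 'a \<times> 'b \<Rightarrow> 'f) module" where
  "pair_algebra A B \<equiv> monoid_algebra (A \<times>\<times> B)"

definition bilinearity ::
  "('f::field, 'a) module \<Rightarrow> ('f, 'b) module \<Rightarrow> (('a \<times> 'b \<Rightarrow> 'f) \<times> ('a \<times> 'b \<Rightarrow> 'f)) set" where
  "bilinearity A B =
     {(basis_vec (a \<oplus>\<^bsub>A\<^esub> a', b), basis_vec (a, b) \<oplus>\<^bsub>pair_algebra A B\<^esub> basis_vec (a', b)) | a a' b.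
        a \<in> carrier A \<and> a' \<in> carrier A \<and> b \<in> carrier B} \<union>
     {(basis_vec (a, b \<oplus>\<^bsub>B\<^esub> b'), basis_vec (a, b) \<oplus>\<^bsub>pair_algebra A B\<^esub> basis_vec (a, b')) | a b b'.
        a \<in> carrier A \<and> b \<in> carrier B \<and> b' \<in> carrier B} \<union>
     {(basis_vec (c \<odot>\<^bsub>A\<^esub> a, b), c \<odot>\<^bsub>pair_algebra A B\<^esub> basis_vec (a, b)) | a b c.
        a \<in> carrier A \<and> b \<in> carrier B} \<union>
     {(basis_vec (a, c \<odot>\<^bsub>B\<^esub> b), c \<odot>\<^bsub>pair_algebra A B\<^esub> basis_vec (a, b)) | a b c.
        a \<in> carrier A \<and> b \<in> carrier B}"

definition tensor_ideal :: "('f::field, 'a) module \<Rightarrow> ('f, 'b) module \<Rightarrow> ('a \<times> 'b \<Rightarrow> 'f) set" where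
  "tensor_ideal A B = Idl\<^bsub>pair_algebra A B\<^esub> (relators (pair_algebra A B) (bilinearity A B))"

definition tensor_algebra ::
  "('f::field, 'a) module \<Rightarrow> ('f, 'b) module \<Rightarrow> ('f, ('a \<times> 'b \<Rightarrow> 'f) set) module" where
  "tensor_algebra A B = quotient_algebra (pair_algebra A B) (tensor_ideal A B)"

definition pure_tensor ::
  "('f::field, 'a) module \<Rightarrow> ('f, 'b) module \<Rightarrow> 'a \<Rightarrow> 'b \<Rightarrow> ('a \<times> 'b \<Rightarrow> 'f) set" where
  "pure_tensor A B a b = tensor_ideal A B +>\<^bsub>pair_algebra A B\<^esub> basis_vec (a, b)"

text \<open>\<open>Q\<close>, with the embedding \<open>\<iota>\<close>, is the skew field of fractions of the Ore domain \<open>A\<close>; it is unique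
  up to unique isomorphism.\<close>

definition skew_field_of_fractions ::
  "('f::field, 'a) module \<Rightarrow> ('f, 'k) module \<Rightarrow> ('a \<Rightarrow> 'k) \<Rightarrow> bool" where
  "skew_field_of_fractions A Q \<iota> \<longleftrightarrow>
     assoc_algebra Q \<and> \<one>\<^bsub>Q\<^esub> \<noteq> \<zero>\<^bsub>Q\<^esub> \<and> Units Q = carrier Q - {\<zero>\<^bsub>Q\<^esub>} \<and>
     \<iota> \<in> alg_hom A Q \<and> inj_on \<iota> (carrier A) \<and>
     (\<forall>x\<in>carrier Q. \<exists>a\<in>carrier A. \<exists>b\<in>carrier A - {\<zero>\<^bsub>A\<^esub>}. x = \<iota> a \<otimes>\<^bsub>Q\<^esub> inv\<^bsub>Q\<^esub> \<iota> b) \<and>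
     (\<forall>x\<in>carrier Q. \<exists>a\<in>carrier A. \<exists>b\<in>carrier A - {\<zero>\<^bsub>A\<^esub>}. x = inv\<^bsub>Q\<^esub> \<iota> b \<otimes>\<^bsub>Q\<^esub> \<iota> a)"

section \<open>The algebras attached to a root datum\<close>

definition lattice_monoid :: "'y::ab_group_add monoid" where
  "lattice_monoid = \<lparr>carrier = UNIV, mult = (+), one = 0\<rparr>"

definition U0 :: "(qfield, 'y::ab_group_add \<Rightarrow> qfield) module" where
  "U0 = monoid_algebra lattice_monoid"

datatype ('i, 'y) bgen = GenF 'i | GenQ 'y

definition Bq_relations ::
  "('i, 'y::ab_group_add, 'x) weyl_data \<Rightarrow>
     ((('i, 'y) bgen list \<Rightarrow> qfield) \<times> (('i, 'y) bgen list \<Rightarrow> qfield)) set" where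
  "Bq_relations D =
     {(basis_vec [GenQ 0], \<one>\<^bsub>free_algebra\<^esub>)} \<union>
     {(basis_vec [GenQ \<kappa>, GenQ \<mu>], basis_vec [GenQ (\<kappa> + \<mu>)]) | \<kappa> \<mu>. True} \<union>
     {(basis_vec [GenQ \<kappa>, GenF i, GenQ (- \<kappa>)],
       qpow D (- dpair D \<kappa> (sroot D i)) \<odot>\<^bsub>free_algebra\<^esub> basis_vec [GenF i]) | \<kappa> i. True} \<union>
     {(basis_vec [GenF i, GenF j],
       (qi D i powi (- eps D i j * cartan D i j)) \<odot>\<^bsub>free_algebra\<^esub> basis_vec [GenF j, GenF i])
       | i j. True}"

type_synonym ('i, 'y) bq = "(('i, 'y) bgen list \<Rightarrow> qfield) set"

definition Bq :: "('i, 'y::ab_group_add, 'x) weyl_data \<Rightarrow> (qfield, ('i, 'y) bq) module" where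
  "Bq D = presented_algebra (Bq_relations D)"

definition bgen_elt :: "('i, 'y::ab_group_add, 'x) weyl_data \<Rightarrow> ('i, 'y) bgen \<Rightarrow> ('i, 'y) bq" where
  "bgen_elt D x =
     Idl\<^bsub>free_algebra\<^esub> (relators free_algebra (Bq_relations D)) +>\<^bsub>free_algebra\<^esub> basis_vec [x]"

definition bf :: "('i, 'y::ab_group_add, 'x) weyl_data \<Rightarrow> 'i \<Rightarrow> ('i, 'y) bq" where
  "bf D i = bgen_elt D (GenF i)"

definition bk :: "('i, 'y::ab_group_add, 'x) weyl_data \<Rightarrow> 'i \<Rightarrow> ('i, 'y) bq" where
  "bk D i = bgen_elt D (GenQ (dsmul D (symm D i) (coroot D i)))"

type_synonym ('i, 'y) bq2 = "(('i, 'y) bq \<times> ('i, 'y) bq \<Rightarrow> qfield) set"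

definition f1 :: "('i, 'y::ab_group_add, 'x) weyl_data \<Rightarrow> 'i \<Rightarrow> ('i, 'y) bq2" where
  "f1 D i = pure_tensor (Bq D) (Bq D) (bf D i) \<one>\<^bsub>Bq D\<^esub>"

definition f2 :: "('i, 'y::ab_group_add, 'x) weyl_data \<Rightarrow> 'i \<Rightarrow> ('i, 'y) bq2" where
  "f2 D i = pure_tensor (Bq D) (Bq D) (inv\<^bsub>Bq D\<^esub> bk D i) (bf D i)"

text \<open>\<open>Atilde0\<close> and \<open>Atilde\<close> are the algebras written \<open>A\<close> with a tilde and index \<open>q,0\<close>, resp. \<open>q\<close>.\<close>

definition Atilde0 :: "('i, 'y::ab_group_add, 'x) weyl_data \<Rightarrow> (qfield, ('i, 'y) bq2) module" where
  "Atilde0 D = generated_subalgebra (tensor_algebra (Bq D) (Bq D)) (range (f1 D) \<union> range (f2 D))"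

type_synonym ('i, 'y) atilde = "(('i, 'y) bq2 \<times> ('y \<Rightarrow> qfield) \<Rightarrow> qfield) set"

definition Atilde :: "('i, 'y::ab_group_add, 'x) weyl_data \<Rightarrow> (qfield, ('i, 'y) atilde) module" where
  "Atilde D = tensor_algebra (Atilde0 D) U0"

text \<open>In the remaining definitions \<open>Q\<close>, with \<open>\<iota>\<close>, is the skew field of fractions of \<open>Atilde D\<close>.\<close>

definition gq ::
  "('i, 'y::ab_group_add, 'x) weyl_data \<Rightarrow> (qfield, 'k) module \<Rightarrow> (('i, 'y) atilde \<Rightarrow> 'k) \<Rightarrow> 'i \<Rightarrow> 'k" where
  "gq D Q \<iota> i =
     inv\<^bsub>Q\<^esub> \<iota> (pure_tensor (Atilde0 D) U0 (f1 D i) \<one>\<^bsub>U0\<^esub>) \<otimes>\<^bsub>Q\<^esub>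
     \<iota> (pure_tensor (Atilde0 D) U0 (f2 D i) \<one>\<^bsub>U0\<^esub>)"

text \<open>The element \<open>q\<^sup>\<kappa>\<close> for \<open>\<kappa> \<in> d\<^sup>-\<^sup>1Y\<close>.\<close>

definition qexp ::
  "('i, 'y::ab_group_add, 'x) weyl_data \<Rightarrow> (('i, 'y) atilde \<Rightarrow> 'k) \<Rightarrow> 'y \<Rightarrow> 'k" where
  "qexp D \<iota> \<kappa> = \<iota> (pure_tensor (Atilde0 D) U0 \<one>\<^bsub>Atilde0 D\<^esub> (basis_vec \<kappa>))"

text \<open>The element written \<open>q\<close> with index \<open>i\<close> and exponent \<open>\<kappa> \<in> Y\<close>.\<close>

definition qiexp ::
  "('i, 'y::ab_group_add, 'x) weyl_data \<Rightarrow> (('i, 'y) atilde \<Rightarrow> 'k) \<Rightarrow> 'i \<Rightarrow> 'y \<Rightarrow> 'k" where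
  "qiexp D \<iota> i \<kappa> = qexp D \<iota> (dsmul D (symm D i) \<kappa>)"

definition Aq ::
  "('i, 'y::ab_group_add, 'x) weyl_data \<Rightarrow> (qfield, 'k) module \<Rightarrow> (('i, 'y) atilde \<Rightarrow> 'k) \<Rightarrow>
     (qfield, 'k) module" where
  "Aq D Q \<iota> = generated_subalgebra Q (range (gq D Q \<iota>) \<union> range (qexp D \<iota>))"

definition QAq ::
  "('i, 'y::ab_group_add, 'x) weyl_data \<Rightarrow> (qfield, 'k) module \<Rightarrow> (('i, 'y) atilde \<Rightarrow> 'k) \<Rightarrow>
     (qfield, 'k) module" where
  "QAq D Q \<iota> = Q\<lparr>carrier := {a \<otimes>\<^bsub>Q\<^esub> inv\<^bsub>Q\<^esub> b | a b.
     a \<in> carrier (Aq D Q \<iota>) \<and> b \<in> carrier (Aq D Q \<iota>) - {\<zero>\<^bsub>Q\<^esub>}}\<rparr>"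

section \<open>Automorphisms\<close>

definition s_tilde ::
  "('i, 'y::ab_group_add, 'x) weyl_data \<Rightarrow> (qfield, 'k) module \<Rightarrow> (('i, 'y) atilde \<Rightarrow> 'k) \<Rightarrow>
     'i \<Rightarrow> 'k \<Rightarrow> 'k" where
  "s_tilde D Q \<iota> i = (THE h. h \<in> alg_aut (QAq D Q \<iota>) \<and>
     (\<forall>j. h (gq D Q \<iota> j) = gq D Q \<iota> j) \<and>
     (\<forall>\<kappa>. h (qexp D \<iota> \<kappa>) = qexp D \<iota> (reflection D i \<kappa>)))"

text \<open>\<open>ratio_prod Q n u v\<close> is the product of the \<open>u \<nu> / v \<nu>\<close> for \<open>\<nu> < n\<close>, in increasing order.\<close>

definition ratio_prod :: "('f, 'k) module \<Rightarrow> nat \<Rightarrow> (nat \<Rightarrow> 'k) \<Rightarrow> (nat \<Rightarrow> 'k) \<Rightarrow> 'k" where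
  "ratio_prod Q n u v =
     foldr (\<lambda>\<nu> y. (u \<nu> \<otimes>\<^bsub>Q\<^esub> inv\<^bsub>Q\<^esub> v \<nu>) \<otimes>\<^bsub>Q\<^esub> y) [0..<n] \<one>\<^bsub>Q\<^esub>"

text \<open>\<open>one_plus D Q i \<nu> y\<close> is \<open>1 + q\<^sub>i\<^sup>2\<^sup>\<nu> y\<close>.\<close>

definition one_plus ::
  "('i, 'y, 'x) weyl_data \<Rightarrow> (qfield, 'k) module \<Rightarrow> 'i \<Rightarrow> nat \<Rightarrow> 'k \<Rightarrow> 'k" where
  "one_plus D Q i \<nu> y = \<one>\<^bsub>Q\<^esub> \<oplus>\<^bsub>Q\<^esub> (qi D i ^ (2 * \<nu>)) \<odot>\<^bsub>Q\<^esub> y"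

definition phi ::
  "('i, 'y::ab_group_add, 'x) weyl_data \<Rightarrow> (qfield, 'k) module \<Rightarrow> (('i, 'y) atilde \<Rightarrow> 'k) \<Rightarrow>
     'i \<Rightarrow> 'i \<Rightarrow> 'k \<Rightarrow> 'k" where
  "phi D Q \<iota> i j x =
     (let g = gq D Q \<iota>; n = nat (- cartan D i j);
          u = (\<lambda>\<nu>. one_plus D Q i \<nu> (g i));
          v = (\<lambda>\<nu>. one_plus D Q i \<nu> (x [^]\<^bsub>Q\<^esub> (- 2 :: int) \<otimes>\<^bsub>Q\<^esub> g i))
      in if i = j then x [^]\<^bsub>Q\<^esub> (- 2 :: int) \<otimes>\<^bsub>Q\<^esub> g i
         else if eps D i j = 1 then g j \<otimes>\<^bsub>Q\<^esub> ratio_prod Q n u v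
         else if eps D i j = - 1 then
           x [^]\<^bsub>Q\<^esub> (2 * (- cartan D i j)) \<otimes>\<^bsub>Q\<^esub> ratio_prod Q n v u \<otimes>\<^bsub>Q\<^esub> g j
         else g j)"

text \<open>\<open>gamma D Q \<iota> i \<kappa>\<close> is conjugation by the power of \<open>f\<^sub>i\<^sub>1 + f\<^sub>i\<^sub>2\<close> with exponent \<open>\<kappa> \<in> Y\<close>.\<close>

definition gamma ::
  "('i, 'y::ab_group_add, 'x) weyl_data \<Rightarrow> (qfield, 'k) module \<Rightarrow> (('i, 'y) atilde \<Rightarrow> 'k) \<Rightarrow>
     'i \<Rightarrow> 'y \<Rightarrow> 'k \<Rightarrow> 'k" where
  "gamma D Q \<iota> i \<kappa> = (THE h. h \<in> alg_aut (QAq D Q \<iota>) \<and>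
     (\<forall>\<mu>. h (qexp D \<iota> \<mu>) = qexp D \<iota> \<mu>) \<and>
     (\<forall>j. h (gq D Q \<iota> j) = phi D Q \<iota> i j (qiexp D \<iota> i \<kappa>)))"

definition S_aut ::
  "('i, 'y::ab_group_add, 'x) weyl_data \<Rightarrow> (qfield, 'k) module \<Rightarrow> (('i, 'y) atilde \<Rightarrow> 'k) \<Rightarrow>
     'i \<Rightarrow> 'k \<Rightarrow> 'k" where
  "S_aut D Q \<iota> i =
     compose (carrier (QAq D Q \<iota>)) (s_tilde D Q \<iota> i) (gamma D Q \<iota> i (- coroot D i))"

section \<open>The Weyl group\<close>

text \<open>Groups presented by generators and relations: the letter \<open>(x, True)\<close> is the generator \<open>x\<close>, the
  letter \<open>(x, False)\<close> its inverse.\<close>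

inductive word_eq :: "(('g \<times> bool) list \<times> ('g \<times> bool) list) set \<Rightarrow>
    ('g \<times> bool) list \<Rightarrow> ('g \<times> bool) list \<Rightarrow> bool" for R where
  word_refl: "word_eq R w w"
| word_sym: "word_eq R v w \<Longrightarrow> word_eq R w v"
| word_trans: "word_eq R u v \<Longrightarrow> word_eq R v w \<Longrightarrow> word_eq R u w"
| word_cong: "word_eq R v w \<Longrightarrow> word_eq R v' w' \<Longrightarrow> word_eq R (v @ v') (w @ w')"
| word_cancel: "word_eq R [(x, b), (x, \<not> b)] []"
| word_rel: "(v, w) \<in> R \<Longrightarrow> word_eq R v w"

definition word_class :: "(('g \<times> bool) list \<times> ('g \<times> bool) list) set \<Rightarrow>
    ('g \<times> bool) list \<Rightarrow> ('g \<times> bool) list set" where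
  "word_class R w = {v. word_eq R w v}"

definition presented_group :: "(('g \<times> bool) list \<times> ('g \<times> bool) list) set \<Rightarrow>
    ('g \<times> bool) list set monoid" where
  "presented_group R =
     \<lparr>carrier = range (word_class R),
      mult = (\<lambda>X Y. \<Union>v\<in>X. \<Union>w\<in>Y. word_class R (v @ w)),
      one = word_class R []\<rparr>"

definition weyl_relations :: "('i \<Rightarrow> 'i \<Rightarrow> int) \<Rightarrow> (('i \<times> bool) list \<times> ('i \<times> bool) list) set" where
  "weyl_relations A =
     (let s = (\<lambda>i. (i, True)); pw = (\<lambda>n i j. concat (replicate n [s i, s j])) in
      {([s i, s i], []) | i. True} \<union>
      {([s i, s j], [s j, s i]) | i j. i \<noteq> j \<and> A i j * A j i = 0} \<union>
      {([s i, s j, s i], [s j, s i, s j]) | i j. i \<noteq> j \<and> A i j * A j i = 1} \<union>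
      {(pw 2 i j, pw 2 j i) | i j. i \<noteq> j \<and> A i j * A j i = 2} \<union>
      {(pw 3 i j, pw 3 j i) | i j. i \<noteq> j \<and> A i j * A j i = 3})"

definition weyl_group :: "('i \<Rightarrow> 'i \<Rightarrow> int) \<Rightarrow> ('i \<times> bool) list set monoid" where
  "weyl_group A = presented_group (weyl_relations A)"

definition weyl_gen :: "('i \<Rightarrow> 'i \<Rightarrow> int) \<Rightarrow> 'i \<Rightarrow> ('i \<times> bool) list set" where
  "weyl_gen A i = word_class (weyl_relations A) [(i, True)]"

text \<open>Actions by algebra automorphisms; extensionality makes equality of actions meaningful.\<close>

definition algebra_action :: "'w monoid \<Rightarrow> ('f, 'a) module \<Rightarrow> ('w \<Rightarrow> 'a \<Rightarrow> 'a) \<Rightarrow> bool" where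
  "algebra_action G A \<rho> \<longleftrightarrow> group_action G (carrier A) \<rho> \<and> \<rho> \<in> extensional (carrier G) \<and>
     (\<forall>w\<in>carrier G. \<rho> w \<in> alg_aut A)"

text \<open>The explicit formulae for the values \<open>\<sigma> i\<close> of the simple reflections.\<close>

definition explicit_formulae ::
  "('i, 'y::ab_group_add, 'x) weyl_data \<Rightarrow> (qfield, 'k) module \<Rightarrow> (('i, 'y) atilde \<Rightarrow> 'k) \<Rightarrow>
     ('i \<Rightarrow> 'k \<Rightarrow> 'k) \<Rightarrow> bool" where
  "explicit_formulae D Q \<iota> \<sigma> \<longleftrightarrow>
     (\<forall>i j. let g = gq D Q \<iota>; a = cartan D i j;
                y = qiexp D \<iota> i (coroot D i) [^]\<^bsub>Q\<^esub> (- 2 :: int);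
                u = (\<lambda>\<nu>. one_plus D Q i \<nu> (g i));
                v = (\<lambda>\<nu>. one_plus D Q i \<nu> (y \<otimes>\<^bsub>Q\<^esub> g i))
      in (eps D i j = 1 \<longrightarrow> \<sigma> i (g j) = g j \<otimes>\<^bsub>Q\<^esub> ratio_prod Q (nat (- a)) u v) \<and>
         (eps D i j = - 1 \<longrightarrow>
            \<sigma> i (g j) = qiexp D \<iota> i (coroot D i) [^]\<^bsub>Q\<^esub> (2 * (- a)) \<otimes>\<^bsub>Q\<^esub>
              ratio_prod Q (nat (- a)) v u \<otimes>\<^bsub>Q\<^esub> g j) \<and>
         (i = j \<longrightarrow> \<sigma> i (g j) = y \<otimes>\<^bsub>Q\<^esub> g i) \<and>
         (a = 0 \<longrightarrow> \<sigma> i (g j) = g j)) \<and>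
     (\<forall>i \<kappa>. \<sigma> i (qexp D \<iota> \<kappa>) = qexp D \<iota> (reflection D i \<kappa>))"

end

theory Submission
  imports Defs "HOL-Library.Function_Algebras" "HOL-Library.Product_Plus" "HOL-Library.Countable_Set"
begin

text \<open>
  The algebra \<open>A\<^sub>q\<close> is a quantum torus in the variables \<open>g\<^sub>i\<close> over the central units \<open>q\<^sup>\<kappa>\<close>: letting \<open>B\<^sub>q \<otimes> B\<^sub>q \<otimes> U\<^sub>q\<^sup>0\<close>
  act by weighted shifts on functions on a lattice shows that the monomials in \<open>f\<^sub>i\<^sub>1\<close>, \<open>f\<^sub>i\<^sub>2\<close>, \<open>q\<^sup>\<kappa>\<close> are linearly
  independent, and polynomial growth gives the Ore property. Hence a homomorphism on \<open>Q(A\<^sub>q)\<close> is determined by its values on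
  the generators, and exists as soon as these satisfy the relations and their monomials stay independent. This yields \<open>\<gamma>\<close>,
  \<open>s\<^sub>i\<close> and \<open>S\<^sub>i\<close>, and reduces the relations of \<open>W\<close> to identities between the images of the generators.

  For a braid relation between \<open>i\<close> and \<open>j\<close>, say \<open>a\<^sub>j\<^sub>i = - 1\<close> and \<open>a\<^sub>i\<^sub>j = - N\<close>, these identities are obtained by unfolding.
  The elements \<open>q\<^sub>i\<^sup>2\<^sup>v g\<^sub>i\<close> with \<open>v < N\<close> behave like \<open>N\<close> commuting leaves attached to the centre \<open>g\<^sub>j\<close>, and
  \<open>S\<^sub>i\<close> acts like the composite of the simply laced mutations at the leaves. The relation becomes the equality
  of two words for the longest element of type \<open>A\<^sub>2\<close>, \<open>A\<^sub>3\<close> or \<open>D\<^sub>4\<close>, which follows from the rank two simply laced case.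
  A further generator \<open>g\<^sub>l\<close> is multiplied by powers of \<open>g\<^sub>i\<close> and \<open>g\<^sub>j\<close> such that it interacts with fewer than
  \<open>N\<close> of the leaves only.

  To compute with the type class of division rings, the countable skew field \<open>Q(A\<^sub>q)\<close> is carried over
  to the natural numbers.
\<close>

section \<open>Mutations of star-shaped diagrams\<close>

text \<open>Compared directly, the two sides of the relation of type G_2 are sixfold composites of
  noncommutative rational functions. Unfolding leaves one identity between such functions, for a
  centre and a single leaf (\<open>Th_braid_right\<close> and its mirror image); what remains is a
  manipulation of words. The exponent by which \<open>g l\<close> q-commutes with \<open>g i\<close>
  can be any integer, while only N leaves are available. A power of \<open>g j\<close> changes this
  exponent by multiples of N, so a remainder modulo N can be reached, and a power of
  \<open>g i\<close> then cancels the exponent towards \<open>g j\<close>. The corrected element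
  still acquires lattice factors; they are recorded in one extra coordinate of the lattice, on which
  the generators again act as reflections. The algebras are given by presentations, so their size
  has to be found out, and the \<open>g i\<close> do not even lie in the presented algebra but only
  in its fractions; hence the clearing of denominators. A map given on generators extends to
  quotients only if nonzero elements stay nonzero. For conjugation by a power this is read off from
  the terms of lowest degree in the \<open>g j\<close>, which change by a lattice shift
  only.\<close>

lemma A3_longest_word:
  fixes a b c :: "'s \<Rightarrow> 's"
  assumes comm: "\<And>x. a (b x) = b (a x)"
    and braid: "\<And>x. a (c (a x)) = c (a (c x))" "\<And>x. b (c (b x)) = c (b (c x))"
  shows "c (b (a (c (b (a x))))) = b (a (c (b (a (c x)))))"
proof -
  have "c (b (a (c (b (a x))))) = c (a (b (c (b (a x)))))"
    by (simp only: comm)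
  also have "\<dots> = c (a (c (b (c (a x)))))"
    by (simp only: braid(2)[of "a x"])
  also have "\<dots> = a (c (a (b (c (a x)))))"
    by (simp only: braid(1)[of "b (c (a x))"])
  also have "\<dots> = a (c (b (a (c (a x)))))"
    by (simp only: comm)
  also have "\<dots> = a (c (b (c (a (c x)))))"
    by (simp only: braid(1)[of "x"])
  also have "\<dots> = a (b (c (b (a (c x)))))"
    by (simp only: braid(2)[of "a (c x)"])
  also have "\<dots> = b (a (c (b (a (c x)))))"
    by (simp only: comm)
  finally show ?thesis .
qed

text \<open>Both sides are reduced words of the longest element of D_4: twelve letters, alternating
  between the centre \<open>c\<close> and the three commuting leaves. Reduced words of one element
  are joined by braid moves, and the chain is such a path; the \<open>comm\<close> steps only
  reorder letters until the next braid move applies. The lemma for A_3 is the same with two leaves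
  and six letters.\<close>

lemma D4_longest_word:
  fixes a b d c :: "'s \<Rightarrow> 's"
  assumes comm: "\<And>x. a (b x) = b (a x)" "\<And>x. a (d x) = d (a x)" "\<And>x. b (d x) = d (b x)"
    and braid: "\<And>x. a (c (a x)) = c (a (c x))" "\<And>x. b (c (b x)) = c (b (c x))" "\<And>x. d (c (d x)) = c (d (c x))"
  shows "c (d (b (a (c (d (b (a (c (d (b (a x))))))))))) = d (b (a (c (d (b (a (c (d (b (a (c x)))))))))))"
proof -
  have "c (d (b (a (c (d (b (a (c (d (b (a x))))))))))) = c (b (a (d (c (b (d (a (c (a (d (b x)))))))))))"
    by (simp only: comm)
  also have "\<dots> = c (b (a (d (c (b (d (c (a (c (d (b x)))))))))))"
    by (simp only: braid(1)[of "d (b x)"])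
  also have "\<dots> = c (a (b (d (c (d (b (c (a (c (b (d x)))))))))))"
    by (simp only: comm)
  also have "\<dots> = c (a (b (c (d (c (b (c (a (c (b (d x)))))))))))"
    by (simp only: braid(3)[of "b (c (a (c (b (d x)))))"])
  also have "\<dots> = c (a (b (c (d (c (b (c (a (c (d (b x)))))))))))"
    by (simp only: comm)
  also have "\<dots> = c (a (b (c (d (b (c (b (a (c (d (b x)))))))))))"
    by (simp only: braid(2)[of "a (c (d (b x)))"])
  also have "\<dots> = c (b (a (c (b (d (c (a (b (c (b (d x)))))))))))"
    by (simp only: comm)
  also have "\<dots> = c (b (a (c (b (d (c (a (c (b (c (d x)))))))))))"
    by (simp only: braid(2)[of "d x"])
  also have "\<dots> = c (b (a (c (b (d (a (c (a (b (c (d x)))))))))))"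
    by (simp only: braid(1)[of "b (c (d x))"])
  also have "\<dots> = c (b (a (c (a (b (d (c (a (b (c (d x)))))))))))"
    by (simp only: comm)
  also have "\<dots> = c (b (c (a (c (b (d (c (a (b (c (d x)))))))))))"
    by (simp only: braid(1)[of "b (d (c (a (b (c (d x))))))"])
  also have "\<dots> = c (b (c (a (c (d (b (c (b (a (c (d x)))))))))))"
    by (simp only: comm)
  also have "\<dots> = b (c (b (a (c (d (b (c (b (a (c (d x)))))))))))"
    by (simp only: braid(2)[of "a (c (d (b (c (b (a (c (d x))))))))"])
  also have "\<dots> = b (c (a (b (c (b (d (c (a (b (c (d x)))))))))))"
    by (simp only: comm)
  also have "\<dots> = b (c (a (c (b (c (d (c (a (b (c (d x)))))))))))"
    by (simp only: braid(2)[of "d (c (a (b (c (d x)))))"])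
  also have "\<dots> = b (c (a (c (b (d (c (d (a (b (c (d x)))))))))))"
    by (simp only: braid(3)[of "a (b (c (d x)))"])
  also have "\<dots> = b (a (c (a (b (d (c (d (a (b (c (d x)))))))))))"
    by (simp only: braid(1)[of "b (d (c (d (a (b (c (d x)))))))"])
  also have "\<dots> = a (b (c (b (a (d (c (a (b (d (c (d x)))))))))))"
    by (simp only: comm)
  also have "\<dots> = a (b (c (b (a (d (c (a (b (c (d (c x)))))))))))"
    by (simp only: braid(3)[of "x"])
  also have "\<dots> = a (b (c (a (d (b (c (b (a (c (d (c x)))))))))))"
    by (simp only: comm)
  also have "\<dots> = a (b (c (a (d (c (b (c (a (c (d (c x)))))))))))"
    by (simp only: braid(2)[of "a (c (d (c x)))"])
  also have "\<dots> = b (a (c (a (d (c (b (c (a (c (d (c x)))))))))))"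
    by (simp only: comm)
  also have "\<dots> = b (a (c (a (d (c (b (a (c (a (d (c x)))))))))))"
    by (simp only: braid(1)[of "d (c x)"])
  also have "\<dots> = a (b (c (d (a (c (a (b (c (a (d (c x)))))))))))"
    by (simp only: comm)
  also have "\<dots> = a (b (c (d (c (a (c (b (c (a (d (c x)))))))))))"
    by (simp only: braid(1)[of "b (c (a (d (c x))))"])
  also have "\<dots> = a (b (c (d (c (a (b (c (b (a (d (c x)))))))))))"
    by (simp only: braid(2)[of "a (d (c x))"])
  also have "\<dots> = a (b (d (c (d (a (b (c (b (a (d (c x)))))))))))"
    by (simp only: braid(3)[of "a (b (c (b (a (d (c x))))))"])
  also have "\<dots> = d (b (a (c (d (b (a (c (d (b (a (c x)))))))))))"
    by (simp only: comm)
  finally show ?thesis .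
qed

text \<open>A seed \<open>(C, h, Yc, Y, z)\<close> consists of the variable \<open>C\<close> at the centre of a star, the variables \<open>h v\<close> at its
  leaves, the central parameters \<open>Yc\<close> and \<open>Y v\<close> of the mutations there, and an extra variable \<open>z\<close> that is
  moved only by the leaves in a given set.\<close>

type_synonym 'b seed_data = "'b \<times> (nat \<Rightarrow> 'b) \<times> 'b \<times> (nat \<Rightarrow> 'b) \<times> 'b"

context division_ring begin

section \<open>Central elements and the simply laced identity of rank two\<close>

definition central :: "'a \<Rightarrow> bool" where
  "central c \<longleftrightarrow> (\<forall>x. c * x = x * c)"

lemma central_comm: "central c \<Longrightarrow> x * c = c * x"
  by (simp add: central_def)

lemma central_left_comm: "central c \<Longrightarrow> x * (c * y) = c * (x * y)"
  by (metis central_def mult.assoc)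

lemma central_1 [simp]: "central 1"
  by (simp add: central_def)

lemma central_mult: "central c \<Longrightarrow> central d \<Longrightarrow> central (c * d)"
  by (metis central_def mult.assoc)

lemma central_inverse: "central c \<Longrightarrow> central (inverse c)"
  by (metis central_def inverse_zero left_inverse mult.assoc mult_zero_left mult_zero_right
      right_inverse mult_1_left mult_1_right)

lemma inverse_mult_cancel_left: "a \<noteq> 0 \<Longrightarrow> inverse a * (a * b) = b"
  by (simp flip: mult.assoc)

lemma mult_inverse_cancel_left: "a \<noteq> 0 \<Longrightarrow> a * (inverse a * b) = b"
  by (simp flip: mult.assoc)

lemma inverse_mult_any: "inverse (a * b) = inverse b * inverse a"
  by (cases "a = 0"; cases "b = 0") (simp_all add: nonzero_inverse_mult_distrib)

lemma inverse_inverse_any: "inverse (inverse a) = a"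
  by (cases "a = 0") (simp_all add: nonzero_inverse_inverse_eq)

text \<open>One factor of the product in \<open>phi\<close>, with \<open>y\<close> in the role of
  the central element x^(-2) there and \<open>x\<close> in the role of q_i^(2 nu) g_i.\<close>

definition Th :: "'a \<Rightarrow> 'a \<Rightarrow> 'a" where
  "Th y x = (1 + x) * inverse (1 + y * x)"

lemma Th_frac:
  assumes "w \<noteq> 0" "central y"
  shows "Th y (u * inverse w) = (w + u) * inverse (w + y * u)"
proof -
  have 1: "1 + u * inverse w = (w + u) * inverse w"
    using assms by (simp add: distrib_right)
  have 2: "1 + y * (u * inverse w) = (w + y * u) * inverse w"
    using assms by (simp add: distrib_right mult.assoc)
  show ?thesis
    unfolding Th_def 1 2 inverse_mult_any inverse_inverse_any
    using assms by (simp add: mult.assoc inverse_mult_cancel_left)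
qed

lemma inverse_mult_swap:
  assumes "w \<noteq> 0" "w' \<noteq> 0" "w * a = a * w'"
  shows "inverse w * a = a * inverse w'"
proof -
  have "a * inverse w' = inverse w * (w * a) * inverse w'"
    using assms(1) by (simp add: inverse_mult_cancel_left)
  also have "\<dots> = inverse w * a"
    using assms(2) unfolding assms(3) by (simp add: mult.assoc)
  finally show ?thesis by simp
qed

text \<open>\<open>A\<close> is the variable of a leaf and \<open>B\<close> that of the centre;
  \<open>A1\<close>, \<open>A2\<close>, \<open>B1\<close> are their values after initial pieces of
  the two words for the longest element of type A_2. The two sides are the factors that a neighbour
  of the leaf collects along these words. Both become the same right fraction
  \<open>inverse Yb * N * inverse D\<close>, with \<open>N\<close> and \<open>D\<close> polynomial
  in \<open>A\<close> and \<open>B\<close>.\<close>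

lemma Th_braid_right:
  assumes AB: "A * B = s * (B * A)" and nz: "s \<noteq> 0" "Ya \<noteq> 0" "Yb \<noteq> 0"
    and c: "central s" "central Ya" "central Yb"
    and n1: "1 + A \<noteq> 0" "1 + Ya * A \<noteq> 0"
    and B1: "B1 = B * Th Ya A" and n2: "1 + B1 \<noteq> 0" "1 + (Ya * Yb) * B1 \<noteq> 0"
    and A2: "A2 = inverse (Ya * Yb) * inverse (Th (Ya * Yb) B1) * (Ya * A)"
    and A1: "A1 = inverse Yb * inverse (Th Yb B) * A"
    and n3: "1 + B \<noteq> 0" "1 + Yb * B \<noteq> 0" and A: "A \<noteq> 0"
  shows "Th Ya A * Th Yb A2 = Th (Ya * Yb) A1"
proof -
  define r where "r = inverse s"
  have sr: "s * r = 1" "r * s = 1" "s * (r * x) = x" "r * (s * x) = x" for x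
    using nz by (simp_all add: r_def mult_inverse_cancel_left inverse_mult_cancel_left)
  have cr: "central r" using c by (simp add: r_def central_inverse)
  have cYi: "central (inverse Yb)" "central (inverse Ya)" using c by (simp_all add: central_inverse)
  have Yi: "Yb * inverse Yb = 1" "inverse Yb * Yb = 1" "inverse Yb * (Yb * x) = x" "Yb * (inverse Yb * x) = x" for x
    using nz by (simp_all add: mult_inverse_cancel_left inverse_mult_cancel_left)
  note comm = central_comm[OF c(1), of A] central_comm[OF c(1), of B]
    central_comm[OF c(2), of A] central_comm[OF c(2), of B]
    central_comm[OF c(3), of A] central_comm[OF c(3), of B] central_comm[OF c(3), of Ya]
    central_comm[OF cr, of A] central_comm[OF cr, of B] central_comm[OF c(2), of r] central_comm[OF c(3), of r]
    central_left_comm[OF c(1), of A] central_left_comm[OF c(1), of B]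
    central_left_comm[OF c(2), of A] central_left_comm[OF c(2), of B]
    central_left_comm[OF c(3), of A] central_left_comm[OF c(3), of B] central_left_comm[OF c(3), of Ya]
    central_left_comm[OF cr, of A] central_left_comm[OF cr, of B] central_left_comm[OF c(2), of r] central_left_comm[OF c(3), of r]
    central_comm[OF c(1), of Ya] central_left_comm[OF c(1), of Ya]
    central_comm[OF c(1), of Yb] central_left_comm[OF c(1), of Yb]
    central_comm[OF cYi(1), of A] central_left_comm[OF cYi(1), of A]
    central_comm[OF cYi(1), of B] central_left_comm[OF cYi(1), of B]
    central_comm[OF cYi(1), of Ya] central_left_comm[OF cYi(1), of Ya]
    central_comm[OF cYi(1), of r] central_left_comm[OF cYi(1), of r]
  have AB': "A * (B * x) = s * (B * (A * x))" for x
    using AB by (metis mult.assoc)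
  note nf = distrib_left distrib_right mult.assoc comm AB AB' sr Yi add.assoc add.commute add.left_commute
  define \<alpha> \<beta> where "\<alpha> = 1 + A" and "\<beta> = 1 + Ya * A"
  \<comment> \<open>Moving the denominator of \<open>A2\<close> past \<open>A\<close> rescales
    \<open>B\<close> by \<open>r\<close> and yields \<open>w\<close>; thus \<open>A2\<close> is the
    right fraction \<open>u * inverse w\<close> and \<open>Th_frac\<close> applies. The polynomials
    \<open>N\<close> and \<open>D\<close> are what survives after the right factor \<alpha> is split
    off from numerator and denominator.\<close>
  define w u where "w = \<beta> + r * B * \<alpha>" and "u = inverse Yb * (\<beta> + Ya * Yb * B * \<alpha>) * A"
  define D N where "D = \<beta> + B * (r + Ya * Yb * A)" and "N = Yb + A + Yb * B * (r + A)"
  have ab: "\<alpha> \<noteq> 0" "\<beta> \<noteq> 0" using n1 by (simp_all add: \<alpha>_def \<beta>_def)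
  have "B1 = B * \<alpha> * inverse \<beta>" by (simp add: B1 Th_def \<alpha>_def \<beta>_def mult.assoc)
  then have Th1: "Th (Ya * Yb) B1 = (\<beta> + B * \<alpha>) * inverse (\<beta> + Ya * Yb * (B * \<alpha>))"
    and b1: "1 + B1 = (\<beta> + B * \<alpha>) * inverse \<beta>"
    using ab c by (simp_all add: Th_frac central_mult distrib_right)
  have n4: "\<beta> + B * \<alpha> \<noteq> 0" using n2 b1 by auto
  have wA: "(\<beta> + B * \<alpha>) * A = A * w"
    unfolding w_def \<alpha>_def \<beta>_def by (simp add: nf)
  have n5: "w \<noteq> 0" using wA n4 A by (metis mult_zero_right no_zero_divisors)
  have A2': "A2 = u * inverse w"
  proof -
    have "A2 = inverse (Ya * Yb) * ((\<beta> + Ya * Yb * (B * \<alpha>)) * inverse (\<beta> + B * \<alpha>)) * (Ya * A)"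
      by (simp add: A2 Th1 inverse_mult_any inverse_inverse_any)
    also have "\<dots> = inverse Yb * (\<beta> + Ya * Yb * (B * \<alpha>)) * (inverse (\<beta> + B * \<alpha>) * A)"
      using nz central_left_comm[OF c(2), of "inverse (\<beta> + B * \<alpha>)"]
        central_left_comm[OF c(2), of "\<beta> + Ya * (Yb * (B * \<alpha>))"]
      by (simp add: inverse_mult_any mult.assoc inverse_mult_cancel_left)
    also have "\<dots> = u * inverse w"
      by (simp add: inverse_mult_swap[OF n4 n5 wA] u_def mult.assoc)
    finally show ?thesis .
  qed
  have D: "w + Yb * u = D * \<alpha>"
    unfolding w_def u_def D_def \<alpha>_def \<beta>_def by (simp add: nf)
  have N: "\<alpha> * inverse \<beta> * (w + u) = inverse Yb * N * \<alpha>"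
  proof -
    have 1: "w + u = \<beta> * (inverse Yb * (Yb + A + Yb * (r * B * \<alpha>)))"
      unfolding w_def u_def \<alpha>_def \<beta>_def by (simp add: nf)
    have "\<alpha> * inverse \<beta> * (w + u) = \<alpha> * (inverse Yb * (Yb + A + Yb * (r * B * \<alpha>)))"
      unfolding 1 using ab by (simp add: mult.assoc inverse_mult_cancel_left)
    also have "\<dots> = inverse Yb * N * \<alpha>"
      unfolding N_def \<alpha>_def by (simp add: nf)
    finally show ?thesis .
  qed
  have "Th Ya A * Th Yb A2 = \<alpha> * inverse \<beta> * (w + u) * inverse (w + Yb * u)"
    unfolding A2' Th_frac[OF n5 c(3)] by (simp add: Th_def \<alpha>_def \<beta>_def mult.assoc)
  also have "\<dots> = inverse Yb * N * inverse D"
    unfolding N D using ab by (simp add: inverse_mult_any mult.assoc mult_inverse_cancel_left)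
  finally have lhs: "Th Ya A * Th Yb A2 = inverse Yb * N * inverse D" .
  define w' u' where "w' = 1 + r * B" and "u' = inverse Yb * (1 + Yb * B) * A"
  have wA': "(1 + B) * A = A * w'"
    unfolding w'_def by (simp add: nf)
  have n6: "w' \<noteq> 0" using wA' n3 A by (metis mult_zero_right no_zero_divisors)
  have A1': "A1 = u' * inverse w'"
    by (simp add: A1 Th_def inverse_mult_any inverse_inverse_any mult.assoc
        inverse_mult_swap[OF n3(1) n6 wA'] u'_def)
  have "w' + u' = inverse Yb * N" "w' + Ya * Yb * u' = D"
    unfolding w'_def u'_def N_def D_def \<beta>_def by (simp_all add: nf)
  then have "Th (Ya * Yb) A1 = inverse Yb * N * inverse D"
    unfolding A1' using Th_frac[OF n6] central_mult[OF c(2,3)] by simp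
  with lhs show ?thesis by simp
qed

text \<open>Since \<open>1 + inverse x = (1 + x) * inverse x\<close>, inverting both arguments costs
  only the factor \<open>y\<close>. Identities for \<open>Th\<close> therefore have mirror
  images.\<close>

lemma Th_inverse:
  assumes "x \<noteq> 0" "y \<noteq> 0" "central y"
  shows "Th (inverse y) (inverse x) = y * Th y x"
proof -
  have 1: "1 + inverse x = (1 + x) * inverse x"
    using assms by (simp add: distrib_right add.commute)
  have 2: "1 + inverse y * inverse x = (1 + y * x) * (inverse x * inverse y)"
  proof -
    have "x * (inverse x * inverse y) = inverse y"
      using assms by (simp add: mult_inverse_cancel_left)
    moreover have "inverse x * inverse y = inverse y * inverse x"
      using central_comm[OF central_inverse[OF assms(3)]] .
    ultimately show ?thesis
      using assms by (simp add: distrib_right mult.assoc add.commute)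
  qed
  have "Th (inverse y) (inverse x) = (1 + x) * (inverse x * (y * x)) * inverse (1 + y * x)"
    unfolding Th_def 1 2 by (simp add: inverse_mult_any inverse_inverse_any mult.assoc)
  also have "inverse x * (y * x) = y"
    using assms by (simp add: central_left_comm)
  also have "(1 + x) * y * inverse (1 + y * x) = y * Th y x"
    using central_left_comm[OF assms(3), of "1 + x"] by (simp add: Th_def mult.assoc)
  finally show ?thesis .
qed

lemma one_plus_inverse_eq_0_iff: "x \<noteq> 0 \<Longrightarrow> 1 + inverse x = 0 \<longleftrightarrow> 1 + x = 0"
  by (metis add.commute distrib_left mult_1_right mult_zero_right right_inverse inverse_inverse_any
      nonzero_imp_inverse_nonzero)

lemma Th_nonzero: "1 + x \<noteq> 0 \<Longrightarrow> 1 + y * x \<noteq> 0 \<Longrightarrow> Th y x \<noteq> 0"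
  by (simp add: Th_def nonzero_imp_inverse_nonzero)

text \<open>The mirror image of \<open>Th_braid_right\<close>: that identity is applied to the
  inverses of all variables with leaf and centre exchanged, and \<open>Th_inverse\<close> removes
  the inverses again.\<close>

lemma Th_braid_left:
  assumes AB: "A * B = s * (B * A)" and nz: "s \<noteq> 0" "Ya \<noteq> 0" "Yb \<noteq> 0" "A \<noteq> 0" "B \<noteq> 0"
    and c: "central s" "central Ya" "central Yb"
    and n1: "1 + B \<noteq> 0" "1 + Yb * B \<noteq> 0"
    and A1: "A1 = inverse Yb * inverse (Th Yb B) * A" and n2: "1 + A1 \<noteq> 0" "1 + (Ya * Yb) * A1 \<noteq> 0"
    and B2: "B2 = Yb * B * Th (Ya * Yb) A1"
    and B1: "B1 = B * Th Ya A"
    and n3: "1 + A \<noteq> 0" "1 + Ya * A \<noteq> 0" and n4: "B2 \<noteq> 0"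
  shows "Th Yb B * Th Ya B2 = Th (Ya * Yb) B1"
proof -
  have nz1: "A1 \<noteq> 0" "B1 \<noteq> 0"
    using nz Th_nonzero[OF n1] Th_nonzero[OF n3] by (simp_all add: A1 B1 nonzero_imp_inverse_nonzero)
  have cY: "central (Ya * Yb)" "Ya * Yb \<noteq> 0" using c nz by (simp_all add: central_mult)
  have "Th (inverse Yb) (inverse B) * Th (inverse Ya) (inverse B2)
    = Th (inverse Yb * inverse Ya) (inverse B1)"
  proof (rule Th_braid_right[where s = "inverse s" and B = "inverse A" and ?B1.0 = "inverse A1"])
    show "inverse B * inverse A = inverse s * (inverse A * inverse B)"
    proof -
      have "inverse (A * B) = inverse (B * A) * inverse s" by (simp add: AB inverse_mult_any)
      then show ?thesis using central_comm[OF central_inverse[OF c(1)]] by (simp add: inverse_mult_any)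
    qed
    show "inverse A1 = inverse A * Th (inverse Yb) (inverse B)"
      using nz c central_left_comm[OF c(3)] central_comm[OF c(3)] by (simp add: A1 Th_inverse inverse_mult_any inverse_inverse_any)
    have "1 + inverse Yb * inverse B = 1 + inverse (Yb * B)"
      using central_comm[OF central_inverse[OF c(3)]] by (simp add: inverse_mult_any)
    then show "1 + inverse Yb * inverse B \<noteq> 0"
      using n1 nz by (simp add: one_plus_inverse_eq_0_iff)
    have "1 + inverse Yb * inverse Ya * inverse A1 = 1 + inverse (Ya * Yb * A1)"
      using central_comm[OF central_inverse[OF cY(1)], of "inverse A1"] by (simp add: inverse_mult_any)
    then show "1 + inverse Yb * inverse Ya * inverse A1 \<noteq> 0"
      using n2 nz nz1 by (simp add: one_plus_inverse_eq_0_iff)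
    show "inverse B1 = inverse (inverse Ya) * inverse (Th (inverse Ya) (inverse A)) * inverse B"
      using nz c by (simp add: B1 Th_inverse inverse_mult_any inverse_inverse_any mult.assoc
        central_left_comm[OF central_inverse[OF c(2)], of "inverse (Th Ya A)"] mult_inverse_cancel_left)
    have "1 + inverse Ya * inverse A = 1 + inverse (Ya * A)"
      using central_comm[OF central_inverse[OF c(2)]] by (simp add: inverse_mult_any)
    then show "1 + inverse Ya * inverse A \<noteq> 0"
      using n3 nz by (simp add: one_plus_inverse_eq_0_iff)
    show "inverse B2 = inverse (inverse Yb * inverse Ya) *
       inverse (Th (inverse Yb * inverse Ya) (inverse A1)) * (inverse Yb * inverse B)"
    proof -
      have 1: "Th (inverse Yb * inverse Ya) (inverse A1) = Ya * Yb * Th (Ya * Yb) A1"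
        using Th_inverse[OF nz1(1) cY(2,1)] by (simp add: inverse_mult_any)
      let ?T = "inverse (Th (Ya * Yb) A1)"
      have "inverse (inverse Yb * inverse Ya) * inverse (Ya * Yb * Th (Ya * Yb) A1) * (inverse Yb * inverse B)
        = (Ya * Yb) * (?T * (inverse (Ya * Yb) * (inverse Yb * inverse B)))"
        by (simp add: inverse_mult_any inverse_inverse_any mult.assoc)
      also have "\<dots> = ?T * (inverse Yb * inverse B)"
        using cY central_left_comm[OF cY(1), of ?T "inverse (Ya * Yb) * (inverse Yb * inverse B)"]
        by (metis mult_inverse_cancel_left)
      also have "\<dots> = inverse (B2)"
        using central_comm[OF central_inverse[OF c(3)], of "inverse B"] by (simp add: B2 inverse_mult_any mult.assoc)
      finally show ?thesis by (simp add: 1)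
    qed
  qed (use nz nz1 c n1 n2 n3 in \<open>simp_all add: central_inverse nonzero_imp_inverse_nonzero one_plus_inverse_eq_0_iff\<close>)
  then have "(Yb * Th Yb B) * (Ya * Th Ya B2) = Ya * Yb * Th (Ya * Yb) B1"
    using nz c n4 Th_inverse[OF nz1(2) cY(2,1)] by (simp add: Th_inverse inverse_mult_any)
  then have "(Ya * Yb) * (Th Yb B * Th Ya B2) = (Ya * Yb) * Th (Ya * Yb) B1"
    by (metis c(2) central_def mult.assoc)
  then show ?thesis
    using cY(2) by simp
qed

text \<open>Imitates the action of a simple reflection at a leaf: the neighbours collect a factor
  \<open>Th\<close>, and the parameters transform like exponentials of simple coroots, with
  \<open>Y v\<close> inverted and \<open>Yc\<close> multiplied by \<open>Y v\<close>.\<close>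

definition leaf_mut :: "nat set \<Rightarrow> nat \<Rightarrow> 'a seed_data \<Rightarrow> 'a seed_data" where
  "leaf_mut J v = (\<lambda>(C, h, Yc, Y, z).
     (C * Th (Y v) (h v), h(v := Y v * h v), Yc * Y v, Y(v := inverse (Y v)),
      if v \<in> J then z * Th (Y v) (h v) else z))"

text \<open>Seen from the centre the sign of the arrow is opposite, so the leaves follow the case
  \<open>eps = - 1\<close> of \<open>phi\<close>: the factor is inverted, stands on the left and is
  accompanied by the inverse parameter.\<close>

definition centre_mut :: "'a seed_data \<Rightarrow> 'a seed_data" where
  "centre_mut = (\<lambda>(C, h, Yc, Y, z).
     (Yc * C, \<lambda>v. inverse Yc * inverse (Th Yc C) * h v, inverse Yc, \<lambda>v. Yc * Y v, z))"

definition seed :: "'a \<Rightarrow> 'a seed_data \<Rightarrow> bool" where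
  "seed s = (\<lambda>(C, h, Yc, Y, z).
     central s \<and> s \<noteq> 0 \<and> s \<noteq> 1 \<and> C \<noteq> 0 \<and> Yc \<noteq> 0 \<and> central Yc \<and>
     (\<forall>v. h v \<noteq> 0 \<and> Y v \<noteq> 0 \<and> central (Y v) \<and> h v * C = s * (C * h v)) \<and>
     (\<forall>u v. h u * h v = h v * h u))"

text \<open>If \<open>1 + y * x = 0\<close> for \<open>x\<close> one of \<open>A\<close> and
  \<open>B\<close>, then \<open>y * x = - 1\<close> makes \<open>x\<close> commute with everything,
  against the q-commutation with \<open>s\<close> different from 1. All denominators of mutations
  are controlled in this way.\<close>

lemma one_plus_nonzero:
  assumes "A * B = s * (B * A)" "s \<noteq> 1" "A \<noteq> 0" "B \<noteq> 0" "central y"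
  shows "1 + y * A \<noteq> 0" "1 + y * B \<noteq> 0"
proof -
  have ne: "A * B \<noteq> B * A"
  proof
    assume "A * B = B * A"
    then have "(s - 1) * (B * A) = 0" using assms(1) by (simp add: left_diff_distrib)
    then show False using assms by simp
  qed
  have *: "x * x' = x' * x" if "1 + y * x = 0" for x x'
  proof (cases "y = 0")
    case False
    have "y * x = - 1" using that by (simp add: eq_neg_iff_add_eq_0 add.commute)
    then have "(y * x) * x' = x' * (y * x)"
      by simp
    then have "y * (x * x') = y * (x' * x)"
      using central_left_comm[OF assms(5), of x' x] by (simp add: mult.assoc)
    then show ?thesis using False by simp
  qed (use that in simp)
  show "1 + y * A \<noteq> 0" "1 + y * B \<noteq> 0" using ne *[of A B] *[of B A] by auto
qed

lemma comm_one_plus: "x * a = a * x \<Longrightarrow> central y \<Longrightarrow> x * (1 + y * a) = (1 + y * a) * x"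
  using central_left_comm[of y x a] by (simp add: distrib_left distrib_right mult.assoc)

lemma comm_inverse: "x * a = a * x \<Longrightarrow> x * inverse a = inverse a * x"
  by (cases "a = 0") (simp_all add: inverse_mult_swap[of a a x])

lemma comm_mult: "x * a = a * x \<Longrightarrow> x * b = b * x \<Longrightarrow> x * (a * b) = (a * b) * x"
  by (metis mult.assoc)

lemma comm_Th: "x * a = a * x \<Longrightarrow> central y \<Longrightarrow> x * Th y a = Th y a * x"
  using comm_one_plus[of x a 1] comm_inverse[OF comm_one_plus[of x a y]] comm_mult[of x]
  by (simp add: Th_def)

lemma Th_shift:
  assumes "x * a = b * x" "x \<noteq> 0" "central y" "1 + y * a \<noteq> 0" "1 + y * b \<noteq> 0"
  shows "x * Th y a = Th y b * x"
proof -
  have 1: "x * (1 + a) = (1 + b) * x" using assms by (simp add: distrib_left distrib_right)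
  have 2: "(1 + y * b) * x = x * (1 + y * a)"
    using assms central_left_comm[of y x a] by (simp add: distrib_left distrib_right mult.assoc)
  have "x * Th y a = (1 + b) * (x * inverse (1 + y * a))"
    unfolding Th_def by (simp add: 1 flip: mult.assoc)
  also have "x * inverse (1 + y * a) = inverse (1 + y * b) * x"
    using inverse_mult_swap[OF assms(5,4) 2] by simp
  finally show ?thesis by (simp add: Th_def mult.assoc)
qed

lemma seed_leaf_mut: "seed s \<sigma> \<Longrightarrow> seed s (leaf_mut J v \<sigma>)"
proof -
  assume S: "seed s \<sigma>"
  obtain C h Yc Y z where \<sigma>: "\<sigma> = (C, h, Yc, Y, z)" by (cases \<sigma>) auto
  note S' = S[unfolded \<sigma> seed_def, simplified]
  have n: "1 + h v \<noteq> 0" "1 + Y v * h v \<noteq> 0"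
    using one_plus_nonzero(1)[of "h v" C s 1] one_plus_nonzero(1)[of "h v" C s "Y v"] S' by simp_all
  have T: "h u * Th (Y v) (h v) = Th (Y v) (h v) * h u" for u
    using comm_Th[of "h u" "h v" "Y v"] S' by blast
  have 1: "h u * (C * Th (Y v) (h v)) = s * (C * (Th (Y v) (h v) * h u))" for u
  proof -
    have "h u * (C * Th (Y v) (h v)) = (h u * C) * Th (Y v) (h v)" by (simp add: mult.assoc)
    also have "h u * C = s * (C * h u)" using S' by auto
    finally show ?thesis by (simp add: mult.assoc T)
  qed
  have cY: "x * (Y v * y) = Y v * (x * y)" for x y using S' central_left_comm by blast
  show ?thesis
    unfolding \<sigma> seed_def leaf_mut_def
    using S' n 1 cY by (simp add: Th_nonzero central_mult central_inverse nonzero_imp_inverse_nonzero mult.assoc)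
qed

lemma seed_centre_mut: "seed s \<sigma> \<Longrightarrow> seed s (centre_mut \<sigma>)"
proof -
  assume S: "seed s \<sigma>"
  obtain C h Yc Y z where \<sigma>: "\<sigma> = (C, h, Yc, Y, z)" by (cases \<sigma>) auto
  note S' = S[unfolded \<sigma> seed_def, simplified]
  have n: "1 + C \<noteq> 0" "1 + Yc * C \<noteq> 0"
    using one_plus_nonzero(2)[of "h 0" C s 1] one_plus_nonzero(2)[of "h 0" C s "Yc"] S' by simp_all
  define T where "T = inverse (Th Yc C)"
  have T0: "T \<noteq> 0" using n Th_nonzero by (simp add: T_def nonzero_imp_inverse_nonzero)
  have TC: "T * C = C * T"
    using comm_inverse[OF comm_Th[of C C Yc]] S' by (simp add: T_def)
  have hC: "h v * C = (s * C) * h v" for v using S' by (simp add: mult.assoc)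
  \<comment> \<open>Moving a leaf variable across a function of \<open>C\<close> rescales
    \<open>C\<close> by \<open>s\<close>; \<open>T'\<close> is \<open>T\<close> after this
    rescaling.\<close>
  define T' where "T' = inverse (Th Yc (s * C))"
  have cS: "central s" "central Yc" using S' by auto
  have sC: "h 0 * (s * C) = s * ((s * C) * h 0)"
    using hC[of 0] central_left_comm[OF cS(1), of "h 0" C] by (simp add: mult.assoc)
  have n': "1 + s * C \<noteq> 0" "1 + Yc * (s * C) \<noteq> 0"
    using one_plus_nonzero(2)[OF sC, of 1] one_plus_nonzero(2)[OF sC, of Yc] S' by simp_all
  have hT: "h v * T = T' * h v" for v
  proof -
    have "h v * Th Yc C = Th Yc (s * C) * h v"
      by (rule Th_shift) (use S' hC n n' in auto)
    then show ?thesis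
      using inverse_mult_swap[of "Th Yc (s * C)" "Th Yc C" "h v"] Th_nonzero[OF n] Th_nonzero[OF n']
      by (simp add: T_def T'_def)
  qed
  have TT: "T * T' = T' * T"
    unfolding T_def T'_def
    by (intro comm_inverse comm_inverse[THEN sym] comm_Th[THEN sym] comm_Th)
      (use cS central_left_comm[OF cS(1), of C C] in \<open>auto simp: mult.assoc\<close>)
  have cYi: "central (inverse Yc)" using S' central_inverse by auto
  have 1: "inverse Yc * T * h v * (Yc * C) = s * (Yc * (C * (inverse Yc * (T * h v))))" for v
  proof -
    have "inverse Yc * T * h v * (Yc * C) = inverse Yc * (T * (h v * (Yc * C)))"
      by (simp only: mult.assoc)
    also have "\<dots> = inverse Yc * (Yc * (T * (h v * C)))"
      by (simp only: central_left_comm[OF cS(2), of T] central_left_comm[OF cS(2), of "h v"])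
    also have "\<dots> = inverse Yc * (Yc * (T * (s * (C * h v))))"
      using S' by simp
    also have "\<dots> = s * (inverse Yc * (Yc * (T * (C * h v))))"
      by (simp only: central_left_comm[OF cS(1), of T] central_left_comm[OF cS(1), of Yc]
          central_left_comm[OF cS(1), of "inverse Yc"])
    also have "T * (C * h v) = C * (T * h v)"
      by (simp only: TC flip: mult.assoc)
    also have "inverse Yc * (Yc * (C * (T * h v))) = Yc * (C * (inverse Yc * (T * h v)))"
      by (simp only: central_left_comm[OF cYi, of Yc] central_left_comm[OF cYi, of C])
    finally show ?thesis .
  qed
  have 2: "inverse Yc * T * h u * (inverse Yc * T * h v) = inverse Yc * T * h v * (inverse Yc * T * h u)" for u v
  proof -
    have *: "inverse Yc * T * h u * (inverse Yc * T * h v) = inverse Yc * (inverse Yc * (T * (T' * (h u * h v))))" for u v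
    proof -
      have "h u * (inverse Yc * (T * h v)) = inverse Yc * (T' * (h u * h v))"
        using central_left_comm[OF cYi, of "h u" "T * h v"] hT[of u] by (metis mult.assoc)
      then show ?thesis
        by (simp only: mult.assoc central_left_comm[OF cYi, of T])
    qed
    have "h u * h v = h v * h u" using S' by auto
    then show ?thesis unfolding * by simp
  qed
  show ?thesis
    unfolding \<sigma> seed_def centre_mut_def prod.case T_def[symmetric]
    using S' T0 1 2 by (simp add: central_mult central_inverse nonzero_imp_inverse_nonzero) (simp add: mult.assoc)
qed

lemma leaf_mut_commute:
  "seed s \<sigma> \<Longrightarrow> leaf_mut J u (leaf_mut J v \<sigma>) = leaf_mut J v (leaf_mut J u \<sigma>)"
proof (cases "u = v")
  case False
  assume S: "seed s \<sigma>"
  obtain C h Yc Y z where \<sigma>: "\<sigma> = (C, h, Yc, Y, z)" by (cases \<sigma>) auto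
  note S' = S[unfolded \<sigma> seed_def, simplified]
  have hh: "h v * h u = h u * h v" and cY: "central (Y u)" "central (Y v)" using S' by blast+
  have "Th (Y u) (h u) * Th (Y v) (h v) = Th (Y v) (h v) * Th (Y u) (h u)"
    by (rule comm_Th[OF comm_Th[OF hh cY(1), symmetric] cY(2)])
  moreover have "Y u * Y v = Y v * Y u" using cY by (simp only: central_comm)
  ultimately show ?thesis
    using False unfolding \<sigma> leaf_mut_def by (auto simp: mult.assoc fun_upd_twist)
qed simp

text \<open>The centre and the extra variable collect the same factors from the leaf, so
  \<open>Th_braid_right\<close> settles both. All leaves, mutated or not, collect the same factors
  from the centre, and \<open>Th_braid_left\<close> settles them together.\<close>

lemma leaf_centre_braid:
  assumes S: "seed s \<sigma>"
  shows "leaf_mut J v (centre_mut (leaf_mut J v \<sigma>)) = centre_mut (leaf_mut J v (centre_mut \<sigma>))"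
proof -
  obtain C h Yc Y z where \<sigma>: "\<sigma> = (C, h, Yc, Y, z)" by (cases \<sigma>) auto
  note S' = S[unfolded \<sigma> seed_def, simplified]
  define A where "A = h v"
  define Ya where "Ya = Y v"
  define B1 where "B1 = C * Th Ya A"
  define A2 where "A2 = inverse (Ya * Yc) * inverse (Th (Ya * Yc) B1) * (Ya * A)"
  define A1 where "A1 = inverse Yc * inverse (Th Yc C) * A"
  define B2 where "B2 = Yc * C * Th (Ya * Yc) A1"
  have cs: "central s" "central Ya" "central Yc" "central (Ya * Yc)" "s \<noteq> 0" "Ya \<noteq> 0" "Yc \<noteq> 0" "A \<noteq> 0" "C \<noteq> 0" "s \<noteq> 1"
    and AC: "A * C = s * (C * A)"
    using S' by (auto simp: A_def Ya_def central_mult)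
  have YY: "Yc * Ya = Ya * Yc" using cs central_comm by metis
  note n = one_plus_nonzero[OF AC cs(10,8,9)]
  have n0: "1 + A \<noteq> 0" "1 + Ya * A \<noteq> 0" "1 + C \<noteq> 0" "1 + Yc * C \<noteq> 0"
    using n[of 1] n(1)[of Ya] n(2)[of Yc] cs by simp_all
  have S1: "seed s (leaf_mut J v \<sigma>)" and S2: "seed s (centre_mut \<sigma>)"
    using S seed_leaf_mut seed_centre_mut by auto
  have "B1 \<noteq> 0 \<and> (h(v := Ya * A)) v * B1 = s * (B1 * (h(v := Ya * A)) v)"
    using S1 unfolding \<sigma> leaf_mut_def seed_def B1_def A_def Ya_def prod.case by blast
  then have S1': "B1 \<noteq> 0" "(Ya * A) * B1 = s * (B1 * (Ya * A))"
    by simp_all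
  have "\<forall>u. inverse Yc * inverse (Th Yc C) * h u \<noteq> 0 \<and>
      inverse Yc * inverse (Th Yc C) * h u * (Yc * C) = s * (Yc * C * (inverse Yc * inverse (Th Yc C) * h u))"
    using S2 unfolding \<sigma> centre_mut_def seed_def prod.case by blast
  then have S2': "A1 \<noteq> 0" "A1 * (Yc * C) = s * ((Yc * C) * A1)"
    unfolding A1_def A_def by blast+
  have nB: "1 + B1 \<noteq> 0" "1 + Ya * Yc * B1 \<noteq> 0"
    using one_plus_nonzero(2)[OF S1'(2), of 1] one_plus_nonzero(2)[OF S1'(2) cs(10) _ S1'(1) cs(4)] cs S1' by simp_all
  have nA: "1 + A1 \<noteq> 0" "1 + Ya * Yc * A1 \<noteq> 0"
    using one_plus_nonzero(1)[OF S2'(2), of 1] one_plus_nonzero(1)[OF S2'(2) cs(10) S2'(1) _ cs(4)] cs S2' by simp_all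
  have B20: "B2 \<noteq> 0" using cs Th_nonzero[OF nA] by (simp add: B2_def)
  have R: "Th Ya A * Th Yc A2 = Th (Ya * Yc) A1"
    by (rule Th_braid_right[OF AC cs(5-7,1-3) n0(1,2) B1_def nB A2_def A1_def n0(3,4) cs(8)])
  have L: "Th Yc C * Th Ya B2 = Th (Ya * Yc) B1"
    by (rule Th_braid_left[OF AC cs(5-9,1-3) n0(3,4) A1_def nA B2_def B1_def n0(1,2) B20])
  have T0: "Th Yc C \<noteq> 0" "Th (Ya * Yc) B1 \<noteq> 0" using Th_nonzero n0 nB by auto
  have iY: "Yc * inverse (Ya * Yc) = inverse Ya" "Ya * inverse (Ya * Yc) = inverse Yc"
      "inverse (Ya * Yc) * Yc = inverse Ya" "Ya * Yc * inverse Ya = Yc" "inverse Yc * (Ya * Yc) = Ya"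
      "inverse (Ya * Yc) = inverse Ya * inverse Yc" "inverse (Ya * Yc) * Ya = inverse Yc"
    using cs
    by (simp_all add: inverse_mult_any mult.assoc mult_inverse_cancel_left inverse_mult_cancel_left
        nonzero_imp_inverse_nonzero
        central_comm[OF cs(3), of Ya] central_comm[OF cs(3), of "inverse Ya"]
        central_left_comm[OF cs(3), of Ya] central_left_comm[OF cs(3), of "inverse Ya"]
        central_comm[OF central_inverse[OF cs(3)], of Ya] central_comm[OF central_inverse[OF cs(3)], of "inverse Ya"]
        central_left_comm[OF central_inverse[OF cs(3)], of Ya] central_left_comm[OF central_inverse[OF cs(3)], of "inverse Ya"])
  define h2 where "h2 = (\<lambda>u. inverse (Ya * Yc) * inverse (Th (Ya * Yc) B1) * (h(v := Ya * A)) u)"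
  define Y2 where "Y2 = (\<lambda>u. Ya * Yc * (Y(v := inverse Ya)) u)"
  define z1 where "z1 = (if v \<in> J then z * Th Ya A else z)"
  have v2: "h2 v = A2" "Y2 v = Yc"
    by (simp_all add: h2_def Y2_def A2_def iY)
  have 0: "leaf_mut J v \<sigma> = (B1, h(v := Ya * A), Ya * Yc, Y(v := inverse Ya), z1)"
    unfolding \<sigma> leaf_mut_def prod.case A_def[symmetric] Ya_def[symmetric] B1_def z1_def YY ..
  have "centre_mut (leaf_mut J v \<sigma>) = (Ya * Yc * B1, h2, inverse (Ya * Yc), Y2, z1)"
    unfolding 0 centre_mut_def prod.case h2_def Y2_def ..
  then have 1: "leaf_mut J v (centre_mut (leaf_mut J v \<sigma>)) =
     (Ya * Yc * B1 * Th Yc A2, h2(v := Yc * A2), inverse Ya, Y2(v := inverse Yc),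
      if v \<in> J then z1 * Th Yc A2 else z1)"
    by (simp only: leaf_mut_def prod.case v2 iY(1-5))
  define h3 where "h3 = (\<lambda>u. inverse Yc * inverse (Th Yc C) * h u)"
  define Y3 where "Y3 = (\<lambda>u. Yc * Y u)"
  have v3: "h3 v = A1" "Y3 v = Ya * Yc"
    by (simp_all add: h3_def Y3_def A1_def A_def Ya_def[symmetric] YY)
  have 3: "centre_mut \<sigma> = (Yc * C, h3, inverse Yc, Y3, z)"
    unfolding \<sigma> centre_mut_def prod.case h3_def Y3_def ..
  have 4: "leaf_mut J v (centre_mut \<sigma>) = (B2, h3(v := Ya * Yc * A1), Ya, Y3(v := inverse (Ya * Yc)),
     if v \<in> J then z * Th (Ya * Yc) A1 else z)"
    unfolding 3 by (simp only: leaf_mut_def prod.case v3 B2_def iY(1-5))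
  have 2: "centre_mut (leaf_mut J v (centre_mut \<sigma>)) =
     (Ya * B2, \<lambda>u. inverse Ya * inverse (Th Ya B2) * (h3(v := Ya * Yc * A1)) u, inverse Ya,
      \<lambda>u. Ya * (Y3(v := inverse (Ya * Yc))) u, if v \<in> J then z * Th (Ya * Yc) A1 else z)"
    unfolding 4 by (simp only: centre_mut_def prod.case)
  have e1: "Ya * Yc * B1 * Th Yc A2 = Ya * B2"
    unfolding B1_def B2_def R[symmetric] by (simp add: mult.assoc)
  have Li: "inverse (Th (Ya * Yc) B1) = inverse (Th Ya B2) * inverse (Th Yc C)"
    by (simp flip: L add: inverse_mult_any)
  have e2: "inverse (Ya * Yc) * inverse (Th (Ya * Yc) B1) * x = inverse Ya * inverse (Th Ya B2) * (inverse Yc * inverse (Th Yc C) * x)" for x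
    unfolding Li iY(6) using central_left_comm[OF central_inverse[OF cs(3)], of "inverse (Th Ya B2)"] by (simp add: mult.assoc)
  have e3: "Yc * A2 = inverse Ya * inverse (Th Ya B2) * (Ya * Yc * A1)"
  proof -
    define W K where "W = inverse Ya * inverse (Th Ya B2)" and "K = inverse Yc * inverse (Th Yc C)"
    have "Yc * (W * (K * (Ya * A))) = Yc * (W * (Ya * (K * A)))"
      by (simp only: central_left_comm[OF cs(2)])
    also have "\<dots> = W * (Yc * (Ya * (K * A)))"
      by (rule central_left_comm[OF cs(3), symmetric])
    also have "Yc * (Ya * (K * A)) = Ya * Yc * (K * A)"
      by (simp only: YY flip: mult.assoc)
    finally show ?thesis
      unfolding A2_def e2 A1_def W_def K_def .
  qed
  have e4: "h2(v := Yc * A2) = (\<lambda>u. inverse Ya * inverse (Th Ya B2) * (h3(v := Ya * Yc * A1)) u)"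
    using e3 e2 by (simp add: fun_eq_iff h2_def h3_def)
  have e5: "Y2(v := inverse Yc) = (\<lambda>u. Ya * (Y3(v := inverse (Ya * Yc))) u)"
    using iY by (simp add: fun_eq_iff Y2_def Y3_def mult.assoc)
  show ?thesis unfolding 1 2 e1 e4 e5 z1_def by (simp add: mult.assoc R)
qed

definition leaves_mut :: "nat set \<Rightarrow> nat \<Rightarrow> 'a seed_data \<Rightarrow> 'a seed_data" where
  "leaves_mut J N = fold (leaf_mut J) [0..<N]"

lemma leaves_centre_braid:
  assumes "seed s \<sigma>"
  shows "centre_mut (leaves_mut J 1 (centre_mut \<sigma>)) = leaves_mut J 1 (centre_mut (leaves_mut J 1 \<sigma>))" (is ?R1)
    and "centre_mut (leaves_mut J 2 (centre_mut (leaves_mut J 2 \<sigma>))) =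
      leaves_mut J 2 (centre_mut (leaves_mut J 2 (centre_mut \<sigma>)))" (is ?R2)
    and "centre_mut (leaves_mut J 3 (centre_mut (leaves_mut J 3 (centre_mut (leaves_mut J 3 \<sigma>))))) =
      leaves_mut J 3 (centre_mut (leaves_mut J 3 (centre_mut (leaves_mut J 3 (centre_mut \<sigma>)))))" (is ?R3)
proof -
  \<comment> \<open>The word lemmas ask for identities valid everywhere, so the mutations are
    replaced by the identity outside the seeds.\<close>
  define L where "L v x = (if seed s x then leaf_mut J v x else x)" for v x
  define M where "M x = (if seed s x then centre_mut x else x)" for x
  have seedL: "seed s x \<Longrightarrow> seed s (L v x)" and seedM: "seed s x \<Longrightarrow> seed s (M x)" for v x
    by (simp_all add: L_def M_def seed_leaf_mut seed_centre_mut)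
  have comm: "L u (L v x) = L v (L u x)" for u v x
    by (simp add: L_def seed_leaf_mut leaf_mut_commute[of s x])
  have braid: "L v (M (L v x)) = M (L v (M x))" for v x
    by (simp add: L_def M_def seed_leaf_mut seed_centre_mut leaf_centre_braid[of s x])
  have eqM: "seed s x \<Longrightarrow> centre_mut x = M x" for x by (simp add: M_def)
  have eqL: "seed s x \<Longrightarrow> leaf_mut J v x = L v x" for v x by (simp add: L_def)
  note eqs = leaves_mut_def eval_nat_numeral eqM eqL seedL seedM assms
  show ?R1
    by (simp add: eqs braid)
  show ?R2
    using A3_longest_word[of "L 0" "L (Suc 0)" M \<sigma>, OF comm braid braid] by (simp add: eqs)
  show ?R3
    using D4_longest_word[of "L 0" "L (Suc 0)" "L (Suc (Suc 0))" M \<sigma>, OF comm comm comm braid braid braid]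
    by (simp add: eqs)
qed

section \<open>Quantum tori and their skew fields of fractions\<close>

definition scalars :: "('f::field \<Rightarrow> 'a) \<Rightarrow> bool" where
  "scalars sc \<longleftrightarrow> (\<forall>a b. sc (a + b) = sc a + sc b) \<and> (\<forall>a b. sc (a * b) = sc a * sc b) \<and>
     sc 1 = 1 \<and> (\<forall>a. central (sc a))"

text \<open>The family \<open>e\<close> multiplies like the basis of a monoid algebra twisted by the
  scalars \<chi>, as the ordered monomials of a quantum torus do.\<close>

definition twisted :: "('f::field \<Rightarrow> 'a) \<Rightarrow> ('g::comm_monoid_add \<Rightarrow> 'a) \<Rightarrow> ('g \<Rightarrow> 'g \<Rightarrow> 'f) \<Rightarrow> bool" where
  "twisted sc e \<chi> \<longleftrightarrow> e 0 = 1 \<and> (\<forall>\<gamma> \<delta>. e \<gamma> * e \<delta> = sc (\<chi> \<gamma> \<delta>) * e (\<gamma> + \<delta>))"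

definition indep :: "('f::field \<Rightarrow> 'a) \<Rightarrow> ('g \<Rightarrow> 'a) \<Rightarrow> bool" where
  "indep sc e \<longleftrightarrow> (\<forall>S c. finite S \<longrightarrow> (\<Sum>\<gamma>\<in>S. sc (c \<gamma>) * e \<gamma>) = 0 \<longrightarrow> (\<forall>\<gamma>\<in>S. c \<gamma> = 0))"

definition lspan :: "('f::field \<Rightarrow> 'a) \<Rightarrow> ('g \<Rightarrow> 'a) \<Rightarrow> 'g set \<Rightarrow> 'a set" where
  "lspan sc e S = {x. \<exists>T c. finite T \<and> T \<subseteq> S \<and> x = (\<Sum>\<gamma>\<in>T. sc (c \<gamma>) * e \<gamma>)}"

lemma scalarsD:
  assumes "scalars sc"
  shows "sc (a + b) = sc a + sc b" "sc (a * b) = sc a * sc b" "sc 1 = 1" "central (sc a)"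
    "sc 0 = 0" "sc (- a) = - sc a" "sc (a - b) = sc a - sc b"
proof -
  show *: "sc (a + b) = sc a + sc b" "sc (a * b) = sc a * sc b" "sc 1 = 1" "central (sc a)" for a b
    using assms by (auto simp: scalars_def)
  have "sc (0 + 0) = sc 0 + sc 0" by (rule *)
  then show 0: "sc 0 = 0" by simp
  have "sc (a + - a) = sc a + sc (- a)" for a by (rule *)
  then show 1: "sc (- a) = - sc a" for a
    using 0 by (simp add: eq_neg_iff_add_eq_0 add.commute)
  show "sc (a - b) = sc a - sc b"
    using *(1)[of a "- b"] 1 by simp
qed

lemma sc_nonzero: "scalars sc \<Longrightarrow> c \<noteq> 0 \<Longrightarrow> sc c \<noteq> 0"
proof
  assume sc: "scalars sc" and c: "c \<noteq> 0" and 0: "sc c = 0"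
  have "sc (c * inverse c) = 0" using 0 by (simp only: scalarsD(2)[OF sc] mult_zero_left)
  then show False using scalarsD(3)[OF sc] c by simp
qed

lemma sc_inj: "scalars sc \<Longrightarrow> sc a = sc b \<Longrightarrow> a = b"
  using sc_nonzero[of sc "a - b"] by (auto simp: scalarsD)

lemma sc_comm: "scalars sc \<Longrightarrow> x * sc a = sc a * x"
  by (rule central_comm[OF scalarsD(4)])

lemma sc_left_comm: "scalars sc \<Longrightarrow> x * (sc a * y) = sc a * (x * y)"
  by (rule central_left_comm[OF scalarsD(4)])

lemma sc_sum: "scalars sc \<Longrightarrow> sc (\<Sum>s\<in>S. c s) = (\<Sum>s\<in>S. sc (c s))"
  by (induction S rule: infinite_finite_induct) (simp_all add: scalarsD)

lemma lspanI: "finite T \<Longrightarrow> T \<subseteq> S \<Longrightarrow> (\<Sum>\<gamma>\<in>T. sc (c \<gamma>) * e \<gamma>) \<in> lspan sc e S"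
  by (auto simp: lspan_def)

lemma lspan_mono: "S \<subseteq> S' \<Longrightarrow> lspan sc e S \<subseteq> lspan sc e S'"
  unfolding lspan_def by blast

lemma sum_extend_coeff:
  assumes "scalars sc" "finite T'" "T \<subseteq> T'"
  shows "(\<Sum>\<gamma>\<in>T. sc (c \<gamma>) * e \<gamma>) = (\<Sum>\<gamma>\<in>T'. sc (if \<gamma> \<in> T then c \<gamma> else 0) * e \<gamma>)"
  using assms by (intro sum.mono_neutral_cong_left) (auto simp: scalarsD)

lemma lspan_0: "0 \<in> lspan sc e S"
  unfolding lspan_def by (auto intro!: exI[of _ "{}"])

lemma lspan_add:
  assumes sc: "scalars sc" and "x \<in> lspan sc e S" "y \<in> lspan sc e S"
  shows "x + y \<in> lspan sc e S"
proof -
  obtain T c where T: "finite T" "T \<subseteq> S" "x = (\<Sum>\<gamma>\<in>T. sc (c \<gamma>) * e \<gamma>)"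
    using assms by (auto simp: lspan_def)
  obtain U d where U: "finite U" "U \<subseteq> S" "y = (\<Sum>\<gamma>\<in>U. sc (d \<gamma>) * e \<gamma>)"
    using assms by (auto simp: lspan_def)
  have "x + y = (\<Sum>\<gamma>\<in>T \<union> U. sc ((if \<gamma> \<in> T then c \<gamma> else 0) + (if \<gamma> \<in> U then d \<gamma> else 0)) * e \<gamma>)"
    using T U sum_extend_coeff[OF sc, of "T \<union> U" T c e] sum_extend_coeff[OF sc, of "T \<union> U" U d e]
    by (simp add: scalarsD[OF sc] distrib_right sum.distrib)
  then show ?thesis using T U by (auto intro!: lspanI)
qed

lemma lspan_smult:
  assumes sc: "scalars sc" and "x \<in> lspan sc e S"
  shows "sc a * x \<in> lspan sc e S"
proof -
  obtain T c where T: "finite T" "T \<subseteq> S" "x = (\<Sum>\<gamma>\<in>T. sc (c \<gamma>) * e \<gamma>)"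
    using assms by (auto simp: lspan_def)
  then have "sc a * x = (\<Sum>\<gamma>\<in>T. sc (a * c \<gamma>) * e \<gamma>)"
    by (simp add: scalarsD[OF sc] sum_distrib_left mult.assoc)
  then show ?thesis using T by (auto intro!: lspanI)
qed

lemma lspan_uminus: "scalars sc \<Longrightarrow> x \<in> lspan sc e S \<Longrightarrow> - x \<in> lspan sc e S"
  using lspan_smult[of sc x e S "- 1"] by (simp add: scalarsD)

lemma lspan_sum:
  "scalars sc \<Longrightarrow> (\<And>s. s \<in> T \<Longrightarrow> f s \<in> lspan sc e S) \<Longrightarrow> (\<Sum>s\<in>T. f s) \<in> lspan sc e S"
  by (induction T rule: infinite_finite_induct) (auto intro: lspan_0 lspan_add)

lemma lspan_base: "scalars sc \<Longrightarrow> \<gamma> \<in> S \<Longrightarrow> e \<gamma> \<in> lspan sc e S"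
  using lspanI[of "{\<gamma>}" S sc "\<lambda>_. 1" e] by (simp add: scalarsD)

lemma lspan_mult:
  assumes sc: "scalars sc" and tw: "twisted sc e \<chi>"
    and x: "x \<in> lspan sc e S" and y: "y \<in> lspan sc e T"
    and ST: "\<And>\<gamma> \<delta>. \<gamma> \<in> S \<Longrightarrow> \<delta> \<in> T \<Longrightarrow> \<gamma> + \<delta> \<in> U"
  shows "x * y \<in> lspan sc e U"
proof -
  obtain S' c where S': "finite S'" "S' \<subseteq> S" "x = (\<Sum>\<gamma>\<in>S'. sc (c \<gamma>) * e \<gamma>)"
    using x by (auto simp: lspan_def)
  obtain T' d where T': "finite T'" "T' \<subseteq> T" "y = (\<Sum>\<gamma>\<in>T'. sc (d \<gamma>) * e \<gamma>)"
    using y by (auto simp: lspan_def)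
  have "sc (c \<gamma>) * e \<gamma> * (sc (d \<delta>) * e \<delta>) = sc (c \<gamma>) * (sc (d \<delta>) * (sc (\<chi> \<gamma> \<delta>) * e (\<gamma> + \<delta>)))" for \<gamma> \<delta>
    using tw sc_left_comm[OF sc, of "e \<gamma>"] by (simp add: twisted_def mult.assoc)
  then show ?thesis
    using S'(2) T'(2) ST unfolding S'(3) T'(3) sum_distrib_left sum_distrib_right
    by (auto intro!: lspan_sum[OF sc] lspan_smult[OF sc] lspan_base[OF sc] simp: subset_iff)
qed

text \<open>Gaussian elimination: each induction step removes one spanning element \<open>t\<close>,
  using a vector with nonzero coefficient at \<open>t\<close> as pivot if there is one.\<close>

lemma nontrivial_relation:
  fixes sc :: "'f::field \<Rightarrow> 'a"
  assumes sc: "scalars sc" and "finite T" "finite S" "card T < card S"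
    and "\<And>s. s \<in> S \<Longrightarrow> v s \<in> lspan sc e T"
  shows "\<exists>c. (\<exists>s\<in>S. c s \<noteq> 0) \<and> (\<Sum>s\<in>S. sc (c s) * v s) = 0"
  using assms(2-)
proof (induction T arbitrary: S v rule: finite_induct)
  case empty
  then have "v s = 0" if "s \<in> S" for s using that by (fastforce simp: lspan_def)
  moreover have "S \<noteq> {}" using empty by auto
  ultimately have *: "(\<exists>s\<in>S. (1 :: 'f) \<noteq> 0) \<and> (\<Sum>s\<in>S. sc 1 * v s) = 0" by auto
  show ?case by (rule exI[of _ "\<lambda>_. 1 :: 'f"]) (use * in simp)
next
  case (insert t T)
  have "\<exists>m w. v s = sc m * e t + w \<and> w \<in> lspan sc e T" if s: "s \<in> S" for s
  proof -
    obtain U c where U: "finite U" "U \<subseteq> insert t T" "v s = (\<Sum>\<gamma>\<in>U. sc (c \<gamma>) * e \<gamma>)"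
      using insert.prems(3)[OF s] by (auto simp: lspan_def)
    show ?thesis
    proof (cases "t \<in> U")
      case True
      then have "v s = sc (c t) * e t + (\<Sum>\<gamma>\<in>U - {t}. sc (c \<gamma>) * e \<gamma>)"
        using U by (simp add: sum.remove)
      moreover have "(\<Sum>\<gamma>\<in>U - {t}. sc (c \<gamma>) * e \<gamma>) \<in> lspan sc e T"
        using U by (intro lspanI) auto
      ultimately show ?thesis by blast
    next
      case False
      then have "v s \<in> lspan sc e T" unfolding U(3) using U by (intro lspanI) auto
      then show ?thesis using scalarsD(5)[OF sc] by (metis add_0_left mult_zero_left)
    qed
  qed
  then obtain m w where mw: "\<And>s. s \<in> S \<Longrightarrow> v s = sc (m s) * e t + w s \<and> w s \<in> lspan sc e T"
    by metis
  show ?case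
  proof (cases "\<exists>s0\<in>S. m s0 \<noteq> 0")
    case False
    then show ?thesis
      using insert.IH[of S v] insert.prems insert.hyps mw by (auto simp: scalarsD[OF sc])
  next
    case True
    then obtain s0 where s0: "s0 \<in> S" "m s0 \<noteq> 0" by blast
    define v' where "v' s = v s + sc (- (m s / m s0)) * v s0" for s
    have "v' s \<in> lspan sc e T" if "s \<in> S - {s0}" for s
    proof -
      have "sc (- (m s / m s0)) * (sc (m s0) * e t) = sc (- m s) * e t"
        using s0 by (simp flip: mult.assoc scalarsD(2)[OF sc])
      then have "v' s = w s + sc (- (m s / m s0)) * w s0"
        using that s0 mw[of s] mw[of s0] by (simp add: v'_def distrib_left scalarsD(6)[OF sc] algebra_simps)
      then show ?thesis
        using that s0 mw[of s] mw[of s0] by (auto intro!: lspan_add[OF sc] lspan_smult[OF sc])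
    qed
    moreover have "card T < card (S - {s0})"
      using insert.prems insert.hyps s0 by (simp add: card_Diff_singleton)
    ultimately obtain c where c: "\<exists>s\<in>S - {s0}. c s \<noteq> 0" "(\<Sum>s\<in>S - {s0}. sc (c s) * v' s) = 0"
      using insert.IH[of "S - {s0}" v'] insert.prems by auto
    \<comment> \<open>The coefficient at the pivot collects the multiples of \<open>v s0\<close>
      that were added in forming \<open>v'\<close>.\<close>
    define c' where "c' = c(s0 := (\<Sum>s\<in>S - {s0}. c s * - (m s / m s0)))"
    have "(\<Sum>s\<in>S. sc (c' s) * v s) = sc (c' s0) * v s0 + (\<Sum>s\<in>S - {s0}. sc (c s) * v s)"
      using s0 insert.prems by (simp add: sum.remove[of S s0] c'_def)
    also have "\<dots> = (\<Sum>s\<in>S - {s0}. sc (c s) * v' s)"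
      unfolding v'_def distrib_left sum.distrib
      by (simp add: c'_def sc_sum[OF sc] sum_distrib_right add.commute flip: mult.assoc scalarsD(2)[OF sc])
    finally have "(\<Sum>s\<in>S. sc (c' s) * v s) = 0" using c by simp
    moreover have "\<exists>s\<in>S. c' s \<noteq> 0" using c by (auto simp: c'_def)
    ultimately show ?thesis by blast
  qed
qed

section \<open>The Ore property from slow growth, and right fractions\<close>

definition right_ore :: "'a set \<Rightarrow> bool" where
  "right_ore A \<longleftrightarrow> 0 \<in> A \<and> 1 \<in> A \<and> (\<forall>x\<in>A. \<forall>y\<in>A. x + y \<in> A \<and> x * y \<in> A) \<and> (\<forall>x\<in>A. - x \<in> A) \<and>
     (\<forall>a\<in>A. \<forall>b\<in>A. b \<noteq> 0 \<longrightarrow> (\<exists>c\<in>A. \<exists>d\<in>A. d \<noteq> 0 \<and> a * d = b * c))"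

text \<open>If no common right multiple of \<open>a\<close> and \<open>b\<close> existed, \<open>a X\<^sub>n\<close> and \<open>b X\<^sub>n\<close> would span a space of dimension
  \<open>2 \<bar>X\<^sub>n\<bar>\<close> inside the span of \<open>X\<^bsub>k + n\<^esub>\<close>.\<close>

lemma right_ore_lspan:
  fixes X :: "nat \<Rightarrow> 'g::comm_monoid_add set" and e :: "'g \<Rightarrow> 'a"
  assumes sc: "scalars sc" and tw: "twisted sc e \<chi>" and ind: "indep sc e"
    and X: "\<And>n. finite (X n)" "\<And>\<gamma>. \<exists>n. \<gamma> \<in> X n"
      "\<And>m n \<gamma> \<delta>. \<gamma> \<in> X m \<Longrightarrow> \<delta> \<in> X n \<Longrightarrow> \<gamma> + \<delta> \<in> X (m + n)" "\<And>m n. m \<le> n \<Longrightarrow> X m \<subseteq> X n"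
    and growth: "\<And>k. \<exists>n. card (X (k + n)) < 2 * card (X n)"
  shows "right_ore (lspan sc e UNIV)"
proof -
  let ?A = "lspan sc e UNIV"
  have X_ex: "\<exists>n. x \<in> lspan sc e (X n)" if x: "x \<in> ?A" for x
  proof -
    obtain T c where T: "finite T" "x = (\<Sum>\<gamma>\<in>T. sc (c \<gamma>) * e \<gamma>)"
      using x by (auto simp: lspan_def)
    have "\<exists>n. T \<subseteq> X n" using T(1)
    proof (induction T rule: finite_induct)
      case (insert t T)
      then obtain m n where "t \<in> X m" "T \<subseteq> X n" using X(2) by blast
      moreover have "X m \<subseteq> X (max m n)" "X n \<subseteq> X (max m n)" by (intro X(4); simp)+
      ultimately have "insert t T \<subseteq> X (max m n)" by blast
      then show ?case by blast
    qed auto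
    then obtain n where "T \<subseteq> X n" by blast
    then show ?thesis unfolding T(2) using lspanI[OF T(1)] by blast
  qed
  have ore: "\<exists>c\<in>?A. \<exists>d\<in>?A. d \<noteq> 0 \<and> a * d = b * c" if a: "a \<in> ?A" and b: "b \<in> ?A" "b \<noteq> 0" for a b
  proof -
    obtain m where m: "a \<in> lspan sc e (X m)" using X_ex a by blast
    obtain m' where m': "b \<in> lspan sc e (X m')" using X_ex b by blast
    define k where "k = max m m'"
    have ak: "a \<in> lspan sc e (X k)" "b \<in> lspan sc e (X k)"
      using m m' lspan_mono[OF X(4)[of m k], of sc e] lspan_mono[OF X(4)[of m' k], of sc e] by (auto simp: k_def)
    obtain n where n: "card (X (k + n)) < 2 * card (X n)" using growth by blast
    define v where "v = (\<lambda>(\<gamma>, z). (if z then a else b) * e \<gamma>)"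
    have "v s \<in> lspan sc e (X (k + n))" if s: "s \<in> X n \<times> (UNIV :: bool set)" for s
    proof -
      have "(if snd s then a else b) \<in> lspan sc e (X k)" using ak by simp
      moreover have "e (fst s) \<in> lspan sc e (X n)" using s by (intro lspan_base[OF sc]) (rule mem_Times_iff[THEN iffD1, THEN conjunct1])
      ultimately show ?thesis
        unfolding v_def case_prod_beta by (rule lspan_mult[OF sc tw _ _ X(3)])
    qed
    moreover have "card (X (k + n)) < card (X n \<times> (UNIV :: bool set))"
      using n by (simp add: card_cartesian_product)
    ultimately obtain c where c: "\<exists>s\<in>X n \<times> UNIV. c s \<noteq> 0" "(\<Sum>s\<in>X n \<times> (UNIV :: bool set). sc (c s) * v s) = 0"
      using nontrivial_relation[OF sc X(1)[of "k + n"] finite_cartesian_product[OF X(1)[of n] finite], where v = v and e = e]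
      by blast
    define d where "d = (\<Sum>\<gamma>\<in>X n. sc (c (\<gamma>, True)) * e \<gamma>)"
    define c' where "c' = (\<Sum>\<gamma>\<in>X n. sc (c (\<gamma>, False)) * e \<gamma>)"
    have "(\<Sum>s\<in>X n \<times> (UNIV :: bool set). sc (c s) * v s) = (\<Sum>\<gamma>\<in>X n. \<Sum>z\<in>UNIV. sc (c (\<gamma>, z)) * v (\<gamma>, z))"
      by (simp add: sum.cartesian_product)
    also have "\<dots> = a * d + b * c'"
      by (simp add: UNIV_bool v_def d_def c'_def sum_distrib_left sum.distrib sc_left_comm[OF sc] add.commute)
    finally have rel: "a * d + b * c' = 0" using c by simp
    have dc: "d \<in> ?A" "c' \<in> ?A" using X(1) by (auto simp: d_def c'_def intro!: lspanI)
    \<comment> \<open>For \<open>d = 0\<close> the relation reads \<open>b * c' = 0\<close>, so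
      \<open>c' = 0\<close> because \<open>b\<close> is nonzero; independence of \<open>e\<close>
      then makes all coefficients vanish.\<close>
    have "d \<noteq> 0"
    proof
      assume d0: "d = 0"
      then have "c' = 0" using rel b by simp
      have "c (\<gamma>, z) = 0" if "\<gamma> \<in> X n" for \<gamma> z
      proof (cases z)
        case True
        show ?thesis
          using ind[unfolded indep_def, rule_format, OF X(1) d0[unfolded d_def] that] True by simp
      next
        case False
        show ?thesis
          using ind[unfolded indep_def, rule_format, OF X(1) \<open>c' = 0\<close>[unfolded c'_def] that] False by simp
      qed
      then show False using c by blast
    qed
    moreover have "a * d = b * (- c')" using rel by (simp add: eq_neg_iff_add_eq_0)
    ultimately show ?thesis using dc lspan_uminus[OF sc] by blast
  qed
  have "1 \<in> ?A" using tw lspan_base[OF sc, of 0 UNIV e] by (simp add: twisted_def)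
  moreover have "x * y \<in> ?A" if "x \<in> ?A" "y \<in> ?A" for x y
    using lspan_mult[OF sc tw that, of UNIV] by simp
  ultimately show ?thesis
    unfolding right_ore_def by (intro conjI ballI impI lspan_0 lspan_add[OF sc] lspan_uminus[OF sc] ore)
qed

definition fracs :: "'a set \<Rightarrow> 'a set" where
  "fracs A = {a * inverse b | a b. a \<in> A \<and> b \<in> A \<and> b \<noteq> 0}"

lemma right_oreD:
  assumes "right_ore A"
  shows "0 \<in> A" "1 \<in> A" "x \<in> A \<Longrightarrow> y \<in> A \<Longrightarrow> x + y \<in> A" "x \<in> A \<Longrightarrow> y \<in> A \<Longrightarrow> x * y \<in> A"
    "x \<in> A \<Longrightarrow> - x \<in> A" "x \<in> A \<Longrightarrow> y \<in> A \<Longrightarrow> y \<noteq> 0 \<Longrightarrow> \<exists>c\<in>A. \<exists>d\<in>A. d \<noteq> 0 \<and> x * d = y * c"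
  using assms by (simp_all add: right_ore_def)

lemma fracs_common_denominator:
  assumes A: "right_ore A" and "x \<in> fracs A" "y \<in> fracs A"
  obtains a b d where "a \<in> A" "b \<in> A" "d \<in> A" "d \<noteq> 0" "x = a * inverse d" "y = b * inverse d"
proof -
  obtain a d where a: "a \<in> A" "d \<in> A" "d \<noteq> 0" "x = a * inverse d" using assms unfolding fracs_def by blast
  obtain b d' where b: "b \<in> A" "d' \<in> A" "d' \<noteq> 0" "y = b * inverse d'" using assms unfolding fracs_def by blast
  obtain u v where uv: "u \<in> A" "v \<in> A" "v \<noteq> 0" "d * v = d' * u"
    using right_oreD(6)[OF A a(2) b(2,3)] by blast
  have "u \<noteq> 0" using uv a by auto
  have "x = (a * v) * inverse (d * v)"
    unfolding a(4) using uv(3) by (simp add: inverse_mult_any mult.assoc mult_inverse_cancel_left)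
  moreover have "y = (b * u) * inverse (d * v)"
    unfolding b(4) uv(4) using \<open>u \<noteq> 0\<close> by (simp add: inverse_mult_any mult.assoc mult_inverse_cancel_left)
  moreover have "a * v \<in> A" "b * u \<in> A" "d * v \<in> A" "d * v \<noteq> 0"
    using a(1-3) b(1-3) uv(1-3) by (simp_all add: right_oreD[OF A])
  ultimately show thesis by (rule that[rotated 4])
qed

lemma fracs_mult_decomp:
  assumes A: "right_ore A" and "b \<in> A" "b \<noteq> 0" "c \<in> A"
  obtains c' b' where "c' \<in> A" "b' \<in> A" "b' \<noteq> 0" "c * b' = b * c'" "inverse b * c = c' * inverse b'"
proof -
  obtain c' b' where *: "c' \<in> A" "b' \<in> A" "b' \<noteq> 0" "c * b' = b * c'"
    using right_oreD(6)[OF A assms(4,2,3)] by blast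
  have "inverse b * c = inverse b * (c * b') * inverse b'"
    using *(3) by (simp add: mult.assoc)
  also have "\<dots> = c' * inverse b'"
    unfolding *(4) using assms by (simp add: inverse_mult_cancel_left)
  finally show thesis using that * by blast
qed

lemma fracsI: "a \<in> A \<Longrightarrow> b \<in> A \<Longrightarrow> b \<noteq> 0 \<Longrightarrow> a * inverse b \<in> fracs A"
  unfolding fracs_def by blast

lemma fracsE:
  assumes "x \<in> fracs A"
  obtains a b where "a \<in> A" "b \<in> A" "b \<noteq> 0" "x = a * inverse b"
  using assms unfolding fracs_def by blast

lemma fracs_closed:
  assumes A: "right_ore A"
  shows "A \<subseteq> fracs A" "x \<in> fracs A \<Longrightarrow> y \<in> fracs A \<Longrightarrow> x + y \<in> fracs A"
    "x \<in> fracs A \<Longrightarrow> y \<in> fracs A \<Longrightarrow> x * y \<in> fracs A" "x \<in> fracs A \<Longrightarrow> - x \<in> fracs A"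
    "x \<in> fracs A \<Longrightarrow> inverse x \<in> fracs A" "0 \<in> fracs A" "1 \<in> fracs A"
proof -
  note o = right_oreD[OF A]
  have sub: "x \<in> fracs A" if "x \<in> A" for x
    using fracsI[OF that o(2)] by simp
  then show "A \<subseteq> fracs A" by blast
  show 0: "0 \<in> fracs A" and "1 \<in> fracs A" using sub[OF o(1)] sub[OF o(2)] .
  show "x + y \<in> fracs A" if xy: "x \<in> fracs A" "y \<in> fracs A"
  proof -
    obtain a b d where *: "a \<in> A" "b \<in> A" "d \<in> A" "d \<noteq> 0" "x = a * inverse d" "y = b * inverse d"
      by (rule fracs_common_denominator[OF A xy])
    have "x + y = (a + b) * inverse d" by (simp only: *(5,6) distrib_right)
    then show ?thesis using fracsI[OF o(3)[OF *(1,2)] *(3,4)] by simp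
  qed
  show "- x \<in> fracs A" if x: "x \<in> fracs A"
  proof -
    obtain a b where *: "a \<in> A" "b \<in> A" "b \<noteq> 0" "x = a * inverse b" by (rule fracsE[OF x])
    have "- x = (- a) * inverse b" by (simp only: *(4) minus_mult_left)
    then show ?thesis using fracsI[OF o(5)[OF *(1)] *(2,3)] by simp
  qed
  show "inverse x \<in> fracs A" if x: "x \<in> fracs A"
  proof -
    obtain a b where *: "a \<in> A" "b \<in> A" "b \<noteq> 0" "x = a * inverse b" by (rule fracsE[OF x])
    have "inverse x = b * inverse a" by (simp only: *(4) inverse_mult_any inverse_inverse_any)
    then show ?thesis using 0 fracsI[OF *(2,1)] by (cases "a = 0") simp_all
  qed
  show "x * y \<in> fracs A" if x: "x \<in> fracs A" and y: "y \<in> fracs A"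
  proof -
    obtain a b where a: "a \<in> A" "b \<in> A" "b \<noteq> 0" "x = a * inverse b" by (rule fracsE[OF x])
    obtain c d where c: "c \<in> A" "d \<in> A" "d \<noteq> 0" "y = c * inverse d" by (rule fracsE[OF y])
    obtain c' b' where *: "c' \<in> A" "b' \<in> A" "b' \<noteq> 0" "c * b' = b * c'" "inverse b * c = c' * inverse b'"
      by (rule fracs_mult_decomp[OF A a(2,3) c(1)])
    have "x * y = a * (inverse b * c) * inverse d" by (simp only: a(4) c(4) mult.assoc)
    also have "\<dots> = (a * c') * inverse (d * b')" by (simp only: *(5) inverse_mult_any mult.assoc)
    finally show ?thesis
      using fracsI[OF o(4)[OF a(1) *(1)] o(4)[OF c(2) *(2)]] c(3) *(3) by simp
  qed
qed

section \<open>Homomorphisms from a quantum torus and from its fractions\<close>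

lemma torus_coeff_unique:
  assumes sc: "scalars sc" and ind: "indep sc e" and fin: "finite T" "finite U"
    and eq: "(\<Sum>\<gamma>\<in>T. sc (c \<gamma>) * e \<gamma>) = (\<Sum>\<gamma>\<in>U. sc (d \<gamma>) * e \<gamma>)"
  shows "(\<Sum>\<gamma>\<in>T. sc (c \<gamma>) * f \<gamma>) = (\<Sum>\<gamma>\<in>U. sc (d \<gamma>) * f \<gamma>)"
proof -
  let ?c = "\<lambda>\<gamma>. if \<gamma> \<in> T then c \<gamma> else 0" and ?d = "\<lambda>\<gamma>. if \<gamma> \<in> U then d \<gamma> else 0"
  have fTU: "finite (T \<union> U)" using fin by simp
  have ext: "(\<Sum>\<gamma>\<in>T. sc (c \<gamma>) * f \<gamma>) = (\<Sum>\<gamma>\<in>T \<union> U. sc (?c \<gamma>) * f \<gamma>)"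
    "(\<Sum>\<gamma>\<in>U. sc (d \<gamma>) * f \<gamma>) = (\<Sum>\<gamma>\<in>T \<union> U. sc (?d \<gamma>) * f \<gamma>)" for f
    by (rule sum_extend_coeff[OF sc fTU]; simp)+
  have *: "sc a * x = sc (a - b) * x + sc b * x" for a b x
    by (simp flip: distrib_right scalarsD(1)[OF sc])
  have "(\<Sum>\<gamma>\<in>T \<union> U. sc (?c \<gamma>) * e \<gamma>) =
      (\<Sum>\<gamma>\<in>T \<union> U. sc (?c \<gamma> - ?d \<gamma>) * e \<gamma>) + (\<Sum>\<gamma>\<in>T \<union> U. sc (?d \<gamma>) * e \<gamma>)"
    by (subst sum.distrib[symmetric], rule sum.cong[OF refl], rule *)
  then have "(\<Sum>\<gamma>\<in>T \<union> U. sc (?c \<gamma> - ?d \<gamma>) * e \<gamma>) = 0"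
    using eq by (simp only: ext) simp
  then have "?c \<gamma> - ?d \<gamma> = 0" if "\<gamma> \<in> T \<union> U" for \<gamma>
    using ind[unfolded indep_def, rule_format, OF fTU _ that, of "\<lambda>\<gamma>. ?c \<gamma> - ?d \<gamma>"] by simp
  then have "?c \<gamma> = ?d \<gamma>" if "\<gamma> \<in> T \<union> U" for \<gamma>
    using that by (auto split: if_splits)
  then show ?thesis
    unfolding ext by (intro sum.cong[OF refl]) (simp only:)
qed

text \<open>The choice is made from a relation that is functional once \<open>e\<close> is
  independent, by \<open>torus_coeff_unique\<close>.\<close>

definition torus_map :: "('f::field \<Rightarrow> 'a) \<Rightarrow> ('g \<Rightarrow> 'a) \<Rightarrow> ('g \<Rightarrow> 'a) \<Rightarrow> 'a \<Rightarrow> 'a" where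
  "torus_map sc e e' x = (SOME y. \<exists>T c. finite T \<and> x = (\<Sum>\<gamma>\<in>T. sc (c \<gamma>) * e \<gamma>) \<and>
     y = (\<Sum>\<gamma>\<in>T. sc (c \<gamma>) * e' \<gamma>))"

lemma torus_map_sum:
  assumes "scalars sc" "indep sc e" "finite T"
  shows "torus_map sc e e' (\<Sum>\<gamma>\<in>T. sc (c \<gamma>) * e \<gamma>) = (\<Sum>\<gamma>\<in>T. sc (c \<gamma>) * e' \<gamma>)"
  unfolding torus_map_def
proof (rule some_equality)
  show "\<exists>T' c'. finite T' \<and> (\<Sum>\<gamma>\<in>T. sc (c \<gamma>) * e \<gamma>) = (\<Sum>\<gamma>\<in>T'. sc (c' \<gamma>) * e \<gamma>) \<and>
     (\<Sum>\<gamma>\<in>T. sc (c \<gamma>) * e' \<gamma>) = (\<Sum>\<gamma>\<in>T'. sc (c' \<gamma>) * e' \<gamma>)"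
    using assms(3) by blast
  fix y assume "\<exists>T' c'. finite T' \<and> (\<Sum>\<gamma>\<in>T. sc (c \<gamma>) * e \<gamma>) = (\<Sum>\<gamma>\<in>T'. sc (c' \<gamma>) * e \<gamma>) \<and>
     y = (\<Sum>\<gamma>\<in>T'. sc (c' \<gamma>) * e' \<gamma>)"
  then obtain T' c' where *: "finite T'" "(\<Sum>\<gamma>\<in>T. sc (c \<gamma>) * e \<gamma>) = (\<Sum>\<gamma>\<in>T'. sc (c' \<gamma>) * e \<gamma>)"
     "y = (\<Sum>\<gamma>\<in>T'. sc (c' \<gamma>) * e' \<gamma>)" by blast
  show "y = (\<Sum>\<gamma>\<in>T. sc (c \<gamma>) * e' \<gamma>)"
    unfolding *(3) by (rule torus_coeff_unique[OF assms(1,2,3) *(1,2), symmetric])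
qed

lemma lspanE:
  assumes "x \<in> lspan sc e S"
  obtains T c where "finite T" "T \<subseteq> S" "x = (\<Sum>\<gamma>\<in>T. sc (c \<gamma>) * e \<gamma>)"
  using assms unfolding lspan_def by blast

lemma torus_map_add:
  assumes sc: "scalars sc" and ind: "indep sc e" and "x \<in> lspan sc e UNIV" "y \<in> lspan sc e UNIV"
  shows "torus_map sc e e' (x + y) = torus_map sc e e' x + torus_map sc e e' y"
proof -
  obtain T c where T: "finite T" "x = (\<Sum>\<gamma>\<in>T. sc (c \<gamma>) * e \<gamma>)" by (rule lspanE[OF assms(3)])
  obtain U d where U: "finite U" "y = (\<Sum>\<gamma>\<in>U. sc (d \<gamma>) * e \<gamma>)" by (rule lspanE[OF assms(4)])
  let ?c = "\<lambda>\<gamma>. if \<gamma> \<in> T then c \<gamma> else 0" and ?d = "\<lambda>\<gamma>. if \<gamma> \<in> U then d \<gamma> else 0"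
  have fTU: "finite (T \<union> U)" using T U by simp
  have ext: "(\<Sum>\<gamma>\<in>T. sc (c \<gamma>) * f \<gamma>) = (\<Sum>\<gamma>\<in>T \<union> U. sc (?c \<gamma>) * f \<gamma>)"
    "(\<Sum>\<gamma>\<in>U. sc (d \<gamma>) * f \<gamma>) = (\<Sum>\<gamma>\<in>T \<union> U. sc (?d \<gamma>) * f \<gamma>)" for f
    by (rule sum_extend_coeff[OF sc fTU]; simp)+
  have *: "(\<Sum>\<gamma>\<in>T \<union> U. sc (?c \<gamma>) * f \<gamma>) + (\<Sum>\<gamma>\<in>T \<union> U. sc (?d \<gamma>) * f \<gamma>) =
     (\<Sum>\<gamma>\<in>T \<union> U. sc (?c \<gamma> + ?d \<gamma>) * f \<gamma>)" for f
    unfolding sum.distrib[symmetric] by (rule sum.cong[OF refl]) (simp only: scalarsD(1)[OF sc] distrib_right)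
  show ?thesis
    unfolding T(2) U(2) ext * torus_map_sum[OF sc ind fTU] ..
qed

lemma torus_map_0: "scalars sc \<Longrightarrow> indep sc e \<Longrightarrow> torus_map sc e e' 0 = 0"
  using torus_map_sum[of sc e "{}" e'] by simp

lemma torus_map_lsum:
  assumes sc: "scalars sc" and ind: "indep sc e"
  shows "(\<And>s. s \<in> S \<Longrightarrow> v s \<in> lspan sc e UNIV) \<Longrightarrow>
    torus_map sc e e' (\<Sum>s\<in>S. v s) = (\<Sum>s\<in>S. torus_map sc e e' (v s))"
proof (induction S rule: infinite_finite_induct)
  case (insert s S)
  have "(\<Sum>s\<in>S. v s) \<in> lspan sc e UNIV"
    by (rule lspan_sum[OF sc]) (use insert.prems in auto)
  then show ?case using insert by (simp add: torus_map_add[OF sc ind])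
qed (simp_all add: torus_map_0[OF sc ind])

lemma torus_map_base:
  assumes sc: "scalars sc" and ind: "indep sc e"
  shows "torus_map sc e e' (sc a * e \<gamma>) = sc a * e' \<gamma>"
  using torus_map_sum[OF sc ind, of "{\<gamma>}" e' "\<lambda>_. a"] by simp

lemma torus_map_mult:
  assumes sc: "scalars sc" and ind: "indep sc e" and tw: "twisted sc e \<chi>" "twisted sc e' \<chi>"
    and x: "x \<in> lspan sc e UNIV" and y: "y \<in> lspan sc e UNIV"
  shows "torus_map sc e e' (x * y) = torus_map sc e e' x * torus_map sc e e' y"
proof -
  obtain T c where T: "finite T" "x = (\<Sum>\<gamma>\<in>T. sc (c \<gamma>) * e \<gamma>)" by (rule lspanE[OF x])
  obtain U d where U: "finite U" "y = (\<Sum>\<gamma>\<in>U. sc (d \<gamma>) * e \<gamma>)" by (rule lspanE[OF y])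
  have prod: "(\<Sum>\<gamma>\<in>T. sc (c \<gamma>) * f \<gamma>) * (\<Sum>\<gamma>\<in>U. sc (d \<gamma>) * f \<gamma>) =
      (\<Sum>\<gamma>\<in>T. \<Sum>\<delta>\<in>U. sc (c \<gamma> * d \<delta> * \<chi> \<gamma> \<delta>) * f (\<gamma> + \<delta>))" if tw: "twisted sc f \<chi>" for f
    unfolding sum_distrib_left sum_distrib_right
  proof (subst sum.swap, rule sum.cong[OF refl], rule sum.cong[OF refl])
    fix \<gamma> \<delta>
    have "f \<gamma> * f \<delta> = sc (\<chi> \<gamma> \<delta>) * f (\<gamma> + \<delta>)" using tw by (simp add: twisted_def)
    then show "sc (c \<gamma>) * f \<gamma> * (sc (d \<delta>) * f \<delta>) = sc (c \<gamma> * d \<delta> * \<chi> \<gamma> \<delta>) * f (\<gamma> + \<delta>)"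
      by (simp only: scalarsD(2)[OF sc] mult.assoc sc_left_comm[OF sc, of "f \<gamma>"])
  qed
  have mem: "sc a * e \<gamma> \<in> lspan sc e UNIV" for a \<gamma>
    by (rule lspan_smult[OF sc lspan_base[OF sc]]) simp
  have "torus_map sc e e' (x * y) = (\<Sum>\<gamma>\<in>T. torus_map sc e e' (\<Sum>\<delta>\<in>U. sc (c \<gamma> * d \<delta> * \<chi> \<gamma> \<delta>) * e (\<gamma> + \<delta>)))"
    unfolding T(2) U(2) prod[OF tw(1)] by (rule torus_map_lsum[OF sc ind lspan_sum[OF sc mem]])
  also have "\<dots> = (\<Sum>\<gamma>\<in>T. \<Sum>\<delta>\<in>U. sc (c \<gamma> * d \<delta> * \<chi> \<gamma> \<delta>) * e' (\<gamma> + \<delta>))"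
    by (simp only: torus_map_lsum[OF sc ind mem] torus_map_base[OF sc ind])
  also have "\<dots> = torus_map sc e e' x * torus_map sc e e' y"
    unfolding T(2) U(2) torus_map_sum[OF sc ind T(1)] torus_map_sum[OF sc ind U(1)] prod[OF tw(2)] ..
  finally show ?thesis .
qed

lemma torus_map_nonzero:
  assumes sc: "scalars sc" and ind: "indep sc e" "indep sc e'" and x: "x \<in> lspan sc e UNIV" "x \<noteq> 0"
  shows "torus_map sc e e' x \<noteq> 0"
proof
  obtain T c where T: "finite T" "x = (\<Sum>\<gamma>\<in>T. sc (c \<gamma>) * e \<gamma>)" by (rule lspanE[OF x(1)])
  assume "torus_map sc e e' x = 0"
  then have "(\<Sum>\<gamma>\<in>T. sc (c \<gamma>) * e' \<gamma>) = 0" unfolding T(2) torus_map_sum[OF sc ind(1) T(1)] .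
  then have "c \<gamma> = 0" if "\<gamma> \<in> T" for \<gamma>
    using ind(2)[unfolded indep_def, rule_format, OF T(1) _ that] by blast
  then have "x = 0" unfolding T(2) by (simp add: scalarsD[OF sc])
  then show False using x by simp
qed

text \<open>Again a choice from a functional relation: \<open>frac_map_wf\<close> shows independence
  of the fraction when \<phi> is multiplicative and sends no nonzero element of \<open>A\<close> to
  zero.\<close>

definition frac_map :: "'a set \<Rightarrow> ('a \<Rightarrow> 'a) \<Rightarrow> 'a \<Rightarrow> 'a" where
  "frac_map A \<phi> x = (SOME y. \<exists>a b. a \<in> A \<and> b \<in> A \<and> b \<noteq> 0 \<and> x = a * inverse b \<and> y = \<phi> a * inverse (\<phi> b))"

context
  fixes A :: "'a set" and \<phi> :: "'a \<Rightarrow> 'a"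
  assumes A: "right_ore A" and hom: "\<And>x y. x \<in> A \<Longrightarrow> y \<in> A \<Longrightarrow> \<phi> (x + y) = \<phi> x + \<phi> y"
    "\<And>x y. x \<in> A \<Longrightarrow> y \<in> A \<Longrightarrow> \<phi> (x * y) = \<phi> x * \<phi> y"
    and nz: "\<And>x. x \<in> A \<Longrightarrow> x \<noteq> 0 \<Longrightarrow> \<phi> x \<noteq> 0"
begin

lemma frac_map_wf:
  assumes a: "a \<in> A" "b \<in> A" "b \<noteq> 0" and c: "c \<in> A" "d \<in> A" "d \<noteq> 0"
    and eq: "a * inverse b = c * inverse d"
  shows "\<phi> a * inverse (\<phi> b) = \<phi> c * inverse (\<phi> d)"
proof -
  obtain u v where uv: "u \<in> A" "v \<in> A" "v \<noteq> 0" "b * v = d * u"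
    using right_oreD(6)[OF A a(2) c(2,3)] by blast
  have u0: "u \<noteq> 0" using uv(3,4) a(3) by auto
  have "a * v = a * inverse b * (b * v)" using a(3) by (simp add: mult.assoc inverse_mult_cancel_left)
  also have "\<dots> = c * u" unfolding eq uv(4) using c(3) by (simp add: mult.assoc inverse_mult_cancel_left)
  finally have 1: "\<phi> a * \<phi> v = \<phi> c * \<phi> u" using hom(2) a(1) c(1) uv(1,2) by metis
  have 2: "\<phi> b * \<phi> v = \<phi> d * \<phi> u" using hom(2) a(2) c(2) uv by metis
  have n: "\<phi> b \<noteq> 0" "\<phi> d \<noteq> 0" "\<phi> u \<noteq> 0" "\<phi> v \<noteq> 0" using nz a c uv u0 by simp_all
  have "\<phi> a * inverse (\<phi> b) = \<phi> a * \<phi> v * inverse (\<phi> b * \<phi> v)"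
    using n by (simp add: inverse_mult_any mult.assoc mult_inverse_cancel_left)
  also have "\<dots> = \<phi> c * inverse (\<phi> d)"
    unfolding 1 2 using n by (simp add: inverse_mult_any mult.assoc mult_inverse_cancel_left)
  finally show ?thesis .
qed

lemma frac_map_frac:
  assumes "a \<in> A" "b \<in> A" "b \<noteq> 0"
  shows "frac_map A \<phi> (a * inverse b) = \<phi> a * inverse (\<phi> b)"
  unfolding frac_map_def
proof (rule some_equality)
  show "\<exists>a' b'. a' \<in> A \<and> b' \<in> A \<and> b' \<noteq> 0 \<and> a * inverse b = a' * inverse b' \<and>
      \<phi> a * inverse (\<phi> b) = \<phi> a' * inverse (\<phi> b')"
    using assms by blast
  fix y assume "\<exists>a' b'. a' \<in> A \<and> b' \<in> A \<and> b' \<noteq> 0 \<and> a * inverse b = a' * inverse b' \<and>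
      y = \<phi> a' * inverse (\<phi> b')"
  then obtain a' b' where *: "a' \<in> A" "b' \<in> A" "b' \<noteq> 0" "a * inverse b = a' * inverse b'"
     "y = \<phi> a' * inverse (\<phi> b')" by blast
  show "y = \<phi> a * inverse (\<phi> b)"
    unfolding *(5) by (rule frac_map_wf[OF *(1,2,3) assms *(4)[symmetric]])
qed

lemma frac_map_1: "\<phi> 1 = 1"
proof -
  have "\<phi> 1 * \<phi> 1 = \<phi> 1" using hom(2)[OF right_oreD(2)[OF A] right_oreD(2)[OF A]] by simp
  moreover have "\<phi> 1 \<noteq> 0" using nz[OF right_oreD(2)[OF A]] by simp
  ultimately show ?thesis by (metis mult.assoc left_inverse mult_1_left)
qed

lemma frac_map_base: "a \<in> A \<Longrightarrow> frac_map A \<phi> a = \<phi> a"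
  using frac_map_frac[of a 1] right_oreD(2)[OF A] frac_map_1 by simp

lemma frac_map_add:
  assumes "x \<in> fracs A" "y \<in> fracs A"
  shows "frac_map A \<phi> (x + y) = frac_map A \<phi> x + frac_map A \<phi> y"
proof -
  obtain a b d where *: "a \<in> A" "b \<in> A" "d \<in> A" "d \<noteq> 0" "x = a * inverse d" "y = b * inverse d"
    by (rule fracs_common_denominator[OF A assms])
  have "x + y = (a + b) * inverse d" by (simp only: *(5,6) distrib_right)
  then have "frac_map A \<phi> (x + y) = \<phi> (a + b) * inverse (\<phi> d)"
    using frac_map_frac[OF right_oreD(3)[OF A *(1,2)] *(3,4)] by simp
  then show ?thesis
    using *(1-4) unfolding *(5,6) by (simp add: frac_map_frac hom distrib_right)
qed

lemma frac_map_mult: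
  assumes "x \<in> fracs A" "y \<in> fracs A"
  shows "frac_map A \<phi> (x * y) = frac_map A \<phi> x * frac_map A \<phi> y"
proof -
  note o = right_oreD[OF A]
  obtain a b where a: "a \<in> A" "b \<in> A" "b \<noteq> 0" "x = a * inverse b" by (rule fracsE[OF assms(1)])
  obtain c d where c: "c \<in> A" "d \<in> A" "d \<noteq> 0" "y = c * inverse d" by (rule fracsE[OF assms(2)])
  obtain c' b' where *: "c' \<in> A" "b' \<in> A" "b' \<noteq> 0" "c * b' = b * c'" "inverse b * c = c' * inverse b'"
    by (rule fracs_mult_decomp[OF A a(2,3) c(1)])
  have n: "\<phi> b \<noteq> 0" "\<phi> b' \<noteq> 0" "\<phi> d \<noteq> 0" using nz a(2,3) *(2,3) c(2,3) by simp_all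
  have "\<phi> c * \<phi> b' = \<phi> b * \<phi> c'" using hom(2) *(1,2,4) a(2) c(1) by metis
  then have "inverse (\<phi> b) * (\<phi> c * \<phi> b') * inverse (\<phi> b') = \<phi> c' * inverse (\<phi> b')"
    using n by (simp add: inverse_mult_cancel_left)
  then have 1: "inverse (\<phi> b) * \<phi> c = \<phi> c' * inverse (\<phi> b')"
    using n by (simp add: mult.assoc)
  have "x * y = a * (inverse b * c) * inverse d" by (simp only: a(4) c(4) mult.assoc)
  also have "\<dots> = (a * c') * inverse (d * b')" by (simp only: *(5) inverse_mult_any mult.assoc)
  finally have "frac_map A \<phi> (x * y) = \<phi> (a * c') * inverse (\<phi> (d * b'))"
    using frac_map_frac[OF o(4)[OF a(1) *(1)] o(4)[OF c(2) *(2)]] c(3) *(3) by simp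
  also have "\<dots> = \<phi> a * (\<phi> c' * inverse (\<phi> b')) * inverse (\<phi> d)"
    using a(1) *(1,2) c(2) by (simp add: hom inverse_mult_any mult.assoc)
  also have "\<dots> = (\<phi> a * inverse (\<phi> b)) * (\<phi> c * inverse (\<phi> d))"
    unfolding 1[symmetric] by (simp only: mult.assoc)
  finally show ?thesis
    unfolding a(4) c(4) using frac_map_frac[OF a(1-3)] frac_map_frac[OF c(1-3)] by simp
qed

end

text \<open>Algebra endomorphisms of a skew subfield \<open>K\<close> inside the ambient division
  ring. Values outside \<open>K\<close> are arbitrary, so such maps are always compared on
  \<open>K\<close> only.\<close>

definition qhom :: "('f::field \<Rightarrow> 'a) \<Rightarrow> 'a set \<Rightarrow> ('a \<Rightarrow> 'a) \<Rightarrow> bool" where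
  "qhom sc K \<phi> \<longleftrightarrow> (\<forall>x\<in>K. \<phi> x \<in> K) \<and> (\<forall>x\<in>K. \<forall>y\<in>K. \<phi> (x + y) = \<phi> x + \<phi> y) \<and>
     (\<forall>x\<in>K. \<forall>y\<in>K. \<phi> (x * y) = \<phi> x * \<phi> y) \<and> (\<forall>c. \<phi> (sc c) = sc c)"

definition subfield :: "('f::field \<Rightarrow> 'a) \<Rightarrow> 'a set \<Rightarrow> bool" where
  "subfield sc K \<longleftrightarrow> (\<forall>x\<in>K. \<forall>y\<in>K. x + y \<in> K) \<and> (\<forall>x\<in>K. \<forall>y\<in>K. x * y \<in> K) \<and> (\<forall>x\<in>K. - x \<in> K) \<and>
     (\<forall>x\<in>K. inverse x \<in> K) \<and> (\<forall>c. sc c \<in> K)"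

lemma subfieldD:
  assumes "subfield sc K" "scalars sc"
  shows "x \<in> K \<Longrightarrow> y \<in> K \<Longrightarrow> x + y \<in> K" "x \<in> K \<Longrightarrow> y \<in> K \<Longrightarrow> x * y \<in> K" "x \<in> K \<Longrightarrow> - x \<in> K"
    "x \<in> K \<Longrightarrow> inverse x \<in> K" "sc c \<in> K" "0 \<in> K" "1 \<in> K" "x \<in> K \<Longrightarrow> x ^ n \<in> K"
proof -
  show *: "x \<in> K \<Longrightarrow> y \<in> K \<Longrightarrow> x + y \<in> K" "x \<in> K \<Longrightarrow> y \<in> K \<Longrightarrow> x * y \<in> K" "x \<in> K \<Longrightarrow> - x \<in> K"
    "x \<in> K \<Longrightarrow> inverse x \<in> K" "sc c \<in> K" for x y c
    using assms(1) by (simp_all add: subfield_def)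
  show "0 \<in> K" "1 \<in> K" using *(5)[of 0] *(5)[of 1] by (simp_all add: scalarsD[OF assms(2)])
  then show "x \<in> K \<Longrightarrow> x ^ n \<in> K" by (induction n) (simp_all add: *(2))
qed

lemma subfield_fracs:
  assumes sc: "scalars sc" and A: "right_ore A" and "\<And>c. sc c \<in> A"
  shows "subfield sc (fracs A)"
  using fracs_closed[OF A] assms(3) by (simp add: subfield_def subset_iff)

lemma qhomD:
  assumes "qhom sc K \<phi>" "subfield sc K" "scalars sc"
  shows "x \<in> K \<Longrightarrow> \<phi> x \<in> K" "x \<in> K \<Longrightarrow> y \<in> K \<Longrightarrow> \<phi> (x + y) = \<phi> x + \<phi> y"
    "x \<in> K \<Longrightarrow> y \<in> K \<Longrightarrow> \<phi> (x * y) = \<phi> x * \<phi> y" "\<phi> (sc c) = sc c" "\<phi> 0 = 0" "\<phi> 1 = 1"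
    "x \<in> K \<Longrightarrow> \<phi> (inverse x) = inverse (\<phi> x)" "x \<in> K \<Longrightarrow> x \<noteq> 0 \<Longrightarrow> \<phi> x \<noteq> 0"
    "x \<in> K \<Longrightarrow> \<phi> (x ^ n) = \<phi> x ^ n"
proof -
  show *: "x \<in> K \<Longrightarrow> \<phi> x \<in> K" "x \<in> K \<Longrightarrow> y \<in> K \<Longrightarrow> \<phi> (x + y) = \<phi> x + \<phi> y"
    "x \<in> K \<Longrightarrow> y \<in> K \<Longrightarrow> \<phi> (x * y) = \<phi> x * \<phi> y" "\<phi> (sc c) = sc c" for x y c
    using assms(1) by (simp_all add: qhom_def)
  show 01: "\<phi> 0 = 0" "\<phi> 1 = 1" using *(4)[of 0] *(4)[of 1] by (simp_all add: scalarsD[OF assms(3)])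
  have inv: "\<phi> x * \<phi> (inverse x) = 1" if "x \<in> K" "x \<noteq> 0" for x
    using *(3)[OF that(1) subfieldD(4)[OF assms(2,3) that(1)]] that(2) 01 by simp
  show "x \<in> K \<Longrightarrow> x \<noteq> 0 \<Longrightarrow> \<phi> x \<noteq> 0" using inv[of x] by (metis mult_zero_left zero_neq_one)
  show "x \<in> K \<Longrightarrow> \<phi> (inverse x) = inverse (\<phi> x)"
    using inv[of x] 01 by (cases "x = 0") (simp_all add: inverse_unique)
  show "x \<in> K \<Longrightarrow> \<phi> (x ^ n) = \<phi> x ^ n"
    by (induction n) (simp_all add: 01 *(3) subfieldD(8)[OF assms(2,3)])
qed

lemma qhom_comp: "qhom sc K \<phi> \<Longrightarrow> qhom sc K \<psi> \<Longrightarrow> qhom sc K (\<phi> \<circ> \<psi>)"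
  by (simp add: qhom_def)

lemma qhom_sum:
  assumes "qhom sc K \<phi>" "subfield sc K" "scalars sc" and "\<And>s. s \<in> S \<Longrightarrow> v s \<in> K"
  shows "(\<Sum>s\<in>S. v s) \<in> K \<and> \<phi> (\<Sum>s\<in>S. v s) = (\<Sum>s\<in>S. \<phi> (v s))"
  using assms(4)
  by (induction S rule: infinite_finite_induct)
    (simp_all add: qhomD[OF assms(1-3)] subfieldD[OF assms(2,3)])

lemma qhom_unique:
  assumes sc: "scalars sc" and K: "K = fracs (lspan sc e UNIV)" "subfield sc K"
    and \<phi>: "qhom sc K \<phi>" "qhom sc K \<psi>" and e: "\<And>\<gamma>. e \<gamma> \<in> K" "\<And>\<gamma>. \<phi> (e \<gamma>) = \<psi> (e \<gamma>)" and x: "x \<in> K"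
  shows "\<phi> x = \<psi> x"
proof -
  note s = subfieldD[OF K(2) sc]
  note h = qhomD[OF \<phi>(1) K(2) sc] qhomD[OF \<phi>(2) K(2) sc]
  have 1: "a \<in> K \<and> \<phi> a = \<psi> a" if a: "a \<in> lspan sc e UNIV" for a
  proof -
    obtain T c where T: "finite T" "a = (\<Sum>\<gamma>\<in>T. sc (c \<gamma>) * e \<gamma>)" by (rule lspanE[OF a])
    have mem: "sc (c \<gamma>) * e \<gamma> \<in> K" for \<gamma> by (simp add: s e)
    have "\<phi> (sc (c \<gamma>) * e \<gamma>) = \<psi> (sc (c \<gamma>) * e \<gamma>)" for \<gamma> by (simp add: h s e)
    then show ?thesis unfolding T(2)
      using qhom_sum[OF \<phi>(1) K(2) sc mem, where S = T] qhom_sum[OF \<phi>(2) K(2) sc mem, where S = T] by simp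
  qed
  obtain a b where ab: "a \<in> lspan sc e UNIV" "b \<in> lspan sc e UNIV" "b \<noteq> 0" "x = a * inverse b"
    using x unfolding K(1) by (rule fracsE)
  show ?thesis unfolding ab(4) using 1[OF ab(1)] 1[OF ab(2)] by (simp add: h s)
qed

text \<open>The common \<chi> makes the linear map between monomials multiplicative. Independence of
  \<open>e'\<close> makes it injective, so denominators have nonzero images and the map passes to
  fractions.\<close>

lemma qhom_exists:
  assumes sc: "scalars sc" and ind: "indep sc e" "indep sc e'" and tw: "twisted sc e \<chi>" "twisted sc e' \<chi>"
    and K: "K = fracs (lspan sc e UNIV)" and A: "right_ore (lspan sc e UNIV)" and e': "\<And>\<gamma>. e' \<gamma> \<in> K"
  shows "\<exists>\<phi>. qhom sc K \<phi> \<and> (\<forall>\<gamma>. \<phi> (e \<gamma>) = e' \<gamma>)"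
proof -
  let ?A = "lspan sc e UNIV"
  define \<phi>0 where "\<phi>0 = torus_map sc e e'"
  define \<phi> where "\<phi> = frac_map ?A \<phi>0"
  note hom = torus_map_add[OF sc ind(1), of _ _ e', folded \<phi>0_def]
    torus_map_mult[OF sc ind(1) tw, folded \<phi>0_def] torus_map_nonzero[OF sc ind, folded \<phi>0_def]
  have scA: "sc c \<in> ?A" for c
  proof -
    have "e 0 = 1" using tw(1) by (simp add: twisted_def)
    then show ?thesis using lspan_smult[OF sc lspan_base[OF sc, of 0 UNIV e], of c] by simp
  qed
  have sub: "subfield sc K" unfolding K by (rule subfield_fracs[OF sc A scA])
  note s = subfieldD[OF sub sc]
  have base: "\<phi> a = \<phi>0 a" if "a \<in> ?A" for a
    unfolding \<phi>_def by (rule frac_map_base[OF A hom that])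
  have \<phi>0K: "\<phi>0 a \<in> K" if a: "a \<in> ?A" for a
  proof -
    obtain T c where T: "finite T" "a = (\<Sum>\<gamma>\<in>T. sc (c \<gamma>) * e \<gamma>)" by (rule lspanE[OF a])
    have "(\<Sum>\<gamma>\<in>T. sc (c \<gamma>) * e' \<gamma>) \<in> K"
      using T(1) by (induction T rule: finite_induct) (simp_all add: s e')
    then show ?thesis unfolding T(2) \<phi>0_def torus_map_sum[OF sc ind(1) T(1)] .
  qed
  have e: "\<phi> (e \<gamma>) = e' \<gamma>" for \<gamma>
    using base[OF lspan_base[OF sc]] torus_map_base[OF sc ind(1), of e' 1] by (simp add: \<phi>0_def scalarsD[OF sc])
  have c: "\<phi> (sc c) = sc c" for c
  proof -
    have "e 0 = 1" "e' 0 = 1" using tw by (simp_all add: twisted_def)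
    then show ?thesis
      using base[OF scA] torus_map_base[OF sc ind(1), of e' c 0] by (simp add: \<phi>0_def)
  qed
  have mem: "\<phi> x \<in> K" if x: "x \<in> K" for x
  proof -
    obtain a b where ab: "a \<in> ?A" "b \<in> ?A" "b \<noteq> 0" "x = a * inverse b"
      using x unfolding K by (rule fracsE)
    show ?thesis unfolding ab(4) \<phi>_def by (subst frac_map_frac[OF A hom ab(1-3)])
      (use \<phi>0K[OF ab(1)] \<phi>0K[OF ab(2)] in \<open>simp_all add: s\<close>)
  qed
  have "qhom sc K \<phi>"
    unfolding qhom_def
  proof (intro conjI ballI allI mem c)
    fix x y assume xy: "x \<in> K" "y \<in> K"
    show "\<phi> (x + y) = \<phi> x + \<phi> y"
      unfolding \<phi>_def by (rule frac_map_add[OF A hom xy[unfolded K]])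
    show "\<phi> (x * y) = \<phi> x * \<phi> y"
      unfolding \<phi>_def by (rule frac_map_mult[OF A hom xy[unfolded K]])
  qed
  then show ?thesis using e by blast
qed

end

section \<open>Conjugation by non-integral powers\<close>

lemma powi_double_add: "q \<noteq> 0 \<Longrightarrow> q powi (2 * c) * q powi (2 * d) = (q :: 'f::field) powi (2 * (c + d))"
  by (simp add: power_int_add distrib_left)

lemma power_double_powi: "(q :: 'f::field) ^ (2 * k) = q powi (2 * int k)"
  by (metis of_nat_mult of_nat_numeral power_int_of_nat)

lemma power2_powi: "(q :: 'f::field)\<^sup>2 = q powi (2 * 1)"
  by (simp add: power_int_def)

lemma power_double_Suc: "(q :: 'f::field) ^ (2 * Suc k) = q ^ (2 * k) * q\<^sup>2"
  by (simp add: power2_eq_square)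

context division_ring begin

definition Pn :: "('f::field \<Rightarrow> 'a) \<Rightarrow> 'f \<Rightarrow> 'a \<Rightarrow> nat \<Rightarrow> 'a \<Rightarrow> 'a" where
  "Pn sc q Y k x = foldr (\<lambda>\<nu> y. Th Y (sc (q ^ (2 * \<nu>)) * x) * y) [0..<k] 1"

text \<open>The product of \<open>Th\<close> at q^(2 nu) x over 0 \<le> nu < c, continued to
  negative \<open>c\<close> as the inverse of the product over c \<le> nu < 0. With this convention
  \<open>Pz_add\<close> holds for all integers, and the cases \<open>eps = 1\<close> and
  \<open>eps = - 1\<close> of \<open>phi\<close> become a single formula.\<close>

definition Pz :: "('f::field \<Rightarrow> 'a) \<Rightarrow> 'f \<Rightarrow> 'a \<Rightarrow> int \<Rightarrow> 'a \<Rightarrow> 'a" where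
  "Pz sc q Y c x = (if c \<ge> 0 then Pn sc q Y (nat c) x
     else inverse (Pn sc q Y (nat (- c)) (sc (q powi (2 * c)) * x)))"

lemma foldr_mult_right: "foldr (\<lambda>\<nu> y. f \<nu> * y) xs z = foldr (\<lambda>\<nu> y. f \<nu> * y) xs 1 * z"
  by (induction xs) (simp_all add: mult.assoc)

lemma Pn_0 [simp]: "Pn sc q Y 0 x = 1"
  by (simp add: Pn_def)

lemma Pn_Suc: "Pn sc q Y (Suc k) x = Pn sc q Y k x * Th Y (sc (q ^ (2 * k)) * x)"
  using foldr_mult_right[of "\<lambda>\<nu>. Th Y (sc (q ^ (2 * \<nu>)) * x)" "[0..<k]" "Th Y (sc (q ^ (2 * k)) * x)"]
  by (simp add: Pn_def)

lemma Pn_Suc_left: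
  assumes "scalars sc"
  shows "Pn sc q Y (Suc k) x = Th Y x * Pn sc q Y k (sc (q\<^sup>2) * x)"
proof (induction k)
  case 0
  then show ?case by (simp add: Pn_Suc scalarsD[OF assms])
next
  case (Suc k)
  have "sc (q ^ (2 * Suc k)) * x = sc (q ^ (2 * k)) * (sc (q\<^sup>2) * x)"
  by (simp only: power_double_Suc scalarsD(2)[OF assms] mult.assoc)
  then show ?case
    unfolding Pn_Suc[of sc q Y "Suc k" x] Suc Pn_Suc[of sc q Y k "sc (q\<^sup>2) * x"] by (simp only: mult.assoc)
qed

text \<open>All scalar multiples of \<open>x\<close> are included because \<open>Pn\<close> and
  \<open>Pz\<close> evaluate \<open>Th\<close> at powers of \<open>q\<close> times \<open>x\<close>;
  the condition is thereby stable under rescaling.\<close>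

definition regular :: "('f::field \<Rightarrow> 'a) \<Rightarrow> 'a \<Rightarrow> 'a \<Rightarrow> bool" where
  "regular sc Y x \<longleftrightarrow> (\<forall>a. 1 + sc a * x \<noteq> 0 \<and> 1 + Y * (sc a * x) \<noteq> 0)"

lemma regular_scale: "scalars sc \<Longrightarrow> regular sc Y x \<Longrightarrow> regular sc Y (sc a * x)"
  unfolding regular_def by (simp flip: mult.assoc scalarsD(2))

lemma regularD: "scalars sc \<Longrightarrow> regular sc Y x \<Longrightarrow> 1 + x \<noteq> 0" "scalars sc \<Longrightarrow> regular sc Y x \<Longrightarrow> 1 + Y * x \<noteq> 0"
  unfolding regular_def by (metis mult_1_left scalarsD(3))+

lemma regular_Th: "scalars sc \<Longrightarrow> regular sc Y x \<Longrightarrow> Th Y x \<noteq> 0"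
  using Th_nonzero regularD by blast

lemma Pn_nonzero: "scalars sc \<Longrightarrow> regular sc Y x \<Longrightarrow> Pn sc q Y k x \<noteq> 0"
  by (induction k) (simp_all add: Pn_Suc regular_Th regular_scale)

lemma Pz_nonzero: "scalars sc \<Longrightarrow> regular sc Y x \<Longrightarrow> Pz sc q Y c x \<noteq> 0"
  by (simp add: Pz_def Pn_nonzero regular_scale nonzero_imp_inverse_nonzero)

lemma Pz_0 [simp]: "Pz sc q Y 0 x = 1"
  by (simp add: Pz_def)

lemma Pz_1: "scalars sc \<Longrightarrow> Pz sc q Y 1 x = Th Y x"
  by (simp add: Pz_def Pn_Suc[of sc q Y 0 x, simplified] scalarsD)

lemma comm_Pn:
  assumes sc: "scalars sc" and Y: "central Y" and z: "z * x = x * z"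
  shows "z * Pn sc q Y k x = Pn sc q Y k x * z"
proof (induction k)
  case (Suc k)
  have "z * (sc (q ^ (2 * k)) * x) = sc (q ^ (2 * k)) * x * z"
    by (simp only: sc_left_comm[OF sc, of z] z mult.assoc)
  from comm_Th[OF this Y] Suc show ?case
    unfolding Pn_Suc by (rule comm_mult[rotated])
qed simp

lemma comm_scale: "scalars sc \<Longrightarrow> z * x = x * z \<Longrightarrow> z * (sc a * x) = sc a * x * z"
  by (simp add: sc_left_comm[of sc z] mult.assoc)

lemma Pz_succ:
  assumes sc: "scalars sc" and r: "regular sc Y x" and q: "q \<noteq> 0" and Y: "central Y"
  shows "Pz sc q Y (c + 1) x = Pz sc q Y c (sc (q\<^sup>2) * x) * Th Y x"
proof (cases "c \<ge> 0")
  case True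
  define k where "k = nat c"
  have c: "c = int k" "nat (int k + 1) = Suc k" using True by (simp_all add: k_def)
  have "x * Th Y x = Th Y x * x" by (rule comm_Th[OF refl Y])
  then have "Th Y x * Pn sc q Y k (sc (q\<^sup>2) * x) = Pn sc q Y k (sc (q\<^sup>2) * x) * Th Y x"
    by (intro comm_Pn[OF sc Y] comm_scale[OF sc]) simp
  then show ?thesis
    using True c(2) by (simp add: Pz_def c(1) Pn_Suc_left[OF sc])
next
  case False
  define k where "k = nat (- c) - 1"
  have c: "nat (- c) = Suc k" "c = - 1 - int k" using False by (simp_all add: k_def)
  define w where "w = sc (q powi (- 2 * int k)) * x"
  have rw: "regular sc Y w" unfolding w_def by (rule regular_scale[OF sc r])
  have x: "sc (q ^ (2 * k)) * w = x"
  proof -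
    have "q ^ (2 * k) * q powi (- 2 * int k) = 1"
      using powi_double_add[OF q, of "int k" "- int k"] unfolding power_double_powi by simp
    then show ?thesis
      unfolding w_def by (simp add: scalarsD(3)[OF sc] flip: mult.assoc scalarsD(2)[OF sc])
  qed
  have 1: "Pz sc q Y (c + 1) x = inverse (Pn sc q Y k w)"
  proof (cases "k = 0")
    case True
    then show ?thesis by (simp add: Pz_def c)
  next
    case False
    then show ?thesis by (simp add: Pz_def c w_def algebra_simps)
  qed
  have "q powi (2 * c) * q\<^sup>2 = q powi (- 2 * int k)"
    unfolding power2_powi powi_double_add[OF q] by (simp add: c(2))
  then have 2: "sc (q powi (2 * c)) * (sc (q\<^sup>2) * x) = w"
    unfolding w_def by (simp flip: mult.assoc scalarsD(2)[OF sc])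
  have "Pz sc q Y c (sc (q\<^sup>2) * x) = inverse (Pn sc q Y k w * Th Y x)"
    using False unfolding Pz_def c(1) 2 Pn_Suc x by simp
  moreover have "Th Y x \<noteq> 0" "Pn sc q Y k w \<noteq> 0"
    using regular_Th[OF sc r] Pn_nonzero[OF sc rw] by auto
  moreover have "Th Y x * Pn sc q Y k w = Pn sc q Y k w * Th Y x"
  proof -
    have "x * Th Y x = Th Y x * x" by (rule comm_Th[OF refl Y])
    then show ?thesis unfolding w_def by (intro comm_Pn[OF sc Y] comm_scale[OF sc]) simp
  qed
  ultimately show ?thesis
    unfolding 1 by (metis inverse_mult_any mult.assoc left_inverse mult_1_right)
qed

text \<open>A cocycle rule. If moving \<open>x\<close> past two elements rescales it by q^(2 c) and
  q^(2 d), their product calls for the factor with exponent \<open>c + d\<close>; this is the reason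
  why conjugation by a power is multiplicative. \<open>Pz_succ\<close> gives the steps of an
  induction in both directions.\<close>

lemma Pz_add:
  assumes sc: "scalars sc" and r: "regular sc Y x" and q: "q \<noteq> 0" and Y: "central Y"
  shows "Pz sc q Y (c + d) x = Pz sc q Y c (sc (q powi (2 * d)) * x) * Pz sc q Y d x"
  using r
proof (induction d arbitrary: x rule: int_induct[where k = 0])
  case base
  then show ?case by (simp add: scalarsD(3)[OF sc])
next
  case (step1 d)
  let ?x = "sc (q\<^sup>2) * x"
  have rx: "regular sc Y ?x" by (rule regular_scale[OF sc step1.prems])
  have e: "sc (q powi (2 * d)) * ?x = sc (q powi (2 * (d + 1))) * x"
    unfolding power2_powi by (simp only: powi_double_add[OF q] flip: mult.assoc scalarsD(2)[OF sc])
  have "Pz sc q Y (c + (d + 1)) x = Pz sc q Y (c + d) ?x * Th Y x"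
    using Pz_succ[OF sc step1.prems q Y, of "c + d"] by (simp add: Groups.add.assoc)
  also have "\<dots> = Pz sc q Y c (sc (q powi (2 * (d + 1))) * x) * (Pz sc q Y d ?x * Th Y x)"
    unfolding step1.IH[OF rx] e by (simp only: mult.assoc)
  also have "Pz sc q Y d ?x * Th Y x = Pz sc q Y (d + 1) x"
    by (rule Pz_succ[OF sc step1.prems q Y, symmetric])
  finally show ?case .
next
  case (step2 d)
  let ?x = "sc (q powi (- 2)) * x"
  have rx: "regular sc Y ?x" by (rule regular_scale[OF sc step2.prems])
  have e: "sc (q\<^sup>2) * ?x = x"
    using q by (simp add: power_int_minus scalarsD(3)[OF sc] flip: mult.assoc scalarsD(2)[OF sc])
  have e': "sc (q powi (2 * d)) * ?x = sc (q powi (2 * (d - 1))) * x"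
  proof -
    have "q powi (2 * d) * q powi (- 2) = q powi (2 * (d - 1))"
      using powi_double_add[OF q, of d "- 1"] by simp
    then show ?thesis by (simp only: flip: mult.assoc scalarsD(2)[OF sc])
  qed
  have T: "Th Y ?x \<noteq> 0" by (rule regular_Th[OF sc rx])
  have "Pz sc q Y (c + (d - 1)) x * Th Y ?x = Pz sc q Y (c + d) ?x"
    using Pz_succ[OF sc rx q Y, of "c + (d - 1)"] unfolding e by (simp add: algebra_simps)
  also have "\<dots> = Pz sc q Y c (sc (q powi (2 * (d - 1))) * x) * Pz sc q Y d ?x"
    unfolding step2.IH[OF rx] e' ..
  also have "Pz sc q Y d ?x = Pz sc q Y (d - 1) x * Th Y ?x"
    using Pz_succ[OF sc rx q Y, of "d - 1"] unfolding e by simp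
  finally show ?case using T by (simp flip: mult.assoc)
qed

lemma Pz_shift:
  assumes sc: "scalars sc" and r: "regular sc Y x" and Y: "central Y"
    and u: "x * u = u * (sc b * x)" "u \<noteq> 0"
  shows "Pz sc q Y c x * u = u * Pz sc q Y c (sc b * x)"
proof -
  have 1: "Pn sc q Y k (sc a * x) * u = u * Pn sc q Y k (sc a * (sc b * x))" for a k
  proof (induction k)
    case (Suc k)
    define a' where "a' = q ^ (2 * k) * a"
    have a': "sc (q ^ (2 * k)) * (sc a * y) = sc a' * y" for y
      by (simp add: a'_def scalarsD(2)[OF sc] mult.assoc)
    have "u * (sc a' * (sc b * x)) = sc a' * x * u"
      unfolding sc_left_comm[OF sc, of u "a'"] u(1)[symmetric] by (simp only: mult.assoc)
    then have "u * Th Y (sc a' * (sc b * x)) = Th Y (sc a' * x) * u"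
      by (rule Th_shift[OF _ u(2) Y])
        (use regular_scale[OF sc regular_scale[OF sc r], of a' b] regular_scale[OF sc r, of a'] in
          \<open>simp_all add: regularD[OF sc]\<close>)
    then show ?case
      unfolding Pn_Suc a' by (metis Suc mult.assoc)
  qed simp
  have n: "Pn sc q Y k (sc a * x) \<noteq> 0" "Pn sc q Y k (sc a * (sc b * x)) \<noteq> 0" for a k
    by (intro Pn_nonzero[OF sc] regular_scale[OF sc] r)+
  show ?thesis
  proof (cases "c \<ge> 0")
    case True
    then show ?thesis using 1[of "nat c" 1] by (simp add: Pz_def scalarsD(3)[OF sc])
  next
    case False
    then show ?thesis using inverse_mult_swap[OF n 1] by (simp add: Pz_def)
  qed
qed

end

text \<open>The scalar produced when the product of two ordered monomials, with exponents
  \<open>m\<close> and \<open>m'\<close>, is brought back into the order of the list.\<close>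

primrec chi :: "('i \<Rightarrow> 'i \<Rightarrow> 'f::field) \<Rightarrow> 'i list \<Rightarrow> ('i \<Rightarrow> nat) \<Rightarrow> ('i \<Rightarrow> nat) \<Rightarrow> 'f" where
  "chi cc [] m m' = 1"
| "chi cc (i # xs) m m' = prod_list (map (\<lambda>j. cc j i ^ (m j * m' i)) xs) * chi cc xs m m'"

definition enum_list :: "'i::finite list" where
  "enum_list = (SOME xs. set xs = UNIV \<and> distinct xs)"

lemma enum_list: "set (enum_list :: 'i::finite list) = UNIV" "distinct (enum_list :: 'i::finite list)"
  using someI_ex[OF finite_distinct_list[OF finite_UNIV[where 'a = 'i]]] by (auto simp: enum_list_def)

section \<open>Polynomial growth of boxes of exponents\<close>

lemma power_less_two_power: "\<exists>t. (2 * t * k + 1) ^ p < (2::nat) ^ t"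
proof -
  \<comment> \<open>Chosen such that \<open>C\<close> times (t ln 2)^p equals ((2 k + 1) t)^p, a
    bound for (2 t k + 1)^p as soon as t \<ge> 1. Then x^p / exp x is small at x = t ln 2, where exp
    x = 2^t.\<close>
  define C where "C = real (2 * k + 1) ^ p / ln 2 ^ p"
  have "C > 0" by (simp add: C_def)
  have "((\<lambda>x::real. x ^ p / exp x) \<longlongrightarrow> 0) at_top" by (rule tendsto_power_div_exp_0)
  then have "eventually (\<lambda>x::real. x ^ p / exp x < inverse C) at_top"
    using \<open>C > 0\<close> by (intro order_tendstoD) auto
  then obtain N where N: "\<And>x. x \<ge> N \<Longrightarrow> x ^ p / exp x < inverse C"
    unfolding eventually_at_top_linorder by blast
  obtain t :: nat where t: "real t > max 1 (N / ln 2)" using reals_Archimedean2 by blast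
  define x where "x = real t * ln 2"
  have "x \<ge> N" using t by (simp add: x_def field_simps)
  then have "C * x ^ p < exp x" using N[of x] \<open>C > 0\<close> by (simp add: field_simps)
  moreover have "exp x = 2 ^ t" by (simp add: x_def exp_of_nat_mult)
  moreover have "C * x ^ p = (real (2 * k + 1) * real t) ^ p"
    by (simp add: C_def x_def power_mult_distrib)
  moreover have "real ((2 * t * k + 1) ^ p) \<le> (real (2 * k + 1) * real t) ^ p"
    unfolding of_nat_power using t by (intro power_mono) (auto simp: algebra_simps)
  ultimately have "real ((2 * t * k + 1) ^ p) < real (2 ^ t)" by simp
  then show ?thesis unfolding of_nat_less_iff by blast
qed

text \<open>Boxes in the monoid of exponents of the monomials in the \<open>g i\<close> and the
  central units: the former are nonnegative, the latter have coordinates with respect to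
  \<open>B\<close> bounded in absolute value. They serve as the exhaustion required by
  \<open>right_ore_lspan\<close>.\<close>

definition grid :: "'y::ab_group_add set \<Rightarrow> nat \<Rightarrow> (('i::finite \<Rightarrow> nat) \<times> 'y) set" where
  "grid B n = {m. \<forall>i. m i \<le> n} \<times> {\<Sum>b\<in>B. zsmul (k b) b | k. \<forall>b. \<bar>k b\<bar> \<le> int n}"

lemma grid_box_finite:
  assumes "finite B"
  shows "finite (grid B n :: (('i::finite \<Rightarrow> nat) \<times> 'y::ab_group_add) set)"
    "card (grid B n :: (('i \<Rightarrow> nat) \<times> 'y) set) \<le> (2 * n + 1) ^ (card (UNIV :: 'i set) + card B)" (is ?R1)
proof -
  have 1: "{m. \<forall>i::'i. m i \<le> n} = PiE UNIV (\<lambda>_. {..n})" by auto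
  have "{\<Sum>b\<in>B. zsmul (k b) b | k. \<forall>b. \<bar>k b\<bar> \<le> int n} \<subseteq>
     (\<lambda>k. \<Sum>b\<in>B. zsmul (k b) b) ` PiE B (\<lambda>_. {- int n..int n})"
  proof
    fix y assume "y \<in> {\<Sum>b\<in>B. zsmul (k b) b | k. \<forall>b. \<bar>k b\<bar> \<le> int n}"
    then obtain k where k: "y = (\<Sum>b\<in>B. zsmul (k b) b)" "\<forall>b. \<bar>k b\<bar> \<le> int n" by blast
    have "- int n \<le> k b \<and> k b \<le> int n" for b using k(2)[rule_format, of b] by linarith
    then have "restrict k B \<in> PiE B (\<lambda>_. {- int n..int n})" by auto
    moreover have "y = (\<Sum>b\<in>B. zsmul (restrict k B b) b)" using k by simp
    ultimately show "y \<in> (\<lambda>k. \<Sum>b\<in>B. zsmul (k b) b) ` PiE B (\<lambda>_. {- int n..int n})" by blast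
  qed
  moreover have fin: "finite (PiE B (\<lambda>_. {- int n..int n}))" using assms by (intro finite_PiE) auto
  ultimately have 2: "finite {\<Sum>b\<in>B. zsmul (k b) b | k. \<forall>b. \<bar>k b\<bar> \<le> int n}"
    "card {\<Sum>b\<in>B. zsmul (k b) b | k. \<forall>b. \<bar>k b\<bar> \<le> int n} \<le> (2 * n + 1) ^ card B"
    using finite_surj[OF fin] surj_card_le[OF fin] assms by (simp_all add: card_PiE nat_add_distrib nat_mult_distrib)
  show "finite (grid B n :: (('i \<Rightarrow> nat) \<times> 'y) set)"
    unfolding grid_def 1 using 2 by (intro finite_cartesian_product finite_PiE) auto
  have "card {m. \<forall>i::'i. m i \<le> n} \<le> (2 * n + 1) ^ card (UNIV :: 'i set)"
    unfolding 1 by (simp add: card_PiE power_mono)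
  then show ?R1
    unfolding grid_def card_cartesian_product power_add using 2 by (intro mult_le_mono)
qed

text \<open>Otherwise the size would at least double every \<open>k\<close> steps, so the box of
  index t k would have at least 2^t elements, against the polynomial bound of
  \<open>grid_box_finite\<close>.\<close>

lemma grid_growth:
  assumes "finite B"
  shows "\<exists>n. card (grid B (k + n) :: (('i::finite \<Rightarrow> nat) \<times> 'y::ab_group_add) set) < 2 * card (grid B n :: (('i \<Rightarrow> nat) \<times> 'y) set)"
proof (rule ccontr)
  let ?X = "\<lambda>n. grid B n :: (('i \<Rightarrow> nat) \<times> 'y) set"
  assume "\<not> ?thesis"
  then have step: "2 * card (?X n) \<le> card (?X (k + n))" for n by (meson not_le)
  have "(\<lambda>_. 0, 0) \<in> ?X 0" by (auto simp: grid_def intro!: exI[of _ "\<lambda>_. 0"])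
  then have "card (?X 0) > 0" using grid_box_finite(1)[OF assms, of 0] card_gt_0_iff by blast
  then have lower: "2 ^ t \<le> card (?X (t * k))" for t
  proof (induction t)
    case (Suc t)
    then have "2 ^ Suc t \<le> 2 * card (?X (t * k))" by simp
    also have "\<dots> \<le> card (?X (Suc t * k))" using step[of "t * k"] by simp
    finally show ?case .
  qed simp
  obtain t where "(2 * t * k + 1) ^ (card (UNIV :: 'i set) + card B) < (2::nat) ^ t"
    using power_less_two_power by blast
  then show False
    using lower[of t] grid_box_finite(2)[OF assms, of "t * k", where 'i = 'i] by (simp add: mult.assoc)
qed

lemma grid_add:
  assumes "\<gamma> \<in> grid B m" "\<delta> \<in> grid B n"
  shows "\<gamma> + \<delta> \<in> grid B (m + n)"
proof -
  obtain k where k: "\<forall>i. fst \<gamma> i \<le> m" "snd \<gamma> = (\<Sum>b\<in>B. zsmul (k b) b)" "\<forall>b. \<bar>k b\<bar> \<le> int m"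
    using assms(1) by (auto simp: grid_def)
  obtain l where l: "\<forall>i. fst \<delta> i \<le> n" "snd \<delta> = (\<Sum>b\<in>B. zsmul (l b) b)" "\<forall>b. \<bar>l b\<bar> \<le> int n"
    using assms(2) by (auto simp: grid_def)
  have "\<bar>k b + l b\<bar> \<le> int (m + n)" for b using k(3)[rule_format, of b] l(3)[rule_format, of b] by linarith
  moreover have "snd (\<gamma> + \<delta>) = (\<Sum>b\<in>B. zsmul (k b + l b) b)"
    by (simp add: k l zmod.scale_left_distrib sum.distrib)
  moreover have "\<forall>i. fst (\<gamma> + \<delta>) i \<le> m + n" using k(1) l(1) by (simp add: add_mono)
  ultimately show ?thesis unfolding grid_def
    by (cases "\<gamma> + \<delta>") (auto intro!: exI[of _ "\<lambda>b. k b + l b"])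
qed

lemma grid_mono:
  "m \<le> n \<Longrightarrow> grid B m \<subseteq> grid B n"
proof
  fix \<gamma> :: "('a \<Rightarrow> nat) \<times> 'b" assume "m \<le> n" "\<gamma> \<in> grid B m"
  then obtain k where k: "\<forall>i. fst \<gamma> i \<le> m" "snd \<gamma> = (\<Sum>b\<in>B. zsmul (k b) b)" "\<forall>b. \<bar>k b\<bar> \<le> int m"
    by (auto simp: grid_def)
  then have "\<forall>i. fst \<gamma> i \<le> n" "\<forall>b. \<bar>k b\<bar> \<le> int n" using \<open>m \<le> n\<close> by (meson order.trans of_nat_mono)+
  then show "\<gamma> \<in> grid B n" unfolding grid_def using k(2) by (cases \<gamma>) auto
qed

lemma grid_exhausts:
  assumes "finite B" "zmod.span B = (UNIV :: 'y::ab_group_add set)"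
  shows "\<exists>n. \<gamma> \<in> (grid B n :: (('i::finite \<Rightarrow> nat) \<times> 'y) set)"
proof -
  obtain k where k: "snd \<gamma> = (\<Sum>b\<in>B. zsmul (k b) b)"
    using assms zmod.span_finite[OF assms(1)] by (metis (no_types, lifting) UNIV_I imageE)
  define k' where "k' b = (if b \<in> B then k b else 0)" for b
  have k'': "snd \<gamma> = (\<Sum>b\<in>B. zsmul (k' b) b)" using k by (simp add: k'_def)
  define n where "n = Max (range (fst \<gamma>)) + (\<Sum>b\<in>B. nat \<bar>k b\<bar>)"
  have "fst \<gamma> i \<le> n" for i unfolding n_def by (simp add: trans_le_add1)
  moreover have "\<bar>k' b\<bar> \<le> int n" for b
  proof (cases "b \<in> B")
    case True
    then have "nat \<bar>k b\<bar> \<le> (\<Sum>b\<in>B. nat \<bar>k b\<bar>)" using assms(1) by (intro member_le_sum) auto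
    then have "int (nat \<bar>k b\<bar>) \<le> int n" unfolding n_def by linarith
    then show ?thesis using True by (simp add: k'_def)
  qed (simp add: k'_def)
  ultimately show ?thesis unfolding grid_def using k'' by (cases \<gamma>) auto
qed

lemma power_Suc_mult: "(c :: 'f::field) ^ (Suc p * n) = c ^ n * c ^ (p * n)"
  by (simp add: power_add)

context division_ring begin

definition gmon :: "('i \<Rightarrow> 'a) \<Rightarrow> 'i list \<Rightarrow> ('i \<Rightarrow> nat) \<Rightarrow> 'a" where
  "gmon g xs m = foldr (\<lambda>i x. g i ^ m i * x) xs 1"

definition qcomm :: "('f::field \<Rightarrow> 'a) \<Rightarrow> ('i \<Rightarrow> 'i \<Rightarrow> 'f) \<Rightarrow> ('i \<Rightarrow> 'a) \<Rightarrow> bool" where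
  "qcomm sc cc g \<longleftrightarrow> (\<forall>i j. g i * g j = sc (cc i j) * (g j * g i))"

lemma power_qcomm:
  assumes sc: "scalars sc" and "x * y = sc c * (y * x)"
  shows "x ^ p * y ^ n = sc (c ^ (p * n)) * (y ^ n * x ^ p)"
proof -
  have 1: "x * y ^ n = sc (c ^ n) * (y ^ n * x)" for n
  proof (induction n)
    case (Suc n)
    have "x * y ^ Suc n = sc c * (y * (x * y ^ n))"
      by (simp add: assms(2) flip: mult.assoc)
    also have "\<dots> = sc (c ^ Suc n) * (y ^ Suc n * x)"
      unfolding Suc sc_left_comm[OF sc, of y] by (simp add: scalarsD(2)[OF sc] mult.assoc)
    finally show ?case .
  qed (simp add: scalarsD(3)[OF sc])
  show ?thesis
  proof (induction p)
    case (Suc p)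
    have "x ^ Suc p * y ^ n = x * (x ^ p * y ^ n)" by (simp add: mult.assoc)
    also have "\<dots> = sc (c ^ (p * n)) * (sc (c ^ n) * (y ^ n * x)) * x ^ p"
      unfolding Suc sc_left_comm[OF sc, of x] 1[symmetric] by (simp only: mult.assoc)
    also have "\<dots> = sc (c ^ (Suc p * n)) * (y ^ n * x ^ Suc p)"
      by (simp only: power_Suc_mult scalarsD(2)[OF sc] mult.assoc sc_left_comm[OF sc, of "sc (c ^ (p * n))" "c ^ n"] power_Suc)
    finally show ?case .
  qed (simp add: scalarsD(3)[OF sc])
qed

lemma gmon_Nil [simp]: "gmon g [] m = 1"
  by (simp add: gmon_def)

lemma gmon_Cons: "gmon g (i # xs) m = g i ^ m i * gmon g xs m"
  by (simp add: gmon_def)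

lemma gmon_power_comm:
  assumes sc: "scalars sc" and g: "qcomm sc cc g"
  shows "gmon g xs m * g i ^ n = sc (prod_list (map (\<lambda>j. cc j i ^ (m j * n)) xs)) * (g i ^ n * gmon g xs m)"
proof (induction xs)
  case (Cons j xs)
  let ?c = "prod_list (map (\<lambda>j. cc j i ^ (m j * n)) xs)" and ?d = "cc j i ^ (m j * n)"
  have "g j * g i = sc (cc j i) * (g i * g j)" using g unfolding qcomm_def by blast
  note p = power_qcomm[OF sc this, of "m j" n]
  have "gmon g (j # xs) m * g i ^ n = g j ^ m j * (gmon g xs m * g i ^ n)"
    by (simp only: gmon_Cons mult.assoc)
  also have "\<dots> = g j ^ m j * (sc ?c * (g i ^ n * gmon g xs m))"
    by (simp only: Cons)
  also have "\<dots> = sc ?c * ((g j ^ m j * g i ^ n) * gmon g xs m)"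
    by (simp only: sc_left_comm[OF sc, of "g j ^ m j"] mult.assoc)
  also have "\<dots> = sc ?c * (sc ?d * (g i ^ n * gmon g (j # xs) m))"
    by (simp only: p gmon_Cons mult.assoc)
  also have "\<dots> = sc (?d * ?c) * (g i ^ n * gmon g (j # xs) m)"
    by (simp only: scalarsD(2)[OF sc] mult.assoc sc_left_comm[OF sc, of "sc ?c" ?d])
  finally show ?case by simp
qed (simp add: scalarsD(3)[OF sc])

lemma gmon_mult:
  assumes sc: "scalars sc" and g: "qcomm sc cc g"
  shows "gmon g xs m * gmon g xs m' = sc (chi cc xs m m') * gmon g xs (m + m')"
proof (induction xs)
  case (Cons i xs)
  let ?c = "prod_list (map (\<lambda>j. cc j i ^ (m j * m' i)) xs)"
  have "gmon g (i # xs) m * gmon g (i # xs) m' = g i ^ m i * ((gmon g xs m * g i ^ m' i) * gmon g xs m')"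
    by (simp only: gmon_Cons mult.assoc)
  also have "\<dots> = g i ^ m i * (sc ?c * (g i ^ m' i * (gmon g xs m * gmon g xs m')))"
    by (simp only: gmon_power_comm[OF sc g, of xs m i "m' i"] mult.assoc)
  also have "\<dots> = sc ?c * (g i ^ m i * (g i ^ m' i * (sc (chi cc xs m m') * gmon g xs (m + m'))))"
    by (simp only: sc_left_comm[OF sc, of "g i ^ m i" ?c] Cons)
  also have "\<dots> = sc ?c * (sc (chi cc xs m m') * (g i ^ m i * (g i ^ m' i * gmon g xs (m + m'))))"
    by (simp only: sc_left_comm[OF sc, of "g i ^ m i" "chi cc xs m m'"] sc_left_comm[OF sc, of "g i ^ m' i" "chi cc xs m m'"])
  also have "\<dots> = sc (chi cc (i # xs) m m') * gmon g (i # xs) (m + m')"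
    by (simp only: scalarsD(2)[OF sc] mult.assoc power_add gmon_Cons plus_fun_apply chi.simps)
  finally show ?case .
qed (simp add: scalarsD(3)[OF sc])

text \<open>Exponents of the \<open>g i\<close> are natural numbers: the algebra generated by the
  \<open>g i\<close> and the central units is spanned by these monomials, and inverses of the
  \<open>g i\<close> appear only among the fractions.\<close>

definition tmon :: "('y \<Rightarrow> 'a) \<Rightarrow> ('i::finite \<Rightarrow> 'a) \<Rightarrow> ('i \<Rightarrow> nat) \<times> 'y \<Rightarrow> 'a" where
  "tmon E g = (\<lambda>(m, \<kappa>). E \<kappa> * gmon g enum_list m)"

definition lattice_units :: "('y::ab_group_add \<Rightarrow> 'a) \<Rightarrow> bool" where
  "lattice_units E \<longleftrightarrow> E 0 = 1 \<and> (\<forall>\<kappa> \<mu>. E (\<kappa> + \<mu>) = E \<kappa> * E \<mu>) \<and> (\<forall>\<kappa>. central (E \<kappa>))"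

lemma lattice_unitsD:
  assumes "lattice_units E"
  shows "E 0 = 1" "E (\<kappa> + \<mu>) = E \<kappa> * E \<mu>" "central (E \<kappa>)" "E \<kappa> \<noteq> 0" "E (- \<kappa>) = inverse (E \<kappa>)"
proof -
  show *: "E 0 = 1" "E (\<kappa> + \<mu>) = E \<kappa> * E \<mu>" "central (E \<kappa>)" for \<kappa> \<mu>
    using assms by (auto simp: lattice_units_def)
  have "E \<kappa> * E (- \<kappa>) = 1" using *(2)[of \<kappa> "- \<kappa>"] *(1) by simp
  then show "E (- \<kappa>) = inverse (E \<kappa>)" "E \<kappa> \<noteq> 0"
    using inverse_unique[of "E \<kappa>" "E (- \<kappa>)"] by (simp, metis mult_zero_left zero_neq_one)
qed

lemma twisted_tmon:
  fixes E :: "'y::ab_group_add \<Rightarrow> 'a" and g :: "'i::finite \<Rightarrow> 'a"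
  assumes sc: "scalars sc" and E: "lattice_units E" and g: "qcomm sc cc g"
  shows "twisted sc (tmon E g) (\<lambda>(m, \<kappa>) (m', \<kappa>'). chi cc enum_list m m')"
  unfolding twisted_def
proof (intro conjI allI)
  have "gmon g xs 0 = 1" for xs by (induction xs) (simp_all add: gmon_Cons)
  then show "tmon E g 0 = 1" by (simp add: tmon_def zero_prod_def lattice_unitsD[OF E])
  fix \<gamma> \<delta> :: "('i \<Rightarrow> nat) \<times> 'y"
  obtain m \<kappa> m' \<kappa>' where *: "\<gamma> = (m, \<kappa>)" "\<delta> = (m', \<kappa>')" by (cases \<gamma>, cases \<delta>)
  have "tmon E g \<gamma> * tmon E g \<delta> = E \<kappa> * (E \<kappa>' * (gmon g enum_list m * gmon g enum_list m'))"
    using central_left_comm[OF lattice_unitsD(3)[OF E], of "gmon g enum_list m"]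
    by (simp add: * tmon_def mult.assoc)
  also have "\<dots> = sc (chi cc enum_list m m') * (E \<kappa> * E \<kappa>' * gmon g enum_list (m + m'))"
    unfolding gmon_mult[OF sc g] sc_left_comm[OF sc, of "E _"] by (simp only: mult.assoc)
  finally show "tmon E g \<gamma> * tmon E g \<delta> =
    sc ((case \<gamma> of (m, \<kappa>) \<Rightarrow> \<lambda>(m', \<kappa>'). chi cc enum_list m m') \<delta>) * tmon E g (\<gamma> + \<delta>)"
    by (simp add: * tmon_def lattice_unitsD[OF E])
qed

lemma right_ore_tmon:
  assumes sc: "scalars sc" and E: "lattice_units (E :: 'y::ab_group_add \<Rightarrow> 'a)" and g: "qcomm sc cc (g :: 'i::finite \<Rightarrow> 'a)"
    and ind: "indep sc (tmon E g)" and fg: "fg_free TYPE('y)"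
  shows "right_ore (lspan sc (tmon E g) UNIV)"
proof -
  obtain B :: "'y set" where B: "finite B" "zmod.span B = UNIV"
    using fg by (auto simp: fg_free_def)
  show ?thesis
  proof (rule right_ore_lspan[OF sc twisted_tmon[OF sc E g] ind, of "grid B"])
    show "finite (grid B n :: (('i \<Rightarrow> nat) \<times> 'y) set)" for n by (rule grid_box_finite(1)[OF B(1)])
    show "\<exists>n. \<gamma> \<in> grid B n" for \<gamma> :: "('i \<Rightarrow> nat) \<times> 'y" by (rule grid_exhausts[OF B])
    show "\<exists>n. card (grid B (k + n) :: (('i \<Rightarrow> nat) \<times> 'y) set) < 2 * card (grid B n :: (('i \<Rightarrow> nat) \<times> 'y) set)" for k
      by (rule grid_growth[OF B(1)])
  qed (rule grid_add grid_mono; assumption)+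
qed

end

definition sng :: "'i \<Rightarrow> 'i \<Rightarrow> nat" where
  "sng i = (\<lambda>j. if j = i then 1 else 0)"

definition mdeg :: "('i::finite \<Rightarrow> nat) \<times> 'y \<Rightarrow> nat" where
  "mdeg \<gamma> = (\<Sum>j\<in>UNIV. fst \<gamma> j)"

lemma mdeg_add: "mdeg (\<gamma> + \<delta>) = mdeg \<gamma> + mdeg \<delta>"
  by (simp add: mdeg_def sum.distrib)

lemma mdeg_sng: "mdeg (sng i, \<kappa>) = 1"
  by (simp add: mdeg_def sng_def)

context division_ring begin

lemma gmon_sng: "gmon g xs (sng i) = (if distinct xs \<and> i \<in> set xs then g i else gmon g xs (sng i))"
proof -
  have "distinct xs \<Longrightarrow> gmon g xs (sng i) = (if i \<in> set xs then g i else 1)"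
    by (induction xs) (auto simp: gmon_Cons sng_def)
  then show ?thesis by simp
qed

lemma tmon_sng: "tmon E g (sng i, \<kappa>) = E \<kappa> * g i"
  using gmon_sng[of g enum_list i] by (simp add: tmon_def enum_list)

lemma tmon_0: "tmon E g (0, \<kappa>) = E \<kappa>"
proof -
  have "gmon g xs 0 = 1" for xs by (induction xs) (simp_all add: gmon_Cons)
  then show ?thesis by (simp add: tmon_def)
qed

section \<open>Leading terms and twisted generators\<close>

definition linprod :: "'a \<Rightarrow> 'a list \<Rightarrow> 'a" where
  "linprod x zs = foldr (\<lambda>z y. (1 + z * x) * y) zs 1"

lemma linprod_simps [simp]:
  "linprod x [] = 1" "linprod x (z # zs) = (1 + z * x) * linprod x zs"
  by (simp_all add: linprod_def)

lemma linprod_append: "linprod x (zs @ ws) = linprod x zs * linprod x ws"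
  by (induction zs) (simp_all add: mult.assoc)

lemma linprod_comm1: "y * x = x * y \<Longrightarrow> \<forall>z\<in>set zs. central z \<Longrightarrow> y * linprod x zs = linprod x zs * y"
  by (induction zs) (auto intro!: comm_mult comm_one_plus)

lemma linprod_comm:
  assumes "\<forall>z\<in>set zs. central z" "\<forall>z\<in>set ws. central z"
  shows "linprod x zs * linprod x ws = linprod x ws * linprod x zs"
proof -
  have "linprod x zs * x = x * linprod x zs" using linprod_comm1[of x x zs] assms by simp
  then show ?thesis using linprod_comm1[of "linprod x zs" x ws] assms by simp
qed

text \<open>Values of \<open>Pz\<close> in factored form. A common denominator of finitely many of
  them is again a product of factors \<open>1 + z * x\<close>, so after clearing it every value
  equals 1 plus terms of positive degree, as \<open>leading_term_independent\<close>
  requires.\<close>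

definition ratprods :: "'a set \<Rightarrow> 'a \<Rightarrow> 'a set" where
  "ratprods Z x = {linprod x zs * inverse (linprod x ws) | zs ws. set zs \<subseteq> Z \<and> set ws \<subseteq> Z}"

lemma linprod_nonzero: "\<forall>z\<in>set zs. 1 + z * x \<noteq> 0 \<Longrightarrow> linprod x zs \<noteq> 0"
  by (induction zs) simp_all

lemma ratprods_mult:
  assumes Z: "\<forall>z\<in>Z. central z" and "r \<in> ratprods Z x" "s \<in> ratprods Z x"
  shows "r * s \<in> ratprods Z x"
proof -
  obtain zs ws where r: "r = linprod x zs * inverse (linprod x ws)" "set zs \<subseteq> Z" "set ws \<subseteq> Z"
    using assms(2) unfolding ratprods_def by blast
  obtain zs' ws' where s: "s = linprod x zs' * inverse (linprod x ws')" "set zs' \<subseteq> Z" "set ws' \<subseteq> Z"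
    using assms(3) unfolding ratprods_def by blast
  have "linprod x zs' * inverse (linprod x ws) = inverse (linprod x ws) * linprod x zs'"
    by (rule comm_inverse[OF linprod_comm]) (use r s Z in auto)
  then have "r * s = linprod x zs * linprod x zs' * (inverse (linprod x ws) * inverse (linprod x ws'))"
    unfolding r(1) s(1) by (simp flip: mult.assoc) (simp add: mult.assoc)
  also have "\<dots> = linprod x (zs @ zs') * inverse (linprod x (ws' @ ws))"
    by (simp add: linprod_append inverse_mult_any)
  finally have "r * s = linprod x (zs @ zs') * inverse (linprod x (ws' @ ws))" .
  moreover have "set (zs @ zs') \<subseteq> Z" "set (ws' @ ws) \<subseteq> Z" using r s by auto
  ultimately show ?thesis unfolding ratprods_def by blast
qed

lemma ratprods_inverse:
  assumes Z: "\<forall>z\<in>Z. central z" and "r \<in> ratprods Z x"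
  shows "inverse r \<in> ratprods Z x"
proof -
  obtain zs ws where r: "r = linprod x zs * inverse (linprod x ws)" "set zs \<subseteq> Z" "set ws \<subseteq> Z"
    using assms(2) unfolding ratprods_def by blast
  have "inverse r = linprod x ws * inverse (linprod x zs)"
    by (simp add: r inverse_mult_any inverse_inverse_any)
  then show ?thesis unfolding ratprods_def using r by blast
qed

lemma ratprods_1: "1 \<in> ratprods Z x"
  unfolding ratprods_def by (auto intro!: exI[of _ "[]"])

lemma ratprods_Th:
  assumes "z \<in> Z" "Y * z \<in> Z"
  shows "Th Y (z * x) \<in> ratprods Z x"
proof -
  have "Th Y (z * x) = linprod x [z] * inverse (linprod x [Y * z])" by (simp add: Th_def mult.assoc)
  moreover have "set [z] \<subseteq> Z" "set [Y * z] \<subseteq> Z" using assms by auto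
  ultimately show ?thesis unfolding ratprods_def by blast
qed

lemma ratprods_common_denominator:
  assumes Z: "\<forall>z\<in>Z. central z \<and> 1 + z * x \<noteq> 0" and "finite S" "\<forall>k\<in>S. r k \<in> ratprods Z x"
  shows "\<exists>ds. set ds \<subseteq> Z \<and> (\<forall>k\<in>S. \<exists>zs. set zs \<subseteq> Z \<and> r k * linprod x ds = linprod x zs)"
  using assms(2,3)
proof (induction S rule: finite_induct)
  case (insert k S)
  then obtain ds where ds: "set ds \<subseteq> Z" "\<forall>k\<in>S. \<exists>zs. set zs \<subseteq> Z \<and> r k * linprod x ds = linprod x zs"
    by auto
  have "r k \<in> ratprods Z x" using insert.prems by simp
  then obtain zs ws where k: "r k = linprod x zs * inverse (linprod x ws)" "set zs \<subseteq> Z" "set ws \<subseteq> Z"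
    unfolding ratprods_def by blast
  have nz: "linprod x ws \<noteq> 0" using k Z by (intro linprod_nonzero) auto
  have 1: "\<exists>zs. set zs \<subseteq> Z \<and> r k' * linprod x (ds @ ws) = linprod x zs" if k': "k' \<in> S" for k'
  proof -
    obtain zs' where "set zs' \<subseteq> Z" "r k' * linprod x ds = linprod x zs'" using ds k' by blast
    then have "set (zs' @ ws) \<subseteq> Z" "r k' * linprod x (ds @ ws) = linprod x (zs' @ ws)"
      using k by (simp_all add: linprod_append flip: mult.assoc)
    then show ?thesis by blast
  qed
  have "linprod x (ds @ ws) = linprod x ws * linprod x ds"
    unfolding linprod_append using ds k Z by (intro linprod_comm) auto
  then have "r k * linprod x (ds @ ws) = linprod x (zs @ ds)"
    using nz by (simp add: k linprod_append mult.assoc inverse_mult_cancel_left)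
  then have 2: "\<exists>zs. set zs \<subseteq> Z \<and> r k * linprod x (ds @ ws) = linprod x zs"
    using ds k by (intro exI[of _ "zs @ ds"]) simp
  show ?case using 1 2 ds k by (intro exI[of _ "ds @ ws"]) simp
qed (auto intro!: exI[of _ "[]"])

text \<open>The terms of lowest degree in a relation between the new elements form a relation between the old ones.\<close>

lemma leading_term_independent:
  fixes deg :: "'g::comm_monoid_add \<Rightarrow> nat"
  assumes sc: "scalars sc" and ind: "indep sc e" and tw: "twisted sc e \<chi>"
    and deg: "\<And>\<gamma> \<delta>. deg (\<gamma> + \<delta>) = deg \<gamma> + deg \<delta>"
    and fin: "finite S" and inj: "inj_on p S"
    and Q: "\<And>s. s \<in> S \<Longrightarrow> Q s - 1 \<in> lspan sc e {\<gamma>. deg \<gamma> \<ge> 1}"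
    and zero: "(\<Sum>s\<in>S. sc (c s) * e (p s) * Q s) = 0" and s: "s \<in> S"
  shows "c s = 0"
proof (rule ccontr)
  assume "c s \<noteq> 0"
  define S' where "S' = {s \<in> S. c s \<noteq> 0}"
  define d where "d = Min ((\<lambda>s. deg (p s)) ` S')"
  define T where "T = {s \<in> S'. deg (p s) = d}"
  have fS': "finite S'" "S' \<noteq> {}" using fin s \<open>c s \<noteq> 0\<close> by (auto simp: S'_def)
  have dle: "d \<le> deg (p s)" if "s \<in> S'" for s
    unfolding d_def using that fS' by (intro Min_le) auto
  have "d \<in> (\<lambda>s. deg (p s)) ` S'" unfolding d_def using fS' by (intro Min_in) auto
  then obtain t where t: "t \<in> T" by (auto simp: T_def)
  let ?H = "lspan sc e {\<gamma>. deg \<gamma> \<ge> d + 1}"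
  have low: "sc (c s) * e (p s) * (Q s - 1) \<in> ?H" if "s \<in> S'" for s
  proof -
    have "sc (c s) * e (p s) \<in> lspan sc e {p s}"
      by (rule lspan_smult[OF sc lspan_base[OF sc]]) simp
    moreover have "Q s - 1 \<in> lspan sc e {\<gamma>. deg \<gamma> \<ge> 1}" using Q that by (simp add: S'_def)
    ultimately show ?thesis
      by (rule lspan_mult[OF sc tw]) (use dle[OF that] in \<open>auto simp: deg\<close>)
  qed
  have high: "sc (c s) * e (p s) \<in> ?H" if "s \<in> S' - T" for s
    using that dle[of s] by (intro lspan_smult[OF sc] lspan_base[OF sc]) (auto simp: T_def)
  have "(\<Sum>s\<in>S. sc (c s) * e (p s) * Q s) = (\<Sum>s\<in>S'. sc (c s) * e (p s) * Q s)"
    by (rule sum.mono_neutral_right) (auto simp: S'_def fin scalarsD[OF sc])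
  also have "\<dots> = (\<Sum>s\<in>S'. sc (c s) * e (p s) * (Q s - 1) + sc (c s) * e (p s))"
    by (rule sum.cong) (simp_all add: right_diff_distrib)
  also have "\<dots> = (\<Sum>s\<in>S'. sc (c s) * e (p s) * (Q s - 1)) + ((\<Sum>s\<in>S' - T. sc (c s) * e (p s)) + (\<Sum>s\<in>T. sc (c s) * e (p s)))"
    unfolding sum.distrib using fS' by (subst sum.subset_diff[of T S' "\<lambda>s. sc (c s) * e (p s)"]) (auto simp: T_def)
  finally have "(\<Sum>s\<in>T. sc (c s) * e (p s)) =
      - ((\<Sum>s\<in>S'. sc (c s) * e (p s) * (Q s - 1)) + (\<Sum>s\<in>S' - T. sc (c s) * e (p s)))"
    using zero by (simp add: eq_neg_iff_add_eq_0 algebra_simps)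
  moreover have "- ((\<Sum>s\<in>S'. sc (c s) * e (p s) * (Q s - 1)) + (\<Sum>s\<in>S' - T. sc (c s) * e (p s))) \<in> ?H"
    by (intro lspan_uminus[OF sc] lspan_add[OF sc] lspan_sum[OF sc] low high)
  ultimately have "(\<Sum>s\<in>T. sc (c s) * e (p s)) \<in> ?H" by simp
  then obtain U b where U: "finite U" "U \<subseteq> {\<gamma>. deg \<gamma> \<ge> d + 1}"
      "(\<Sum>s\<in>T. sc (c s) * e (p s)) = (\<Sum>\<gamma>\<in>U. sc (b \<gamma>) * e \<gamma>)"
    by (rule lspanE)
  have injT: "inj_on p T" using inj by (rule inj_on_subset) (auto simp: T_def S'_def)
  define c' where "c' \<gamma> = c (the_inv_into T p \<gamma>)" for \<gamma>
  have re: "(\<Sum>s\<in>T. sc (c s) * f (p s)) = (\<Sum>\<gamma>\<in>p ` T. sc (c' \<gamma>) * f \<gamma>)" for f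
    unfolding sum.reindex[OF injT] c'_def by (rule sum.cong) (simp_all add: the_inv_into_f_f[OF injT])
  have finT: "finite T" using fS' by (auto simp: T_def)
  have "(\<Sum>\<gamma>\<in>p ` T. sc (c' \<gamma>) * f \<gamma>) = (\<Sum>\<gamma>\<in>U. sc (b \<gamma>) * f \<gamma>)" for f
    by (rule torus_coeff_unique[OF sc ind finite_imageI[OF finT] U(1)]) (simp only: U(3) flip: re)
  \<comment> \<open>Putting the indicator function of \<open>p t\<close> in place of the monomials
    reads off the coefficient there. No exponent in \<open>U\<close> equals \<open>p t\<close>,
    since those have degree above \<open>d\<close>.\<close>
  from this[of "\<lambda>\<gamma>. if \<gamma> = p t then 1 else 0"]
  have "(\<Sum>s\<in>T. sc (c s) * (if p s = p t then 1 else 0)) = (\<Sum>\<gamma>\<in>U. sc (b \<gamma>) * (if \<gamma> = p t then 1 else 0))"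
    by (simp only: flip: re)
  also have "\<dots> = 0" using U(2) t by (intro sum.neutral) (auto simp: T_def)
  also have "(\<Sum>s\<in>T. sc (c s) * (if p s = p t then 1 else 0)) = (\<Sum>s\<in>{t}. sc (c s) * (if p s = p t then 1 else 0))"
    using t finT injT by (intro sum.mono_neutral_right) (auto dest: inj_onD)
  finally show False using t sc_nonzero[OF sc, of "c t"] by (simp add: T_def S'_def)
qed

text \<open>\<open>u'\<close> is the image of \<open>u\<close> under the conjugation by a power of \<open>f\<^sub>i\<^sub>1 + f\<^sub>i\<^sub>2\<close>, where \<open>x = g\<^sub>i\<close>, up to the
  central factor \<open>E (n\<mu>)\<close>.\<close>

definition gtwist :: "('f::field \<Rightarrow> 'a) \<Rightarrow> ('y::ab_group_add \<Rightarrow> 'a) \<Rightarrow> 'f \<Rightarrow> 'a \<Rightarrow> 'y \<Rightarrow> 'a \<Rightarrow> 'a \<Rightarrow> int \<Rightarrow> int \<Rightarrow> bool" where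
  "gtwist sc E q x \<mu> u u' k n \<longleftrightarrow> u \<noteq> 0 \<and> x * u = u * (sc (q powi (2 * k)) * x) \<and>
     u' = E (zsmul n \<mu>) * (u * Pz sc q (E \<mu>) k x)"

context
  fixes sc :: "'f::field \<Rightarrow> 'a" and E :: "'y::ab_group_add \<Rightarrow> 'a" and q :: 'f and x :: 'a and \<mu> :: 'y
  assumes sc: "scalars sc" and E: "lattice_units E" and q: "q \<noteq> 0" and r: "regular sc (E \<mu>) x"
begin

lemma gtwist_1: "gtwist sc E q x \<mu> 1 1 0 0"
  by (simp add: gtwist_def scalarsD[OF sc] lattice_unitsD[OF E])

text \<open>\<open>x\<close> passes \<open>u\<close> and \<open>v\<close> in turn,
  \<open>Pz_shift\<close> carries the factor of \<open>u\<close> across \<open>v\<close>, and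
  \<open>Pz_add\<close> merges the two factors. Both exponents are thus additive.\<close>

lemma gtwist_mult:
  assumes "gtwist sc E q x \<mu> u u' k n" "gtwist sc E q x \<mu> v v' l m"
  shows "gtwist sc E q x \<mu> (u * v) (u' * v') (k + l) (n + m)"
proof -
  let ?P = "Pz sc q (E \<mu>)"
  have u: "u \<noteq> 0" "x * u = u * (sc (q powi (2 * k)) * x)" "u' = E (zsmul n \<mu>) * (u * ?P k x)"
    using assms(1) by (simp_all add: gtwist_def)
  have v: "v \<noteq> 0" "x * v = v * (sc (q powi (2 * l)) * x)" "v' = E (zsmul m \<mu>) * (v * ?P l x)"
    using assms(2) by (simp_all add: gtwist_def)
  note cE = lattice_unitsD(3)[OF E]
  have "x * (u * v) = u * (sc (q powi (2 * k)) * (x * v))"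
    by (simp only: u(2) flip: mult.assoc)
  also have "\<dots> = u * v * (sc (q powi (2 * (k + l))) * x)"
    unfolding v(2) sc_left_comm[OF sc, of v] powi_double_add[OF q, symmetric] scalarsD(2)[OF sc]
      sc_left_comm[OF sc, of u] by (simp only: mult.assoc sc_left_comm[OF sc, of v] sc_left_comm[OF sc, of u])
  finally have 1: "x * (u * v) = u * v * (sc (q powi (2 * (k + l))) * x)" .
  have "u' * v' = E (zsmul n \<mu>) * (E (zsmul m \<mu>) * (u * (?P k x * v) * ?P l x))"
    unfolding u(3) v(3)
    by (simp only: mult.assoc central_left_comm[OF cE, of u] central_left_comm[OF cE, of "?P k x"])
  also have "?P k x * v = v * ?P k (sc (q powi (2 * l)) * x)"
    by (rule Pz_shift[OF sc r cE v(2,1)])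
  also have "u * (v * ?P k (sc (q powi (2 * l)) * x)) * ?P l x = u * v * ?P (k + l) x"
    unfolding Pz_add[OF sc r q cE] by (simp only: mult.assoc)
  finally have "u' * v' = E (zsmul (n + m) \<mu>) * (u * v * ?P (k + l) x)"
    by (simp only: zmod.scale_left_distrib lattice_unitsD(2)[OF E] mult.assoc)
  then show ?thesis using 1 u(1) v(1) by (simp add: gtwist_def)
qed

lemma gtwist_inverse:
  assumes "gtwist sc E q x \<mu> u u' k n"
  shows "gtwist sc E q x \<mu> (inverse u) (inverse u') (- k) (- n)"
proof -
  let ?P = "Pz sc q (E \<mu>)" and ?b = "q powi (2 * - k)"
  have u: "u \<noteq> 0" "x * u = u * (sc (q powi (2 * k)) * x)" "u' = E (zsmul n \<mu>) * (u * ?P k x)"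
    using assms(1) by (simp_all add: gtwist_def)
  note cE = lattice_unitsD(3)[OF E]
  have b: "q powi (2 * k) * ?b = 1" using powi_double_add[OF q, of k "- k"] by simp
  have "inverse u * x * u = sc (q powi (2 * k)) * x"
    using u(1) by (simp add: u(2) mult.assoc inverse_mult_cancel_left)
  then have "inverse u * x = sc (q powi (2 * k)) * x * inverse u"
    using u(1) by (metis mult.assoc mult_1_right right_inverse)
  then have "inverse u * (sc ?b * x) = sc ?b * (sc (q powi (2 * k)) * x * inverse u)"
    by (simp only: sc_left_comm[OF sc, of "inverse u"])
  also have "\<dots> = x * inverse u"
    using b by (simp add: scalarsD(3)[OF sc] mult.commute flip: mult.assoc scalarsD(2)[OF sc])
  finally have 1: "x * inverse u = inverse u * (sc ?b * x)" ..
  have "?P k (sc ?b * x) * ?P (- k) x = 1"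
    using Pz_add[OF sc r q cE, of k "- k"] by simp
  then have P: "inverse (?P k (sc ?b * x)) = ?P (- k) x" by (rule inverse_unique)
  have "inverse u' = inverse (?P k x) * inverse u * E (zsmul (- n) \<mu>)"
    by (simp add: u(3) inverse_mult_any lattice_unitsD(5)[OF E])
  also have "inverse (?P k x) * inverse u = inverse u * inverse (?P k (sc ?b * x))"
    by (rule inverse_mult_swap) (use Pz_nonzero[OF sc] r regular_scale[OF sc r] Pz_shift[OF sc r cE 1] u(1) in \<open>simp_all add: nonzero_imp_inverse_nonzero\<close>)
  finally have "inverse u' = E (zsmul (- n) \<mu>) * (inverse u * ?P (- k) x)"
    unfolding P by (simp only: central_comm[OF cE])
  then show ?thesis using 1 u(1) by (simp add: gtwist_def nonzero_imp_inverse_nonzero)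
qed

lemma gtwist_power:
  assumes "gtwist sc E q x \<mu> u u' k n"
  shows "gtwist sc E q x \<mu> (u ^ p) (u' ^ p) (int p * k) (int p * n)"
proof (induction p)
  case (Suc p)
  from gtwist_mult[OF assms Suc] show ?case by (simp add: algebra_simps)
qed (simp add: gtwist_1)

lemma gtwist_gmon:
  assumes "\<And>j. \<exists>k n. gtwist sc E q x \<mu> (g j) (g' j) k n"
  shows "\<exists>k n. gtwist sc E q x \<mu> (gmon g xs m) (gmon g' xs m) k n"
proof (induction xs)
  case (Cons j xs)
  then obtain k n where 1: "gtwist sc E q x \<mu> (gmon g xs m) (gmon g' xs m) k n" by blast
  obtain l p where 2: "gtwist sc E q x \<mu> (g j) (g' j) l p" using assms by blast
  show ?case using gtwist_mult[OF gtwist_power[OF 2, of "m j"] 1] unfolding gmon_Cons by blast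
qed (use gtwist_1 in auto)

text \<open>The factors attached to \<open>u * v\<close> and to \<open>v * u\<close> depend only on
  \<open>k + l\<close> and \<open>n + m\<close>, so they coincide and the q-commutation relation
  survives the twist.\<close>

lemma gtwist_comm:
  assumes u: "gtwist sc E q x \<mu> u u' k n" and v: "gtwist sc E q x \<mu> v v' l m"
    and uv: "u * v = sc b * (v * u)"
  shows "u' * v' = sc b * (v' * u')"
proof -
  have "u' * v' = E (zsmul (n + m) \<mu>) * (u * v * Pz sc q (E \<mu>) (k + l) x)"
    using gtwist_mult[OF u v] by (simp add: gtwist_def)
  also have "\<dots> = sc b * (E (zsmul (m + n) \<mu>) * (v * u * Pz sc q (E \<mu>) (l + k) x))"
    unfolding uv mult.assoc sc_left_comm[OF sc, of "E _"] Groups.add.commute[of n m] Groups.add.commute[of k l] ..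
  also have "\<dots> = sc b * (v' * u')"
    using gtwist_mult[OF v u] by (simp add: gtwist_def)
  finally show ?thesis .
qed

end

section \<open>Endomorphisms of the skew field of a quantum torus\<close>

definition torus_frame :: "('f::field \<Rightarrow> 'a) \<Rightarrow> ('y::ab_group_add \<Rightarrow> 'a) \<Rightarrow> ('i::finite \<Rightarrow> 'a) \<Rightarrow> ('i \<Rightarrow> 'f) \<Rightarrow>
    ('i \<Rightarrow> 'i \<Rightarrow> int) \<Rightarrow> bool" where
  "torus_frame sc E g q c \<longleftrightarrow> scalars sc \<and> lattice_units E \<and> qcomm sc (\<lambda>i j. q i powi (2 * c i j)) g \<and>
     indep sc (tmon E g) \<and> (\<forall>i. q i \<noteq> 0) \<and> fg_free TYPE('y)"

definition torus_field :: "('f::field \<Rightarrow> 'a) \<Rightarrow> ('y::ab_group_add \<Rightarrow> 'a) \<Rightarrow> ('i::finite \<Rightarrow> 'a) \<Rightarrow> 'a set" where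
  "torus_field sc E g = fracs (lspan sc (tmon E g) UNIV)"

context
  fixes sc :: "'f::field \<Rightarrow> 'a" and E :: "'y::ab_group_add \<Rightarrow> 'a" and g :: "'i::finite \<Rightarrow> 'a"
    and q :: "'i \<Rightarrow> 'f" and c :: "'i \<Rightarrow> 'i \<Rightarrow> int"
  assumes frame: "torus_frame sc E g q c"
begin

lemma frame_sc: "scalars sc" and frame_E: "lattice_units E"
  and frame_qcomm: "qcomm sc (\<lambda>i j. q i powi (2 * c i j)) g" and frame_indep: "indep sc (tmon E g)"
  and frame_q: "q i \<noteq> 0" and frame_fg: "fg_free TYPE('y)"
  using frame by (simp_all add: torus_frame_def)

lemma frame_comm: "g i * g j = sc (q i powi (2 * c i j)) * (g j * g i)"
  using frame_qcomm unfolding qcomm_def by blast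

lemma frame_ore: "right_ore (lspan sc (tmon E g) UNIV)"
  by (rule right_ore_tmon[OF frame_sc frame_E frame_qcomm frame_indep frame_fg])

lemma frame_tmon_in: "tmon E g \<gamma> \<in> torus_field sc E g"
proof -
  have "tmon E g \<gamma> \<in> lspan sc (tmon E g) UNIV" by (rule lspan_base[OF frame_sc]) simp
  then show ?thesis unfolding torus_field_def using fracs_closed(1)[OF frame_ore] by blast
qed

lemma frame_E_in: "E \<kappa> \<in> torus_field sc E g" and frame_g_in: "g i \<in> torus_field sc E g"
  using frame_tmon_in[of "(0, \<kappa>)"] frame_tmon_in[of "(sng i, 0)"]
  by (simp_all add: tmon_0 tmon_sng lattice_unitsD(1)[OF frame_E])

lemma frame_subfield: "subfield sc (torus_field sc E g)"
  unfolding torus_field_def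
proof (rule subfield_fracs[OF frame_sc frame_ore])
  fix a
  have "sc a * tmon E g 0 \<in> lspan sc (tmon E g) UNIV"
    by (rule lspan_smult[OF frame_sc lspan_base[OF frame_sc]]) simp
  then show "sc a \<in> lspan sc (tmon E g) UNIV"
    using tmon_0[of E g 0] by (simp add: lattice_unitsD(1)[OF frame_E] zero_prod_def)
qed

lemma frame_one_plus_nonzero: "1 + sc a * E \<kappa> * g i \<noteq> 0"
proof
  assume *: "1 + sc a * E \<kappa> * g i = 0"
  define b where "b \<gamma> = (if \<gamma> = (0, 0) then 1 else a)" for \<gamma> :: "('i \<Rightarrow> nat) \<times> 'y"
  have ne: "(0, 0) \<noteq> (sng i, \<kappa>)" by (auto simp: sng_def fun_eq_iff)
  have "(\<Sum>\<gamma>\<in>{(0, 0), (sng i, \<kappa>)}. sc (b \<gamma>) * tmon E g \<gamma>) = 0"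
    using * ne by (auto simp: b_def tmon_0 tmon_sng lattice_unitsD(1)[OF frame_E] scalarsD(3)[OF frame_sc] mult.assoc)
  then have "b (0, 0) = 0"
    using frame_indep[unfolded indep_def, rule_format, of "{(0, 0), (sng i, \<kappa>)}" b "(0, 0)"] by simp
  then show False by (simp add: b_def)
qed

lemma frame_g_nonzero: "g i \<noteq> 0"
proof
  assume *: "g i = 0"
  have "(\<Sum>\<gamma>\<in>{(sng i, 0)}. sc 1 * tmon E g \<gamma>) = 0"
    using * by (simp add: tmon_sng)
  then show False
    using frame_indep[unfolded indep_def, rule_format, of "{(sng i, 0)}" "\<lambda>_. 1" "(sng i, 0)"] by simp
qed

lemma frame_regular: "regular sc (E \<mu>) (g i)"
  unfolding regular_def
proof (intro allI conjI)
  fix a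
  show "1 + sc a * g i \<noteq> 0"
    using frame_one_plus_nonzero[of a 0 i] by (simp add: lattice_unitsD(1)[OF frame_E])
  show "1 + E \<mu> * (sc a * g i) \<noteq> 0"
    using frame_one_plus_nonzero[of a \<mu> i] by (simp add: sc_left_comm[OF frame_sc, of "E \<mu>"] mult.assoc)
qed

lemma frame_Pz_in: "Pz sc b (E \<mu>) k (g i) \<in> torus_field sc E g"
proof -
  note s = subfieldD[OF frame_subfield frame_sc]
  have Th: "Th (E \<mu>) (sc a * g i) \<in> torus_field sc E g" for a
    unfolding Th_def by (intro s frame_E_in frame_g_in)
  have Pn: "Pn sc b (E \<mu>) k (sc a * g i) \<in> torus_field sc E g" for k a
  proof (induction k)
    case (Suc k)
    have "sc (b ^ (2 * k)) * (sc a * g i) = sc (b ^ (2 * k) * a) * g i"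
      by (simp only: scalarsD(2)[OF frame_sc] mult.assoc)
    then show ?case unfolding Pn_Suc using s(2)[OF Suc Th] by simp
  qed (simp add: s)
  show ?thesis using Pn[of _ 1] Pn by (simp add: Pz_def s scalarsD(3)[OF frame_sc])
qed

lemma gtwist_g:
  "gtwist sc E (q i) (g i) \<mu> (g j) (E (zsmul n \<mu>) * (g j * Pz sc (q i) (E \<mu>) (c i j) (g i))) (c i j) n"
  unfolding gtwist_def by (simp only: frame_g_nonzero frame_comm[of i j] sc_left_comm[OF frame_sc, of "g j"]) simp

lemma frame_Pz_ratprods:
  "Pz sc (q i) (E \<mu>) k (g i) \<in> ratprods {sc a * E \<kappa> | a \<kappa>. True} (g i)"
proof -
  let ?Z = "{sc a * E \<kappa> | a \<kappa>. True}"
  have Z: "\<forall>z\<in>?Z. central z"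
    by (auto intro!: central_mult scalarsD(4)[OF frame_sc] lattice_unitsD(3)[OF frame_E])
  have Th: "Th (E \<mu>) (sc a * g i) \<in> ratprods ?Z (g i)" for a
  proof (rule ratprods_Th)
    have "sc a = sc a * E 0" by (simp add: lattice_unitsD(1)[OF frame_E])
    then show "sc a \<in> ?Z" by blast
    show "E \<mu> * sc a \<in> ?Z" using sc_comm[OF frame_sc, of "E \<mu>" a] by auto
  qed
  have Pn: "Pn sc b (E \<mu>) k (sc a * g i) \<in> ratprods ?Z (g i)" for k a b
  proof (induction k)
    case (Suc k)
    have "sc (b ^ (2 * k)) * (sc a * g i) = sc (b ^ (2 * k) * a) * g i"
      by (simp only: scalarsD(2)[OF frame_sc] mult.assoc)
    then show ?case unfolding Pn_Suc using ratprods_mult[OF Z Suc Th] by simp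
  qed (simp add: ratprods_1)
  show ?thesis
    using Pn[of _ _ 1] Pn ratprods_inverse[OF Z] by (simp add: Pz_def scalarsD(3)[OF frame_sc])
qed

lemma frame_linprod_leading:
  assumes "set zs \<subseteq> {sc a * E \<kappa> | a \<kappa>. True}"
  shows "linprod (g i) zs - 1 \<in> lspan sc (tmon E g) {\<gamma>. mdeg \<gamma> \<ge> 1}"
  using assms
proof (induction zs)
  case Nil
  then show ?case by (simp add: lspan_0)
next
  case (Cons z zs)
  let ?A = "\<lambda>n. lspan sc (tmon E g) {\<gamma>. mdeg \<gamma> \<ge> n}"
  obtain a \<kappa> where z: "z = sc a * E \<kappa>" using Cons.prems by auto
  have IH: "linprod (g i) zs - 1 \<in> ?A 1" using Cons by simp
  have "1 \<in> ?A 0"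
    using lspan_base[OF frame_sc, of 0 "{\<gamma>. mdeg \<gamma> \<ge> 0}" "tmon E g"] tmon_0[of E g 0]
    by (simp add: lattice_unitsD(1)[OF frame_E] zero_prod_def)
  moreover have "linprod (g i) zs - 1 \<in> ?A 0" using IH lspan_mono[of "{\<gamma>. mdeg \<gamma> \<ge> 1}" "{\<gamma>. mdeg \<gamma> \<ge> 0}"] by auto
  ultimately have L: "linprod (g i) zs \<in> ?A 0"
    using lspan_add[OF frame_sc, of 1 "tmon E g" "{\<gamma>. mdeg \<gamma> \<ge> 0}" "linprod (g i) zs - 1"]
    by (simp only: add_diff_cancel_left' add_diff_eq)
  have zg: "z * g i \<in> ?A 1"
    using lspan_smult[OF frame_sc lspan_base[OF frame_sc, of "(sng i, \<kappa>)" "{\<gamma>. mdeg \<gamma> \<ge> 1}" "tmon E g"], of a]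
    by (simp add: mdeg_sng tmon_sng z mult.assoc)
  have "z * g i * linprod (g i) zs \<in> ?A 1"
    by (rule lspan_mult[OF frame_sc twisted_tmon[OF frame_sc frame_E frame_qcomm] zg L]) (simp add: mdeg_add)
  from lspan_add[OF frame_sc IH this] show ?case
    by (simp add: distrib_right algebra_simps)
qed

text \<open>The images satisfy the old relations by \<open>gtwist_comm\<close>. Each monomial in
  them is an old monomial, shifted in the lattice, times a factored function of \<open>g i\<close>;
  after a common denominator is cleared these functions are 1 plus higher terms, and
  \<open>leading_term_independent\<close> gives the independence that \<open>qhom_exists\<close>
  asks for.\<close>

lemma gamma_exists:
  "\<exists>\<phi>. qhom sc (torus_field sc E g) \<phi> \<and> (\<forall>\<kappa>. \<phi> (E \<kappa>) = E \<kappa>) \<and>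
     (\<forall>j. \<phi> (g j) = E (zsmul (n j) \<mu>) * (g j * Pz sc (q i) (E \<mu>) (c i j) (g i)))"
proof -
  define g' where "g' j = E (zsmul (n j) \<mu>) * (g j * Pz sc (q i) (E \<mu>) (c i j) (g i))" for j
  note s = subfieldD[OF frame_subfield frame_sc]
  note cE = lattice_unitsD(3)[OF frame_E]
  have gt: "gtwist sc E (q i) (g i) \<mu> (g j) (g' j) (c i j) (n j)" for j
    unfolding g'_def by (rule gtwist_g)
  have qc: "qcomm sc (\<lambda>i j. q i powi (2 * c i j)) g'"
    unfolding qcomm_def by (intro allI gtwist_comm[OF frame_sc frame_E frame_q frame_regular gt gt frame_comm])
  have g'K: "g' j \<in> torus_field sc E g" for j
    unfolding g'_def by (intro s frame_E_in frame_g_in frame_Pz_in)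
  have "gmon g' xs m \<in> torus_field sc E g" for xs m
    by (induction xs) (simp_all add: gmon_Cons s g'K)
  then have e'K: "tmon E g' \<gamma> \<in> torus_field sc E g" for \<gamma>
    by (cases \<gamma>) (simp add: tmon_def s frame_E_in)
  have "\<exists>k p. gtwist sc E (q i) (g i) \<mu> (gmon g enum_list m) (gmon g' enum_list m) k p" for m
    by (rule gtwist_gmon[OF frame_sc frame_E frame_q frame_regular]) (rule exI, rule exI, rule gt)
  then have "\<forall>m. \<exists>kp. gtwist sc E (q i) (g i) \<mu> (gmon g enum_list m) (gmon g' enum_list m) (fst kp) (snd kp)"
    by simp
  from choice[OF this] obtain kp where
    kp: "\<And>m. gtwist sc E (q i) (g i) \<mu> (gmon g enum_list m) (gmon g' enum_list m) (fst (kp m)) (snd (kp m))"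
    by blast
  define k p where "k m = fst (kp m)" and "p m = snd (kp m)" for m
  \<comment> \<open>The shift moves the lattice part by an amount that depends on \<open>m\<close>
    alone and keeps \<open>m\<close>, hence it is injective.\<close>
  define \<pi> where "\<pi> = (\<lambda>(m, \<kappa>). (m :: 'i \<Rightarrow> nat, \<kappa> + zsmul (p m) \<mu>))"
  define R where "R m = Pz sc (q i) (E \<mu>) (k m) (g i)" for m
  have e': "tmon E g' \<gamma> = tmon E g (\<pi> \<gamma>) * R (fst \<gamma>)" for \<gamma>
  proof -
    obtain m \<kappa> where \<gamma>: "\<gamma> = (m, \<kappa>)" by (cases \<gamma>)
    have "gmon g' enum_list m = E (zsmul (p m) \<mu>) * (gmon g enum_list m * R m)"
      using kp[of m] unfolding gtwist_def R_def k_def p_def by blast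
    then show ?thesis by (simp add: \<gamma> tmon_def \<pi>_def lattice_unitsD(2)[OF frame_E] mult.assoc)
  qed
  have inj: "inj \<pi>" by (auto simp: inj_def \<pi>_def)
  have ind: "indep sc (tmon E g')"
    unfolding indep_def
  proof (intro allI impI ballI)
    fix S b \<gamma> assume S: "finite S" "(\<Sum>\<gamma>\<in>S. sc (b \<gamma>) * tmon E g' \<gamma>) = 0" "\<gamma> \<in> S"
    let ?Z = "{sc a * E \<kappa> | a \<kappa>. True}"
    have Z: "\<forall>z\<in>?Z. central z \<and> 1 + z * g i \<noteq> 0"
      using frame_one_plus_nonzero by (auto intro!: central_mult scalarsD(4)[OF frame_sc] cE)
    have "\<forall>m\<in>fst ` S. R m \<in> ratprods ?Z (g i)" unfolding R_def by (intro ballI frame_Pz_ratprods)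
    from ratprods_common_denominator[OF Z finite_imageI[OF S(1)] this]
    obtain ds where ds: "\<forall>m\<in>fst ` S. \<exists>zs. set zs \<subseteq> ?Z \<and> R m * linprod (g i) ds = linprod (g i) zs"
      by blast
    show "b \<gamma> = 0"
    proof (rule leading_term_independent[OF frame_sc frame_indep twisted_tmon[OF frame_sc frame_E frame_qcomm] mdeg_add S(1)])
      show "inj_on \<pi> S" using inj by (rule inj_on_subset) simp
      show "R (fst s) * linprod (g i) ds - 1 \<in> lspan sc (tmon E g) {\<gamma>. mdeg \<gamma> \<ge> 1}" if "s \<in> S" for s
      proof -
        have "fst s \<in> fst ` S" using that by simp
        from bspec[OF ds this] obtain zs where zs: "set zs \<subseteq> ?Z \<and> R (fst s) * linprod (g i) ds = linprod (g i) zs" ..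
        then show ?thesis using frame_linprod_leading[OF conjunct1[OF zs], of i] by simp
      qed
      have "(\<Sum>s\<in>S. sc (b s) * tmon E g (\<pi> s) * (R (fst s) * linprod (g i) ds)) =
        (\<Sum>s\<in>S. sc (b s) * tmon E g' s) * linprod (g i) ds"
        unfolding sum_distrib_right e' by (simp only: mult.assoc)
      then show "(\<Sum>s\<in>S. sc (b s) * tmon E g (\<pi> s) * (R (fst s) * linprod (g i) ds)) = 0"
        using S(2) by simp
    qed (rule S(3))
  qed
  from qhom_exists[OF frame_sc frame_indep ind twisted_tmon[OF frame_sc frame_E frame_qcomm]
      twisted_tmon[OF frame_sc frame_E qc] torus_field_def frame_ore e'K]
  obtain \<phi> where \<phi>: "qhom sc (torus_field sc E g) \<phi>" "\<And>\<gamma>. \<phi> (tmon E g \<gamma>) = tmon E g' \<gamma>"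
    by blast
  have "\<phi> (E \<kappa>) = E \<kappa>" for \<kappa> using \<phi>(2)[of "(0, \<kappa>)"] by (simp add: tmon_0)
  moreover have "\<phi> (g j) = g' j" for j
    using \<phi>(2)[of "(sng j, 0)"] by (simp add: tmon_sng lattice_unitsD(1)[OF frame_E])
  ultimately show ?thesis using \<phi>(1) unfolding g'_def by blast
qed

text \<open>The new monomials are old ones, reindexed by the injective map \<open>\<pi>\<close>; so
  their independence is inherited.\<close>

lemma lattice_hom_exists:
  assumes s: "\<And>\<kappa> \<mu>. s (\<kappa> + \<mu>) = s \<kappa> + s \<mu>" "inj s"
  shows "\<exists>\<phi>. qhom sc (torus_field sc E g) \<phi> \<and> (\<forall>\<kappa>. \<phi> (E \<kappa>) = E (s \<kappa>)) \<and> (\<forall>j. \<phi> (g j) = g j)"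
proof -
  define E' where "E' \<kappa> = E (s \<kappa>)" for \<kappa>
  have s0: "s 0 = 0" using s(1)[of 0 0] by simp
  have E': "lattice_units E'"
    unfolding lattice_units_def E'_def by (simp add: s s0 lattice_unitsD(1-3)[OF frame_E])
  define \<pi> where "\<pi> = (\<lambda>(m :: 'i \<Rightarrow> nat, \<kappa>). (m, s \<kappa>))"
  have e': "tmon E' g \<gamma> = tmon E g (\<pi> \<gamma>)" for \<gamma>
    by (simp add: tmon_def E'_def \<pi>_def split: prod.split)
  have inj: "inj \<pi>" using s(2) by (auto simp: inj_def \<pi>_def)
  have ind: "indep sc (tmon E' g)"
    unfolding indep_def
  proof (intro allI impI ballI)
    fix S b \<gamma> assume S: "finite S" "(\<Sum>\<gamma>\<in>S. sc (b \<gamma>) * tmon E' g \<gamma>) = 0" "\<gamma> \<in> S"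
    have "(\<Sum>\<delta>\<in>\<pi> ` S. sc (b (the_inv \<pi> \<delta>)) * tmon E g \<delta>) = 0"
      using S(2) by (simp add: sum.reindex[OF inj_on_subset[OF inj]] e' the_inv_f_f[OF inj])
    then have "b (the_inv \<pi> (\<pi> \<gamma>)) = 0"
      using frame_indep[unfolded indep_def, rule_format, of "\<pi> ` S" "\<lambda>\<delta>. b (the_inv \<pi> \<delta>)" "\<pi> \<gamma>"] S by blast
    then show "b \<gamma> = 0" by (simp add: the_inv_f_f[OF inj])
  qed
  obtain \<phi> where \<phi>: "qhom sc (torus_field sc E g) \<phi>" "\<And>\<gamma>. \<phi> (tmon E g \<gamma>) = tmon E' g \<gamma>"
    using qhom_exists[OF frame_sc frame_indep ind twisted_tmon[OF frame_sc frame_E frame_qcomm]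
      twisted_tmon[OF frame_sc E' frame_qcomm] torus_field_def frame_ore frame_tmon_in[of "\<pi> _", folded e']] by blast
  have "\<phi> (E \<kappa>) = E (s \<kappa>)" for \<kappa> using \<phi>(2)[of "(0, \<kappa>)"] by (simp add: tmon_0 E'_def)
  moreover have "\<phi> (g j) = g j" for j
    using \<phi>(2)[of "(sng j, 0)"] by (simp add: tmon_sng E'_def s0 lattice_unitsD(1)[OF frame_E])
  ultimately show ?thesis using \<phi>(1) by blast
qed

lemma torus_hom_unique:
  assumes \<phi>: "qhom sc (torus_field sc E g) \<phi>" "qhom sc (torus_field sc E g) \<psi>"
    and eq: "\<And>\<kappa>. \<phi> (E \<kappa>) = \<psi> (E \<kappa>)" "\<And>j. \<phi> (g j) = \<psi> (g j)" and x: "x \<in> torus_field sc E g"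
  shows "\<phi> x = \<psi> x"
proof -
  note s = subfieldD[OF frame_subfield frame_sc]
  note h = qhomD[OF \<phi>(1) frame_subfield frame_sc] qhomD[OF \<phi>(2) frame_subfield frame_sc]
  have 1: "gmon g xs m \<in> torus_field sc E g \<and> \<phi> (gmon g xs m) = \<psi> (gmon g xs m)" for xs m
    by (induction xs) (simp_all add: gmon_Cons s h frame_g_in eq)
  have "\<phi> (tmon E g \<gamma>) = \<psi> (tmon E g \<gamma>)" for \<gamma>
    using 1 by (cases \<gamma>) (simp add: tmon_def h eq frame_E_in)
  then show ?thesis
    by (rule qhom_unique[OF frame_sc torus_field_def frame_subfield \<phi> frame_tmon_in _ x])
qed

end

end

section \<open>Braid relations\<close>

text \<open>The state \<open>(u, v)\<close> stands for \<open>x - u h - v k\<close>.\<close>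

lemma reflection_braid:
  fixes h k :: "'v::ab_group_add"
  assumes f: "additive f" "f h = 2" and g: "additive g" "g k = 2"
  defines "r \<equiv> \<lambda>x. x - zsmul (f x) h" and "t \<equiv> \<lambda>x. x - zsmul (g x) k"
  shows "f k = 0 \<Longrightarrow> g h = 0 \<Longrightarrow> r (t x) = t (r x)"
    and "f k = - 1 \<Longrightarrow> g h = - 1 \<Longrightarrow> r (t (r x)) = t (r (t x))"
    and "f k * g h = 2 \<Longrightarrow> f k = - 1 \<or> g h = - 1 \<Longrightarrow> r (t (r (t x))) = t (r (t (r x)))"
    and "f k * g h = 3 \<Longrightarrow> f k = - 1 \<or> g h = - 1 \<Longrightarrow> r (t (r (t (r (t x))))) = t (r (t (r (t (r x)))))"
    and "r (r x) = x"
proof -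
  have fz: "f (zsmul n y) = n * f y" if "additive f" for f n and y :: 'v
  proof -
    interpret additive f by fact
    have "f (\<Sum>k<m. y) = int m * f y" for m :: nat by (induction m) (simp_all add: add zero algebra_simps)
    then show ?thesis by (cases "n \<ge> 0") (simp_all add: zsmul_def diff minus)
  qed
  define st where "st u v = x - zsmul u h - zsmul v k" for u v
  have "f (st u v) = f x - 2 * u - f k * v" "g (st u v) = g x - g h * u - 2 * v" for u v
    by (simp_all add: st_def additive.diff[OF f(1)] additive.diff[OF g(1)] fz f g)
  then have rs: "r (st u v) = st (f x - u - f k * v) v" and ts: "t (st u v) = st u (g x - v - g h * u)" for u v
    by (simp_all add: r_def t_def) (simp_all add: st_def algebra_simps flip: zmod.scale_left_distrib)
  have x: "x = st 0 0" by (simp add: st_def)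
  note cong = arg_cong2[where f = st]
  show "r (r x) = x" using rs[of 0 0] rs[of "f x" 0] x by simp
  show "f k = 0 \<Longrightarrow> g h = 0 \<Longrightarrow> r (t x) = t (r x)"
    by (subst (1 2) x) (simp add: rs ts)
  show "f k = - 1 \<Longrightarrow> g h = - 1 \<Longrightarrow> r (t (r x)) = t (r (t x))"
    by (subst (1 2) x) (simp add: rs ts)
  show "r (t (r (t x))) = t (r (t (r x)))" if "f k * g h = 2" "f k = - 1 \<or> g h = - 1"
  proof -
    have "f k = - 1 \<and> g h = - 2 \<or> f k = - 2 \<and> g h = - 1" using that by auto
    then show ?thesis by (subst (1 2) x) (auto simp: rs ts intro!: cong)
  qed
  show "r (t (r (t (r (t x))))) = t (r (t (r (t (r x)))))" if "f k * g h = 3" "f k = - 1 \<or> g h = - 1"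
  proof -
    have "f k = - 1 \<and> g h = - 3 \<or> f k = - 3 \<and> g h = - 1" using that by auto
    then show ?thesis by (subst (1 2) x) (auto simp: rs ts intro!: cong)
  qed
qed

context division_ring begin

definition tprod :: "(nat \<Rightarrow> 'a) \<Rightarrow> (nat \<Rightarrow> 'a) \<Rightarrow> nat \<Rightarrow> 'a" where
  "tprod Y h n = foldr (\<lambda>v y. Th (Y v) (h v) * y) [0..<n] 1"

lemma tprod_0 [simp]: "tprod Y h 0 = 1"
  by (simp add: tprod_def)

lemma tprod_Suc: "tprod Y h (Suc n) = tprod Y h n * Th (Y n) (h n)"
  using foldr_mult_right[of "\<lambda>v. Th (Y v) (h v)" "[0..<n]" "Th (Y n) (h n)"] by (simp add: tprod_def)

lemma tprod_cong: "(\<And>v. v < n \<Longrightarrow> Y v = Y' v) \<Longrightarrow> (\<And>v. v < n \<Longrightarrow> h v = h' v) \<Longrightarrow> tprod Y h n = tprod Y' h' n"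
  by (induction n) (simp_all add: tprod_Suc)

text \<open>A mutation at one leaf does not touch the variables and parameters of the others, so all
  leaves can be treated at once. As the marked leaves are the first \<open>r\<close>, the extra
  variable stops collecting factors after them.\<close>

lemma leaves_mut_eq:
  assumes "\<And>v. v < n \<Longrightarrow> Y v = y"
  shows "leaves_mut {..<r} n (C, h, Yc, Y, z) =
    (C * tprod Y h n, \<lambda>v. if v < n then Y v * h v else h v, Yc * y ^ n,
     \<lambda>v. if v < n then inverse (Y v) else Y v, z * tprod Y h (min r n))"
  using assms
proof (induction n)
  case 0
  then show ?case by (simp add: leaves_mut_def)
next
  case (Suc n)
  have "leaves_mut {..<r} (Suc n) (C, h, Yc, Y, z) = leaf_mut {..<r} n (leaves_mut {..<r} n (C, h, Yc, Y, z))"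
    by (simp add: leaves_mut_def)
  also have "\<dots> = (C * tprod Y h (Suc n), \<lambda>v. if v < Suc n then Y v * h v else h v, Yc * y ^ n * Y n,
     \<lambda>v. if v < Suc n then inverse (Y v) else Y v, z * tprod Y h (min r (Suc n)))"
    using Suc by (auto simp: leaf_mut_def tprod_Suc mult.assoc fun_eq_iff min_def not_less less_Suc_eq
        dest: le_antisym)
  also have "Yc * y ^ n * Y n = Yc * y ^ Suc n"
    using Suc.prems[of n] by (simp add: mult.assoc flip: power_Suc2)
  finally show ?case .
qed

text \<open>The homomorphism \<open>\<phi>\<close> maps the initial seed \<open>(G, H, E yj, E yi, z)\<close> to \<open>\<sigma>\<close>, except that \<open>\<phi> z\<close> has an additional
  factor in the lattice. The map \<open>W\<close> records this factor and the action on the lattice.\<close>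

definition tracks :: "('y::ab_group_add \<Rightarrow> 'a) \<Rightarrow> 'a \<Rightarrow> (nat \<Rightarrow> 'a) \<Rightarrow> nat \<Rightarrow> 'y \<Rightarrow> 'y \<Rightarrow> 'a \<Rightarrow> ('a \<Rightarrow> 'a) \<Rightarrow>
    ('y \<times> int \<Rightarrow> 'y \<times> int) \<Rightarrow> 'a seed_data \<Rightarrow> bool" where
  "tracks E G H N yi yj z \<phi> W \<sigma> \<longleftrightarrow> (case \<sigma> of (C, h, Yc, Y, \<zeta>) \<Rightarrow>
     C = \<phi> G \<and> (\<forall>v<N. h v = \<phi> (H v)) \<and> Yc = \<phi> (E yj) \<and> (\<forall>v<N. Y v = \<phi> (E yi)) \<and>
     \<phi> z = E (fst (W (0, 1))) * \<zeta>) \<and>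
     (\<forall>\<kappa>. \<phi> (E \<kappa>) = E (fst (W (\<kappa>, 0)))) \<and> (\<forall>a b. W (a + b) = W a + W b)"

lemma tracks_agree:
  assumes "tracks E G H N yi yj z \<phi> W \<sigma>" "tracks E G H N yi yj z \<psi> W \<sigma>"
  shows "\<phi> G = \<psi> G" "v < N \<Longrightarrow> \<phi> (H v) = \<psi> (H v)" "\<phi> z = \<psi> z" "\<phi> (E \<kappa>) = \<psi> (E \<kappa>)"
  using assms by (auto simp: tracks_def split: prod.splits)

section \<open>Words in two generators as sequences of mutations\<close>

context
  fixes sc :: "'f::field \<Rightarrow> 'a" and K :: "'a set" and E :: "'y::ab_group_add \<Rightarrow> 'a"
    and Si Sj :: "'a \<Rightarrow> 'a" and Ti Tj :: "'y \<times> int \<Rightarrow> 'y \<times> int" and ti tj yi yj :: 'y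
    and G :: 'a and H :: "nat \<Rightarrow> 'a" and N r :: nat and b :: 'f and z :: 'a
  assumes sc: "scalars sc" and K: "subfield sc K" and E: "lattice_units E"
    and mem: "\<And>\<kappa>. E \<kappa> \<in> K" "G \<in> K" "\<And>v. H v \<in> K" "z \<in> K"
    and b: "b \<noteq> 0" "b \<noteq> 1" and nz: "G \<noteq> 0" "\<And>v. H v \<noteq> 0"
    and comm: "\<And>v. H v * G = sc b * (G * H v)" "\<And>u v. H u * H v = H v * H u"
    and hom: "qhom sc K Si" "qhom sc K Sj"
    and T: "\<And>x y. Ti (x + y) = Ti x + Ti y" "\<And>x y. Tj (x + y) = Tj x + Tj y"
      "\<And>\<kappa>. snd (Ti (\<kappa>, 0)) = 0" "\<And>\<kappa>. snd (Tj (\<kappa>, 0)) = 0" "Ti (0, 1) = (ti, 1)" "Tj (0, 1) = (tj, 1)"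
    and SE: "\<And>\<kappa>. Si (E \<kappa>) = E (fst (Ti (\<kappa>, 0)))" "\<And>\<kappa>. Sj (E \<kappa>) = E (fst (Tj (\<kappa>, 0)))"
    and SiY: "Si (E yi) = inverse (E yi)" "Si (E yj) = E yj * E yi ^ N"
    and SjY: "Sj (E yj) = inverse (E yj)" "Sj (E yi) = E yj * E yi"
    and SG: "Si G = G * tprod (\<lambda>_. E yi) H N" "Sj G = E yj * G"
    and SH: "\<And>v. v < N \<Longrightarrow> Si (H v) = E yi * H v"
      "\<And>v. v < N \<Longrightarrow> Sj (H v) = inverse (E yj) * inverse (Th (E yj) G) * H v"
    and Sz: "Si z = E ti * z * tprod (\<lambda>_. E yi) H r" "Sj z = E tj * z" and r: "r \<le> N"
begin

private lemma h: "qhom sc K \<phi> \<Longrightarrow> x \<in> K \<Longrightarrow> y \<in> K \<Longrightarrow> \<phi> (x * y) = \<phi> x * \<phi> y"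
  "qhom sc K \<phi> \<Longrightarrow> x \<in> K \<Longrightarrow> \<phi> (inverse x) = inverse (\<phi> x)"
  "qhom sc K \<phi> \<Longrightarrow> x \<in> K \<Longrightarrow> \<phi> (x ^ n) = \<phi> x ^ n"
  "qhom sc K \<phi> \<Longrightarrow> \<phi> 1 = 1"
  "qhom sc K \<phi> \<Longrightarrow> x \<in> K \<Longrightarrow> y \<in> K \<Longrightarrow> \<phi> (x + y) = \<phi> x + \<phi> y"
  using qhomD[OF _ K sc, of \<phi>] by auto

private lemma Th_hom:
  assumes "qhom sc K \<phi>" "x \<in> K" "y \<in> K"
  shows "\<phi> (Th y x) = Th (\<phi> y) (\<phi> x)" "Th y x \<in> K"
  using assms subfieldD[OF K sc] by (simp_all add: Th_def h)

private lemma tprod_hom: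
  assumes "qhom sc K \<phi>"
  shows "tprod (\<lambda>_. E yi) H n \<in> K \<and> \<phi> (tprod (\<lambda>_. E yi) H n) = tprod (\<lambda>_. \<phi> (E yi)) (\<lambda>v. \<phi> (H v)) n"
  by (induction n) (simp_all add: tprod_Suc h[OF assms] Th_hom[OF assms] mem subfieldD[OF K sc])

text \<open>\<open>\<phi> \<circ> Si\<close> applies \<open>Si\<close> to the initial variables and
  then substitutes the current seed through \<open>\<phi>\<close>. As the formulae for
  \<open>Si\<close> are those of the leaf mutations, the result is the mutated current seed; a word
  read from left to right becomes a sequence of mutations.\<close>

lemma tracks_leaves:
  assumes \<phi>: "qhom sc K \<phi>" and tr: "tracks E G H N yi yj z \<phi> W \<sigma>"
  shows "tracks E G H N yi yj z (\<phi> \<circ> Si) (W \<circ> Ti) (leaves_mut {..<r} N \<sigma>)"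
proof -
  obtain C h' Yc Y \<zeta> where \<sigma>: "\<sigma> = (C, h', Yc, Y, \<zeta>)" by (cases \<sigma>) auto
  note t = tr[unfolded tracks_def \<sigma> prod.case]
  note s = subfieldD[OF K sc]
  have tp: "tprod Y h' n = tprod (\<lambda>_. \<phi> (E yi)) (\<lambda>v. \<phi> (H v)) n" if "n \<le> N" for n
    using t that by (intro tprod_cong) auto
  have tpK: "tprod (\<lambda>_. E yi) H n \<in> K" for n using tprod_hom[OF \<phi>] by blast
  have L: "leaves_mut {..<r} N \<sigma> = (C * tprod Y h' N, \<lambda>v. if v < N then Y v * h' v else h' v, Yc * \<phi> (E yi) ^ N,
     \<lambda>v. if v < N then inverse (Y v) else Y v, \<zeta> * tprod Y h' r)"
    unfolding \<sigma> using leaves_mut_eq[of N Y "\<phi> (E yi)" r C h' Yc \<zeta>] t r by (simp add: min_def)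
  have W: "W (a + b) = W a + W b" for a b using t by blast
  \<comment> \<open>The pair \<open>(0, 1)\<close> stands for the extra variable itself. Additivity
    of \<open>W\<close> separates the lattice factor gained in this step from the one recorded
    before.\<close>
  have "Ti (0, 1) = (ti, 0) + (0, 1)" by (simp add: T)
  then have "W (Ti (0, 1)) = W (ti, 0) + W (0, 1)" by (simp only: W)
  then have W1: "fst (W (Ti (0, 1))) = fst (W (ti, 0)) + fst (W (0, 1))" by simp
  have Ti0: "Ti (\<kappa>, 0) = (fst (Ti (\<kappa>, 0)), 0)" for \<kappa> by (simp add: prod_eq_iff T)
  have "\<phi> (Si z) = E (fst (W (ti, 0))) * (E (fst (W (0, 1))) * \<zeta>) * tprod Y h' r"
    unfolding Sz using t tprod_hom[OF \<phi>] by (simp add: h[OF \<phi>] s mem tpK tp[OF r])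
  then have z': "\<phi> (Si z) = E (fst (W (Ti (0, 1)))) * (\<zeta> * tprod Y h' r)"
    by (simp add: W1 lattice_unitsD(2)[OF E] mult.assoc)
  have G': "\<phi> (Si G) = C * tprod Y h' N"
    unfolding SG using t tprod_hom[OF \<phi>] by (simp add: h[OF \<phi>] mem tpK tp)
  have "\<phi> (Si (E \<kappa>)) = E (fst (W (Ti (\<kappa>, 0))))" for \<kappa>
    using t Ti0[of \<kappa>] by (metis SE(1))
  then show ?thesis
    unfolding L tracks_def prod.case
    using t G' z' by (simp add: SH SiY h[OF \<phi>] mem s T W)
qed

lemma tracks_centre:
  assumes \<phi>: "qhom sc K \<phi>" and tr: "tracks E G H N yi yj z \<phi> W \<sigma>"
  shows "tracks E G H N yi yj z (\<phi> \<circ> Sj) (W \<circ> Tj) (centre_mut \<sigma>)"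
proof -
  obtain C h' Yc Y \<zeta> where \<sigma>: "\<sigma> = (C, h', Yc, Y, \<zeta>)" by (cases \<sigma>) auto
  note t = tr[unfolded tracks_def \<sigma> prod.case]
  note s = subfieldD[OF K sc]
  have W: "W (a + b) = W a + W b" for a b using t by blast
  have "Tj (0, 1) = (tj, 0) + (0, 1)" by (simp add: T)
  then have "W (Tj (0, 1)) = W (tj, 0) + W (0, 1)" by (simp only: W)
  then have W1: "fst (W (Tj (0, 1))) = fst (W (tj, 0)) + fst (W (0, 1))" by simp
  have Tj0: "Tj (\<kappa>, 0) = (fst (Tj (\<kappa>, 0)), 0)" for \<kappa> by (simp add: prod_eq_iff T)
  have z': "\<phi> (Sj z) = E (fst (W (Tj (0, 1)))) * \<zeta>"
    unfolding Sz using t by (simp add: h[OF \<phi>] mem W1 lattice_unitsD(2)[OF E] mult.assoc)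
  have "\<phi> (Sj (E \<kappa>)) = E (fst (W (Tj (\<kappa>, 0))))" for \<kappa>
    using t Tj0[of \<kappa>] by (metis SE(2))
  moreover have "\<phi> (Sj (H v)) = inverse Yc * inverse (Th Yc C) * h' v" if "v < N" for v
    using t that by (simp add: SH h[OF \<phi>] Th_hom[OF \<phi>] mem s)
  ultimately show ?thesis
    unfolding \<sigma> tracks_def centre_mut_def prod.case
    using t z' by (simp add: SG SjY h[OF \<phi>] mem s T W)
qed

lemma tracks_id: "tracks E G H N yi yj z id id (G, H, E yj, \<lambda>_. E yi, z)"
  by (simp add: tracks_def lattice_unitsD[OF E])

lemma seed_id: "seed (sc b) (G, H, E yj, \<lambda>_. E yi, z)"
proof -
  have "sc b \<noteq> 1" using sc_inj[OF sc, of b 1] b by (auto simp: scalarsD(3)[OF sc])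
  then show ?thesis
    unfolding seed_def prod.case
    using nz comm by (simp add: scalarsD(4)[OF sc] sc_nonzero[OF sc b(1)] lattice_unitsD[OF E])
qed

text \<open>The seeds reached by the two words agree by \<open>leaves_centre_braid\<close>, the
  lattice maps agree by hypothesis; so one pair of \<open>W\<close> and \<open>\<sigma>\<close>
  describes both composites.\<close>

lemma seed_words_agree:
  shows "N = 1 \<Longrightarrow> Ti \<circ> Tj \<circ> Ti = Tj \<circ> Ti \<circ> Tj \<Longrightarrow>
      \<exists>W \<sigma>. tracks E G H N yi yj z (Si \<circ> Sj \<circ> Si) W \<sigma> \<and> tracks E G H N yi yj z (Sj \<circ> Si \<circ> Sj) W \<sigma>"
    and "N = 2 \<Longrightarrow> Ti \<circ> Tj \<circ> Ti \<circ> Tj = Tj \<circ> Ti \<circ> Tj \<circ> Ti \<Longrightarrow>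
      \<exists>W \<sigma>. tracks E G H N yi yj z (Si \<circ> Sj \<circ> Si \<circ> Sj) W \<sigma> \<and>
        tracks E G H N yi yj z (Sj \<circ> Si \<circ> Sj \<circ> Si) W \<sigma>"
    and "N = 3 \<Longrightarrow> Ti \<circ> Tj \<circ> Ti \<circ> Tj \<circ> Ti \<circ> Tj = Tj \<circ> Ti \<circ> Tj \<circ> Ti \<circ> Tj \<circ> Ti \<Longrightarrow>
      \<exists>W \<sigma>. tracks E G H N yi yj z (Si \<circ> Sj \<circ> Si \<circ> Sj \<circ> Si \<circ> Sj) W \<sigma> \<and>
        tracks E G H N yi yj z (Sj \<circ> Si \<circ> Sj \<circ> Si \<circ> Sj \<circ> Si) W \<sigma>"
proof -
  define \<sigma>0 where "\<sigma>0 = (G, H, E yj, \<lambda>_::nat. E yi, z)"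
  let ?t = "\<lambda>\<phi> W \<sigma>. qhom sc K \<phi> \<and> tracks E G H N yi yj z \<phi> W \<sigma>"
  have i: "?t \<phi> W \<sigma> \<Longrightarrow> ?t (\<phi> \<circ> Si) (W \<circ> Ti) (leaves_mut {..<r} N \<sigma>)" for \<phi> W \<sigma>
    using tracks_leaves qhom_comp[OF _ hom(1)] by blast
  have j: "?t \<phi> W \<sigma> \<Longrightarrow> ?t (\<phi> \<circ> Sj) (W \<circ> Tj) (centre_mut \<sigma>)" for \<phi> W \<sigma>
    using tracks_centre qhom_comp[OF _ hom(2)] by blast
  have 0: "?t id id \<sigma>0" unfolding \<sigma>0_def using tracks_id by (simp add: qhom_def subfieldD[OF K sc])
  note i0 = i[OF 0, unfolded id_comp] and j0 = j[OF 0, unfolded id_comp]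
  note br = leaves_centre_braid[OF seed_id, folded \<sigma>0_def, of "{..<r}"]
  show "\<exists>W \<sigma>. tracks E G H N yi yj z (Si \<circ> Sj \<circ> Si) W \<sigma> \<and> tracks E G H N yi yj z (Sj \<circ> Si \<circ> Sj) W \<sigma>"
    if "N = 1" "Ti \<circ> Tj \<circ> Ti = Tj \<circ> Ti \<circ> Tj"
    using i[OF j[OF i0]] j[OF i[OF j0]] br(1) that by metis
  show "\<exists>W \<sigma>. tracks E G H N yi yj z (Si \<circ> Sj \<circ> Si \<circ> Sj) W \<sigma> \<and>
        tracks E G H N yi yj z (Sj \<circ> Si \<circ> Sj \<circ> Si) W \<sigma>"
    if "N = 2" "Ti \<circ> Tj \<circ> Ti \<circ> Tj = Tj \<circ> Ti \<circ> Tj \<circ> Ti"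
    using j[OF i[OF j[OF i0]]] i[OF j[OF i[OF j0]]] br(2) that by metis
  show "\<exists>W \<sigma>. tracks E G H N yi yj z (Si \<circ> Sj \<circ> Si \<circ> Sj \<circ> Si \<circ> Sj) W \<sigma> \<and>
        tracks E G H N yi yj z (Sj \<circ> Si \<circ> Sj \<circ> Si \<circ> Sj \<circ> Si) W \<sigma>"
    if "N = 3" "Ti \<circ> Tj \<circ> Ti \<circ> Tj \<circ> Ti \<circ> Tj = Tj \<circ> Ti \<circ> Tj \<circ> Ti \<circ> Tj \<circ> Ti"
    using j[OF i[OF j[OF i[OF j[OF i0]]]]] i[OF j[OF i[OF j[OF i[OF j0]]]]] br(3) that by metis
qed

end

end

lemma zsmul_Pair: "zsmul n (x, y) = (zsmul n x, zsmul n y)"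
proof -
  have "(\<Sum>k<m. (x, y)) = (\<Sum>k<m. x, \<Sum>k<m. y)" for m :: nat
    by (induction m) (simp_all add: zero_prod_def)
  then show ?thesis by (simp add: zsmul_def)
qed

context division_ring begin

definition ipow :: "'a \<Rightarrow> int \<Rightarrow> 'a" where
  "ipow x n = (if n \<ge> 0 then x ^ nat n else inverse (x ^ nat (- n)))"

lemma ipow_nonzero: "x \<noteq> 0 \<Longrightarrow> ipow x n \<noteq> 0"
  by (simp add: ipow_def nonzero_imp_inverse_nonzero)

lemma qhom_ipow:
  assumes "qhom sc K \<phi>" "subfield sc K" "scalars sc" "x \<in> K"
  shows "\<phi> (ipow x n) = ipow (\<phi> x) n" "ipow x n \<in> K"
  using qhomD[OF assms(1-3)] subfieldD[OF assms(2,3)] assms(4) by (simp_all add: ipow_def)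

lemma gtwist_ipow:
  assumes "scalars sc" "lattice_units E" "q \<noteq> 0" "regular sc (E \<mu>) x" "gtwist sc E q x \<mu> u u' k n"
  shows "gtwist sc E q x \<mu> (ipow u p) (ipow u' p) (p * k) (p * n)"
proof (cases "p \<ge> 0")
  case True
  then show ?thesis using gtwist_power[OF assms, of "nat p"] by (simp add: ipow_def)
next
  case False
  then show ?thesis using gtwist_inverse[OF assms(1-4) gtwist_power[OF assms, of "nat (- p)"]] by (simp add: ipow_def)
qed

lemma qhom_Pn:
  assumes "qhom sc K \<phi>" "subfield sc K" "scalars sc" "x \<in> K" "Y \<in> K"
  shows "\<phi> (Pn sc q Y k x) = Pn sc q (\<phi> Y) k (\<phi> x)" (is ?R1) "Pn sc q Y k x \<in> K"
proof -
  note h = qhomD[OF assms(1-3)] and s = subfieldD[OF assms(2,3)]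
  have Th: "Th Y x \<in> K \<and> \<phi> (Th Y x) = Th (\<phi> Y) (\<phi> x)" if "x \<in> K" for x
    using that assms(5) by (simp add: Th_def h s)
  have "Pn sc q Y k x \<in> K \<and> \<phi> (Pn sc q Y k x) = Pn sc q (\<phi> Y) k (\<phi> x)"
    by (induction k) (simp_all add: Pn_Suc h s Th assms(4))
  then show ?R1 "Pn sc q Y k x \<in> K" by auto
qed

lemma qhom_Pz:
  assumes "qhom sc K \<phi>" "subfield sc K" "scalars sc" "x \<in> K" "Y \<in> K"
  shows "\<phi> (Pz sc q Y k x) = Pz sc q (\<phi> Y) k (\<phi> x)" "Pz sc q Y k x \<in> K"
  using qhomD[OF assms(1-3)] subfieldD[OF assms(2,3)] assms(4,5)
  by (simp_all add: Pz_def qhom_Pn[OF assms(1-3)])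

text \<open>Replacing \<open>Y\<close> by its inverse and \<open>x\<close> by \<open>Y * x\<close>
  interchanges numerator and denominator of each factor \<open>Th\<close>. All factors are functions
  of \<open>x\<close> and central elements, so the reversal of their order is harmless.\<close>

lemma Pn_invert:
  assumes sc: "scalars sc" and Y: "central Y" "Y \<noteq> 0" and r: "regular sc Y x"
  shows "Pn sc q (inverse Y) k (Y * x) = inverse (Pn sc q Y k x)"
proof -
  have cYi: "central (inverse Y)" by (rule central_inverse[OF Y(1)])
  have T: "Th (inverse Y) (sc a * (Y * x)) = inverse (Th Y (sc a * x))" for a
  proof -
    have "sc a * (Y * x) = Y * (sc a * x)" by (rule central_left_comm[OF Y(1)])
    then show ?thesis using Y(2) by (simp add: Th_def inverse_mult_any inverse_inverse_any inverse_mult_cancel_left)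
  qed
  show ?thesis
  proof (induction k)
    case (Suc k)
    let ?T = "Th Y (sc (q ^ (2 * k)) * x)"
    have "x * ?T = ?T * x" by (rule comm_Th[OF comm_scale[OF sc refl] Y(1)])
    then have "?T * Pn sc q Y k x = Pn sc q Y k x * ?T" by (intro comm_Pn[OF sc Y(1)]) simp
    then have "inverse (Pn sc q Y (Suc k) x) = inverse (?T * Pn sc q Y k x)" by (simp add: Pn_Suc)
    then show ?case unfolding Pn_Suc[of sc q "inverse Y"] Suc T by (simp add: inverse_mult_any)
  qed simp
qed

lemma Pz_invert:
  assumes sc: "scalars sc" and Y: "central Y" "Y \<noteq> 0" and r: "regular sc Y x"
  shows "Pz sc q (inverse Y) k (Y * x) = inverse (Pz sc q Y k x)"
proof -
  have "sc a * (Y * x) = Y * (sc a * x)" for a by (rule central_left_comm[OF Y(1)])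
  then show ?thesis using Pn_invert[OF sc Y] regular_scale[OF sc r] r by (simp add: Pz_def inverse_inverse_any)
qed

lemma Pz_comm:
  assumes sc: "scalars sc" and Y: "central Y" and z: "z * x = x * z"
  shows "z * Pz sc q Y k x = Pz sc q Y k x * z"
  using comm_Pn[OF sc Y z] comm_inverse[OF comm_Pn[OF sc Y comm_scale[OF sc z]]] by (simp add: Pz_def)

section \<open>Involutions and braid relations for the maps S_i\<close>

context
  fixes sc :: "'f::field \<Rightarrow> 'a" and E :: "'y::ab_group_add \<Rightarrow> 'a" and g :: "'i::finite \<Rightarrow> 'a"
    and q :: "'i \<Rightarrow> 'f" and a e :: "'i \<Rightarrow> 'i \<Rightarrow> int" and f :: "'i \<Rightarrow> 'y \<Rightarrow> int" and h :: "'i \<Rightarrow> 'y"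
    and \<mu> :: "'i \<Rightarrow> 'y" and m :: "'i \<Rightarrow> int" and c n :: "'i \<Rightarrow> 'i \<Rightarrow> int" and s :: "'i \<Rightarrow> 'y \<Rightarrow> 'y"
    and S :: "'i \<Rightarrow> 'a \<Rightarrow> 'a"
  assumes frame: "torus_frame sc E g q c" and gcm: "gcm a" and sign: "sign_system a e"
    and q_sym: "\<And>i j. q i powi a i j = q j powi a j i" and q_inf: "\<And>i k. q i powi k = 1 \<Longrightarrow> k = 0"
    and c_def: "\<And>i j. c i j = - e i j * a i j"
    and n_def: "\<And>i j. n i j = (if i = j then 1 else if e i j = - 1 then a i j else 0)"
    and f: "\<And>i. additive (f i)" "\<And>i j. f i (h j) = a j i" and \<mu>: "\<And>i. \<mu> i = zsmul (m i) (h i)"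
    and m: "\<And>i j. m j * a j i = m i * a i j" and s: "\<And>i \<kappa>. s i \<kappa> = \<kappa> - zsmul (f i \<kappa>) (h i)"
    and S: "\<And>i. qhom sc (torus_field sc E g) (S i)" "\<And>i \<kappa>. S i (E \<kappa>) = E (s i \<kappa>)"
      "\<And>i j. S i (g j) = E (zsmul (n i j) (\<mu> i)) * (g j * Pz sc (q i) (E (\<mu> i)) (c i j) (g i))"
begin

private lemmas fr = frame_sc[OF frame] frame_E[OF frame] frame_subfield[OF frame]
private lemmas sc = fr(1) and EE = fr(2) and subK = fr(3)
private lemmas mem = frame_E_in[OF frame] frame_g_in[OF frame]
private lemmas K = subfieldD[OF subK sc]
private lemmas hom = qhomD[OF S(1) subK sc]
private lemmas reg = frame_regular[OF frame]
private lemmas q0 = frame_q[OF frame]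
private lemmas cE = lattice_unitsD(3)[OF EE]

private lemma a_diag: "a i i = 2" and a_off: "i \<noteq> j \<Longrightarrow> a i j \<le> 0" and a_zero: "a i j = 0 \<longleftrightarrow> a j i = 0"
  using gcm by (auto simp: gcm_def)

private lemma e_diag: "e i i = 0" and e_zero: "a i j = 0 \<Longrightarrow> e i j = 0"
  and e_anti: "e j i = - e i j" and e_unit: "i \<noteq> j \<Longrightarrow> a i j \<noteq> 0 \<Longrightarrow> e i j = 1 \<or> e i j = - 1"
proof -
  have *: "if i \<noteq> j \<and> a i j \<noteq> 0 then (e i j = 1 \<or> e i j = - 1) \<and> e j i = - e i j else e i j = 0" for i j
    using sign unfolding sign_system_def by blast
  show "e i i = 0" and "a i j = 0 \<Longrightarrow> e i j = 0" using *[of i i] *[of i j] by simp_all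
  show "i \<noteq> j \<Longrightarrow> a i j \<noteq> 0 \<Longrightarrow> e i j = 1 \<or> e i j = - 1" using *[of i j] by simp
  show "e j i = - e i j"
    using *[of i j] *[of j i] a_zero[of i j] by (cases "i \<noteq> j \<and> a i j \<noteq> 0") auto
qed

private lemma fz: "f i (zsmul k y) = k * f i y"
proof -
  interpret additive "f i" by (rule f(1))
  have "f i (\<Sum>l<p. y) = int p * f i y" for p :: nat by (induction p) (simp_all add: add zero algebra_simps)
  then show ?thesis by (cases "k \<ge> 0") (simp_all add: zsmul_def diff minus)
qed

private lemma s_add: "s i (\<kappa> + \<kappa>') = s i \<kappa> + s i \<kappa>'"
  by (simp add: s additive.add[OF f(1)] zmod.scale_left_distrib)

private lemma s_zsmul_\<mu>: "s i (zsmul k (\<mu> j)) = zsmul k (\<mu> j) - zsmul (k * a i j) (\<mu> i)"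
  using m[of j i] by (simp add: s \<mu> fz f(2) mult.assoc) (simp add: mult.left_commute mult.commute)

private lemma s_self: "s i (zsmul k (\<mu> i)) = zsmul (- k) (\<mu> i)"
  unfolding s_zsmul_\<mu> a_diag
  by (simp flip: zmod.scale_left_diff_distrib zmod.scale_minus_left)

private lemma S_\<mu>: "S i (E (zsmul k (\<mu> i))) = E (zsmul (- k) (\<mu> i))"
  by (simp add: S s_self)

private lemma S_self: "S i (g i) = E (\<mu> i) * g i"
  by (simp add: S n_def c_def e_diag)

lemma S_gtwist: "gtwist sc E (q i) (g i) (\<mu> i) (g j) (S i (g j)) (c i j) (n i j)"
  unfolding S by (rule gtwist_g[OF frame])

text \<open>\<open>S i\<close> inverts its own parameter and multiplies \<open>g i\<close> by it. By
  \<open>Pz_invert\<close> the factor collected in the second application is the inverse of the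
  first one, and the lattice factors cancel likewise.\<close>

lemma S_involution: "x \<in> torus_field sc E g \<Longrightarrow> S i (S i x) = x"
proof -
  assume x: "x \<in> torus_field sc E g"
  have id: "qhom sc (torus_field sc E g) (\<lambda>x. x)" by (simp add: qhom_def)
  have "(S i \<circ> S i) x = x"
  proof (rule torus_hom_unique[OF frame qhom_comp[OF S(1) S(1)] id _ _ x])
    fix \<kappa>
    have "s i (s i \<kappa>) = \<kappa>"
      using reflection_braid(5)[OF f(1), of i "h i" "f i" "h i" \<kappa>] f a_diag by (simp add: s)
    then show "(S i \<circ> S i) (E \<kappa>) = E \<kappa>" by (simp add: S(2))
  next
    fix j
    let ?P = "Pz sc (q i) (E (\<mu> i)) (c i j) (g i)"
    have E1: "S i (E (\<mu> i)) = inverse (E (\<mu> i))"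
      using S_\<mu>[of i 1] by (simp add: lattice_unitsD(5)[OF EE])
    have "S i (S i (g j)) = E (zsmul (- n i j) (\<mu> i)) * (S i (g j) * S i ?P)"
      by (simp add: S(3)[of i j] hom mem K S_\<mu> frame_Pz_in[OF frame])
    also have "S i ?P = inverse ?P"
      unfolding qhom_Pz(1)[OF S(1) subK sc mem(2) mem(1)] E1 S_self
      by (rule Pz_invert[OF sc cE lattice_unitsD(4)[OF EE] reg])
    also have "E (zsmul (- n i j) (\<mu> i)) * (S i (g j) * inverse ?P) = g j"
      using Pz_nonzero[OF sc reg, of "q i" "\<mu> i" "c i j" i]
      by (simp add: S(3)[of i j] lattice_unitsD(4,5)[OF EE] mult.assoc inverse_mult_cancel_left)
    finally show "(S i \<circ> S i) (g j) = g j" by simp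
  qed
  then show ?thesis by simp
qed

text \<open>For orthogonal nodes each map fixes the generator and the parameter of the other one,
  and \<open>g i\<close> commutes with \<open>g j\<close>. The factors collected by any
  \<open>g l\<close> are therefore the same in both orders.\<close>

lemma S_commute: "a i j = 0 \<Longrightarrow> i \<noteq> j \<Longrightarrow> x \<in> torus_field sc E g \<Longrightarrow> S i (S j x) = S j (S i x)"
proof -
  assume a0: "a i j = 0" and ij: "i \<noteq> j" and x: "x \<in> torus_field sc E g"
  have a0': "a j i = 0" using a0 a_zero by blast
  have gE: "S u (E (zsmul k (\<mu> v))) = E (zsmul k (\<mu> v))" "S u (g v) = g v"
    if "a u v = 0" "u \<noteq> v" for u v k
    using that e_zero[OF that(1)] by (simp_all add: S s_zsmul_\<mu> n_def c_def lattice_unitsD(1)[OF EE])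
  have 1: "S u (S v (g l)) = E (zsmul (n v l) (\<mu> v)) * (E (zsmul (n u l) (\<mu> u)) *
      (g l * (Pz sc (q u) (E (\<mu> u)) (c u l) (g u) * Pz sc (q v) (E (\<mu> v)) (c v l) (g v))))"
    if "a u v = 0" "u \<noteq> v" for u v l
  proof -
    have "S u (E (\<mu> v)) = E (\<mu> v)" using gE(1)[OF that, of 1] by simp
    then have "S u (Pz sc (q v) (E (\<mu> v)) (c v l) (g v)) = Pz sc (q v) (E (\<mu> v)) (c v l) (g v)"
      unfolding qhom_Pz(1)[OF S(1) subK sc mem(2) mem(1)] gE(2)[OF that] by simp
    then show ?thesis
      by (simp add: S(3)[of v l] hom mem K gE(1)[OF that] frame_Pz_in[OF frame]) (simp add: S(3) mult.assoc)
  qed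
  have "g i * g j = g j * g i"
    using frame_comm[OF frame, of i j] a0 by (simp add: c_def scalarsD(3)[OF sc])
  then have "g j * Pz sc (q i) (E (\<mu> i)) k (g i) = Pz sc (q i) (E (\<mu> i)) k (g i) * g j" for k
    by (intro Pz_comm[OF sc cE]) simp
  then have P: "Pz sc (q i) (E (\<mu> i)) k (g i) * Pz sc (q j) (E (\<mu> j)) k' (g j) =
      Pz sc (q j) (E (\<mu> j)) k' (g j) * Pz sc (q i) (E (\<mu> i)) k (g i)" for k k'
    by (intro Pz_comm[OF sc cE]) simp
  have "(S i \<circ> S j) x = (S j \<circ> S i) x"
  proof (rule torus_hom_unique[OF frame qhom_comp[OF S(1) S(1)] qhom_comp[OF S(1) S(1)] _ _ x])
    fix \<kappa>
    have "s i (s j \<kappa>) = s j (s i \<kappa>)"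
      using reflection_braid(1)[OF f(1) _ f(1), of i "h i" j "h j" \<kappa>] f a_diag a0 a0' by (simp add: s)
    then show "(S i \<circ> S j) (E \<kappa>) = (S j \<circ> S i) (E \<kappa>)" by (simp add: S(2))
  next
    fix l
    show "(S i \<circ> S j) (g l) = (S j \<circ> S i) (g l)"
      using 1[OF a0 ij, of l] 1[OF a0' not_sym[OF ij], of l] P[of "c i l" "c j l"]
        central_left_comm[OF cE, of "E (zsmul (n j l) (\<mu> j))" "zsmul (n i l) (\<mu> i)"] by simp
  qed
  then show ?thesis by simp
qed

text \<open>With one coordinate added for the extra variable, \<open>T k p\<close> is again a
  reflection along \<open>(h k, 0)\<close>, for the functional \<open>F k p\<close> that absorbs the
  shift. On the vectors \<open>(h l, 0)\<close> these functionals take the Cartan integers as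
  values, so \<open>reflection_braid\<close> covers the shifts too.\<close>

lemma word_lattice_maps:
  fixes i j :: 'i and pi pj :: int
  defines "T \<equiv> \<lambda>k p (\<kappa>, l :: int). (s k \<kappa> + zsmul (l * p) (\<mu> k), l)"
  assumes ij: "a j i = - 1" "a i j = - int N" "i \<noteq> j"
  shows "N = 1 \<Longrightarrow> T i pi \<circ> T j pj \<circ> T i pi = T j pj \<circ> T i pi \<circ> T j pj"
    and "N = 2 \<Longrightarrow> T i pi \<circ> T j pj \<circ> T i pi \<circ> T j pj = T j pj \<circ> T i pi \<circ> T j pj \<circ> T i pi"
    and "N = 3 \<Longrightarrow> T i pi \<circ> T j pj \<circ> T i pi \<circ> T j pj \<circ> T i pi \<circ> T j pj =
      T j pj \<circ> T i pi \<circ> T j pj \<circ> T i pi \<circ> T j pj \<circ> T i pi"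
proof -
  define F where "F k p = (\<lambda>(\<kappa>, l). f k \<kappa> - l * (p * m k))" for k and p :: int
  have T: "T k p x = x - zsmul (F k p x) (h k, 0)" for k p x
    by (cases x) (simp add: T_def F_def s \<mu> zsmul_Pair zmod.scale_left_diff_distrib Groups.mult.assoc)
  have addF: "additive (F k p)" for k p
    by (rule additive.intro) (auto simp: F_def additive.add[OF f(1)] algebra_simps)
  have Fh: "F k p (h l, 0) = a l k" for k p l by (simp add: F_def f)
  note br = reflection_braid[OF addF _ addF, of i pi "(h i, 0)" j pj "(h j, 0)", unfolded Fh a_diag, folded T]
  show "N = 1 \<Longrightarrow> T i pi \<circ> T j pj \<circ> T i pi = T j pj \<circ> T i pi \<circ> T j pj"
    using br(2) ij by (simp add: fun_eq_iff)
  show "N = 2 \<Longrightarrow> T i pi \<circ> T j pj \<circ> T i pi \<circ> T j pj = T j pj \<circ> T i pi \<circ> T j pj \<circ> T i pi"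
    using br(3) ij by (simp add: fun_eq_iff)
  show "N = 3 \<Longrightarrow> T i pi \<circ> T j pj \<circ> T i pi \<circ> T j pj \<circ> T i pi \<circ> T j pj =
      T j pj \<circ> T i pi \<circ> T j pj \<circ> T i pi \<circ> T j pj \<circ> T i pi"
    using br(4) ij by (simp add: fun_eq_iff)
qed

text \<open>Correcting \<open>g\<^sub>l\<close> by powers of \<open>g\<^sub>i\<close> and \<open>g\<^sub>j\<close> gives an element on which \<open>S\<^sub>j\<close> acts by a central factor
  and \<open>S\<^sub>i\<close> involves fewer than \<open>- a\<^sub>i\<^sub>j\<close> factors.\<close>

lemma corrected_generator:
  assumes ij: "a j i = - 1" "a i j = - int N" "i \<noteq> j" "N > 0"
  obtains A B r pi pj where "r < N"
    "gtwist sc E (q i) (g i) (\<mu> i) (g l * ipow (g j) B * ipow (g i) A) (S i (g l * ipow (g j) B * ipow (g i) A)) (int r) pi"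
    "gtwist sc E (q j) (g j) (\<mu> j) (g l * ipow (g j) B * ipow (g i) A) (S j (g l * ipow (g j) B * ipow (g i) A)) 0 pj"
proof -
  define \<delta> where "\<delta> = e i j"
  have \<delta>: "\<delta> = 1 \<or> \<delta> = - 1" using e_unit[of i j] ij by (auto simp: \<delta>_def)
  then have \<delta>2: "\<delta> * \<delta> = 1" by auto
  have cij: "c i j = \<delta> * int N" "c j i = - \<delta>" using ij e_anti[of j i] by (simp_all add: c_def \<delta>_def)
  have cd: "c k k = 0" for k by (simp add: c_def e_diag)
  \<comment> \<open>As \<open>c i j = \<delta> * int N\<close> and
    \<open>\<delta> * \<delta> = 1\<close>, \<open>B\<close> subtracts N times the quotient from
    \<open>c i l\<close> and leaves the remainder; \<open>A\<close> cancels \<open>c j l\<close>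
    because \<open>c j i = - \<delta>\<close>. The corrections do not interfere, since
    \<open>c\<close> vanishes on the diagonal.\<close>
  define B where "B = - \<delta> * (c i l div int N)"
  define A where "A = \<delta> * c j l"
  define z where "z = g l * ipow (g j) B * ipow (g i) A"
  have Sz: "S k z = S k (g l) * ipow (S k (g j)) B * ipow (S k (g i)) A" for k
    unfolding z_def by (simp add: hom mem K qhom_ipow[OF S(1) subK sc])
  have tw: "gtwist sc E (q k) (g k) (\<mu> k) z (S k z) (c k l + B * c k j + A * c k i) (n k l + B * n k j + A * n k i)" for k
    unfolding Sz unfolding z_def
    by (intro gtwist_mult[OF sc EE q0 reg] gtwist_ipow[OF sc EE q0 reg] S_gtwist)
  have "c i l + B * c i j + A * c i i = c i l - (\<delta> * \<delta>) * (int N * (c i l div int N))"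
    by (simp add: B_def cij cd algebra_simps)
  also have "\<dots> = int (nat (c i l mod int N))"
    using ij(4) by (simp add: \<delta>2 minus_mult_div_eq_mod)
  finally have 1: "c i l + B * c i j + A * c i i = int (nat (c i l mod int N))" .
  have "c j l + B * c j j + A * c j i = c j l - (\<delta> * \<delta>) * c j l"
    by (simp add: A_def cij cd algebra_simps)
  then have 2: "c j l + B * c j j + A * c j i = 0" by (simp add: \<delta>2)
  have "nat (c i l mod int N) < N" using ij(4) by (simp add: nat_less_iff)
  from that[OF this tw[of i, unfolded 1, unfolded z_def] tw[of j, unfolded 2, unfolded z_def]] show thesis .
qed

lemma agree_of_corrected:
  assumes \<phi>: "qhom sc (torus_field sc E g) \<phi>" "qhom sc (torus_field sc E g) \<psi>"
    and eq: "\<phi> (g i) = \<psi> (g i)" "\<phi> (g j) = \<psi> (g j)"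
      "\<phi> (g l * ipow (g j) B * ipow (g i) A) = \<psi> (g l * ipow (g j) B * ipow (g i) A)"
  shows "\<phi> (g l) = \<psi> (g l)"
proof -
  note h = qhomD[OF \<phi>(1) subK sc] qhomD[OF \<phi>(2) subK sc] qhom_ipow[OF \<phi>(1) subK sc] qhom_ipow[OF \<phi>(2) subK sc]
  let ?w = "ipow (g j) B * ipow (g i) A"
  have w: "?w \<in> torus_field sc E g" "?w \<noteq> 0"
    using frame_g_nonzero[OF frame] by (simp_all add: h K mem ipow_nonzero)
  have "\<phi> ?w = \<psi> ?w" by (simp add: h mem eq)
  moreover have "\<phi> (g l) * \<phi> ?w = \<psi> (g l) * \<psi> ?w"
    using eq(3) w(1) by (simp add: mult.assoc h mem K)
  ultimately show ?thesis using h(8)[OF w] by simp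
qed

text \<open>The pair \<open>i, j\<close> of type \<open>A\<^sub>2\<close>, \<open>B\<^sub>2\<close> or \<open>G\<^sub>2\<close> with \<open>j\<close> long is unfolded to the star with centre \<open>j\<close> and
  \<open>N = - a\<^sub>i\<^sub>j\<close> leaves: as \<open>q\<^sub>j = q\<^sub>i\<^sup>N\<close>, the elements \<open>q\<^sub>i\<^sup>2\<^sup>v g\<^sub>i\<close> with \<open>v < N\<close> behave towards \<open>g\<^sub>j\<close> like leaves of a
  simply laced diagram with parameter \<open>q\<^sub>j\<close>, and a product over \<open>\<nu> < N\<close> in \<open>S\<^sub>i\<close> becomes a product over the leaves.
  If \<open>\<epsilon>\<^sub>i\<^sub>j = - 1\<close>, all variables are replaced by their inverses.\<close>

lemma folded_words_agree:
  fixes l :: 'i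
  assumes ij: "a j i = - 1" "a i j = - int N" "i \<noteq> j" "N > 0"
  defines "agree \<equiv> \<lambda>\<phi> \<psi>. \<phi> (g i) = \<psi> (g i) \<and> \<phi> (g j) = \<psi> (g j) \<and> \<phi> (g l) = \<psi> (g l) \<and> (\<forall>\<kappa>. \<phi> (E \<kappa>) = \<psi> (E \<kappa>))"
  shows "N = 1 \<Longrightarrow> agree (S i \<circ> S j \<circ> S i) (S j \<circ> S i \<circ> S j)"
    and "N = 2 \<Longrightarrow> agree (S i \<circ> S j \<circ> S i \<circ> S j) (S j \<circ> S i \<circ> S j \<circ> S i)"
    and "N = 3 \<Longrightarrow> agree (S i \<circ> S j \<circ> S i \<circ> S j \<circ> S i \<circ> S j) (S j \<circ> S i \<circ> S j \<circ> S i \<circ> S j \<circ> S i)"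
proof -
  obtain A B r pi pj where r: "r < N"
    and zi: "gtwist sc E (q i) (g i) (\<mu> i) (g l * ipow (g j) B * ipow (g i) A) (S i (g l * ipow (g j) B * ipow (g i) A)) (int r) pi"
    and zj: "gtwist sc E (q j) (g j) (\<mu> j) (g l * ipow (g j) B * ipow (g i) A) (S j (g l * ipow (g j) B * ipow (g i) A)) 0 pj"
    by (rule corrected_generator[OF ij])
  define z where "z = g l * ipow (g j) B * ipow (g i) A"
  define x where "x = g i"
  define Y where "Y = E (\<mu> i)"
  have zK: "z \<in> torus_field sc E g" by (simp add: z_def K mem qhom_ipow(2)[OF S(1) subK sc])
  have Siz: "S i z = E (zsmul pi (\<mu> i)) * (z * Pn sc (q i) Y r x)"
    using zi by (simp add: gtwist_def z_def Pz_def x_def Y_def)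
  have Sjz: "S j z = E (zsmul pj (\<mu> j)) * z"
    using zj by (simp add: gtwist_def z_def)
  define \<delta> where "\<delta> = e i j"
  have \<delta>: "\<delta> = 1 \<or> \<delta> = - 1" using e_unit[of i j] ij by (auto simp: \<delta>_def)
  have cij: "c i j = \<delta> * int N" "c j i = - \<delta>" using ij e_anti[of j i] by (simp_all add: c_def \<delta>_def)
  define G where "G = (if \<delta> = 1 then g j else inverse (g j))"
  define H where "H v = (if \<delta> = 1 then sc (q i ^ (2 * v)) * x else inverse (sc (q i ^ (2 * v)) * x))" for v
  define yi yj where "yi = zsmul \<delta> (\<mu> i)" and "yj = zsmul \<delta> (\<mu> j)"
  define b where "b = q i powi (2 * (\<delta> * int N))"
  \<comment> \<open>Passing to inverses turns every factor \<open>Th\<close> into itself times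
    \<open>Y\<close>, by \<open>Th_inverse\<close>. The \<open>r\<close> factors collected by
    \<open>z\<close> then contain \<open>Y ^ r\<close>, for which the lattice exponent is
    corrected.\<close>
  define pi' where "pi' = (if \<delta> = 1 then pi else pi - int r)"
  define T where "T = (\<lambda>k p (\<kappa>, l :: int). (s k \<kappa> + zsmul (l * p) (\<mu> k), l))"
  have x0: "x \<noteq> 0" "g j \<noteq> 0" using frame_g_nonzero[OF frame] by (simp_all add: x_def)
  have sq: "sc (q i ^ p) \<noteq> 0" for p using sc_nonzero[OF sc] q0 by simp
  have xK: "x \<in> torus_field sc E g" by (simp add: x_def mem)
  have E_pow: "E (zsmul (int k) y) = E y ^ k" for k y
    by (induction k) (simp_all add: zmod.scale_left_distrib lattice_unitsD[OF EE])
  have E_pow': "E (zsmul (int k * p) y) = E (zsmul p y) ^ k" for k p y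
    by (simp flip: E_pow)
  have yE: "E yi = (if \<delta> = 1 then Y else inverse Y)" "E yj = (if \<delta> = 1 then E (\<mu> j) else inverse (E (\<mu> j)))"
    using \<delta> by (auto simp: yi_def yj_def Y_def lattice_unitsD(5)[OF EE])
  have cY: "central Y" "Y \<noteq> 0" "central (Y ^ k)" for k
    using cE lattice_unitsD(4)[OF EE] by (simp_all add: Y_def flip: E_pow)
  have tp: "tprod (\<lambda>_. E yi) H k = (if \<delta> = 1 then 1 else Y ^ k) * Pn sc (q i) Y k x" for k
  proof (cases "\<delta> = 1")
    case True
    then show ?thesis by (simp add: tprod_def Pn_def H_def yE)
  next
    case False
    have T: "Th (E yi) (H v) = Y * Th Y (sc (q i ^ (2 * v)) * x)" for v
      using False Th_inverse[OF _ cY(2,1), of "sc (q i ^ (2 * v)) * x"] sq x0 by (simp add: H_def yE)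
    have "tprod (\<lambda>_. E yi) H k = Y ^ k * Pn sc (q i) Y k x"
    proof (induction k)
      case (Suc k)
      show ?case
        unfolding tprod_Suc Suc T Pn_Suc
        by (simp only: power_Suc2 mult.assoc central_left_comm[OF cY(1), of "Pn sc (q i) Y k x"])
    qed simp
    then show ?thesis using False by simp
  qed
  have mem': "G \<in> torus_field sc E g" "H v \<in> torus_field sc E g" for v
    by (simp_all add: G_def H_def K mem xK)
  \<comment> \<open>By \<open>q_inf\<close> no nonzero power of \<open>q i\<close> is 1, and N is
    positive; so \<open>b\<close> is admissible as the parameter of a seed.\<close>
  have b01: "b \<noteq> 0" "b \<noteq> 1" using q0[of i] q_inf[of i "2 * (\<delta> * int N)"] \<delta> ij(4) by (auto simp: b_def)
  have nz': "G \<noteq> 0" "H v \<noteq> 0" for v using x0 sq by (simp_all add: G_def H_def nonzero_imp_inverse_nonzero)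
  have comm1: "H v * G = sc b * (G * H v)" for v
  proof -
    let ?w = "sc (q i ^ (2 * v)) * x"
    have xg: "x * g j = sc b * (g j * x)" using frame_comm[OF frame, of i j] by (simp add: cij b_def x_def)
    have wg: "?w * g j = sc b * (g j * ?w)"
      by (simp only: mult.assoc xg sc_left_comm[OF sc, of "g j"] sc_left_comm[OF sc, of "sc b"])
    show ?thesis
    proof (cases "\<delta> = 1")
      case True
      then show ?thesis using wg by (simp add: G_def H_def)
    next
      case False
      have "inverse (g j) * inverse ?w = inverse (sc b * (g j * ?w))"
        by (simp only: wg[symmetric] inverse_mult_any)
      also have "\<dots> = inverse (sc b) * (inverse ?w * inverse (g j))"
        by (simp only: inverse_mult_any[of "sc b"] inverse_mult_any[of "g j"] central_comm[OF central_inverse[OF scalarsD(4)[OF sc]]])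
      finally show ?thesis
        using False sc_nonzero[OF sc b01(1)] by (simp add: G_def H_def mult_inverse_cancel_left)
    qed
  qed
  have comm2: "H u * H v = H v * H u" for u v
  proof -
    have w: "sc c * x * (sc d * x) = sc d * x * (sc c * x)" for c d
      by (simp only: mult.assoc sc_left_comm[OF sc, of x]) (rule sc_left_comm[OF sc])
    show ?thesis
    proof (cases "\<delta> = 1")
      case True
      then show ?thesis by (simp add: H_def w)
    next
      case False
      then show ?thesis unfolding H_def by (simp add: inverse_mult_any[symmetric] w)
    qed
  qed
  have T_add: "T k p (\<alpha> + \<beta>) = T k p \<alpha> + T k p \<beta>" for k p \<alpha> \<beta>
    by (cases \<alpha>; cases \<beta>) (simp add: T_def s_add zmod.scale_left_distrib int_distrib(1))
  have s0: "s k 0 = 0" for k using s_add[of k 0 0] by simp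
  have T_simps: "snd (T k p (\<kappa>, 0)) = 0" "T k p (0, 1) = (zsmul p (\<mu> k), 1)" "S k (E \<kappa>) = E (fst (T k p (\<kappa>, 0)))" for k p \<kappa>
    by (simp_all add: T_def s0 S)
  have SiY: "S i (E yi) = inverse (E yi)" "S i (E yj) = E yj * E yi ^ N"
    unfolding yi_def yj_def S_\<mu>
    by (simp_all add: lattice_unitsD(5)[OF EE, symmetric] S s_zsmul_\<mu> ij)
      (simp flip: E_pow' lattice_unitsD(2)[OF EE] add: mult.commute)
  have SjY: "S j (E yj) = inverse (E yj)" "S j (E yi) = E yj * E yi"
    unfolding yi_def yj_def S_\<mu>
    by (simp_all add: lattice_unitsD(5)[OF EE, symmetric] S s_zsmul_\<mu> ij)
      (simp flip: lattice_unitsD(2)[OF EE] add: Groups.add.commute)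
  have eji: "e j i = - \<delta>" using e_anti[of j i] by (simp add: \<delta>_def)
  have SG: "S i G = G * tprod (\<lambda>_. E yi) H N" "S j G = E yj * G"
  proof -
    show "S i G = G * tprod (\<lambda>_. E yi) H N"
    proof (cases "\<delta> = 1")
      case True
      then have "n i j = 0" using ij by (simp add: n_def \<delta>_def)
      then show ?thesis
        using True by (simp add: G_def S(3)[of i j] cij tp lattice_unitsD(1)[OF EE] Pz_def Y_def x_def)
    next
      case False
      then have \<delta>': "\<delta> = - 1" using \<delta> by simp
      then have n: "n i j = - int N" using ij by (simp add: n_def \<delta>_def)
      have "inverse (S i (g j)) = E (zsmul (int N) (\<mu> i)) * (inverse (g j) * Pz sc (q i) (E (\<mu> i)) (int N) (g i))"
        using gtwist_inverse[OF sc EE q0 reg S_gtwist[of i j]] \<delta>' by (simp add: gtwist_def cij n)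
      also have "\<dots> = inverse (g j) * (Y ^ N * Pn sc (q i) Y N x)"
        by (simp add: Pz_def E_pow Y_def x_def) (simp only: central_left_comm[OF cY(3)[unfolded Y_def]])
      finally show ?thesis using False by (simp add: G_def hom mem tp)
    qed
    show "S j G = E yj * G"
    proof (cases "\<delta> = 1")
      case True
      then show ?thesis by (simp add: G_def yE S_self)
    next
      case False
      then show ?thesis
        by (simp add: G_def yE hom mem S_self inverse_mult_any central_comm[OF central_inverse[OF cE]])
    qed
  qed
  have SH1: "S i (H v) = E yi * H v" for v
  proof (cases "\<delta> = 1")
    case True
    then show ?thesis by (simp add: H_def yE hom K mem xK) (simp add: x_def Y_def S_self sc_left_comm[OF sc])
  next
    case False
    have "S i (H v) = inverse (sc (q i ^ (2 * v)) * (Y * x))"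
      using False by (simp add: H_def hom K mem xK) (simp add: x_def Y_def S_self)
    also have "sc (q i ^ (2 * v)) * (Y * x) = Y * (sc (q i ^ (2 * v)) * x)"
      by (rule central_left_comm[OF cY(1)])
    finally show ?thesis
      using False by (simp add: H_def yE inverse_mult_any[of Y] central_comm[OF central_inverse[OF cY(1)]])
  qed
  have SH2: "S j (H v) = inverse (E yj) * inverse (Th (E yj) G) * H v" for v
  proof (cases "\<delta> = 1")
    case True
    \<comment> \<open>Here \<open>e j i = - 1\<close>, so \<open>S j\<close> puts a factor with
      exponent - 1 to the right of \<open>x\<close>; \<open>Pz_shift\<close> brings it to the left,
      where \<open>centre_mut\<close> has it.\<close>
    let ?b = "q j powi (2 * c j i)"
    have n: "n j i = - 1" using True ij eji by (simp add: n_def)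
    have xg: "g j * x = x * (sc ?b * g j)"
      using frame_comm[OF frame, of j i] by (simp only: x_def sc_left_comm[OF sc, of "g i"])
    have P: "Pz sc (q j) (E (\<mu> j)) (- 1) (g j) = inverse (Th (E (\<mu> j)) (sc ?b * g j))"
      using True by (simp add: Pz_def Pn_Suc[of _ _ _ 0, simplified] cij scalarsD(3)[OF sc])
    have "Th (E (\<mu> j)) (g j) * x = x * Th (E (\<mu> j)) (sc ?b * g j)"
      using Pz_shift[OF sc reg cE xg x0(1), where c = 1 and q = "q j"] by (simp only: Pz_1[OF sc])
    then have sw: "inverse (Th (E (\<mu> j)) (g j)) * x = x * inverse (Th (E (\<mu> j)) (sc ?b * g j))"
      by (intro inverse_mult_swap regular_Th[OF sc] regular_scale[OF sc] reg)
    have "S j x = inverse (E (\<mu> j)) * (inverse (Th (E (\<mu> j)) (g j)) * x)"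
      unfolding sw P[symmetric] using True by (simp add: x_def S(3)[of j i] n cij lattice_unitsD(5)[OF EE])
    then show ?thesis
      using True by (simp add: H_def G_def yE hom K xK mult.assoc)
        (simp only: sc_left_comm[OF sc, of "inverse (E (\<mu> j))"] sc_left_comm[OF sc, of "inverse (Th (E (\<mu> j)) (g j))"])
  next
    case False
    then have \<delta>': "\<delta> = - 1" using \<delta> by simp
    let ?T = "Th (E (\<mu> j)) (g j)"
    have n: "n j i = 0" using \<delta>' ij eji by (simp add: n_def)
    have "S j x = x * ?T"
      using \<delta>' by (simp add: x_def S(3)[of j i] n cij lattice_unitsD(1)[OF EE] Pz_1[OF sc])
    then have "S j (H v) = inverse (sc (q i ^ (2 * v)) * x * ?T)"
      using False by (simp add: H_def hom K xK mult.assoc)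
    also have "\<dots> = inverse ?T * H v" using False by (simp add: H_def inverse_mult_any[of _ ?T])
    also have "inverse ?T = inverse (E yj) * inverse (Th (E yj) G)"
    proof -
      have "inverse (E yj) * inverse (Th (E yj) G) = E (\<mu> j) * (inverse ?T * inverse (E (\<mu> j)))"
        using False Th_inverse[OF x0(2) lattice_unitsD(4)[OF EE] cE]
        by (simp add: G_def yE inverse_inverse_any inverse_mult_any)
      also have "\<dots> = inverse ?T"
        using lattice_unitsD(4)[OF EE] by (simp add: central_comm[OF central_inverse[OF cE]] mult_inverse_cancel_left)
      finally show ?thesis ..
    qed
    finally show ?thesis .
  qed
  have Sz: "S i z = E (zsmul pi' (\<mu> i)) * z * tprod (\<lambda>_. E yi) H r"
  proof (cases "\<delta> = 1")
    case True
    then show ?thesis by (simp add: Siz tp pi'_def mult.assoc)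
  next
    case False
    have "E (zsmul pi (\<mu> i)) = E (zsmul (pi - int r) (\<mu> i)) * Y ^ r"
      by (simp add: Y_def flip: E_pow lattice_unitsD(2)[OF EE] zmod.scale_left_distrib)
    then show ?thesis
      using False by (simp add: Siz tp pi'_def mult.assoc central_left_comm[OF cY(3), of z])
  qed
  note sw = seed_words_agree[OF sc subK EE mem(1) mem' zK b01 nz' comm1 comm2 S(1) S(1) T_add T_add T_simps(1) T_simps(1)
    T_simps(2)[of i pi'] T_simps(2)[of j pj] T_simps(3) T_simps(3) SiY SjY SG SH1 SH2 Sz Sjz less_imp_le[OF r]]
  have lat: "N = 1 \<Longrightarrow> T i pi' \<circ> T j pj \<circ> T i pi' = T j pj \<circ> T i pi' \<circ> T j pj"
    "N = 2 \<Longrightarrow> T i pi' \<circ> T j pj \<circ> T i pi' \<circ> T j pj = T j pj \<circ> T i pi' \<circ> T j pj \<circ> T i pi'"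
    "N = 3 \<Longrightarrow> T i pi' \<circ> T j pj \<circ> T i pi' \<circ> T j pj \<circ> T i pi' \<circ> T j pj =
      T j pj \<circ> T i pi' \<circ> T j pj \<circ> T i pi' \<circ> T j pj \<circ> T i pi'"
    unfolding T_def by (intro word_lattice_maps[OF ij(1-3)]; assumption)+
  have words: "(N = 1 \<longrightarrow> (\<exists>W \<sigma>. tracks E G H N yi yj z (S i \<circ> S j \<circ> S i) W \<sigma> \<and> tracks E G H N yi yj z (S j \<circ> S i \<circ> S j) W \<sigma>)) \<and>
    (N = 2 \<longrightarrow> (\<exists>W \<sigma>. tracks E G H N yi yj z (S i \<circ> S j \<circ> S i \<circ> S j) W \<sigma> \<and>
        tracks E G H N yi yj z (S j \<circ> S i \<circ> S j \<circ> S i) W \<sigma>)) \<and>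
    (N = 3 \<longrightarrow> (\<exists>W \<sigma>. tracks E G H N yi yj z (S i \<circ> S j \<circ> S i \<circ> S j \<circ> S i \<circ> S j) W \<sigma> \<and>
        tracks E G H N yi yj z (S j \<circ> S i \<circ> S j \<circ> S i \<circ> S j \<circ> S i) W \<sigma>))"
    by (intro conjI impI) (rule sw(1)[OF _ lat(1)] sw(2)[OF _ lat(2)] sw(3)[OF _ lat(3)]; simp)+
  have fin: "agree \<phi> \<psi>" if \<phi>: "qhom sc (torus_field sc E g) \<phi>" "qhom sc (torus_field sc E g) \<psi>"
      and ex: "\<exists>W \<sigma>. tracks E G H N yi yj z \<phi> W \<sigma> \<and> tracks E G H N yi yj z \<psi> W \<sigma>" for \<phi> \<psi>
  proof -
    note h = qhomD[OF \<phi>(1) subK sc] qhomD[OF \<phi>(2) subK sc]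
    obtain W \<sigma> where tr: "tracks E G H N yi yj z \<phi> W \<sigma>" "tracks E G H N yi yj z \<psi> W \<sigma>" using ex by blast
    have G: "\<phi> G = \<psi> G" and H: "\<phi> (H 0) = \<psi> (H 0)" and z: "\<phi> z = \<psi> z" and E: "\<phi> (E \<kappa>) = \<psi> (E \<kappa>)" for \<kappa>
      using tracks_agree[OF tr] ij(4) by blast+
    have "\<phi> (g j) = \<psi> (g j)"
      using G arg_cong[OF G, of inverse] by (cases "\<delta> = 1") (simp_all add: G_def h mem inverse_inverse_any)
    moreover have "\<phi> (g i) = \<psi> (g i)"
      using H arg_cong[OF H, of inverse]
      by (cases "\<delta> = 1") (simp_all add: H_def x_def h mem scalarsD(3)[OF sc] inverse_inverse_any)
    ultimately show ?thesis
      unfolding agree_def using agree_of_corrected[OF \<phi>, of i j l B A] z E unfolding z_def by blast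
  qed
  show "agree (S i \<circ> S j \<circ> S i) (S j \<circ> S i \<circ> S j)" if "N = 1"
    by (intro fin qhom_comp S(1)) (use words that in simp)
  show "agree (S i \<circ> S j \<circ> S i \<circ> S j) (S j \<circ> S i \<circ> S j \<circ> S i)" if "N = 2"
    by (intro fin qhom_comp S(1)) (use words that in simp)
  show "agree (S i \<circ> S j \<circ> S i \<circ> S j \<circ> S i \<circ> S j) (S j \<circ> S i \<circ> S j \<circ> S i \<circ> S j \<circ> S i)" if "N = 3"
    by (intro fin qhom_comp S(1)) (use words that in simp)
qed

lemma S_braid_ordered:
  assumes ij: "a j i = - 1" "a i j = - int N" "i \<noteq> j" "N > 0" and x: "x \<in> torus_field sc E g"
  shows "N = 1 \<Longrightarrow> S i (S j (S i x)) = S j (S i (S j x))"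
    and "N = 2 \<Longrightarrow> S i (S j (S i (S j x))) = S j (S i (S j (S i x)))"
    and "N = 3 \<Longrightarrow> S i (S j (S i (S j (S i (S j x))))) = S j (S i (S j (S i (S j (S i x)))))"
proof -
  note fw = folded_words_agree[OF ij]
  have "(S i \<circ> S j \<circ> S i) x = (S j \<circ> S i \<circ> S j) x" if "N = 1"
    by (rule torus_hom_unique[OF frame _ _ _ _ x]) (intro qhom_comp S(1), intro qhom_comp S(1), use fw(1) that in blast, use fw(1) that in blast)
  then show "N = 1 \<Longrightarrow> S i (S j (S i x)) = S j (S i (S j x))" by simp
  have "(S i \<circ> S j \<circ> S i \<circ> S j) x = (S j \<circ> S i \<circ> S j \<circ> S i) x" if "N = 2"
    by (rule torus_hom_unique[OF frame _ _ _ _ x]) (intro qhom_comp S(1), intro qhom_comp S(1), use fw(2) that in blast, use fw(2) that in blast)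
  then show "N = 2 \<Longrightarrow> S i (S j (S i (S j x))) = S j (S i (S j (S i x)))" by simp
  have "(S i \<circ> S j \<circ> S i \<circ> S j \<circ> S i \<circ> S j) x = (S j \<circ> S i \<circ> S j \<circ> S i \<circ> S j \<circ> S i) x" if "N = 3"
    by (rule torus_hom_unique[OF frame _ _ _ _ x]) (intro qhom_comp S(1), intro qhom_comp S(1), use fw(3) that in blast, use fw(3) that in blast)
  then show "N = 3 \<Longrightarrow> S i (S j (S i (S j (S i (S j x))))) = S j (S i (S j (S i (S j (S i x)))))" by simp
qed

lemma S_braid:
  assumes ij: "i \<noteq> j" and x: "x \<in> torus_field sc E g"
  shows "a i j * a j i = 1 \<Longrightarrow> S i (S j (S i x)) = S j (S i (S j x))"
    and "a i j * a j i = 2 \<Longrightarrow> S i (S j (S i (S j x))) = S j (S i (S j (S i x)))"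
    and "a i j * a j i = 3 \<Longrightarrow> S i (S j (S i (S j (S i (S j x))))) = S j (S i (S j (S i (S j (S i x)))))"
proof -
  have cases: "(a j i = - 1 \<and> a i j = - int N) \<or> (a i j = - 1 \<and> a j i = - int N)"
    if N: "a i j * a j i = int N" "N \<in> {1, 2, 3}" for N
  proof -
    have "a i j \<le> 0" "a j i \<le> 0" using a_off ij by auto
    then have "nat (- a i j) * nat (- a j i) = N" using N(1) by (simp flip: nat_mult_distrib_neg)
    \<comment> \<open>Two natural numbers whose product is prime or 1 include the number 1. Hence
      one of the Cartan integers is - 1, and the other is then determined.\<close>
    moreover have "prime N \<or> N = 1" using N(2) by auto
    ultimately have "nat (- a i j) = 1 \<or> nat (- a j i) = 1" by (metis One_nat_def prime_product nat_mult_eq_1_iff)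
    then have "a i j = - 1 \<or> a j i = - 1" by linarith
    then show ?thesis using N(1) by auto
  qed
  show "a i j * a j i = 1 \<Longrightarrow> S i (S j (S i x)) = S j (S i (S j x))"
    using cases[of 1] S_braid_ordered(1)[of j i 1 x] S_braid_ordered(1)[of i j 1 x] ij x by auto
  show "a i j * a j i = 2 \<Longrightarrow> S i (S j (S i (S j x))) = S j (S i (S j (S i x)))"
    using cases[of 2] S_braid_ordered(2)[of j i 2 x] S_braid_ordered(2)[of i j 2 x] ij x by auto
  show "a i j * a j i = 3 \<Longrightarrow> S i (S j (S i (S j (S i (S j x))))) = S j (S i (S j (S i (S j (S i x)))))"
    using cases[of 3] S_braid_ordered(3)[of j i 3 x] S_braid_ordered(3)[of i j 3 x] ij x by auto
qed

end

end

section \<open>Monoid algebras, quotients and tensor products\<close>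

definition msupp :: "('m \<Rightarrow> 'f::zero) \<Rightarrow> 'm set" where
  "msupp a = {m. a m \<noteq> 0}"

lemma monoid_algebra_simps:
  "a \<in> carrier (monoid_algebra M) \<longleftrightarrow> finite (msupp a) \<and> msupp a \<subseteq> carrier M"
  "a \<oplus>\<^bsub>monoid_algebra M\<^esub> b = (\<lambda>m. a m + b m)" "\<zero>\<^bsub>monoid_algebra M\<^esub> = (\<lambda>m. 0)"
  "\<one>\<^bsub>monoid_algebra M\<^esub> = basis_vec \<one>\<^bsub>M\<^esub>" "c \<odot>\<^bsub>monoid_algebra M\<^esub> a = (\<lambda>m. c * a m)"
  by (simp_all add: monoid_algebra_def msupp_def)

lemma monoid_algebra_mult:
  assumes "finite A" "finite B" "msupp a \<subseteq> A" "msupp b \<subseteq> B"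
  shows "(a \<otimes>\<^bsub>monoid_algebra M\<^esub> b) m = (\<Sum>u\<in>A. \<Sum>v\<in>B. if u \<otimes>\<^bsub>M\<^esub> v = m then a u * b v else 0)"
proof -
  have "(\<Sum>v\<in>msupp b. if u \<otimes>\<^bsub>M\<^esub> v = m then a u * b v else 0) = (\<Sum>v\<in>B. if u \<otimes>\<^bsub>M\<^esub> v = m then a u * b v else 0)" for u
    using assms by (intro sum.mono_neutral_left) (auto simp: msupp_def)
  then have "(a \<otimes>\<^bsub>monoid_algebra M\<^esub> b) m = (\<Sum>u\<in>msupp a. \<Sum>v\<in>B. if u \<otimes>\<^bsub>M\<^esub> v = m then a u * b v else 0)"
    by (simp add: monoid_algebra_def flip: msupp_def)
  also have "\<dots> = (\<Sum>u\<in>A. \<Sum>v\<in>B. if u \<otimes>\<^bsub>M\<^esub> v = m then a u * b v else 0)"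
    using assms by (intro sum.mono_neutral_left) (auto simp: msupp_def cong: if_cong)
  finally show ?thesis .
qed

lemma msupp_mult:
  assumes "finite (msupp a)" "finite (msupp b)"
  shows "msupp (a \<otimes>\<^bsub>monoid_algebra M\<^esub> b) \<subseteq> (\<lambda>(u, v). u \<otimes>\<^bsub>M\<^esub> v) ` (msupp a \<times> msupp b)"
proof
  fix m assume "m \<in> msupp (a \<otimes>\<^bsub>monoid_algebra M\<^esub> b)"
  then have "(\<Sum>u\<in>msupp a. \<Sum>v\<in>msupp b. if u \<otimes>\<^bsub>M\<^esub> v = m then a u * b v else 0) \<noteq> 0"
    using monoid_algebra_mult[OF assms order_refl order_refl, of M m] by (simp add: msupp_def)
  then obtain u where u: "u \<in> msupp a" "(\<Sum>v\<in>msupp b. if u \<otimes>\<^bsub>M\<^esub> v = m then a u * b v else 0) \<noteq> 0"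
    by (rule sum.not_neutral_contains_not_neutral)
  obtain v where "v \<in> msupp b" "(if u \<otimes>\<^bsub>M\<^esub> v = m then a u * b v else 0) \<noteq> 0"
    using u(2) by (rule sum.not_neutral_contains_not_neutral)
  then show "m \<in> (\<lambda>(u, v). u \<otimes>\<^bsub>M\<^esub> v) ` (msupp a \<times> msupp b)"
    using u(1) by (force split: if_splits)
qed

text \<open>The value at \<open>a\<close> of the linear extension of \<open>\<phi>\<close>. Elements
  are compared by pairing them with every \<open>\<phi>\<close>, which turns convolution into
  iterated pairing (\<open>mpair_mult\<close>); the algebra laws then follow from those of the
  monoid without handling double sums.\<close>

definition mpair :: "('m \<Rightarrow> 'f::field) \<Rightarrow> ('m \<Rightarrow> 'f) \<Rightarrow> 'f" where
  "mpair a \<phi> = (\<Sum>m\<in>msupp a. a m * \<phi> m)"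

lemma mpair_superset: "finite A \<Longrightarrow> msupp a \<subseteq> A \<Longrightarrow> mpair a \<phi> = (\<Sum>m\<in>A. a m * \<phi> m)"
  unfolding mpair_def by (intro sum.mono_neutral_left) (auto simp: msupp_def)

lemma mpair_add: "finite (msupp a) \<Longrightarrow> finite (msupp b) \<Longrightarrow> mpair (\<lambda>m. a m + b m) \<phi> = mpair a \<phi> + mpair b \<phi>"
proof -
  assume "finite (msupp a)" "finite (msupp b)"
  then have f: "finite (msupp a \<union> msupp b)" by simp
  have "msupp (\<lambda>m. a m + b m) \<subseteq> msupp a \<union> msupp b" by (auto simp: msupp_def)
  then show ?thesis
    using mpair_superset[OF f, of _ \<phi>] by (simp add: distrib_right sum.distrib)
qed

lemma mpair_smult: "finite (msupp a) \<Longrightarrow> mpair (\<lambda>m. c * a m) \<phi> = c * mpair a \<phi>"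
proof -
  assume f: "finite (msupp a)"
  have "msupp (\<lambda>m. c * a m) \<subseteq> msupp a" by (auto simp: msupp_def)
  from mpair_superset[OF f this] show ?thesis by (simp add: mpair_def sum_distrib_left mult.assoc)
qed

lemma mpair_basis: "mpair (basis_vec u) \<phi> = \<phi> u"
proof -
  have "msupp (basis_vec u :: 'b \<Rightarrow> 'a) \<subseteq> {u}" by (auto simp: msupp_def basis_vec_def)
  from mpair_superset[OF _ this] show ?thesis by (simp add: basis_vec_def)
qed

lemma mpair_mult:
  assumes a: "finite (msupp a)" and b: "finite (msupp b)"
  shows "mpair (a \<otimes>\<^bsub>monoid_algebra M\<^esub> b) \<phi> = mpair a (\<lambda>u. mpair b (\<lambda>v. \<phi> (u \<otimes>\<^bsub>M\<^esub> v)))"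
proof -
  let ?I = "(\<lambda>(u, v). u \<otimes>\<^bsub>M\<^esub> v) ` (msupp a \<times> msupp b)"
  have fin: "finite ?I" using a b by simp
  have "mpair (a \<otimes>\<^bsub>monoid_algebra M\<^esub> b) \<phi> = (\<Sum>m\<in>?I. (a \<otimes>\<^bsub>monoid_algebra M\<^esub> b) m * \<phi> m)"
    by (rule mpair_superset[OF fin msupp_mult[OF a b]])
  also have "\<dots> = (\<Sum>m\<in>?I. \<Sum>u\<in>msupp a. \<Sum>v\<in>msupp b. (if u \<otimes>\<^bsub>M\<^esub> v = m then a u * b v * \<phi> m else 0))"
    unfolding monoid_algebra_mult[OF a b order_refl order_refl] sum_distrib_right
    by (intro sum.cong refl) simp
  also have "\<dots> = (\<Sum>u\<in>msupp a. \<Sum>v\<in>msupp b. \<Sum>m\<in>?I. (if u \<otimes>\<^bsub>M\<^esub> v = m then a u * b v * \<phi> m else 0))"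
  proof -
    have "(\<Sum>m\<in>?I. \<Sum>u\<in>msupp a. g m u) = (\<Sum>u\<in>msupp a. \<Sum>m\<in>?I. g m u)" for g :: "'a \<Rightarrow> 'a \<Rightarrow> 'b"
      by (rule sum.swap)
    moreover have "(\<Sum>m\<in>?I. \<Sum>v\<in>msupp b. g m v) = (\<Sum>v\<in>msupp b. \<Sum>m\<in>?I. g m v)" for g :: "'a \<Rightarrow> 'a \<Rightarrow> 'b"
      by (rule sum.swap)
    ultimately show ?thesis by presburger
  qed
  also have "\<dots> = (\<Sum>u\<in>msupp a. \<Sum>v\<in>msupp b. a u * b v * \<phi> (u \<otimes>\<^bsub>M\<^esub> v))"
    using fin by (intro sum.cong refl) (auto simp: sum.delta)
  finally show ?thesis by (simp add: mpair_def sum_distrib_left mult.assoc)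
qed

lemma monoid_algebra_eqI:
  assumes "\<And>\<phi>. mpair a \<phi> = mpair b \<phi>" "finite (msupp a)" "finite (msupp b)"
  shows "a = b"
proof
  fix m
  have "mpair c (basis_vec m) = c m" if "finite (msupp c)" for c :: "'a \<Rightarrow> 'b"
    using mpair_superset[of "insert m (msupp c)" c "basis_vec m"] that
    by (simp add: basis_vec_def if_distrib[of "\<lambda>x. _ * x"] sum.delta cong: if_cong)
      (auto simp: msupp_def split: if_splits)
  then show "a m = b m" using assms by metis
qed

lemma monoid_algebra_closed:
  fixes M :: "'m monoid" and a b :: "'m \<Rightarrow> 'f::field"
  assumes "monoid M"
  shows "a \<in> carrier (monoid_algebra M) \<Longrightarrow> b \<in> carrier (monoid_algebra M) \<Longrightarrow>
      a \<otimes>\<^bsub>monoid_algebra M\<^esub> b \<in> carrier (monoid_algebra M)"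
    and "a \<in> carrier (monoid_algebra M) \<Longrightarrow> b \<in> carrier (monoid_algebra M) \<Longrightarrow>
      a \<oplus>\<^bsub>monoid_algebra M\<^esub> b \<in> carrier (monoid_algebra M)"
    and "a \<in> carrier (monoid_algebra M) \<Longrightarrow> c \<odot>\<^bsub>monoid_algebra M\<^esub> a \<in> carrier (monoid_algebra M)"
    and "u \<in> carrier M \<Longrightarrow> (basis_vec u :: 'm \<Rightarrow> 'f) \<in> carrier (monoid_algebra M)"
proof -
  interpret M: monoid M by fact
  show "a \<otimes>\<^bsub>monoid_algebra M\<^esub> b \<in> carrier (monoid_algebra M)"
    if "a \<in> carrier (monoid_algebra M)" "b \<in> carrier (monoid_algebra M)"
  proof -
    have ab: "finite (msupp a)" "finite (msupp b)" "msupp a \<subseteq> carrier M" "msupp b \<subseteq> carrier M"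
      using that by (simp_all add: monoid_algebra_simps)
    have "(\<lambda>(u, v). u \<otimes>\<^bsub>M\<^esub> v) ` (msupp a \<times> msupp b) \<subseteq> carrier M" using ab by auto
    then show ?thesis
      using msupp_mult[OF ab(1,2), of M] ab finite_subset[OF msupp_mult[OF ab(1,2), of M]]
      by (auto simp: monoid_algebra_simps)
  qed
  show "a \<oplus>\<^bsub>monoid_algebra M\<^esub> b \<in> carrier (monoid_algebra M)"
    if "a \<in> carrier (monoid_algebra M)" "b \<in> carrier (monoid_algebra M)"
  proof -
    have "msupp (\<lambda>m. a m + b m) \<subseteq> msupp a \<union> msupp b" by (auto simp: msupp_def)
    then show ?thesis using that by (auto simp: monoid_algebra_simps intro: finite_subset)
  qed
  show "c \<odot>\<^bsub>monoid_algebra M\<^esub> a \<in> carrier (monoid_algebra M)" if "a \<in> carrier (monoid_algebra M)"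
  proof -
    have "msupp (\<lambda>m. c * a m) \<subseteq> msupp a" by (auto simp: msupp_def)
    then show ?thesis using that by (auto simp: monoid_algebra_simps intro: finite_subset)
  qed
  show "(basis_vec u :: 'm \<Rightarrow> 'f) \<in> carrier (monoid_algebra M)" if "u \<in> carrier M"
  proof -
    have "msupp (basis_vec u :: 'm \<Rightarrow> 'f) \<subseteq> {u}" by (auto simp: msupp_def basis_vec_def)
    then show ?thesis using that by (auto simp: monoid_algebra_simps intro: finite_subset)
  qed
qed

lemma assoc_algebra_monoid_algebra:
  fixes M :: "'m monoid" (structure)
  assumes "monoid M"
  shows "assoc_algebra (monoid_algebra M :: ('f::field, 'm \<Rightarrow> 'f) module)"
proof -
  interpret M: monoid M by fact
  let ?A = "monoid_algebra M :: ('f, 'm \<Rightarrow> 'f) module"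
  note cl = monoid_algebra_closed[OF assms]
  have fin: "finite (msupp a)" if "a \<in> carrier ?A" for a using that by (simp add: monoid_algebra_simps)
  have supp: "m \<in> msupp a \<Longrightarrow> m \<in> carrier M" if "a \<in> carrier ?A" for a m
    using that by (auto simp: monoid_algebra_simps)
  have cong: "mpair a \<phi> = mpair a \<psi>" if "\<And>m. m \<in> msupp a \<Longrightarrow> \<phi> m = \<psi> m" for a \<phi> \<psi> :: "'m \<Rightarrow> 'f"
    unfolding mpair_def using that by simp
  have padd: "mpair a (\<lambda>m. \<phi> m + \<psi> m) = mpair a \<phi> + mpair a \<psi>" for a \<phi> \<psi> :: "'m \<Rightarrow> 'f"
    unfolding mpair_def by (simp add: distrib_left sum.distrib)
  have psmult: "mpair a (\<lambda>m. c * \<phi> m) = c * mpair a \<phi>" for a \<phi> :: "'m \<Rightarrow> 'f" and c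
    unfolding mpair_def by (simp add: sum_distrib_left mult.left_commute)
  have madd: "mpair (a \<oplus>\<^bsub>?A\<^esub> b) \<phi> = mpair a \<phi> + mpair b \<phi>" if "a \<in> carrier ?A" "b \<in> carrier ?A" for a b \<phi>
    using that by (simp add: monoid_algebra_simps mpair_add)
  have msm: "mpair (c \<odot>\<^bsub>?A\<^esub> a) \<phi> = c * mpair a \<phi>" if "a \<in> carrier ?A" for a c \<phi>
    using that by (simp add: monoid_algebra_simps mpair_smult)
  have one: "\<one>\<^bsub>?A\<^esub> \<in> carrier ?A" using cl(4)[of "\<one>"] by (simp add: monoid_algebra_simps(4))
  have mone: "mpair \<one>\<^bsub>?A\<^esub> \<phi> = \<phi> \<one>" for \<phi> by (simp add: monoid_algebra_simps(4) mpair_basis)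
  note eqI = monoid_algebra_eqI[OF _ fin fin]
  have mm: "mpair (a \<otimes>\<^bsub>?A\<^esub> b) \<phi> = mpair a (\<lambda>u. mpair b (\<lambda>v. \<phi> (u \<otimes> v)))"
    if "a \<in> carrier ?A" "b \<in> carrier ?A" for a b \<phi>
    using that fin by (intro mpair_mult)
  have ring: "ring ?A"
  proof (rule ringI)
    show "abelian_group ?A"
    proof (rule abelian_groupI)
      show "\<exists>b\<in>carrier ?A. b \<oplus>\<^bsub>?A\<^esub> a = \<zero>\<^bsub>?A\<^esub>" if "a \<in> carrier ?A" for a
        using cl(3)[OF that, of "- 1"]
        by (intro bexI[of _ "(- 1) \<odot>\<^bsub>?A\<^esub> a"]) (auto simp: monoid_algebra_simps(2,3,5))
    qed (simp_all only: cl(2), auto simp: monoid_algebra_simps(2,3) add.assoc add.commute, simp add: monoid_algebra_simps msupp_def)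
    show "Group.monoid ?A"
    proof (rule monoidI)
      fix a b c assume abc: "a \<in> carrier ?A" "b \<in> carrier ?A" "c \<in> carrier ?A"
      show "a \<otimes>\<^bsub>?A\<^esub> b \<otimes>\<^bsub>?A\<^esub> c = a \<otimes>\<^bsub>?A\<^esub> (b \<otimes>\<^bsub>?A\<^esub> c)"
      proof (rule eqI)
        fix \<phi>
        show "mpair (a \<otimes>\<^bsub>?A\<^esub> b \<otimes>\<^bsub>?A\<^esub> c) \<phi> = mpair (a \<otimes>\<^bsub>?A\<^esub> (b \<otimes>\<^bsub>?A\<^esub> c)) \<phi>"
          using abc by (simp add: mm cl(1)) (intro cong, simp add: M.m_assoc supp)
      qed (use abc cl(1) in auto)
    next
      fix a assume a: "a \<in> carrier ?A"
      show "\<one>\<^bsub>?A\<^esub> \<otimes>\<^bsub>?A\<^esub> a = a"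
      proof (rule eqI)
        fix \<phi> show "mpair (\<one>\<^bsub>?A\<^esub> \<otimes>\<^bsub>?A\<^esub> a) \<phi> = mpair a \<phi>"
          using a one by (simp add: mm mone) (intro cong, simp add: supp)
      qed (use a one cl(1) in auto)
      show "a \<otimes>\<^bsub>?A\<^esub> \<one>\<^bsub>?A\<^esub> = a"
      proof (rule eqI)
        fix \<phi> show "mpair (a \<otimes>\<^bsub>?A\<^esub> \<one>\<^bsub>?A\<^esub>) \<phi> = mpair a \<phi>"
          using a one by (simp add: mm mone) (intro cong, simp add: supp)
      qed (use a one cl(1) in auto)
    qed (auto simp: cl(1) one)
    fix a b c assume abc: "a \<in> carrier ?A" "b \<in> carrier ?A" "c \<in> carrier ?A"
    show "(a \<oplus>\<^bsub>?A\<^esub> b) \<otimes>\<^bsub>?A\<^esub> c = a \<otimes>\<^bsub>?A\<^esub> c \<oplus>\<^bsub>?A\<^esub> b \<otimes>\<^bsub>?A\<^esub> c"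
      by (rule eqI) (use abc in \<open>simp_all add: mm madd cl\<close>)
    show "c \<otimes>\<^bsub>?A\<^esub> (a \<oplus>\<^bsub>?A\<^esub> b) = c \<otimes>\<^bsub>?A\<^esub> a \<oplus>\<^bsub>?A\<^esub> c \<otimes>\<^bsub>?A\<^esub> b"
      by (rule eqI) (use abc in \<open>simp_all add: mm madd padd cl\<close>)
  qed
  show ?thesis
    unfolding assoc_algebra_def
  proof (intro conjI allI ballI ring cl(3))
    fix c a b assume ab: "a \<in> carrier ?A" "b \<in> carrier ?A"
    show "c \<odot>\<^bsub>?A\<^esub> (a \<otimes>\<^bsub>?A\<^esub> b) = (c \<odot>\<^bsub>?A\<^esub> a) \<otimes>\<^bsub>?A\<^esub> b"
      by (rule eqI) (use ab in \<open>simp_all add: mm msm cl\<close>)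
    show "c \<odot>\<^bsub>?A\<^esub> (a \<otimes>\<^bsub>?A\<^esub> b) = a \<otimes>\<^bsub>?A\<^esub> (c \<odot>\<^bsub>?A\<^esub> b)"
      by (rule eqI) (use ab in \<open>simp_all add: mm msm psmult cl\<close>)
  qed (auto simp: monoid_algebra_simps(2,5) algebra_simps)
qed

lemma assoc_algebraD:
  fixes A (structure)
  assumes "assoc_algebra A"
  shows "ring A" and "x \<in> carrier A \<Longrightarrow> c \<odot> x \<in> carrier A"
    and "x \<in> carrier A \<Longrightarrow> 1 \<odot> x = x"
    and "x \<in> carrier A \<Longrightarrow> (b * c) \<odot> x = b \<odot> (c \<odot> x)"
    and "x \<in> carrier A \<Longrightarrow> (b + c) \<odot> x = b \<odot> x \<oplus> c \<odot> x"
    and "x \<in> carrier A \<Longrightarrow> y \<in> carrier A \<Longrightarrow> c \<odot> (x \<oplus> y) = c \<odot> x \<oplus> c \<odot> y"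
    and "x \<in> carrier A \<Longrightarrow> y \<in> carrier A \<Longrightarrow> (c \<odot> x) \<otimes> y = c \<odot> (x \<otimes> y)"
    and "x \<in> carrier A \<Longrightarrow> y \<in> carrier A \<Longrightarrow> x \<otimes> (c \<odot> y) = c \<odot> (x \<otimes> y)"
proof -
  note a = assms[unfolded assoc_algebra_def]
  show "ring A" and "x \<in> carrier A \<Longrightarrow> c \<odot> x \<in> carrier A"
    and "x \<in> carrier A \<Longrightarrow> 1 \<odot> x = x"
    and "x \<in> carrier A \<Longrightarrow> (b * c) \<odot> x = b \<odot> (c \<odot> x)"
    and "x \<in> carrier A \<Longrightarrow> (b + c) \<odot> x = b \<odot> x \<oplus> c \<odot> x"
    and "x \<in> carrier A \<Longrightarrow> y \<in> carrier A \<Longrightarrow> c \<odot> (x \<oplus> y) = c \<odot> x \<oplus> c \<odot> y"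
    using a by blast+
  show "(c \<odot> x) \<otimes> y = c \<odot> (x \<otimes> y)" if "x \<in> carrier A" "y \<in> carrier A"
    using a that by metis
  show "x \<otimes> (c \<odot> y) = c \<odot> (x \<otimes> y)" if "x \<in> carrier A" "y \<in> carrier A"
    using a that by metis
qed

lemma smult_as_mult:
  fixes A (structure)
  assumes "assoc_algebra A" "x \<in> carrier A"
  shows "c \<odot> x = (c \<odot> \<one>) \<otimes> x"
proof -
  interpret ring A by (rule assoc_algebraD(1)[OF assms(1)])
  show ?thesis using assms by (simp add: assoc_algebraD)
qed

lemma quotient_algebra_simps:
  "carrier (quotient_algebra A J) = carrier (A Quot J)"
  "mult (quotient_algebra A J) = mult (A Quot J)"
  "one (quotient_algebra A J) = J +>\<^bsub>A\<^esub> \<one>\<^bsub>A\<^esub>"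
  "zero (quotient_algebra A J) = J"
  "add (quotient_algebra A J) = add (A Quot J)"
  by (simp_all add: quotient_algebra_def ring.extend_def module.fields_def FactRing_def)

text \<open>The union in the scalar action is over equal cosets: with \<open>j\<close> also
  \<open>c \<odot> j\<close> lies in the ideal, as it equals
  \<open>(c \<odot> \<one>) \<otimes> j\<close>.\<close>

lemma quotient_algebra_ops:
  fixes A (structure)
  assumes A: "assoc_algebra A" and J: "ideal J A" and x: "x \<in> carrier A"
  shows "J +> x \<in> carrier (quotient_algebra A J)"
    and "y \<in> carrier A \<Longrightarrow> (J +> x) \<otimes>\<^bsub>quotient_algebra A J\<^esub> (J +> y) = J +> (x \<otimes> y)"
    and "y \<in> carrier A \<Longrightarrow> (J +> x) \<oplus>\<^bsub>quotient_algebra A J\<^esub> (J +> y) = J +> (x \<oplus> y)"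
    and "c \<odot>\<^bsub>quotient_algebra A J\<^esub> (J +> x) = J +> (c \<odot> x)" (is ?R1)
proof -
  interpret J: ideal J A by fact
  show "J +> x \<in> carrier (quotient_algebra A J)"
    using x by (auto simp: quotient_algebra_simps FactRing_def A_RCOSETS_def')
  show "(J +> x) \<otimes>\<^bsub>quotient_algebra A J\<^esub> (J +> y) = J +> (x \<otimes> y)" if "y \<in> carrier A"
    using x that by (simp add: quotient_algebra_simps FactRing_def J.rcoset_mult_add)
  show "(J +> x) \<oplus>\<^bsub>quotient_algebra A J\<^esub> (J +> y) = J +> (x \<oplus> y)" if "y \<in> carrier A"
    using x that by (simp add: quotient_algebra_simps FactRing_def J.a_rcos_sum)
  have eq: "J +> (c \<odot> y) = J +> (c \<odot> x)" if "y \<in> J +> x" for y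
  proof -
    obtain j where j: "j \<in> J" "y = j \<oplus> x" using \<open>y \<in> J +> x\<close> unfolding a_r_coset_def' by blast
    then have jc: "j \<in> carrier A" using J.a_subset by auto
    have cj: "c \<odot> j \<in> J"
      unfolding smult_as_mult[OF A jc, of c] by (intro J.I_l_closed j assoc_algebraD(2)[OF A] J.one_closed)
    have "c \<odot> y \<in> J +> (c \<odot> x)"
      using cj assoc_algebraD(6)[OF A jc x] by (auto simp: j a_r_coset_def')
    then show ?thesis by (intro J.a_repr_independence[symmetric] assoc_algebraD(2)[OF A] x J.a_subgroup)
  qed
  have "(\<Union>y\<in>J +> x. J +> (c \<odot> y)) = (\<Union>y\<in>J +> x. J +> (c \<odot> x))"
    by (rule SUP_cong[OF refl eq])
  also have "\<dots> = J +> (c \<odot> x)" using J.a_rcos_self[OF x] by blast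
  finally show ?R1
    by (simp add: quotient_algebra_def ring.extend_def module.fields_def)
qed

lemma quotient_algebra_carrier:
  assumes "X \<in> carrier (quotient_algebra A J)"
  obtains x where "x \<in> carrier A" "X = J +>\<^bsub>A\<^esub> x"
  using assms that by (auto simp: quotient_algebra_simps FactRing_def A_RCOSETS_def')

lemma ring_cong:
  assumes "ring R" "carrier S = carrier R" "mult S = mult R" "one S = one R" "zero S = zero R" "add S = add R"
  shows "ring S"
proof -
  interpret R: ring R by fact
  show ?thesis
  proof (intro ringI abelian_groupI monoidI)
    show "\<exists>y\<in>carrier S. y \<oplus>\<^bsub>S\<^esub> x = \<zero>\<^bsub>S\<^esub>" if "x \<in> carrier S" for x
      using that R.l_neg R.a_inv_closed unfolding assms(2-6) by blast
  qed (simp_all add: assms(2-6) R.ring_simprules R.m_assoc)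
qed

lemma assoc_algebra_quotient:
  assumes A: "assoc_algebra A" and J: "ideal J A"
  shows "assoc_algebra (quotient_algebra A J)"
proof -
  let ?B = "quotient_algebra A J"
  interpret A: ring A by (rule assoc_algebraD(1)[OF A])
  note ops = quotient_algebra_ops[OF A J]
  note AD = assoc_algebraD[OF A]
  have "ring ?B"
    by (rule ring_cong[OF ideal.quotient_is_ring[OF J]]) (simp_all add: quotient_algebra_simps FactRing_def)
  then show ?thesis
    unfolding assoc_algebra_def
    by (intro conjI allI ballI; (assumption | (elim quotient_algebra_carrier; simp add: ops AD)))
qed

text \<open>The kernel of \<open>h\<close> is an ideal containing \<open>S\<close>, hence contains
  the generated ideal. So \<open>h\<close> is constant on cosets, and evaluating it at an
  arbitrarily chosen representative is legitimate.\<close>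

lemma quotient_algebra_hom:
  fixes A (structure)
  assumes A: "assoc_algebra A" and B: "assoc_algebra B" and h: "h \<in> alg_hom A B"
    and S: "S \<subseteq> carrier A" "\<And>s. s \<in> S \<Longrightarrow> h s = \<zero>\<^bsub>B\<^esub>"
  obtains H where "H \<in> alg_hom (quotient_algebra A (Idl S)) B" "\<And>x. x \<in> carrier A \<Longrightarrow> H (Idl S +> x) = h x"
proof -
  let ?J = "Idl S"
  interpret A: ring A by (rule assoc_algebraD(1)[OF A])
  interpret B: ring B by (rule assoc_algebraD(1)[OF B])
  have hr: "h \<in> ring_hom A B" and hs: "h (c \<odot> x) = c \<odot>\<^bsub>B\<^esub> h x" if "x \<in> carrier A" for c x
    using h that by (auto simp: alg_hom_def)
  interpret h: ring_hom_ring A B h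
    using h by (intro ring_hom_ringI2 A.ring_axioms B.ring_axioms) (auto simp: alg_hom_def)
  have J: "ideal ?J A" by (rule A.genideal_ideal[OF S(1)])
  interpret J: ideal ?J A by (rule J)
  have "?J \<subseteq> a_kernel A B h"
  proof (rule A.genideal_minimal[OF h.kernel_is_ideal])
    show "S \<subseteq> a_kernel A B h" unfolding a_kernel_def' using S by blast
  qed
  then have ker: "h j = \<zero>\<^bsub>B\<^esub>" if "j \<in> ?J" for j using that unfolding a_kernel_def' by blast
  have coset: "h y = h x" if x: "x \<in> carrier A" and y: "y \<in> ?J +> x" for x y
  proof -
    obtain j where j: "j \<in> ?J" "y = j \<oplus> x" using y unfolding a_r_coset_def' by blast
    then show ?thesis using x subsetD[OF J.a_subset j(1)] ker[OF j(1)] by (simp add: h.hom_add)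
  qed
  define H where "H X = h (SOME x. x \<in> X)" for X
  have H: "H (?J +> x) = h x" if "x \<in> carrier A" for x
    unfolding H_def by (rule coset[OF that], rule someI, rule J.a_rcos_self[OF that])
  note ops = quotient_algebra_ops[OF A J]
  have "H \<in> alg_hom (quotient_algebra A ?J) B"
    unfolding alg_hom_def
  proof (intro CollectI conjI allI ballI ring_hom_memI)
    show "H \<one>\<^bsub>quotient_algebra A ?J\<^esub> = \<one>\<^bsub>B\<^esub>" by (simp add: quotient_algebra_simps(3) H)
  qed (auto elim!: quotient_algebra_carrier simp: ops H hs assoc_algebraD(2)[OF A])
  then show thesis using H by (rule that)
qed

lemma generated_subalgebra_simps:
  "mult (generated_subalgebra A H) = mult A" "one (generated_subalgebra A H) = one A"
  "zero (generated_subalgebra A H) = zero A" "add (generated_subalgebra A H) = add A"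
  "smult (generated_subalgebra A H) = smult A"
  by (simp_all add: generated_subalgebra_def)

lemma
  fixes A (structure)
  assumes A: "assoc_algebra A" and H: "H \<subseteq> carrier A"
  shows generated_subalgebra_subset: "carrier (generated_subalgebra A H) \<subseteq> carrier A"
    and generated_subalgebra_incl: "H \<subseteq> carrier (generated_subalgebra A H)" (is ?R1)
    and assoc_algebra_generated: "assoc_algebra (generated_subalgebra A H)"
proof -
  interpret A: ring A by (rule assoc_algebraD(1)[OF A])
  let ?H = "H \<union> {c \<odot> \<one> | c. True}"
  let ?G = "generate_ring A ?H"
  have H': "?H \<subseteq> carrier A" using H by (auto intro: assoc_algebraD(2)[OF A])
  have sub: "subring ?G A" by (rule A.generate_ring_is_subring[OF H'])
  have inc: "?H \<subseteq> ?G" by (auto intro: generate_ring.incl)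
  have c: "carrier (generated_subalgebra A H) = ?G" by (simp add: generated_subalgebra_def)
  show le: "carrier (generated_subalgebra A H) \<subseteq> carrier A" unfolding c by (rule subringE(1)[OF sub])
  show ?R1 unfolding c using inc by auto
  have ring: "ring (generated_subalgebra A H)"
    by (rule ring_cong[OF A.subring_is_ring[OF sub]]) (simp_all add: generated_subalgebra_def)
  have sm: "k \<odot> x \<in> ?G" if "x \<in> ?G" for k x
  proof -
    have "(k \<odot> \<one>) \<otimes> x \<in> ?G" using inc that by (intro subringE(6)[OF sub]) auto
    then show ?thesis using smult_as_mult[OF A, of x k] le c that by auto
  qed
  show "assoc_algebra (generated_subalgebra A H)"
    unfolding assoc_algebra_def
    using ring sm le assoc_algebraD(3-)[OF A] by (auto simp: generated_subalgebra_simps c subset_iff)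
qed

lemma alg_homD:
  fixes A (structure)
  assumes "h \<in> alg_hom A B"
  shows "x \<in> carrier A \<Longrightarrow> h x \<in> carrier B"
    and "x \<in> carrier A \<Longrightarrow> y \<in> carrier A \<Longrightarrow> h (x \<otimes> y) = h x \<otimes>\<^bsub>B\<^esub> h y"
    and "x \<in> carrier A \<Longrightarrow> y \<in> carrier A \<Longrightarrow> h (x \<oplus> y) = h x \<oplus>\<^bsub>B\<^esub> h y"
    and "h \<one> = \<one>\<^bsub>B\<^esub>" and "x \<in> carrier A \<Longrightarrow> h (c \<odot> x) = c \<odot>\<^bsub>B\<^esub> h x"
  using assms by (auto simp: alg_hom_def ring_hom_def)

lemma relators_closed:
  assumes A: "assoc_algebra A" and R: "R \<subseteq> carrier A \<times> carrier A"
  shows "relators A R \<subseteq> carrier A"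
proof -
  interpret A: ring A by (rule assoc_algebraD(1)[OF A])
  show ?thesis using R by (auto simp: relators_def)
qed

lemma ideal_relators:
  assumes A: "assoc_algebra A" and R: "R \<subseteq> carrier A \<times> carrier A"
  shows "ideal (Idl\<^bsub>A\<^esub> (relators A R)) A"
  by (rule ring.genideal_ideal[OF assoc_algebraD(1)[OF A] relators_closed[OF A R]])

lemma relation_holds:
  fixes A (structure)
  assumes A: "assoc_algebra A" and R: "R \<subseteq> carrier A \<times> carrier A" and lr: "(l, r) \<in> R"
  shows "Idl (relators A R) +> l = Idl (relators A R) +> r"
proof -
  interpret A: ring A by (rule assoc_algebraD(1)[OF A])
  interpret J: ideal "Idl (relators A R)" A by (rule ideal_relators[OF A R])
  have c: "l \<in> carrier A" "r \<in> carrier A" using R lr by auto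
  have "l \<ominus> r \<in> relators A R" using lr by (auto simp: relators_def)
  then have "l \<ominus> r \<in> Idl (relators A R)"
    using A.genideal_self[OF relators_closed[OF A R]] by blast
  moreover have "l = (l \<ominus> r) \<oplus> r" using c by (simp add: a_minus_def A.a_assoc A.l_neg)
  ultimately have "l \<in> Idl (relators A R) +> r" unfolding a_r_coset_def' by blast
  then show ?thesis using J.a_repr_independence'[OF _ c(2)] by metis
qed

lemma relation_hom:
  fixes A (structure)
  assumes A: "assoc_algebra A" and B: "assoc_algebra B" and h: "h \<in> alg_hom A B"
    and R: "R \<subseteq> carrier A \<times> carrier A" "\<And>l r. (l, r) \<in> R \<Longrightarrow> h l = h r"
  obtains H where "H \<in> alg_hom (quotient_algebra A (Idl (relators A R))) B"
    "\<And>x. x \<in> carrier A \<Longrightarrow> H (Idl (relators A R) +> x) = h x"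
proof (rule quotient_algebra_hom[OF A B h relators_closed[OF A R(1)]])
  interpret A: ring A by (rule assoc_algebraD(1)[OF A])
  interpret B: ring B by (rule assoc_algebraD(1)[OF B])
  interpret h: ring_hom_ring A B h
    using h by (intro ring_hom_ringI2 A.ring_axioms B.ring_axioms) (auto simp: alg_hom_def)
  fix s assume "s \<in> relators A R"
  then obtain l r where s: "s = l \<ominus> r" and lr: "(l, r) \<in> R" unfolding relators_def by blast
  have c: "l \<in> carrier A" "r \<in> carrier A" using R(1) lr by auto
  show "h s = \<zero>\<^bsub>B\<^esub>"
    unfolding s a_minus_def using c R(2)[OF lr] h.hom_closed[OF c(2)]
    by (simp add: B.r_neg)
qed (rule that)

section \<open>Representation by weighted shifts\<close>

definition op_algebra :: "('f::field, ('w \<Rightarrow> 'f) \<Rightarrow> 'w \<Rightarrow> 'f) module" where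
  "op_algebra =
     \<lparr>carrier = {T. (\<forall>\<psi> \<chi>. T (\<lambda>w. \<psi> w + \<chi> w) = (\<lambda>w. T \<psi> w + T \<chi> w)) \<and>
        (\<forall>c \<psi>. T (\<lambda>w. c * \<psi> w) = (\<lambda>w. c * T \<psi> w))},
      mult = (\<circ>), one = id, zero = (\<lambda>\<psi> w. 0), add = (\<lambda>S T \<psi> w. S \<psi> w + T \<psi> w),
      smult = (\<lambda>c T \<psi> w. c * T \<psi> w)\<rparr>"

lemma op_algebra_simps:
  "T \<in> carrier op_algebra \<longleftrightarrow> (\<forall>\<psi> \<chi>. T (\<lambda>w. \<psi> w + \<chi> w) = (\<lambda>w. T \<psi> w + T \<chi> w)) \<and>
     (\<forall>c \<psi>. T (\<lambda>w. c * \<psi> w) = (\<lambda>w. c * T \<psi> w))"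
  "S \<otimes>\<^bsub>op_algebra\<^esub> T = S \<circ> T" "\<one>\<^bsub>op_algebra\<^esub> = id" "\<zero>\<^bsub>op_algebra\<^esub> = (\<lambda>\<psi> w. 0)"
  "S \<oplus>\<^bsub>op_algebra\<^esub> T = (\<lambda>\<psi> w. S \<psi> w + T \<psi> w)" "c \<odot>\<^bsub>op_algebra\<^esub> T = (\<lambda>\<psi> w. c * T \<psi> w)"
  by (simp_all add: op_algebra_def)

lemma assoc_algebra_op: "assoc_algebra (op_algebra :: ('f::field, ('w \<Rightarrow> 'f) \<Rightarrow> 'w \<Rightarrow> 'f) module)"
proof -
  let ?A = "op_algebra :: ('f, ('w \<Rightarrow> 'f) \<Rightarrow> 'w \<Rightarrow> 'f) module"
  have neg: "\<exists>S\<in>carrier ?A. S \<oplus>\<^bsub>?A\<^esub> T = \<zero>\<^bsub>?A\<^esub>" if "T \<in> carrier ?A" for T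
    using that by (intro bexI[of _ "\<lambda>\<psi> w. - T \<psi> w"]) (auto simp: op_algebra_simps)
  have "ring ?A"
    by (intro ringI abelian_groupI monoidI neg)
      (auto simp: op_algebra_simps algebra_simps)
  then show ?thesis
    unfolding assoc_algebra_def by (auto simp: op_algebra_simps algebra_simps)
qed

lemma op_algebra_sum:
  assumes "T \<in> carrier op_algebra"
  shows "T (\<lambda>w. \<Sum>v\<in>V. c v * \<chi> v w) = (\<lambda>w. \<Sum>v\<in>V. c v * T (\<chi> v) w)"
proof -
  have add: "T (\<lambda>w. \<psi> w + \<chi> w) = (\<lambda>w. T \<psi> w + T \<chi> w)" and sm: "T (\<lambda>w. c * \<psi> w) = (\<lambda>w. c * T \<psi> w)" for \<psi> \<chi> c
    using assms unfolding op_algebra_simps by blast+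
  have z: "T (\<lambda>w. 0) = (\<lambda>w. 0)" using sm[of 0 "\<lambda>w. 0"] by simp
  show ?thesis
    by (induction V rule: infinite_finite_induct) (simp_all add: z add sm)
qed

definition op_ext :: "('m \<Rightarrow> ('w \<Rightarrow> 'f) \<Rightarrow> 'w \<Rightarrow> 'f::field) \<Rightarrow> ('m \<Rightarrow> 'f) \<Rightarrow> ('w \<Rightarrow> 'f) \<Rightarrow> 'w \<Rightarrow> 'f" where
  "op_ext \<phi> a = (\<lambda>\<psi> w. mpair a (\<lambda>m. \<phi> m \<psi> w))"

lemma op_ext_basis: "op_ext \<phi> (basis_vec m) = \<phi> m"
  by (simp add: op_ext_def mpair_basis)

lemma op_ext_commute:
  assumes "T \<in> carrier op_algebra" "\<And>m. m \<in> msupp a \<Longrightarrow> T \<circ> \<phi> m = \<phi> m \<circ> T"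
  shows "T \<circ> op_ext \<phi> a = op_ext \<phi> a \<circ> T"
proof (intro ext)
  fix \<psi> w
  have "T (\<phi> m \<psi>) = \<phi> m (T \<psi>)" if "m \<in> msupp a" for m using assms(2)[OF that] by (metis comp_apply)
  then show "(T \<circ> op_ext \<phi> a) \<psi> w = (op_ext \<phi> a \<circ> T) \<psi> w"
    by (simp add: op_ext_def mpair_def op_algebra_sum[OF assms(1)])
qed

lemma op_ext_hom:
  fixes M :: "'m monoid" (structure) and \<phi> :: "'m \<Rightarrow> ('w \<Rightarrow> 'f::field) \<Rightarrow> 'w \<Rightarrow> 'f"
  assumes M: "monoid M" and \<phi>: "\<And>m. m \<in> carrier M \<Longrightarrow> \<phi> m \<in> carrier op_algebra"
    "\<And>u v. u \<in> carrier M \<Longrightarrow> v \<in> carrier M \<Longrightarrow> \<phi> (u \<otimes> v) = \<phi> u \<circ> \<phi> v" "\<phi> \<one> = id"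
  shows "op_ext \<phi> \<in> alg_hom (monoid_algebra M) op_algebra"
  unfolding alg_hom_def
proof (intro CollectI conjI ring_hom_memI allI ballI)
  have fin: "finite (msupp a)" if "a \<in> carrier (monoid_algebra M)" for a :: "'m \<Rightarrow> 'f"
    using that by (simp add: monoid_algebra_simps)
  have supp: "m \<in> carrier M" if "a \<in> carrier (monoid_algebra M)" "m \<in> msupp a" for a :: "'m \<Rightarrow> 'f" and m
    using that by (auto simp: monoid_algebra_simps)
  show "op_ext \<phi> \<one>\<^bsub>monoid_algebra M\<^esub> = \<one>\<^bsub>op_algebra\<^esub>"
    by (simp only: monoid_algebra_simps op_algebra_simps op_ext_basis \<phi>(3))
  fix a :: "'m \<Rightarrow> 'f" assume a: "a \<in> carrier (monoid_algebra M)"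
  have add: "\<phi> m (\<lambda>w. \<psi> w + \<chi> w) = (\<lambda>w. \<phi> m \<psi> w + \<phi> m \<chi> w)"
    and sm: "\<phi> m (\<lambda>w. c * \<psi> w) = (\<lambda>w. c * \<phi> m \<psi> w)" if "m \<in> msupp a" for m \<psi> \<chi> c
    using \<phi>(1)[OF supp[OF a that]] unfolding op_algebra_simps by blast+
  show "op_ext \<phi> a \<in> carrier op_algebra"
    by (simp add: op_algebra_simps op_ext_def mpair_def add sm distrib_left sum.distrib
        sum_distrib_left mult.left_commute)
  show "op_ext \<phi> (c \<odot>\<^bsub>monoid_algebra M\<^esub> a) = c \<odot>\<^bsub>op_algebra\<^esub> op_ext \<phi> a" for c
    using fin[OF a] by (simp add: monoid_algebra_simps op_algebra_simps op_ext_def mpair_smult)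
  fix b :: "'m \<Rightarrow> 'f" assume b: "b \<in> carrier (monoid_algebra M)"
  show "op_ext \<phi> (a \<oplus>\<^bsub>monoid_algebra M\<^esub> b) = op_ext \<phi> a \<oplus>\<^bsub>op_algebra\<^esub> op_ext \<phi> b"
    using fin[OF a] fin[OF b] by (simp add: monoid_algebra_simps op_algebra_simps op_ext_def mpair_add)
  have \<phi>m: "\<phi> (u \<otimes> v) = \<phi> u \<circ> \<phi> v" if "u \<in> msupp a" "v \<in> msupp b" for u v
    using that by (intro \<phi>(2) supp[OF a] supp[OF b])
  show "op_ext \<phi> (a \<otimes>\<^bsub>monoid_algebra M\<^esub> b) = op_ext \<phi> a \<otimes>\<^bsub>op_algebra\<^esub> op_ext \<phi> b"
    unfolding op_algebra_simps
    by (simp add: op_ext_def mpair_mult[OF fin[OF a] fin[OF b]] fun_eq_iff)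
      (simp add: mpair_def \<phi>m op_algebra_sum[OF \<phi>(1)[OF supp[OF a]]])
qed

section \<open>Tensor products and their representations\<close>

lemma pair_monoid:
  assumes "assoc_algebra A" "assoc_algebra B"
  shows "monoid (A \<times>\<times> B)"
  using assms by (intro DirProd_monoid ring.is_monoid assoc_algebraD(1))

lemmas assoc_algebra_pair = assoc_algebra_monoid_algebra[OF pair_monoid]

lemma bilinearity_closed:
  assumes A: "assoc_algebra A" and B: "assoc_algebra B"
  shows "bilinearity A B \<subseteq> carrier (pair_algebra A B) \<times> carrier (pair_algebra A B)"
proof -
  interpret A: ring A by (rule assoc_algebraD(1)[OF A])
  interpret B: ring B by (rule assoc_algebraD(1)[OF B])
  note cl = monoid_algebra_closed[OF pair_monoid[OF A B]]
  show ?thesis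
    unfolding bilinearity_def
    by (auto intro!: cl(2-4) simp: assoc_algebraD(2)[OF A] assoc_algebraD(2)[OF B])
qed

lemma tensor_quotient:
  "tensor_algebra A B = quotient_algebra (pair_algebra A B)
     (Idl\<^bsub>pair_algebra A B\<^esub> (relators (pair_algebra A B) (bilinearity A B)))"
  by (simp add: tensor_algebra_def tensor_ideal_def)

lemma finite_msupp_basis: "finite (msupp (basis_vec u))"
  by (rule finite_subset[of _ "{u}"]) (auto simp: msupp_def basis_vec_def)

lemma basis_vec_mult:
  "basis_vec u \<otimes>\<^bsub>monoid_algebra M\<^esub> basis_vec v = basis_vec (u \<otimes>\<^bsub>M\<^esub> v)"
proof (rule monoid_algebra_eqI[OF _ _ finite_msupp_basis])
  show "mpair (basis_vec u \<otimes>\<^bsub>monoid_algebra M\<^esub> basis_vec v) \<phi> = mpair (basis_vec (u \<otimes>\<^bsub>M\<^esub> v)) \<phi>" for \<phi>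
    by (simp add: mpair_mult finite_msupp_basis mpair_basis)
qed (rule finite_subset[OF msupp_mult[OF finite_msupp_basis finite_msupp_basis]], simp add: finite_msupp_basis)

lemma
  fixes A :: "('f::field, 'a) module" (structure) and B :: "('f, 'b) module"
  assumes A: "assoc_algebra A" and B: "assoc_algebra B"
  shows assoc_algebra_tensor: "assoc_algebra (tensor_algebra A B)"
    and pure_tensor_closed: "a \<in> carrier A \<Longrightarrow> b \<in> carrier B \<Longrightarrow> pure_tensor A B a b \<in> carrier (tensor_algebra A B)"
    and pure_tensor_one: "\<one>\<^bsub>tensor_algebra A B\<^esub> = pure_tensor A B \<one> \<one>\<^bsub>B\<^esub>" (is ?R1)
    and pure_tensor_mult: "a \<in> carrier A \<Longrightarrow> b \<in> carrier B \<Longrightarrow> a' \<in> carrier A \<Longrightarrow> b' \<in> carrier B \<Longrightarrow>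
      pure_tensor A B a b \<otimes>\<^bsub>tensor_algebra A B\<^esub> pure_tensor A B a' b' = pure_tensor A B (a \<otimes> a') (b \<otimes>\<^bsub>B\<^esub> b')"
    and pure_tensor_smult_left: "a \<in> carrier A \<Longrightarrow> b \<in> carrier B \<Longrightarrow>
      pure_tensor A B (c \<odot> a) b = c \<odot>\<^bsub>tensor_algebra A B\<^esub> pure_tensor A B a b"
    and pure_tensor_smult_right: "a \<in> carrier A \<Longrightarrow> b \<in> carrier B \<Longrightarrow>
      pure_tensor A B a (c \<odot>\<^bsub>B\<^esub> b) = c \<odot>\<^bsub>tensor_algebra A B\<^esub> pure_tensor A B a b"
    and tensor_algebra_carrier: "X \<in> carrier (tensor_algebra A B) \<Longrightarrow>
      \<exists>a\<in>carrier (pair_algebra A B). X = tensor_ideal A B +>\<^bsub>pair_algebra A B\<^esub> a"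
proof -
  let ?P = "pair_algebra A B"
  note P = assoc_algebra_pair[OF A B]
  have J: "ideal (tensor_ideal A B) ?P"
    unfolding tensor_ideal_def by (rule ideal_relators[OF P bilinearity_closed[OF A B]])
  note ops = quotient_algebra_ops[OF P J, folded tensor_algebra_def]
  note cl = monoid_algebra_closed[OF pair_monoid[OF A B]]
  have bv: "(basis_vec (a, b) :: _ \<Rightarrow> 'f) \<in> carrier ?P" if "a \<in> carrier A" "b \<in> carrier B" for a b
    by (rule cl(4)) (use that in simp)
  note rel = relation_holds[OF P bilinearity_closed[OF A B], folded tensor_ideal_def]
  show "assoc_algebra (tensor_algebra A B)"
    unfolding tensor_algebra_def by (rule assoc_algebra_quotient[OF P J])
  show "pure_tensor A B a b \<in> carrier (tensor_algebra A B)" if "a \<in> carrier A" "b \<in> carrier B"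
    unfolding pure_tensor_def by (rule ops(1)[OF bv[OF that]])
  show ?R1
    by (simp add: tensor_algebra_def quotient_algebra_simps pure_tensor_def monoid_algebra_simps)
  show "pure_tensor A B a b \<otimes>\<^bsub>tensor_algebra A B\<^esub> pure_tensor A B a' b' = pure_tensor A B (a \<otimes> a') (b \<otimes>\<^bsub>B\<^esub> b')"
    if "a \<in> carrier A" "b \<in> carrier B" "a' \<in> carrier A" "b' \<in> carrier B"
    unfolding pure_tensor_def using that by (simp add: ops(2) bv basis_vec_mult)
  show "pure_tensor A B (c \<odot> a) b = c \<odot>\<^bsub>tensor_algebra A B\<^esub> pure_tensor A B a b"
    if "a \<in> carrier A" "b \<in> carrier B"
    unfolding pure_tensor_def ops(4)[OF bv[OF that]] by (rule rel) (use that in \<open>auto simp: bilinearity_def\<close>)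
  show "pure_tensor A B a (c \<odot>\<^bsub>B\<^esub> b) = c \<odot>\<^bsub>tensor_algebra A B\<^esub> pure_tensor A B a b"
    if "a \<in> carrier A" "b \<in> carrier B"
    unfolding pure_tensor_def ops(4)[OF bv[OF that]]
    by (rule rel, unfold bilinearity_def, rule UnI2) (use that in blast)
  show "\<exists>a\<in>carrier ?P. X = tensor_ideal A B +>\<^bsub>?P\<^esub> a" if "X \<in> carrier (tensor_algebra A B)"
    using that unfolding tensor_algebra_def by (rule quotient_algebra_carrier) blast
qed

text \<open>Commutation of the two actions makes the map on pairs multiplicative, and linearity of
  each makes it respect the bilinearity relations. The last conclusion describes \<open>H\<close> on
  arbitrary classes, since a general element is not a pure tensor.\<close>

lemma tensor_algebra_hom:
  fixes A :: "('f::field, 'a) module" and B :: "('f, 'b) module"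
    and \<alpha> :: "'a \<Rightarrow> ('w \<Rightarrow> 'f) \<Rightarrow> 'w \<Rightarrow> 'f"
  assumes A: "assoc_algebra A" and B: "assoc_algebra B"
    and \<alpha>: "\<alpha> \<in> alg_hom A op_algebra" and \<beta>: "\<beta> \<in> alg_hom B op_algebra"
    and comm: "\<And>a b. a \<in> carrier A \<Longrightarrow> b \<in> carrier B \<Longrightarrow> \<alpha> a \<circ> \<beta> b = \<beta> b \<circ> \<alpha> a"
  obtains H where "H \<in> alg_hom (tensor_algebra A B) op_algebra"
    "\<And>a b. a \<in> carrier A \<Longrightarrow> b \<in> carrier B \<Longrightarrow> H (pure_tensor A B a b) = \<alpha> a \<circ> \<beta> b"
    "\<And>x. x \<in> carrier (pair_algebra A B) \<Longrightarrow>
      H (tensor_ideal A B +>\<^bsub>pair_algebra A B\<^esub> x) = op_ext (\<lambda>(a, b). \<alpha> a \<circ> \<beta> b) x"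
proof -
  let ?P = "pair_algebra A B"
  let ?\<phi> = "\<lambda>(a, b). \<alpha> a \<circ> \<beta> b"
  interpret A: ring A by (rule assoc_algebraD(1)[OF A])
  interpret B: ring B by (rule assoc_algebraD(1)[OF B])
  interpret O: ring "op_algebra :: ('f, ('w \<Rightarrow> 'f) \<Rightarrow> 'w \<Rightarrow> 'f) module"
    by (rule assoc_algebraD(1)[OF assoc_algebra_op])
  note P = assoc_algebra_pair[OF A B]
  note a = alg_homD[OF \<alpha>] and b = alg_homD[OF \<beta>]
  note cl = monoid_algebra_closed[OF pair_monoid[OF A B]]
  have h: "op_ext ?\<phi> \<in> alg_hom ?P op_algebra"
  proof (rule op_ext_hom[OF pair_monoid[OF A B]])
    show "?\<phi> m \<in> carrier op_algebra" if "m \<in> carrier (A \<times>\<times> B)" for m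
      using that a(1) b(1) O.m_closed[unfolded op_algebra_simps(2)] by auto
    show "?\<phi> (u \<otimes>\<^bsub>A \<times>\<times> B\<^esub> v) = ?\<phi> u \<circ> ?\<phi> v" if uv: "u \<in> carrier (A \<times>\<times> B)" "v \<in> carrier (A \<times>\<times> B)" for u v
    proof -
      obtain x y x' y' where e: "u = (x, y)" "v = (x', y')" by (cases u, cases v)
      then have c: "x \<in> carrier A" "y \<in> carrier B" "x' \<in> carrier A" "y' \<in> carrier B" using uv by auto
      have "\<alpha> (x \<otimes>\<^bsub>A\<^esub> x') \<circ> \<beta> (y \<otimes>\<^bsub>B\<^esub> y') = \<alpha> x \<circ> (\<alpha> x' \<circ> \<beta> y) \<circ> \<beta> y'"
        using c by (simp add: a(2) b(2) op_algebra_simps(2) o_assoc)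
      then show ?thesis unfolding comm[OF c(3,2)] by (simp add: e o_assoc)
    qed
    show "?\<phi> \<one>\<^bsub>A \<times>\<times> B\<^esub> = id" by (simp add: a(4) b(4) op_algebra_simps)
  qed
  note hD = alg_homD[OF h]
  have bv: "(basis_vec (a, b) :: _ \<Rightarrow> 'f) \<in> carrier ?P" if "a \<in> carrier A" "b \<in> carrier B" for a b
    by (rule cl(4)) (use that in simp)
  have lin: "\<alpha> a (\<lambda>w. \<psi> w + \<chi> w) = (\<lambda>w. \<alpha> a \<psi> w + \<alpha> a \<chi> w)" "\<alpha> a (\<lambda>w. c * \<psi> w) = (\<lambda>w. c * \<alpha> a \<psi> w)"
    if "a \<in> carrier A" for a \<psi> \<chi> c
    using a(1)[OF that] unfolding op_algebra_simps by blast+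
  have rel: "op_ext ?\<phi> l = op_ext ?\<phi> r" if "(l, r) \<in> bilinearity A B" for l r
    using that unfolding bilinearity_def
    by (auto simp: hD bv op_ext_basis a b op_algebra_simps intro!: ext) (simp_all add: lin)
  obtain H where H: "H \<in> alg_hom (tensor_algebra A B) op_algebra"
    "\<And>x. x \<in> carrier ?P \<Longrightarrow> H (tensor_ideal A B +>\<^bsub>?P\<^esub> x) = op_ext ?\<phi> x"
    by (rule relation_hom[OF P assoc_algebra_op h bilinearity_closed[OF A B] rel,
          folded tensor_quotient tensor_ideal_def]) blast+
  show thesis
    by (rule that[OF H(1) _ H(2)]) (simp_all only: pure_tensor_def H(2) bv op_ext_basis prod.case)
qed

section \<open>The algebra \<open>B_q\<close> and its actions by weighted shifts\<close>

lemma monoid_word: "monoid word_monoid"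
  by (rule monoidI) (simp_all add: word_monoid_def)

lemmas assoc_algebra_free = assoc_algebra_monoid_algebra[OF monoid_word]

lemma basis_vec_free: "basis_vec w \<in> carrier free_algebra"
  by (rule monoid_algebra_closed(4)[OF monoid_word]) (simp add: word_monoid_def)

lemma basis_vec_free_mult: "basis_vec u \<otimes>\<^bsub>free_algebra\<^esub> basis_vec v = basis_vec (u @ v)"
  by (simp add: basis_vec_mult) (simp add: word_monoid_def)

lemma one_free: "\<one>\<^bsub>free_algebra\<^esub> = basis_vec []"
  by (simp add: monoid_algebra_simps) (simp add: word_monoid_def)

lemma Bq_relations_closed: "Bq_relations D \<subseteq> carrier free_algebra \<times> carrier free_algebra"
  unfolding Bq_relations_def one_free
  by (auto intro!: basis_vec_free monoid_algebra_closed(3)[OF monoid_word])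

definition bword :: "('i, 'y::ab_group_add, 'x) weyl_data \<Rightarrow> ('i, 'y) bgen list \<Rightarrow> ('i, 'y) bq" where
  "bword D w = Idl\<^bsub>free_algebra\<^esub> (relators free_algebra (Bq_relations D)) +>\<^bsub>free_algebra\<^esub> basis_vec w"

lemma bgen_elt_bword: "bgen_elt D x = bword D [x]"
  by (simp add: bgen_elt_def bword_def)

context
  fixes D :: "('i, 'y::ab_group_add, 'x) weyl_data"
begin

private lemmas ops = quotient_algebra_ops[OF assoc_algebra_free ideal_relators[OF assoc_algebra_free Bq_relations_closed[of D]],
    folded presented_algebra_def, folded Bq_def]

private lemmas rel = relation_holds[OF assoc_algebra_free Bq_relations_closed[of D]]

lemma assoc_algebra_Bq: "assoc_algebra (Bq D)"
  unfolding Bq_def presented_algebra_def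
  by (rule assoc_algebra_quotient[OF assoc_algebra_free ideal_relators[OF assoc_algebra_free Bq_relations_closed]])

lemma bword_closed: "bword D w \<in> carrier (Bq D)"
  unfolding bword_def by (rule ops(1)[OF basis_vec_free])

lemma bword_mult: "bword D u \<otimes>\<^bsub>Bq D\<^esub> bword D v = bword D (u @ v)"
  unfolding bword_def by (simp add: ops(2) basis_vec_free basis_vec_free_mult)

lemma bword_one: "\<one>\<^bsub>Bq D\<^esub> = bword D []"
  by (simp add: Bq_def presented_algebra_def quotient_algebra_simps bword_def one_free)

lemma bword_GenQ_zero: "bword D [GenQ 0] = bword D []"
  unfolding bword_def by (rule rel) (simp add: Bq_relations_def one_free)

lemma bword_GenQ_add: "bword D [GenQ \<kappa>, GenQ \<mu>] = bword D [GenQ (\<kappa> + \<mu>)]"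
  unfolding bword_def by (rule rel) (auto simp: Bq_relations_def)

lemma bword_conj:
  "bword D [GenQ \<kappa>, GenF i, GenQ (- \<kappa>)] = qpow D (- dpair D \<kappa> (sroot D i)) \<odot>\<^bsub>Bq D\<^esub> bword D [GenF i]"
  unfolding bword_def ops(4)[OF basis_vec_free] by (rule rel) (auto simp: Bq_relations_def)

lemma bword_GenF_comm:
  "bword D [GenF i, GenF j] = (qi D i powi (- eps D i j * cartan D i j)) \<odot>\<^bsub>Bq D\<^esub> bword D [GenF j, GenF i]"
  unfolding bword_def ops(4)[OF basis_vec_free] by (rule rel) (auto simp: Bq_relations_def)

lemma bword_GenQ_GenF:
  "bword D [GenQ \<kappa>, GenF i] = qpow D (- dpair D \<kappa> (sroot D i)) \<odot>\<^bsub>Bq D\<^esub> bword D [GenF i, GenQ \<kappa>]"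
proof -
  have "bword D [GenQ \<kappa>, GenF i, GenQ (- \<kappa>)] \<otimes>\<^bsub>Bq D\<^esub> bword D [GenQ \<kappa>]
      = bword D [GenQ \<kappa>, GenF i] \<otimes>\<^bsub>Bq D\<^esub> bword D [GenQ (- \<kappa>), GenQ \<kappa>]" by (simp add: bword_mult)
  also have "\<dots> = bword D [GenQ \<kappa>, GenF i]"
    by (simp only: bword_GenQ_add bword_GenQ_zero ab_left_minus bword_mult append_Nil2)
  finally show ?thesis
    by (simp only: bword_conj assoc_algebraD(7)[OF assoc_algebra_Bq] bword_closed bword_mult append.simps)
qed

lemma inv_bk: "inv\<^bsub>Bq D\<^esub> bk D i = bword D [GenQ (- dsmul D (symm D i) (coroot D i))]"
proof -
  interpret ring "Bq D" by (rule assoc_algebraD(1)[OF assoc_algebra_Bq])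
  let ?\<kappa> = "dsmul D (symm D i) (coroot D i)"
  have "bword D [GenQ (- ?\<kappa>)] \<otimes>\<^bsub>Bq D\<^esub> bword D [GenQ ?\<kappa>] = \<one>\<^bsub>Bq D\<^esub>"
    "bword D [GenQ ?\<kappa>] \<otimes>\<^bsub>Bq D\<^esub> bword D [GenQ (- ?\<kappa>)] = \<one>\<^bsub>Bq D\<^esub>"
    by (simp_all add: bword_mult bword_GenQ_add bword_GenQ_zero bword_one)
  then show ?thesis
    unfolding bk_def bgen_elt_bword by (intro inv_unique'[symmetric] bword_closed)
qed

text \<open>The universal property of the presentation. By the last conclusion an operator commuting
  with the images of the generators commutes with the whole image; this is how the commutation
  needed for \<open>tensor_algebra_hom\<close> is obtained.\<close>

lemma Bq_op_hom:
  fixes F :: "'i \<Rightarrow> ('w \<Rightarrow> qfield) \<Rightarrow> 'w \<Rightarrow> qfield" and K :: "'y \<Rightarrow> ('w \<Rightarrow> qfield) \<Rightarrow> 'w \<Rightarrow> qfield"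
  assumes op: "\<And>i. F i \<in> carrier op_algebra" "\<And>\<kappa>. K \<kappa> \<in> carrier op_algebra"
    and rels: "K 0 = id" "\<And>\<kappa> \<mu>. K \<kappa> \<circ> K \<mu> = K (\<kappa> + \<mu>)"
      "\<And>\<kappa> i. K \<kappa> \<circ> (F i \<circ> K (- \<kappa>)) = qpow D (- dpair D \<kappa> (sroot D i)) \<odot>\<^bsub>op_algebra\<^esub> F i"
      "\<And>i j. F i \<circ> F j = (qi D i powi (- eps D i j * cartan D i j)) \<odot>\<^bsub>op_algebra\<^esub> (F j \<circ> F i)"
  obtains H where "H \<in> alg_hom (Bq D) op_algebra"
    "\<And>w. H (bword D w) = foldr (\<lambda>x T. (case x of GenF i \<Rightarrow> F i | GenQ \<kappa> \<Rightarrow> K \<kappa>) \<circ> T) w id"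
    "\<And>T X. T \<in> carrier op_algebra \<Longrightarrow> (\<And>i. T \<circ> F i = F i \<circ> T) \<Longrightarrow> (\<And>\<kappa>. T \<circ> K \<kappa> = K \<kappa> \<circ> T) \<Longrightarrow>
      X \<in> carrier (Bq D) \<Longrightarrow> T \<circ> H X = H X \<circ> T"
proof -
  define G where "G x = (case x of GenF i \<Rightarrow> F i | GenQ \<kappa> \<Rightarrow> K \<kappa>)" for x
  define \<phi> where "\<phi> w = foldr (\<lambda>x T. G x \<circ> T) w id" for w
  interpret O: ring "op_algebra :: (qfield, ('w \<Rightarrow> qfield) \<Rightarrow> 'w \<Rightarrow> qfield) module"
    by (rule assoc_algebraD(1)[OF assoc_algebra_op])
  have G: "G x \<in> carrier op_algebra" for x using op by (cases x) (simp_all add: G_def)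
  have \<phi>0: "\<phi> [] = id" and \<phi>1: "\<phi> (x # w) = G x \<circ> \<phi> w" for x w
    by (simp_all only: \<phi>_def foldr.simps id_apply comp_apply)
  have \<phi>c: "\<phi> w \<in> carrier op_algebra" for w
  proof (induction w)
    case Nil show ?case unfolding \<phi>0 by (rule O.one_closed[unfolded op_algebra_simps(3)])
  next
    case (Cons x w) then show ?case unfolding \<phi>1 by (intro O.m_closed[unfolded op_algebra_simps(2)] G)
  qed
  have \<phi>m: "\<phi> (u @ v) = \<phi> u \<circ> \<phi> v" for u v
    by (induction u) (simp_all only: \<phi>0 \<phi>1 append.simps o_assoc id_o)
  have h: "op_ext \<phi> \<in> alg_hom free_algebra op_algebra"
    by (rule op_ext_hom[OF monoid_word \<phi>c]) (simp_all only: word_monoid_def monoid.simps \<phi>m \<phi>0)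
  have \<phi>s: "\<phi> [GenF i] = F i" "\<phi> [GenQ \<kappa>] = K \<kappa>" "\<phi> [GenF i, GenF j] = F i \<circ> F j"
    "\<phi> [GenQ \<kappa>, GenQ \<mu>] = K \<kappa> \<circ> K \<mu>" "\<phi> [GenQ \<kappa>, GenF i, GenQ \<mu>] = K \<kappa> \<circ> (F i \<circ> K \<mu>)" "\<phi> [] = id" for i j \<kappa> \<mu>
    by (simp_all only: \<phi>0 \<phi>1 G_def bgen.case o_id)
  have r: "op_ext \<phi> l = op_ext \<phi> r" if "(l, r) \<in> Bq_relations D" for l r
    using that unfolding Bq_relations_def one_free
    by (elim UnE CollectE exE conjE Pair_inject singletonE)
      (simp_all only: op_ext_basis \<phi>s rels(1-3) alg_homD(5)[OF h basis_vec_free] prod.inject rels(4)[symmetric])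
  obtain H where H: "H \<in> alg_hom (Bq D) op_algebra"
    "\<And>x. x \<in> carrier free_algebra \<Longrightarrow> H (Idl\<^bsub>free_algebra\<^esub> (relators free_algebra (Bq_relations D)) +>\<^bsub>free_algebra\<^esub> x) = op_ext \<phi> x"
    by (rule relation_hom[OF assoc_algebra_free assoc_algebra_op h Bq_relations_closed r,
        folded presented_algebra_def, folded Bq_def]) blast+
  show thesis
  proof (rule that[OF H(1)])
    show "H (bword D w) = foldr (\<lambda>x T. (case x of GenF i \<Rightarrow> F i | GenQ \<kappa> \<Rightarrow> K \<kappa>) \<circ> T) w id" for w
      by (simp only: bword_def H(2) basis_vec_free op_ext_basis \<phi>_def G_def)
    fix T X assume T: "T \<in> carrier op_algebra" "\<And>i. T \<circ> F i = F i \<circ> T" "\<And>\<kappa>. T \<circ> K \<kappa> = K \<kappa> \<circ> T"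
      and X: "X \<in> carrier (Bq D)"
    obtain a where a: "a \<in> carrier free_algebra"
      "X = Idl\<^bsub>free_algebra\<^esub> (relators free_algebra (Bq_relations D)) +>\<^bsub>free_algebra\<^esub> a"
      using X unfolding Bq_def presented_algebra_def by (rule quotient_algebra_carrier)
    have TG: "T \<circ> G x = G x \<circ> T" for x using T(2,3) by (cases x) (simp_all only: G_def bgen.case)
    have "T \<circ> \<phi> w = \<phi> w \<circ> T" for w
    proof (induction w)
      case (Cons x w)
      have "T \<circ> \<phi> (x # w) = (T \<circ> G x) \<circ> \<phi> w" by (simp only: \<phi>1 o_assoc)
      also have "\<dots> = G x \<circ> (T \<circ> \<phi> w)" by (simp only: TG o_assoc)
      also have "\<dots> = \<phi> (x # w) \<circ> T" unfolding Cons by (simp only: \<phi>1 o_assoc)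
      finally show ?case .
    qed (simp only: \<phi>0 o_id id_o)
    then have "T \<circ> op_ext \<phi> a = op_ext \<phi> a \<circ> T" by (rule op_ext_commute[OF T(1)])
    then show "T \<circ> H X = H X \<circ> T" by (simp only: a(2) H(2)[OF a(1)])
  qed
qed

end

text \<open>Products of weighted shifts are weighted shifts with added translation vectors
  (\<open>wshift_comp\<close>), so the translation vector acts as a degree, while commutation
  scalars are stored in the weight \<open>c\<close>.\<close>

definition wshift :: "('w::ab_group_add \<Rightarrow> int) \<Rightarrow> 'w \<Rightarrow> ('w \<Rightarrow> qfield) \<Rightarrow> 'w \<Rightarrow> qfield" where
  "wshift c v = (\<lambda>\<psi> w. qroot powi c w * \<psi> (w - v))"

lemma qroot_nonzero: "qroot \<noteq> 0"
  by (simp add: qroot_def Zero_fract_def eq_fract)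

lemma wshift_op: "wshift c v \<in> carrier op_algebra"
  by (simp add: op_algebra_simps wshift_def distrib_left mult.left_commute)

lemma wshift_id: "wshift (\<lambda>_. 0) 0 = id"
  by (simp add: wshift_def fun_eq_iff)

lemma wshift_comp: "wshift c v \<circ> wshift c' v' = wshift (\<lambda>w. c w + c' (w - v)) (v + v')"
  by (simp add: wshift_def fun_eq_iff power_int_add qroot_nonzero diff_diff_eq mult.assoc)

lemma wshift_smult: "(qroot powi k) \<odot>\<^bsub>op_algebra\<^esub> wshift c v = wshift (\<lambda>w. k + c w) v"
  by (simp add: op_algebra_simps wshift_def fun_eq_iff power_int_add qroot_nonzero mult.assoc)

text \<open>Applied to the indicator function of 0, each shift gives a function supported at its own
  translation vector, with nonzero value there; these points are distinct.\<close>

lemma wshift_indep: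
  assumes "finite S" "inj_on v S" "(\<lambda>\<psi> w. \<Sum>s\<in>S. \<alpha> s * wshift (c s) (v s) \<psi> w) = (\<lambda>\<psi> w. 0)" "s \<in> S"
  shows "\<alpha> s = 0"
proof -
  have "(\<Sum>t\<in>S. \<alpha> t * wshift (c t) (v t) (\<lambda>w. if w = 0 then 1 else 0) (v s)) = 0"
    using assms(3) by metis
  moreover have "\<alpha> t * wshift (c t) (v t) (\<lambda>w. if w = 0 then 1 else 0) (v s)
      = (if t = s then \<alpha> s * qroot powi c s (v s) else 0)" if "t \<in> S" for t
    using inj_onD[OF assms(2) _ that assms(4)] by (auto simp: wshift_def)
  ultimately show ?thesis
    using assms(1,4) by (simp add: qroot_nonzero cong: sum.cong)
qed

definition dint :: "('i, 'y, 'x) weyl_data \<Rightarrow> 'i \<Rightarrow> int" where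
  "dint D i = \<lfloor>of_nat (lcd D) * symm D i\<rfloor>"

text \<open>The product of all denominators of the \<open>symm D i\<close> is a common denominator,
  so the least one in \<open>lcd\<close> exists.\<close>

lemma lcd_props:
  fixes D :: "('i::finite, 'y, 'x) weyl_data"
  shows "0 < lcd D" "of_int (dint D i) = of_nat (lcd D) * symm D i"
proof -
  let ?P = "\<lambda>d::nat. 0 < d \<and> (\<forall>i. of_nat d * symm D i \<in> \<int>)"
  define b where "b i = snd (quotient_of (symm D i))" for i
  have b: "0 < b i" "symm D i = of_int (fst (quotient_of (symm D i))) / of_int (b i)" for i
    using quotient_of_denom_pos[of "symm D i"] quotient_of_div[of "symm D i"]
    by (auto simp: b_def prod_eq_iff split: prod.splits)
  have "?P (nat (\<Prod>i\<in>UNIV. b i))"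
  proof (intro conjI allI)
    have pos: "0 < (\<Prod>i\<in>UNIV. b i)" using b(1) by (intro prod_pos) auto
    then show "0 < nat (\<Prod>i\<in>UNIV. b i)" by simp
    fix i
    have "(\<Prod>i\<in>UNIV. b i) = b i * (\<Prod>j\<in>UNIV - {i}. b j)" by (simp add: prod.remove)
    then have "of_nat (nat (\<Prod>i\<in>UNIV. b i)) * symm D i
        = of_int ((\<Prod>j\<in>UNIV - {i}. b j) * fst (quotient_of (symm D i)))"
      using pos b(1)[of i] by (subst b(2)) simp
    then show "of_nat (nat (\<Prod>i\<in>UNIV. b i)) * symm D i \<in> \<int>" by (simp only: Ints_of_int)
  qed
  then have "?P (lcd D)" unfolding lcd_def by (rule LeastI)
  then show "0 < lcd D" "of_int (dint D i) = of_nat (lcd D) * symm D i"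
    unfolding dint_def by (auto elim: Ints_cases)
qed

lemma dint_qi: "qi D i = qroot powi dint D i" and dint_dsmul: "dsmul D (symm D i) \<kappa> = zsmul (dint D i) \<kappa>"
  by (simp_all add: qi_def qpow_def dint_def dsmul_def)

lemma
  fixes D :: "('i::finite, 'y::ab_group_add, 'x::ab_group_add) weyl_data"
  shows qpow_dpair: "qpow D (- dpair D \<kappa> x) = qroot powi (- pairing D \<kappa> x)" (is ?R1)
    and reflection_zsmul: "reflection D i \<kappa> = \<kappa> - zsmul (pairing D \<kappa> (sroot D i)) (coroot D i)" (is ?R2)
proof -
  have "of_nat (lcd D) * - dpair D \<kappa> x = of_int (- pairing D \<kappa> x)"
    using lcd_props(1)[of D] by (simp add: dpair_def)
  then show ?R1
    unfolding qpow_def by (simp only: floor_of_int)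
  have "of_nat (lcd D) * dpair D \<kappa> (sroot D i) = of_int (pairing D \<kappa> (sroot D i))"
    using lcd_props(1)[of D] by (simp add: dpair_def)
  then show ?R2
    unfolding reflection_def dsmul_def by (simp only: floor_of_int)
qed

lemma dint_sym:
  fixes D :: "('i::finite, 'y, 'x) weyl_data"
  assumes "symmetrized_by (cartan D) (symm D)"
  shows "dint D i * cartan D i j = dint D j * cartan D j i" (is ?R1) "0 < dint D i"
proof -
  have "(of_int (dint D i * cartan D i j) :: rat) = of_int (dint D j * cartan D j i)"
    using assms by (simp add: lcd_props(2) symmetrized_by_def mult.assoc)
  then show ?R1 by (simp only: of_int_eq_iff)
  have "(0 :: rat) < of_int (dint D i)"
    using assms lcd_props(1)[of D] by (simp add: lcd_props(2) symmetrized_by_def)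
  then show "0 < dint D i" by simp
qed

text \<open>The degrees: exponents of the \<open>f1 D i\<close>, exponents of the
  \<open>f2 D i\<close>, and the lattice element coming from \<open>U0\<close>.\<close>

type_synonym ('i, 'y) wgt = "('i \<Rightarrow> int) \<times> ('i \<Rightarrow> int) \<times> 'y"

definition unitv :: "'i \<Rightarrow> 'i \<Rightarrow> int" where
  "unitv i = (\<lambda>j. if j = i then 1 else 0)"

lemma
  fixes D :: "('i, 'y::ab_group_add, 'x::ab_group_add) weyl_data"
  assumes datum: "root_datum D"
  shows pairing_add: "pairing D (\<kappa> + \<mu>) x = pairing D \<kappa> x + pairing D \<mu> x" (is ?R1)
  and pairing_zero: "pairing D 0 x = 0" and pairing_minus: "pairing D (- \<kappa>) x = - pairing D \<kappa> x" (is ?R2)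
  and pairing_zsmul: "pairing D (zsmul n \<kappa>) x = n * pairing D \<kappa> x" (is ?R3)
  and pairing_coroot: "pairing D (coroot D i) (sroot D j) = cartan D i j" (is ?R4)
proof -
  have a: "additive (\<lambda>y. pairing D y x)"
    using datum by (auto simp: root_datum_def perfect_pairing_def bilinear_form_def)
  interpret additive "\<lambda>y. pairing D y x" by (rule a)
  show ?R1 by (rule add)
  show "pairing D 0 x = 0" by (rule zero)
  show ?R2 by (rule minus)
  show ?R3
    by (cases "0 \<le> n") (simp_all add: zsmul_def minus sum zero)
  show ?R4 using datum by (simp add: root_datum_def)
qed

text \<open>One half of the skew form that governs the relations between the f_i: entries are kept
  only for sign + 1, and by \<open>bwt_swap\<close> the difference of the two orders is the required
  exponent in powers of \<open>qroot\<close>.\<close>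

definition bwt :: "('i, 'y, 'x) weyl_data \<Rightarrow> 'i \<Rightarrow> 'i \<Rightarrow> int" where
  "bwt D i j = (if eps D i j = 1 then - dint D i * cartan D i j else 0)"

text \<open>The function \<open>p\<close> extracts from a weight the degree seen by one copy of
  \<open>B_q\<close>, and \<open>v i\<close> is the direction in which the generator of index i of
  this copy moves; two copies can thus act on one weight lattice.\<close>

definition fshift :: "('i::finite, 'y, 'x) weyl_data \<Rightarrow> ('w \<Rightarrow> 'i \<Rightarrow> int) \<Rightarrow> ('i \<Rightarrow> 'w) \<Rightarrow> 'i \<Rightarrow> ('w::ab_group_add \<Rightarrow> qfield) \<Rightarrow> 'w \<Rightarrow> qfield" where
  "fshift D p v i = wshift (\<lambda>w. \<Sum>j\<in>UNIV. bwt D i j * p w j) (v i)"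

definition kshift :: "('i::finite, 'y, 'x) weyl_data \<Rightarrow> ('w \<Rightarrow> 'i \<Rightarrow> int) \<Rightarrow> 'y \<Rightarrow> ('w::ab_group_add \<Rightarrow> qfield) \<Rightarrow> 'w \<Rightarrow> qfield" where
  "kshift D p \<kappa> = wshift (\<lambda>w. - (\<Sum>j\<in>UNIV. p w j * pairing D \<kappa> (sroot D j))) 0"

lemma sum_unitv: "(\<Sum>j\<in>UNIV. c j * unitv i j) = c i" "(\<Sum>j\<in>UNIV. unitv i j * c j) = c i"
  for c :: "'i::finite \<Rightarrow> int"
proof -
  have "c j * unitv i j = (if j = i then c j else 0)" "unitv i j * c j = (if j = i then c j else 0)" for j
    by (simp_all add: unitv_def)
  then show "(\<Sum>j\<in>UNIV. c j * unitv i j) = c i" "(\<Sum>j\<in>UNIV. unitv i j * c j) = c i" by simp_all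
qed

definition tshift :: "'y::ab_group_add \<Rightarrow> (('i, 'y) wgt \<Rightarrow> qfield) \<Rightarrow> ('i, 'y) wgt \<Rightarrow> qfield" where
  "tshift \<kappa> = wshift (\<lambda>_. 0) (0, 0, \<kappa>)"

lemma
  fixes D :: "('i::finite, 'y::ab_group_add, 'x::ab_group_add) weyl_data"
  shows f1_bword: "f1 D i = pure_tensor (Bq D) (Bq D) (bword D [GenF i]) (bword D [])"
  and f2_bword: "f2 D i = pure_tensor (Bq D) (Bq D) (bword D [GenQ (- zsmul (dint D i) (coroot D i))]) (bword D [GenF i])"
  by (simp_all add: f1_def f2_def bf_def bgen_elt_bword bword_one inv_bk dint_dsmul)

context
  fixes D :: "('i::finite, 'y::ab_group_add, 'x::ab_group_add) weyl_data"
  assumes symz: "symmetrized_by (cartan D) (symm D)"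
    and datum: "root_datum D"
    and signs: "sign_system (cartan D) (eps D)"
begin

lemma bwt_swap: "bwt D i j = bwt D j i - dint D i * eps D i j * cartan D i j"
proof -
  have s: "if i \<noteq> j \<and> cartan D i j \<noteq> 0 then (eps D i j = 1 \<or> eps D i j = - 1) \<and> eps D j i = - eps D i j
      else eps D i j = 0" for i j
    using signs unfolding sign_system_def by blast
  have c: "dint D i * cartan D i j = dint D j * cartan D j i" by (rule dint_sym(1)[OF symz])
  show ?thesis
  proof (cases "i \<noteq> j \<and> cartan D i j \<noteq> 0")
    case True
    then show ?thesis using s[of i j] c by (auto simp: bwt_def)
  next
    case False
    then have "eps D i j = 0" "dint D j * cartan D j i = 0 \<or> i = j" using s[of i j] c by auto
    then show ?thesis by (auto simp: bwt_def)
  qed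
qed

lemma Bq_shift_hom:
  fixes p :: "'w::ab_group_add \<Rightarrow> 'i \<Rightarrow> int"
  assumes p: "\<And>w w' j. p (w - w') j = p w j - p w' j" "\<And>i. p (v i) = unitv i"
  obtains H where "H \<in> alg_hom (Bq D) op_algebra"
    "\<And>i. H (bword D [GenF i]) = fshift D p v i" "\<And>\<kappa>. H (bword D [GenQ \<kappa>]) = kshift D p \<kappa>"
    "\<And>T X. T \<in> carrier op_algebra \<Longrightarrow> (\<And>i. T \<circ> fshift D p v i = fshift D p v i \<circ> T) \<Longrightarrow>
      (\<And>\<kappa>. T \<circ> kshift D p \<kappa> = kshift D p \<kappa> \<circ> T) \<Longrightarrow> X \<in> carrier (Bq D) \<Longrightarrow> T \<circ> H X = H X \<circ> T"
proof -
  have p0: "p 0 j = 0" for j using p(1)[of 0 0 j] by simp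
  have op: "fshift D p v i \<in> carrier op_algebra" "kshift D p \<kappa> \<in> carrier op_algebra" for i \<kappa>
    unfolding fshift_def kshift_def by (rule wshift_op)+
  have r1: "kshift D p 0 = id" by (simp add: kshift_def pairing_zero[OF datum] wshift_id)
  have r2: "kshift D p \<kappa> \<circ> kshift D p \<mu> = kshift D p (\<kappa> + \<mu>)" for \<kappa> \<mu>
    unfolding kshift_def wshift_comp by (simp add: pairing_add[OF datum] distrib_left sum.distrib)
  have r3: "kshift D p \<kappa> \<circ> (fshift D p v i \<circ> kshift D p (- \<kappa>))
      = qpow D (- dpair D \<kappa> (sroot D i)) \<odot>\<^bsub>op_algebra\<^esub> fshift D p v i" for \<kappa> i
    unfolding kshift_def fshift_def wshift_comp qpow_dpair wshift_smult
    by (rule arg_cong2[where f = wshift])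
      (simp_all add: fun_eq_iff p pairing_minus[OF datum] left_diff_distrib sum_subtractf sum_unitv sum_negf)
  have r4: "fshift D p v i \<circ> fshift D p v j
      = (qi D i powi (- eps D i j * cartan D i j)) \<odot>\<^bsub>op_algebra\<^esub> (fshift D p v j \<circ> fshift D p v i)" for i j
  proof -
    have e: "qi D i powi (- eps D i j * cartan D i j) = qroot powi (bwt D i j - bwt D j i)"
      unfolding dint_qi power_int_mult[symmetric] by (rule arg_cong[where f = "power_int qroot"]) (simp add: bwt_swap[of i j])
    show ?thesis
      unfolding fshift_def wshift_comp e wshift_smult
      by (rule arg_cong2[where f = wshift])
        (simp_all add: fun_eq_iff p right_diff_distrib sum_subtractf sum_unitv add.commute)
  qed
  show thesis
  proof (rule Bq_op_hom[of "fshift D p v" "kshift D p", OF op r1 r2 r3 r4])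
    fix H assume H: "H \<in> alg_hom (Bq D) op_algebra"
      "\<And>w. H (bword D w) = foldr (\<lambda>x T. (case x of GenF i \<Rightarrow> fshift D p v i | GenQ \<kappa> \<Rightarrow> kshift D p \<kappa>) \<circ> T) w id"
      "\<And>T X. T \<in> carrier op_algebra \<Longrightarrow> (\<And>i. T \<circ> fshift D p v i = fshift D p v i \<circ> T) \<Longrightarrow>
      (\<And>\<kappa>. T \<circ> kshift D p \<kappa> = kshift D p \<kappa> \<circ> T) \<Longrightarrow> X \<in> carrier (Bq D) \<Longrightarrow> T \<circ> H X = H X \<circ> T"
    show thesis
      by (rule that[OF H(1) _ _ H(3)]) (simp_all only: H(2) foldr.simps o_id comp_apply id_apply bgen.case)
  qed
qed

text \<open>The directions of each copy are invisible to the degree function of the other one, so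
  neither changes the weights used by the other.\<close>

lemma shifts_commute:
  assumes "\<And>w w' j. p (w - w') j = p w j - p w' j" "\<And>w w' j. p' (w - w') j = p' w j - p' w' j"
    "\<And>i j. p (v' i) j = 0" "\<And>i j. p' (v i) j = 0"
  shows "fshift D p v i \<circ> fshift D p' v' i' = fshift D p' v' i' \<circ> fshift D p v i"
    "fshift D p v i \<circ> kshift D p' \<kappa>' = kshift D p' \<kappa>' \<circ> fshift D p v i"
    "kshift D p \<kappa> \<circ> fshift D p' v' i' = fshift D p' v' i' \<circ> kshift D p \<kappa>"
    "kshift D p \<kappa> \<circ> kshift D p' \<kappa>' = kshift D p' \<kappa>' \<circ> kshift D p \<kappa>"
  unfolding fshift_def kshift_def wshift_comp
  by (rule arg_cong2[where f = wshift]; simp add: assms fun_eq_iff add.commute)+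

text \<open>The copies of \<open>B_q\<close> act on the first and second coordinate of the weight.
  The inverse of k_i inside \<open>f2 D i\<close> contributes to the scalar weight only, not to the
  translation. The third coordinate stays untouched, so its translations \<open>tshift\<close>
  commute with everything and are free to represent \<open>U0\<close>.\<close>

lemma BqBq_hom:
  obtains H where "H \<in> alg_hom (tensor_algebra (Bq D) (Bq D)) op_algebra"
    "\<And>i. \<exists>c. H (f1 D i) = wshift c ((unitv i, 0, 0) :: ('i, 'y) wgt)" "\<And>i. \<exists>c. H (f2 D i) = wshift c (0, unitv i, 0)"
    "\<And>\<kappa> X. X \<in> carrier (tensor_algebra (Bq D) (Bq D)) \<Longrightarrow> tshift \<kappa> \<circ> H X = H X \<circ> tshift \<kappa>"
proof -
  define p1 v1 p2 v2 where "p1 = (fst :: ('i, 'y) wgt \<Rightarrow> _)" and "v1 i = ((unitv i, 0, 0) :: ('i, 'y) wgt)"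
    and "p2 = fst \<circ> (snd :: ('i, 'y) wgt \<Rightarrow> _)" and "v2 i = ((0, unitv i, 0) :: ('i, 'y) wgt)" for i :: 'i
  note d = p1_def v1_def p2_def v2_def
  have p: "p1 (w - w') j = p1 w j - p1 w' j" "p2 (w - w') j = p2 w j - p2 w' j" "p1 (v1 i) = unitv i" "p2 (v2 i) = unitv i"
    "p1 (v2 i) j = 0" "p2 (v1 i) j = 0" for w w' j i by (simp_all add: d)
  obtain H1 where H1: "H1 \<in> alg_hom (Bq D) op_algebra"
    "\<And>i. H1 (bword D [GenF i]) = fshift D p1 v1 i" "\<And>\<kappa>. H1 (bword D [GenQ \<kappa>]) = kshift D p1 \<kappa>"
    "\<And>T X. T \<in> carrier op_algebra \<Longrightarrow> (\<And>i. T \<circ> fshift D p1 v1 i = fshift D p1 v1 i \<circ> T) \<Longrightarrow>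
      (\<And>\<kappa>. T \<circ> kshift D p1 \<kappa> = kshift D p1 \<kappa> \<circ> T) \<Longrightarrow> X \<in> carrier (Bq D) \<Longrightarrow> T \<circ> H1 X = H1 X \<circ> T"
    by (rule Bq_shift_hom[of p1 v1, OF p(1,3)]) blast+
  obtain H2 where H2: "H2 \<in> alg_hom (Bq D) op_algebra"
    "\<And>i. H2 (bword D [GenF i]) = fshift D p2 v2 i" "\<And>\<kappa>. H2 (bword D [GenQ \<kappa>]) = kshift D p2 \<kappa>"
    "\<And>T X. T \<in> carrier op_algebra \<Longrightarrow> (\<And>i. T \<circ> fshift D p2 v2 i = fshift D p2 v2 i \<circ> T) \<Longrightarrow>
      (\<And>\<kappa>. T \<circ> kshift D p2 \<kappa> = kshift D p2 \<kappa> \<circ> T) \<Longrightarrow> X \<in> carrier (Bq D) \<Longrightarrow> T \<circ> H2 X = H2 X \<circ> T"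
    by (rule Bq_shift_hom[of p2 v2, OF p(2,4)]) blast+
  note sc = shifts_commute[OF p(1,2,5,6)]
  have op: "fshift D p1 v1 i \<in> carrier op_algebra" "kshift D p1 \<kappa> \<in> carrier op_algebra" for i \<kappa>
    unfolding fshift_def kshift_def by (rule wshift_op)+
  have comm: "H1 X \<circ> H2 Y = H2 Y \<circ> H1 X" if X: "X \<in> carrier (Bq D)" and Y: "Y \<in> carrier (Bq D)" for X Y
  proof (rule H1(4)[symmetric, OF alg_homD(1)[OF H2(1) Y] _ _ X])
    show "H2 Y \<circ> fshift D p1 v1 i = fshift D p1 v1 i \<circ> H2 Y" for i
      by (rule H2(4)[symmetric, OF op(1) sc(1,2) Y])
    show "H2 Y \<circ> kshift D p1 \<kappa> = kshift D p1 \<kappa> \<circ> H2 Y" for \<kappa>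
      by (rule H2(4)[symmetric, OF op(2) sc(3,4) Y])
  qed
  have t: "tshift \<kappa> \<circ> H1 X = H1 X \<circ> tshift \<kappa>" "tshift \<kappa> \<circ> H2 X = H2 X \<circ> tshift \<kappa>" if "X \<in> carrier (Bq D)" for X \<kappa>
    by (rule H1(4)[OF _ _ _ that] H2(4)[OF _ _ _ that];
        simp add: tshift_def wshift_op fshift_def kshift_def wshift_comp p d add.commute)+
  obtain H where H: "H \<in> alg_hom (tensor_algebra (Bq D) (Bq D)) op_algebra"
    "\<And>a b. a \<in> carrier (Bq D) \<Longrightarrow> b \<in> carrier (Bq D) \<Longrightarrow> H (pure_tensor (Bq D) (Bq D) a b) = H1 a \<circ> H2 b"
    "\<And>x. x \<in> carrier (pair_algebra (Bq D) (Bq D)) \<Longrightarrow>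
      H (tensor_ideal (Bq D) (Bq D) +>\<^bsub>pair_algebra (Bq D) (Bq D)\<^esub> x) = op_ext (\<lambda>(a, b). H1 a \<circ> H2 b) x"
    by (rule tensor_algebra_hom[OF assoc_algebra_Bq assoc_algebra_Bq H1(1) H2(1) comm]) blast+
  show thesis
  proof (rule that[OF H(1)])
    have one: "H2 (bword D []) = id"
      using alg_homD(4)[OF H2(1)] by (simp only: bword_one op_algebra_simps)
    show "\<exists>c. H (f1 D i) = wshift c (unitv i, 0, 0)" for i
      unfolding f1_bword H(2)[OF bword_closed bword_closed] H1(2) one fshift_def v1_def by auto
    show "\<exists>c. H (f2 D i) = wshift c (0, unitv i, 0)" for i
      unfolding f2_bword H(2)[OF bword_closed bword_closed] H1(3) H2(2) fshift_def kshift_def wshift_comp v2_def by auto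
    fix \<kappa> X assume "X \<in> carrier (tensor_algebra (Bq D) (Bq D))"
    then obtain a where a: "a \<in> carrier (pair_algebra (Bq D) (Bq D))"
      "X = tensor_ideal (Bq D) (Bq D) +>\<^bsub>pair_algebra (Bq D) (Bq D)\<^esub> a"
      using tensor_algebra_carrier[OF assoc_algebra_Bq assoc_algebra_Bq] by blast
    show "tshift \<kappa> \<circ> H X = H X \<circ> tshift \<kappa>"
      unfolding a(2) H(3)[OF a(1)]
    proof (rule op_ext_commute)
      show "tshift \<kappa> \<in> carrier op_algebra" unfolding tshift_def by (rule wshift_op)
      fix m assume "m \<in> msupp a"
      then obtain x y where m: "m = (x, y)" "x \<in> carrier (Bq D)" "y \<in> carrier (Bq D)"
        using a(1) by (cases m) (auto simp: monoid_algebra_simps)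
      show "tshift \<kappa> \<circ> (case m of (a, b) \<Rightarrow> H1 a \<circ> H2 b) = (case m of (a, b) \<Rightarrow> H1 a \<circ> H2 b) \<circ> tshift \<kappa>"
        unfolding m(1) prod.case o_assoc t(1)[OF m(2)] unfolding o_assoc[symmetric] t(2)[OF m(3)] ..
    qed
  qed
qed

end

section \<open>Relations and shift representation of \<open>Atilde\<close>\<close>

lemma basis_vec_central:
  assumes "u \<in> carrier M" "\<And>v. v \<in> carrier M \<Longrightarrow> u \<otimes>\<^bsub>M\<^esub> v = v \<otimes>\<^bsub>M\<^esub> u" "a \<in> carrier (monoid_algebra M)"
  shows "basis_vec u \<otimes>\<^bsub>monoid_algebra M\<^esub> a = a \<otimes>\<^bsub>monoid_algebra M\<^esub> basis_vec u"
proof -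
  have fin: "finite (msupp a)" and supp: "msupp a \<subseteq> carrier M" using assms(3) by (simp_all add: monoid_algebra_simps)
  note f = fin finite_msupp_basis[of u]
  show ?thesis
  proof (rule monoid_algebra_eqI)
    have "mpair a (\<lambda>v. \<phi> (u \<otimes>\<^bsub>M\<^esub> v)) = mpair a (\<lambda>v. \<phi> (v \<otimes>\<^bsub>M\<^esub> u))" for \<phi>
      unfolding mpair_def by (intro sum.cong refl) (simp add: assms(2) subsetD[OF supp])
    then show "mpair (basis_vec u \<otimes>\<^bsub>monoid_algebra M\<^esub> a) \<phi> = mpair (a \<otimes>\<^bsub>monoid_algebra M\<^esub> basis_vec u) \<phi>" for \<phi>
      by (simp only: mpair_mult[OF f(2) f(1)] mpair_mult[OF f(1) f(2)] mpair_basis)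
    show "finite (msupp (basis_vec u \<otimes>\<^bsub>monoid_algebra M\<^esub> a))"
      by (rule finite_subset[OF msupp_mult[OF f(2) f(1)]]) (simp add: f)
    show "finite (msupp (a \<otimes>\<^bsub>monoid_algebra M\<^esub> basis_vec u))"
      by (rule finite_subset[OF msupp_mult[OF f]]) (simp add: f)
  qed
qed

definition xt :: "('i, 'y::ab_group_add, 'x) weyl_data \<Rightarrow> 'i \<Rightarrow> ('i, 'y) atilde" where
  "xt D i = pure_tensor (Atilde0 D) U0 (f1 D i) \<one>\<^bsub>U0\<^esub>"

definition yt :: "('i, 'y::ab_group_add, 'x) weyl_data \<Rightarrow> 'i \<Rightarrow> ('i, 'y) atilde" where
  "yt D i = pure_tensor (Atilde0 D) U0 (f2 D i) \<one>\<^bsub>U0\<^esub>"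

definition et :: "('i, 'y::ab_group_add, 'x) weyl_data \<Rightarrow> 'y \<Rightarrow> ('i, 'y) atilde" where
  "et D \<kappa> = pure_tensor (Atilde0 D) U0 \<one>\<^bsub>Atilde0 D\<^esub> (basis_vec \<kappa>)"

lemma monoid_lattice: "monoid lattice_monoid"
  by (rule monoidI) (simp_all add: lattice_monoid_def add.assoc)

lemma assoc_algebra_U0: "assoc_algebra U0"
  unfolding U0_def by (rule assoc_algebra_monoid_algebra[OF monoid_lattice])

lemma U0_basis: "basis_vec \<kappa> \<in> carrier U0" "\<one>\<^bsub>U0\<^esub> = basis_vec 0"
  "basis_vec \<kappa> \<otimes>\<^bsub>U0\<^esub> basis_vec \<mu> = basis_vec (\<kappa> + \<mu>)"
proof -
  show "basis_vec \<kappa> \<in> carrier U0"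
    unfolding U0_def by (rule monoid_algebra_closed(4)[OF monoid_lattice]) (simp add: lattice_monoid_def)
  show "\<one>\<^bsub>U0\<^esub> = basis_vec 0" unfolding U0_def monoid_algebra_simps by (simp add: lattice_monoid_def)
  show "basis_vec \<kappa> \<otimes>\<^bsub>U0\<^esub> basis_vec \<mu> = basis_vec (\<kappa> + \<mu>)"
    unfolding U0_def basis_vec_mult by (simp add: lattice_monoid_def)
qed

context
  fixes D :: "('i::finite, 'y::ab_group_add, 'x::ab_group_add) weyl_data"
begin

private abbreviation "B2 \<equiv> tensor_algebra (Bq D) (Bq D)"

private lemmas B = assoc_algebra_Bq[of D]

private lemma B2: "assoc_algebra B2" by (rule assoc_algebra_tensor[OF B B])

private lemma f_closed: "f1 D i \<in> carrier B2" "f2 D i \<in> carrier B2"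
  unfolding f1_bword f2_bword by (intro pure_tensor_closed[OF B B bword_closed bword_closed])+

private lemma gens: "range (f1 D) \<union> range (f2 D) \<subseteq> carrier B2" using f_closed by auto

lemma assoc_algebra_Atilde0: "assoc_algebra (Atilde0 D)"
  unfolding Atilde0_def by (rule assoc_algebra_generated[OF B2 gens])

lemma Atilde0_carrier: "carrier (Atilde0 D) \<subseteq> carrier B2" "f1 D i \<in> carrier (Atilde0 D)" "f2 D i \<in> carrier (Atilde0 D)"
  using generated_subalgebra_subset[OF B2 gens] generated_subalgebra_incl[OF B2 gens]
  unfolding Atilde0_def by auto

private lemmas A0_ops = generated_subalgebra_simps[of B2 "range (f1 D) \<union> range (f2 D)", folded Atilde0_def]

lemma Atilde0_relations:
  assumes "root_datum D"
  shows "f1 D i \<otimes>\<^bsub>Atilde0 D\<^esub> f1 D j = (qi D i powi (- eps D i j * cartan D i j)) \<odot>\<^bsub>Atilde0 D\<^esub> (f1 D j \<otimes>\<^bsub>Atilde0 D\<^esub> f1 D i)" (is ?R1)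
    and "f2 D i \<otimes>\<^bsub>Atilde0 D\<^esub> f2 D j = (qi D i powi (- eps D i j * cartan D i j)) \<odot>\<^bsub>Atilde0 D\<^esub> (f2 D j \<otimes>\<^bsub>Atilde0 D\<^esub> f2 D i)" (is ?R2)
    and "f2 D j \<otimes>\<^bsub>Atilde0 D\<^esub> f1 D i = (qi D j powi cartan D j i) \<odot>\<^bsub>Atilde0 D\<^esub> (f1 D i \<otimes>\<^bsub>Atilde0 D\<^esub> f2 D j)" (is ?R3)
proof -
  note pm = pure_tensor_mult[OF B B bword_closed bword_closed bword_closed bword_closed]
  note ps = pure_tensor_smult_left[OF B B bword_closed bword_closed] pure_tensor_smult_right[OF B B bword_closed bword_closed]
  show ?R1
    unfolding A0_ops f1_bword pm bword_mult append.simps ps(1)[symmetric] bword_GenF_comm[of D i j] ..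
  have k: "bword D [GenQ \<kappa>, GenQ \<mu>] = bword D [GenQ \<mu>, GenQ \<kappa>]" for \<kappa> \<mu>
    unfolding bword_GenQ_add by (simp only: add.commute)
  show ?R2
    unfolding A0_ops f2_bword pm bword_mult append.simps ps(2)[symmetric] bword_GenF_comm[of D i j]
      k[of "- zsmul (dint D j) (coroot D j)"] ..
  have "- pairing D (- zsmul (dint D j) (coroot D j)) (sroot D i) = dint D j * cartan D j i"
    by (simp add: pairing_minus[OF assms] pairing_zsmul[OF assms] pairing_coroot[OF assms])
  then show ?R3
    unfolding A0_ops f1_bword f2_bword pm bword_mult append.simps bword_GenQ_GenF[of D _ i] qpow_dpair dint_qi
      ps(1)[symmetric] by (simp add: power_int_mult)
qed

private lemmas A0 = assoc_algebra_Atilde0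

lemma assoc_algebra_Atilde: "assoc_algebra (Atilde D)"
  unfolding Atilde_def by (rule assoc_algebra_tensor[OF A0 assoc_algebra_U0])

lemma Atilde_closed: "xt D i \<in> carrier (Atilde D)" "yt D i \<in> carrier (Atilde D)" "et D \<kappa> \<in> carrier (Atilde D)"
proof -
  interpret A0: ring "Atilde0 D" by (rule assoc_algebraD(1)[OF A0])
  show "xt D i \<in> carrier (Atilde D)" "yt D i \<in> carrier (Atilde D)" "et D \<kappa> \<in> carrier (Atilde D)"
    unfolding Atilde_def xt_def yt_def et_def U0_basis(2)
    by (intro pure_tensor_closed[OF A0 assoc_algebra_U0] Atilde0_carrier(2,3) U0_basis(1) A0.one_closed)+
qed

lemma Atilde_relations:
  assumes "root_datum D"
  shows "xt D i \<otimes>\<^bsub>Atilde D\<^esub> xt D j = (qi D i powi (- eps D i j * cartan D i j)) \<odot>\<^bsub>Atilde D\<^esub> (xt D j \<otimes>\<^bsub>Atilde D\<^esub> xt D i)" (is ?R1)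
    and "yt D i \<otimes>\<^bsub>Atilde D\<^esub> yt D j = (qi D i powi (- eps D i j * cartan D i j)) \<odot>\<^bsub>Atilde D\<^esub> (yt D j \<otimes>\<^bsub>Atilde D\<^esub> yt D i)" (is ?R2)
    and "yt D j \<otimes>\<^bsub>Atilde D\<^esub> xt D i = (qi D j powi cartan D j i) \<odot>\<^bsub>Atilde D\<^esub> (xt D i \<otimes>\<^bsub>Atilde D\<^esub> yt D j)" (is ?R3)
    and "et D 0 = \<one>\<^bsub>Atilde D\<^esub>" "et D \<kappa> \<otimes>\<^bsub>Atilde D\<^esub> et D \<mu> = et D (\<kappa> + \<mu>)" (is ?R4)
    and "X \<in> carrier (Atilde D) \<Longrightarrow> et D \<kappa> \<otimes>\<^bsub>Atilde D\<^esub> X = X \<otimes>\<^bsub>Atilde D\<^esub> et D \<kappa>"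
proof -
  interpret A0: ring "Atilde0 D" by (rule assoc_algebraD(1)[OF A0])
  note r = Atilde0_relations[OF assms]
  note c = Atilde0_carrier(2,3) U0_basis(1) A0.one_closed A0.m_closed
  note pm = pure_tensor_mult[OF A0 assoc_algebra_U0]
  note ps = pure_tensor_smult_left[OF A0 assoc_algebra_U0]
  note d = Atilde_def xt_def yt_def et_def U0_basis(2)
  show ?R1
    unfolding d by (subst pm, (rule c)+, subst pm, (rule c)+, subst r(1), rule ps(1); (intro c | simp only: U0_basis(3), rule c))
  show ?R2
    unfolding d by (subst pm, (rule c)+, subst pm, (rule c)+, subst r(2), rule ps(1); (intro c | simp only: U0_basis(3), rule c))
  show ?R3
    unfolding d by (subst pm, (rule c)+, subst pm, (rule c)+, subst r(3), rule ps(1); (intro c | simp only: U0_basis(3), rule c))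
  show "et D 0 = \<one>\<^bsub>Atilde D\<^esub>"
    unfolding d pure_tensor_one[OF A0 assoc_algebra_U0] ..
  show ?R4
    unfolding d by (subst pm, (rule c)+, simp add: U0_basis(3))
  \<comment> \<open>The claim concerns all elements and not just pure tensors, so it is proved
    before passing to the quotient, where the corresponding basis vector of the pair algebra is
    already central.\<close>
  show "et D \<kappa> \<otimes>\<^bsub>Atilde D\<^esub> X = X \<otimes>\<^bsub>Atilde D\<^esub> et D \<kappa>" if X: "X \<in> carrier (Atilde D)"
  proof -
    let ?M = "Atilde0 D \<times>\<times> (U0 :: (qfield, 'y \<Rightarrow> qfield) module)"
    let ?u = "(\<one>\<^bsub>Atilde0 D\<^esub>, basis_vec \<kappa> :: 'y \<Rightarrow> qfield)"
    obtain a where a: "a \<in> carrier (pair_algebra (Atilde0 D) U0)" "X = tensor_ideal (Atilde0 D) U0 +>\<^bsub>pair_algebra (Atilde0 D) U0\<^esub> a"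
      using tensor_algebra_carrier[OF A0 assoc_algebra_U0] X unfolding Atilde_def by blast
    have u: "?u \<in> carrier ?M" using c by simp
    have cb: "basis_vec \<kappa> \<otimes>\<^bsub>U0\<^esub> b = b \<otimes>\<^bsub>U0\<^esub> basis_vec \<kappa>" if "b \<in> carrier U0" for b :: "'y \<Rightarrow> qfield"
      using that unfolding U0_def
      by (intro basis_vec_central) (simp_all add: lattice_monoid_def add.commute)
    have "?u \<otimes>\<^bsub>?M\<^esub> v = v \<otimes>\<^bsub>?M\<^esub> ?u" if "v \<in> carrier ?M" for v
      using that by (cases v) (simp add: cb)
    from basis_vec_central[OF u this a(1)]
    have e: "basis_vec ?u \<otimes>\<^bsub>pair_algebra (Atilde0 D) U0\<^esub> a = a \<otimes>\<^bsub>pair_algebra (Atilde0 D) U0\<^esub> basis_vec ?u" .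
    note P = assoc_algebra_pair[OF A0 assoc_algebra_U0]
    have bu: "(basis_vec ?u :: _ \<Rightarrow> qfield) \<in> carrier (pair_algebra (Atilde0 D) U0)"
      by (rule monoid_algebra_closed(4)[OF pair_monoid[OF A0 assoc_algebra_U0] u])
    have J: "ideal (tensor_ideal (Atilde0 D) U0) (pair_algebra (Atilde0 D) U0)"
      unfolding tensor_ideal_def by (rule ideal_relators[OF P bilinearity_closed[OF A0 assoc_algebra_U0]])
    note ops = quotient_algebra_ops(2)[OF P J, folded tensor_algebra_def]
    show ?thesis
      unfolding a(2) et_def pure_tensor_def Atilde_def ops[OF bu a(1)] ops[OF a(1) bu] e ..
  qed
qed

end

text \<open>The three kinds of generators translate in independent directions. Together with
  \<open>wshift_indep\<close> this takes the place of a basis theorem for the presented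
  algebra.\<close>

lemma Atilde_hom:
  fixes D :: "('i::finite, 'y::ab_group_add, 'x::ab_group_add) weyl_data"
  assumes D: "symmetrized_by (cartan D) (symm D)" "root_datum D" "sign_system (cartan D) (eps D)"
  obtains H where "H \<in> alg_hom (Atilde D) op_algebra"
    "\<And>i. \<exists>c. H (xt D i) = wshift c ((unitv i, 0, 0) :: ('i, 'y) wgt)" "\<And>i. \<exists>c. H (yt D i) = wshift c (0, unitv i, 0)"
    "\<And>\<kappa>. H (et D \<kappa>) = wshift (\<lambda>_. 0) (0, 0, \<kappa>)"
proof -
  note A0 = assoc_algebra_Atilde0[of D]
  obtain H where H: "H \<in> alg_hom (tensor_algebra (Bq D) (Bq D)) op_algebra"
    "\<And>i. \<exists>c. H (f1 D i) = wshift c ((unitv i, 0, 0) :: ('i, 'y) wgt)" "\<And>i. \<exists>c. H (f2 D i) = wshift c (0, unitv i, 0)"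
    "\<And>\<kappa> X. X \<in> carrier (tensor_algebra (Bq D) (Bq D)) \<Longrightarrow> tshift \<kappa> \<circ> H X = H X \<circ> tshift \<kappa>"
    by (rule BqBq_hom[OF D]) blast+
  have h0: "H \<in> alg_hom (Atilde0 D) op_algebra"
    using H(1) Atilde0_carrier(1)[of D]
    unfolding alg_hom_def ring_hom_def by (auto simp: Atilde0_def generated_subalgebra_simps subset_iff)
  let ?t = "tshift :: 'y \<Rightarrow> (('i, 'y) wgt \<Rightarrow> qfield) \<Rightarrow> _"
  have t: "?t \<kappa> \<in> carrier op_algebra" for \<kappa> unfolding tshift_def by (rule wshift_op)
  have u: "op_ext ?t \<in> alg_hom U0 op_algebra"
    unfolding U0_def
    by (rule op_ext_hom[OF monoid_lattice t]) (simp_all add: lattice_monoid_def tshift_def wshift_comp wshift_id flip: zero_prod_def)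
  have comm: "H a \<circ> op_ext ?t b = op_ext ?t b \<circ> H a" if "a \<in> carrier (Atilde0 D)" "b \<in> carrier U0" for a b
    using Atilde0_carrier(1)[of D] that alg_homD(1)[OF h0]
    by (intro op_ext_commute H(4)[symmetric]) auto
  obtain K where K: "K \<in> alg_hom (Atilde D) op_algebra"
    "\<And>a b. a \<in> carrier (Atilde0 D) \<Longrightarrow> b \<in> carrier U0 \<Longrightarrow> K (pure_tensor (Atilde0 D) U0 a b) = H a \<circ> op_ext ?t b"
    by (rule tensor_algebra_hom[OF A0 assoc_algebra_U0 h0 u comm, folded Atilde_def]) blast+
  have one: "op_ext ?t \<one>\<^bsub>U0\<^esub> = id" "H \<one>\<^bsub>Atilde0 D\<^esub> = id" "\<one>\<^bsub>Atilde0 D\<^esub> \<in> carrier (Atilde0 D)"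
    using alg_homD(4)[OF u] alg_homD(4)[OF h0] ring.ring_simprules(6)[OF assoc_algebraD(1)[OF A0]]
    by (simp_all only: op_algebra_simps)
  show thesis
  proof (rule that[OF K(1)])
    have u1: "\<one>\<^bsub>U0\<^esub> \<in> carrier (U0 :: (qfield, 'y \<Rightarrow> qfield) module)" unfolding U0_basis(2) by (rule U0_basis(1))
    show "\<exists>c. K (xt D i) = wshift c ((unitv i, 0, 0) :: ('i, 'y) wgt)" for i
      unfolding xt_def K(2)[OF Atilde0_carrier(2) u1] one o_id by (rule H(2))
    show "\<exists>c. K (yt D i) = wshift c (0, unitv i, 0)" for i
      unfolding yt_def K(2)[OF Atilde0_carrier(3) u1] one o_id by (rule H(3))
    show "K (et D \<kappa>) = wshift (\<lambda>_. 0) (0, 0, \<kappa>)" for \<kappa>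
      unfolding et_def K(2)[OF one(3) U0_basis(1)] one id_o op_ext_basis tshift_def ..
  qed
qed

section \<open>The quantum torus of the \<open>g\<^sub>i\<close>\<close>

lemma countable_qfield: "countable (UNIV :: qfield set)"
proof -
  have "inj (coeffs :: rat poly \<Rightarrow> rat list)" by (auto intro: injI simp: coeffs_eq_iff)
  then have p: "countable (UNIV :: rat poly set)" by (rule countableI' [OF inj_on_subset]) auto
  have "(UNIV :: qfield set) = (\<lambda>(a, b). Fract a b) ` (UNIV \<times> UNIV)"
    by (auto simp: image_iff) (metis Fract_cases)
  moreover have "countable ((\<lambda>(a, b). Fract a b) ` (UNIV \<times> (UNIV :: rat poly set)) :: qfield set)"
    using p by (intro countable_image countable_SIGMA) auto
  ultimately show ?thesis by simp
qed

text \<open>An element is determined by its graph over the support, which is a finite subset of a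
  countable set.\<close>

lemma countable_monoid_algebra:
  assumes "countable (carrier M)" "countable (UNIV :: 'f::field set)"
  shows "countable (carrier (monoid_algebra M :: ('f, 'm \<Rightarrow> 'f) module))"
proof -
  let ?g = "\<lambda>a :: 'm \<Rightarrow> 'f. (\<lambda>m. (m, a m)) ` msupp a"
  have "countable (Fpow (carrier M \<times> (UNIV :: 'f set)))"
    using assms by (intro countable_Fpow countable_SIGMA) auto
  moreover have "?g ` carrier (monoid_algebra M) \<subseteq> Fpow (carrier M \<times> UNIV)"
    by (auto simp: monoid_algebra_simps Fpow_def)
  ultimately have "countable (?g ` carrier (monoid_algebra M))" by (rule countable_subset[rotated])
  moreover have "inj_on ?g (carrier (monoid_algebra M))"
  proof (rule inj_onI, rule ext)
    fix a b :: "'m \<Rightarrow> 'f" and m assume eq: "?g a = ?g b"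
    have "(m, k) \<in> ?g c \<longleftrightarrow> c m = k \<and> k \<noteq> 0" for c k by (auto simp: msupp_def)
    then show "a m = b m" using eq by metis
  qed
  ultimately show ?thesis by (rule countable_image_inj_on)
qed

lemma countable_quotient_algebra:
  assumes "countable (carrier A)"
  shows "countable (carrier (quotient_algebra A J))"
proof (rule countable_subset)
  show "carrier (quotient_algebra A J) \<subseteq> (\<lambda>x. J +>\<^bsub>A\<^esub> x) ` carrier A"
    by (auto elim: quotient_algebra_carrier)
qed (use assms in simp)

lemma countable_tensor:
  fixes A :: "('f::field, 'a) module" and B :: "('f, 'b) module"
  assumes "countable (carrier A)" "countable (carrier B)" "countable (UNIV :: 'f set)"
  shows "countable (carrier (tensor_algebra A B))"
  unfolding tensor_algebra_def using assms
  by (intro countable_quotient_algebra countable_monoid_algebra) simp_all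

lemma countable_fg_free:
  assumes "fg_free TYPE('y::ab_group_add)"
  shows "countable (UNIV :: 'y set)"
proof -
  obtain B :: "'y set" where B: "finite B" "zmod.span B = UNIV" using assms by (auto simp: fg_free_def)
  have span: "zmod.span C = range (\<lambda>u. \<Sum>v\<in>C. zsmul (u v) v)" if "finite C" for C :: "'y set"
    by (rule zmod.span_finite[OF that])
  have "countable (zmod.span C)" if "finite C" for C :: "'y set"
    using that
  proof (induction C)
    case (insert b C)
    have "zmod.span (insert b C) \<subseteq> (\<lambda>(k, z). zsmul k b + z) ` (UNIV \<times> zmod.span C)"
      using insert(1,2) by (auto simp: span image_iff)
    moreover have "countable ((\<lambda>(k :: int, z). zsmul k b + z) ` (UNIV \<times> zmod.span C))"
      using insert(3) by (intro countable_image countable_SIGMA) auto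
    ultimately show ?case by (rule countable_subset)
  qed simp
  then show ?thesis using B by metis
qed

lemma countable_Atilde:
  fixes D :: "('i::finite, 'y::ab_group_add, 'x::ab_group_add) weyl_data"
  assumes "fg_free TYPE('y)"
  shows "countable (carrier (Atilde D))"
proof -
  note y = countable_fg_free[OF assms]
  have "(UNIV :: ('i, 'y) bgen set) = range GenF \<union> range GenQ"
    by (metis UNIV_eq_I UnCI bgen.exhaust rangeI)
  moreover have "countable (range (GenF :: 'i \<Rightarrow> ('i, 'y) bgen) \<union> range GenQ)"
    using y by (intro countable_Un countable_image) (auto intro: countable_finite)
  ultimately have "countable (UNIV :: ('i, 'y) bgen set)" by simp
  then have "countable (UNIV :: ('i, 'y) bgen list set)"
    using countable_lists[of "UNIV :: ('i, 'y) bgen set"] by (simp add: lists_UNIV)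
  then have "countable (carrier (Bq D))"
    unfolding Bq_def presented_algebra_def
    by (intro countable_quotient_algebra countable_monoid_algebra countable_qfield) (simp add: word_monoid_def)
  then have "countable (carrier (tensor_algebra (Bq D) (Bq D)))"
    by (intro countable_tensor countable_qfield)
  then have "countable (carrier (Atilde0 D))"
    using Atilde0_carrier(1)[of D] countable_subset by blast
  moreover have "countable (carrier (U0 :: (qfield, 'y \<Rightarrow> qfield) module))"
    unfolding U0_def using y by (intro countable_monoid_algebra countable_qfield) (simp add: lattice_monoid_def)
  ultimately show ?thesis unfolding Atilde_def by (intro countable_tensor countable_qfield)
qed

lemma qroot_power_eq_one: "qroot ^ n = 1 \<Longrightarrow> n = 0"
proof -
  assume "qroot ^ n = 1"
  moreover have "qroot ^ n = Fract ([:0, 1:] ^ n) 1"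
    by (induction n) (simp_all add: qroot_def One_fract_def)
  ultimately have "([:0, 1:] :: rat poly) ^ n = 1" by (simp add: One_fract_def eq_fract)
  then have "degree (([:0, 1:] :: rat poly) ^ n) = 0" by simp
  then show "n = 0" by (simp add: degree_power_eq)
qed

lemma qroot_powi_eq_one: "qroot powi k = 1 \<Longrightarrow> k = 0"
proof -
  assume k: "qroot powi k = 1"
  have "qroot ^ nat \<bar>k\<bar> = 1"
  proof (cases "0 \<le> k")
    case False
    then have "inverse (qroot ^ nat (- k)) = 1" using k by (simp add: power_int_def power_inverse)
    then show ?thesis using False by simp
  qed (use k in \<open>simp add: power_int_def\<close>)
  then show "k = 0" using qroot_power_eq_one by fastforce
qed

lemma infinite_qfield: "infinite (UNIV :: qfield set)"
proof -
  have "inj (\<lambda>n::nat. qroot powi int n)"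
  proof (rule injI)
    fix m n assume "qroot powi int m = qroot powi int n"
    then have "qroot powi (int m - int n) = 1" by (simp add: power_int_diff qroot_nonzero)
    then show "m = n" using qroot_powi_eq_one by fastforce
  qed
  then show ?thesis using range_inj_infinite infinite_super by (metis subset_UNIV)
qed

lemma field_units: "s \<noteq> 0 \<Longrightarrow> t \<noteq> 0 \<Longrightarrow> s * t \<noteq> 0" "s \<noteq> 0 \<Longrightarrow> inverse s \<noteq> 0" "s \<noteq> 0 \<Longrightarrow> inverse s * s = 1" "(1 :: 'f) \<noteq> 0"
  for s t :: "'f::field"
  by auto

text \<open>The degree of \<open>gq\<close>: minus one step in the direction of f_{i1}, plus one in
  that of f_{i2}.\<close>

definition gdeg :: "'i \<Rightarrow> ('i, 'y::ab_group_add) wgt" where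
  "gdeg i = (- unitv i, unitv i, 0)"

lemma gdeg_sum: "(\<Sum>k<n. gdeg i) = ((\<lambda>j. - int n * unitv i j), (\<lambda>j. int n * unitv i j), 0)"
  by (induction n) (simp_all add: gdeg_def fun_eq_iff zero_prod_def int_distrib)

lemma gdeg_foldr:
  "distinct xs \<Longrightarrow> foldr (\<lambda>i w. (\<Sum>k<m i. gdeg i) + w) xs 0
    = ((\<lambda>j. if j \<in> set xs then - int (m j) else 0), (\<lambda>j. if j \<in> set xs then int (m j) else 0), 0)"
  by (induction xs) (auto simp: gdeg_sum zero_prod_def fun_eq_iff unitv_def)

lemma power_int_double: "q powi (2 * n) = q powi n * q powi n" if "q \<noteq> 0" for q :: "'f::field"
  using power_int_add[of q n n] that by simp

context division_ring begin

section \<open>Independence after clearing denominators\<close>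

definition qcommutes :: "('f::field \<Rightarrow> 'a) \<Rightarrow> 'a \<Rightarrow> 'a \<Rightarrow> bool" where
  "qcommutes sc x y \<longleftrightarrow> (\<exists>s. s \<noteq> 0 \<and> x * y = sc s * (y * x))"

lemma qcommutes_mult_right:
  assumes sc: "scalars sc" and "qcommutes sc x y" "qcommutes sc x z"
  shows "qcommutes sc x (y * z)"
proof -
  obtain s t where s: "s \<noteq> 0" "x * y = sc s * (y * x)" "t \<noteq> 0" "x * z = sc t * (z * x)"
    using assms(2,3) unfolding qcommutes_def by blast
  have "x * (y * z) = sc s * (y * (x * z))" by (simp only: mult.assoc[symmetric] s(2))
  also have "\<dots> = sc (s * t) * (y * z * x)"
    by (simp only: s(4) scalarsD(2)[OF sc] mult.assoc sc_left_comm[OF sc, of y t])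
  finally show ?thesis unfolding qcommutes_def using field_units(1)[OF s(1,3)] by blast
qed

lemma qcommutes_sym:
  assumes sc: "scalars sc" and "qcommutes sc x y"
  shows "qcommutes sc y x"
proof -
  obtain s where s: "s \<noteq> 0" "x * y = sc s * (y * x)" using assms(2) unfolding qcommutes_def by blast
  have "y * x = sc (inverse s) * (x * y)"
    unfolding s(2) mult.assoc[symmetric] scalarsD(2)[OF sc, symmetric] field_units(3)[OF s(1)] scalarsD(3)[OF sc]
    by (simp only: mult_1_left)
  then show ?thesis unfolding qcommutes_def using field_units(2)[OF s(1)] by blast
qed

lemma qcommutes_central:
  fixes sc :: "'f::field \<Rightarrow> 'a"
  assumes "scalars sc" "central z"
  shows "qcommutes sc z x"
proof -
  have "z * x = sc 1 * (x * z)"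
    using assms(2) unfolding central_def scalarsD(3)[OF assms(1)] mult_1_left by blast
  then show ?thesis unfolding qcommutes_def using field_units(4) by blast
qed

lemma qcommutes_inverse:
  assumes sc: "scalars sc" and "qcommutes sc x y" "x \<noteq> 0"
  shows "qcommutes sc (inverse x) y"
proof -
  obtain s where s: "s \<noteq> 0" "y * x = sc s * (x * y)"
    using qcommutes_sym[OF sc assms(2)] unfolding qcommutes_def by blast
  have "inverse x * y = inverse x * (y * x) * inverse x" using assms(3) by (simp add: mult.assoc)
  also have "\<dots> = sc s * (y * inverse x)"
    unfolding s(2) sc_left_comm[OF sc] using assms(3) by (simp add: mult.assoc[symmetric])
  finally show ?thesis unfolding qcommutes_def using s(1) by blast
qed

definition uword :: "('b \<Rightarrow> 'a) \<Rightarrow> 'b list \<Rightarrow> 'a" where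
  "uword u l = foldr (\<lambda>b x. u b * x) l 1"

definition udeg :: "('b \<Rightarrow> 'w::ab_group_add) \<Rightarrow> 'b list \<Rightarrow> 'w" where
  "udeg dg l = foldr (\<lambda>b w. dg b + w) l 0"

text \<open>The element \<open>z\<close> of the skew field is homogeneous of degree \<open>v\<close> after clearing denominators.\<close>

definition cleared :: "('f::field \<Rightarrow> 'a) \<Rightarrow> ('a \<Rightarrow> 'w::ab_group_add \<Rightarrow> bool) \<Rightarrow> ('b \<Rightarrow> 'a) \<Rightarrow> ('b \<Rightarrow> 'w) \<Rightarrow> 'a \<Rightarrow> 'w \<Rightarrow> bool" where
  "cleared sc P u dg z v \<longleftrightarrow> (\<forall>b. qcommutes sc z (u b)) \<and> (\<exists>l. P (uword u l * z) (udeg dg l + v))"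

context
  fixes sc :: "'f::field \<Rightarrow> 'a" and P :: "'a \<Rightarrow> 'w::ab_group_add \<Rightarrow> bool" and u :: "'b \<Rightarrow> 'a" and dg :: "'b \<Rightarrow> 'w"
  assumes sc: "scalars sc" and u: "\<And>b. u b \<noteq> 0" "\<And>b b'. qcommutes sc (u b) (u b')"
    and P_u: "\<And>b. P (u b) (dg b)" and P_mult: "\<And>x y v w. P x v \<Longrightarrow> P y w \<Longrightarrow> P (x * y) (v + w)"
    and P_sc: "\<And>c. c \<noteq> 0 \<Longrightarrow> P (sc c) 0"
begin

lemma P_word: "P (uword u l) (udeg dg l)"
proof (induction l)
  case Nil show ?case using P_sc[OF field_units(4)] by (simp add: uword_def udeg_def scalarsD(3)[OF sc])
next
  case (Cons b l) then show ?case using P_mult[OF P_u[of b] Cons] by (simp add: uword_def udeg_def)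
qed

lemma uword_append: "uword u (l @ l') = uword u l * uword u l'" and udeg_append: "udeg dg (l @ l') = udeg dg l + udeg dg l'"
  by (induction l) (simp_all add: uword_def udeg_def mult.assoc Groups.add.assoc)

lemma qcommutes_uword:
  assumes "\<And>b. qcommutes sc z (u b)" shows "qcommutes sc z (uword u l)"
proof (induction l)
  case Nil
  have "central 1" by (rule central_1)
  then show ?case unfolding uword_def foldr.simps id_apply by (rule qcommutes_sym[OF sc qcommutes_central[OF sc]])
next
  case (Cons b l)
  have "qcommutes sc z (u b * uword u l)" by (rule qcommutes_mult_right[OF sc assms Cons])
  then show ?case by (simp only: uword_def foldr.simps comp_apply)
qed

lemma cleared_P: "(\<And>b. qcommutes sc z (u b)) \<Longrightarrow> P z v \<Longrightarrow> cleared sc P u dg z v"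
  unfolding cleared_def by (intro conjI allI exI[of _ "[]"]) (simp_all add: uword_def udeg_def)

lemma cleared_inverse: "cleared sc P u dg (inverse (u b)) (- dg b)"
  unfolding cleared_def
  using qcommutes_inverse[OF sc u(2) u(1)] P_sc[OF field_units(4)] u(1)
  by (intro conjI allI exI[of _ "[b]"]) (simp_all add: uword_def udeg_def scalarsD(3)[OF sc])

text \<open>The word clearing \<open>z'\<close> has to be moved past \<open>z\<close>; this costs
  just a scalar because \<open>z\<close> q-commutes with every letter.\<close>

lemma cleared_mult:
  assumes "cleared sc P u dg z v" "cleared sc P u dg z' v'"
  shows "cleared sc P u dg (z * z') (v + v')"
proof -
  obtain l l' where l: "P (uword u l * z) (udeg dg l + v)" "P (uword u l' * z') (udeg dg l' + v')"
    and q: "\<And>b. qcommutes sc z (u b)" "\<And>b. qcommutes sc z' (u b)"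
    using assms unfolding cleared_def by blast
  have "P ((uword u l * z) * (uword u l' * z')) ((udeg dg l + v) + (udeg dg l' + v'))"
    by (rule P_mult[OF l])
  moreover have "qcommutes sc (uword u l') z" by (rule qcommutes_sym[OF sc qcommutes_uword[OF q(1)]])
  then obtain s where s: "s \<noteq> 0" "uword u l' * z = sc s * (z * uword u l')" unfolding qcommutes_def by blast
  have "uword u (l @ l') * (z * z') = sc s * ((uword u l * z) * (uword u l' * z'))"
    unfolding uword_append mult.assoc
    by (simp only: mult.assoc[symmetric, of "uword u l'"] s(2)) (simp only: mult.assoc sc_left_comm[OF sc, of "uword u l"])
  ultimately have "P (uword u (l @ l') * (z * z')) (0 + ((udeg dg l + v) + (udeg dg l' + v')))"
    using P_mult[OF P_sc[OF s(1)]] by simp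
  moreover have "0 + ((udeg dg l + v) + (udeg dg l' + v')) = udeg dg (l @ l') + (v + v')"
    by (simp only: udeg_append Groups.ac_simps Groups.add_0_left)
  moreover have "qcommutes sc (z * z') (u b)" for b
    by (rule qcommutes_sym[OF sc], rule qcommutes_mult_right[OF sc]; rule qcommutes_sym[OF sc], rule q)
  ultimately show ?thesis unfolding cleared_def by metis
qed

lemma cleared_power: "cleared sc P u dg z v \<Longrightarrow> cleared sc P u dg (z ^ n) (\<Sum>k<n. v)"
proof (induction n)
  case 0
  show ?case using P_sc[OF field_units(4)]
    by (simp add: scalarsD(3)[OF sc]) (intro cleared_P qcommutes_central[OF sc] central_1)
next
  case (Suc n) then show ?case using cleared_mult[OF Suc(2) Suc(1)[OF Suc(2)]] by (simp add: Groups.add.commute)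
qed

lemma common_word:
  assumes "finite S" "\<And>s. s \<in> S \<Longrightarrow> cleared sc P u dg (z s) (v s)"
  shows "\<exists>l. \<forall>s\<in>S. P (uword u l * z s) (udeg dg l + v s)"
  using assms
proof (induction S)
  case (insert t S)
  obtain l where l: "\<forall>s\<in>S. P (uword u l * z s) (udeg dg l + v s)" using insert by blast
  obtain l' where l': "P (uword u l' * z t) (udeg dg l' + v t)"
    using insert(4)[of t] unfolding cleared_def by blast
  have "P (uword u (l' @ l) * z s) (udeg dg (l' @ l) + v s)" if "s \<in> insert t S" for s
  proof (cases "s = t")
    case True
    have q: "qcommutes sc (uword u l') (uword u l)"
      by (rule qcommutes_uword, rule qcommutes_sym[OF sc], rule qcommutes_uword, rule u(2))
    obtain k where k: "k \<noteq> 0" "uword u l' * uword u l = sc k * (uword u l * uword u l')"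
      using q unfolding qcommutes_def by blast
    have "P (sc k * (uword u l * (uword u l' * z t))) (0 + (udeg dg l + (udeg dg l' + v t)))"
      by (intro P_mult P_sc k P_word l')
    then show ?thesis unfolding True uword_append udeg_append k(2)
      by (simp add: mult.assoc Groups.ac_simps)
  next
    case False
    then have "P (uword u l * z s) (udeg dg l + v s)" using l that by blast
    from P_mult[OF P_word this, of l']
    have "P (uword u l' * (uword u l * z s)) (udeg dg l' + (udeg dg l + v s))" .
    then show ?thesis unfolding uword_append udeg_append by (simp add: mult.assoc Groups.add.assoc)
  qed
  then show ?case by blast
qed simp

text \<open>A common word on the left makes all elements homogeneous and shifts their degrees by the
  same vector. The degrees remain distinct, so the independence \<open>ind\<close> of homogeneous
  elements applies.\<close>

lemma cleared_indep:
  fixes z :: "'s::comm_monoid_add \<Rightarrow> 'a"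
  assumes ind: "\<And>(S :: 's set) z v \<alpha>. finite S \<Longrightarrow> inj_on v S \<Longrightarrow> (\<And>s. s \<in> S \<Longrightarrow> P (z s) (v s)) \<Longrightarrow>
      (\<Sum>s\<in>S. sc (\<alpha> s) * z s) = 0 \<Longrightarrow> \<forall>s\<in>S. \<alpha> s = 0"
    and z: "\<And>s. cleared sc P u dg (z s) (v s)" "inj v"
  shows "indep sc z"
  unfolding indep_def
proof (intro allI impI)
  fix S \<alpha> assume S: "finite S" and eq: "(\<Sum>s\<in>S. sc (\<alpha> s) * z s) = 0"
  obtain l where l: "\<forall>s\<in>S. P (uword u l * z s) (udeg dg l + v s)"
    using common_word[of S z v, OF S z(1)] by blast
  show "\<forall>s\<in>S. \<alpha> s = 0"
  proof (rule ind[OF S])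
    show "inj_on (\<lambda>s. udeg dg l + v s) S" using z(2) by (simp add: inj_on_def)
    show "P (uword u l * z s) (udeg dg l + v s)" if "s \<in> S" for s using l that by blast
    have "(\<Sum>s\<in>S. sc (\<alpha> s) * (uword u l * z s)) = uword u l * (\<Sum>s\<in>S. sc (\<alpha> s) * z s)"
      by (simp only: sum_distrib_left sc_left_comm[OF sc, of "uword u l"])
    then show "(\<Sum>s\<in>S. sc (\<alpha> s) * (uword u l * z s)) = 0" by (simp only: eq mult_zero_right)
  qed
qed

lemma cleared_gmon:
  assumes "\<And>i. cleared sc P u dg (g i) (v i)"
  shows "cleared sc P u dg (gmon g xs m) (foldr (\<lambda>i w. (\<Sum>k<m i. v i) + w) xs 0)"
proof (induction xs)
  case Nil show ?case using P_sc[OF field_units(4)]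
    by (simp add: gmon_def scalarsD(3)[OF sc]) (intro cleared_P qcommutes_central[OF sc] central_1)
next
  case (Cons i xs)
  have "cleared sc P u dg (g i ^ m i * gmon g xs m) ((\<Sum>k<m i. v i) + foldr (\<lambda>i w. (\<Sum>k<m i. v i) + w) xs 0)"
    by (rule cleared_mult[OF cleared_power[OF assms] Cons])
  then show ?case by (simp only: gmon_def foldr.simps comp_apply)
qed

end

text \<open>Exchanging \<open>y\<close> with \<open>inverse x'\<close> gives the inverse of
  \<open>d\<close>, exchanging \<open>y'\<close> with \<open>inverse x\<close> on the way back gives
  \<open>d\<close>, and the two cancel. The relations within the \<open>x\<close> and within the
  \<open>y\<close> contribute one \<open>c\<close> each; hence the doubled exponent in the relations
  of the \<open>g i\<close>.\<close>

lemma quotient_qcomm: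
  assumes sc: "scalars sc" and nz: "x \<noteq> 0" "x' \<noteq> 0" and c: "c \<noteq> 0" "d \<noteq> 0"
    and xx: "x * x' = sc c * (x' * x)" and yy: "y * y' = sc c * (y' * y)"
    and yx: "y * x' = sc d * (x' * y)" and yx': "y' * x = sc d * (x * y')"
  shows "(inverse x * y) * (inverse x' * y') = sc (c * c) * ((inverse x' * y') * (inverse x * y))"
proof -
  have m: "y * inverse x' = sc (inverse d) * (inverse x' * y)"
    if "y * x' = sc d * (x' * y)" "x' \<noteq> 0" for x' y
  proof -
    have "inverse x' * y = inverse x' * (y * x') * inverse x'" using that(2) by (simp add: mult.assoc)
    also have "\<dots> = sc d * (y * inverse x')"
      unfolding that(1) sc_left_comm[OF sc] using that(2) by (simp add: mult.assoc[symmetric])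
    finally have e: "inverse x' * y = sc d * (y * inverse x')" .
    have "sc (inverse d) * (sc d * (y * inverse x')) = y * inverse x'"
      unfolding mult.assoc[symmetric] scalarsD(2)[OF sc, symmetric] field_units(3)[OF c(2)] scalarsD(3)[OF sc]
      by (simp only: mult_1_left)
    then show ?thesis unfolding e by (rule sym)
  qed
  have i: "inverse x * inverse x' = sc c * (inverse x' * inverse x)"
  proof -
    have e: "inverse (x' * x) = inverse (sc (inverse c) * (x * x'))"
      unfolding xx mult.assoc[symmetric] scalarsD(2)[OF sc, symmetric] field_units(3)[OF c(1)] scalarsD(3)[OF sc] mult_1_left ..
    have ic: "inverse (sc (inverse c)) = sc c"
      by (rule inverse_unique)
        (simp only: scalarsD(2)[OF sc, symmetric] field_units(3)[OF c(1)] scalarsD(3)[OF sc])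
    have nzc: "sc (inverse c) \<noteq> 0"
    proof
      assume "sc (inverse c) = 0"
      then have "sc (inverse c * c) = 0" unfolding scalarsD(2)[OF sc] by (simp only: mult_zero_left)
      then show False unfolding field_units(3)[OF c(1)] scalarsD(3)[OF sc] by (simp only: one_neq_zero)
    qed
    have "inverse (x' * x) = inverse x * inverse x'" using nz by (simp add: nonzero_inverse_mult_distrib)
    moreover have "inverse (sc (inverse c) * (x * x')) = inverse x' * inverse x * sc c"
      using nz nzc by (simp add: nonzero_inverse_mult_distrib ic)
    ultimately show ?thesis using e central_comm[OF scalarsD(4)[OF sc], of "inverse x' * inverse x" c] by (simp only:)
  qed
  have "(inverse x * y) * (inverse x' * y') = inverse x * (y * inverse x') * y'" by (simp only: mult.assoc)
  also have "\<dots> = sc (inverse d) * ((inverse x * inverse x') * (y * y'))"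
    unfolding m[OF yx nz(2)] by (simp only: mult.assoc sc_left_comm[OF sc, of "inverse x"])
  also have "\<dots> = sc (inverse d) * (sc (c * c) * (inverse x' * (inverse x * (y' * y))))"
    unfolding i yy scalarsD(2)[OF sc]
    by (simp only: mult.assoc sc_left_comm[OF sc, of "inverse x"] sc_left_comm[OF sc, of "inverse x'"])
  also have "\<dots> = sc (c * c) * (inverse x' * ((sc (inverse d) * (inverse x * y')) * y))"
    by (simp only: mult.assoc sc_left_comm[OF sc, of "inverse x'"] sc_left_comm[OF sc, of "sc (inverse d)" "c * c"])
  also have "\<dots> = sc (c * c) * ((inverse x' * y') * (inverse x * y))"
    unfolding m[OF yx' nz(1), symmetric] by (simp only: mult.assoc)
  finally show ?thesis .
qed

text \<open>\<open>P z v\<close> is an abstract notion of homogeneity: in the application,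
  \<open>z\<close> comes from an element represented by a nonzero multiple of a weighted shift along
  \<open>v\<close>. The quotients \<open>inverse (x i) * y i\<close> need not satisfy it, which is
  why \<open>cleared\<close> is used for them.\<close>

lemma graded_torus_frame:
  fixes sc :: "'f::field \<Rightarrow> 'a" and P :: "'a \<Rightarrow> ('i::finite, 'y::ab_group_add) wgt \<Rightarrow> bool"
    and x y :: "'i \<Rightarrow> 'a" and E :: "'y \<Rightarrow> 'a"
  assumes sc: "scalars sc" and E: "lattice_units E" and free: "fg_free TYPE('y)"
    and q: "\<And>i. q i \<noteq> 0" and q_sym: "\<And>i j. q i powi a i j = q j powi a j i"
    and nz: "\<And>i. x i \<noteq> 0" "\<And>i. y i \<noteq> 0"
    and rel: "\<And>i j. x i * x j = sc (q i powi c i j) * (x j * x i)" "\<And>i j. y i * y j = sc (q i powi c i j) * (y j * y i)"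
      "\<And>i j. y j * x i = sc (q j powi a j i) * (x i * y j)"
    and P: "\<And>i. P (x i) (unitv i, 0, 0)" "\<And>i. P (y i) (0, unitv i, 0)" "\<And>\<kappa>. P (E \<kappa>) (0, 0, \<kappa>)"
      "\<And>x y v w. P x v \<Longrightarrow> P y w \<Longrightarrow> P (x * y) (v + w)" "\<And>c. c \<noteq> 0 \<Longrightarrow> P (sc c) 0"
    and ind: "\<And>(S :: (('i \<Rightarrow> nat) \<times> 'y) set) z v \<alpha>. finite S \<Longrightarrow> inj_on v S \<Longrightarrow> (\<And>s. s \<in> S \<Longrightarrow> P (z s) (v s)) \<Longrightarrow>
      (\<Sum>s\<in>S. sc (\<alpha> s) * z s) = 0 \<Longrightarrow> \<forall>s\<in>S. \<alpha> s = 0"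
  shows "torus_frame sc E (\<lambda>i. inverse (x i) * y i) q c"
proof -
  let ?g = "\<lambda>i. inverse (x i) * y i"
  have qn: "q i powi n \<noteq> 0" for i n using q by (simp add: power_int_eq_0_iff)
  define u where "u = case_sum x y"
  define dg where "dg = case_sum (\<lambda>i. (unitv i, 0, 0)) (\<lambda>i. ((0, unitv i, 0) :: ('i, 'y) wgt))"
  have u: "u b \<noteq> 0" "P (u b) (dg b)" for b using nz P(1,2) by (cases b; simp add: u_def dg_def)+
  have qs: "qcommutes sc (y j) (x i)" for i j
    unfolding qcommutes_def using rel(3)[of j i] qn[of j "a j i"] by blast
  have uu: "qcommutes sc (u b) (u b')" for b b'
  proof (cases b; cases b')
    fix i j assume "b = Inl i" "b' = Inl j"
    moreover have "qcommutes sc (x i) (x j)" unfolding qcommutes_def using rel(1)[of i j] qn[of i "c i j"] by blast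
    ultimately show ?thesis by (simp add: u_def)
  next
    fix i j assume "b = Inr i" "b' = Inr j"
    moreover have "qcommutes sc (y i) (y j)" unfolding qcommutes_def using rel(2)[of i j] qn[of i "c i j"] by blast
    ultimately show ?thesis by (simp add: u_def)
  next
    fix i j assume "b = Inr i" "b' = Inl j"
    then show ?thesis unfolding u_def using qs[of i j] by simp
  next
    fix i j assume "b = Inl i" "b' = Inr j"
    then show ?thesis unfolding u_def using qcommutes_sym[OF sc qs[of j i]] by simp
  qed
  note ctx = sc u(1) uu u(2) P(4,5)
  have g: "cleared sc P u dg (?g i) (gdeg i)" for i
  proof -
    have a: "cleared sc P u dg (inverse (u (Inl i))) (- dg (Inl i))" by (rule cleared_inverse[OF ctx])
    have b: "cleared sc P u dg (u (Inr i)) (dg (Inr i))" by (rule cleared_P[OF ctx uu u(2)])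
    have "cleared sc P u dg (inverse (u (Inl i)) * u (Inr i)) (- dg (Inl i) + dg (Inr i))"
      by (rule cleared_mult[OF ctx a b])
    then show ?thesis by (simp add: u_def dg_def gdeg_def)
  qed
  \<comment> \<open>The degree of the monomial with exponents \<open>m\<close> and \<kappa>; its
    last two components recover both, so it is injective.\<close>
  define v where "v = (\<lambda>(m :: 'i \<Rightarrow> nat, \<kappa> :: 'y). ((\<lambda>j. - int (m j)), (\<lambda>j. int (m j)), \<kappa>))"
  have cl: "cleared sc P u dg (tmon E ?g s) (v s)" for s
  proof -
    obtain m \<kappa> where s: "s = (m, \<kappa>)" by (cases s)
    have "cleared sc P u dg (E \<kappa>) (0, 0, \<kappa>)"
      by (rule cleared_P[OF ctx qcommutes_central[OF sc lattice_unitsD(3)[OF E]] P(3)])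
    moreover have "cleared sc P u dg (gmon ?g enum_list m) (foldr (\<lambda>i w. (\<Sum>k<m i. gdeg i) + w) enum_list 0)"
      by (rule cleared_gmon) (rule sc u uu g P(4,5); assumption?)+
    ultimately have "cleared sc P u dg (E \<kappa> * gmon ?g enum_list m)
        ((0, 0, \<kappa>) + foldr (\<lambda>i w. (\<Sum>k<m i. gdeg i) + w) enum_list 0)"
      by (intro cleared_mult[OF ctx])
    then     show ?thesis by (simp add: s tmon_def v_def gdeg_foldr enum_list)
  qed
  have "inj v" by (auto simp: inj_on_def v_def fun_eq_iff)
  then have "indep sc (tmon E ?g)"
    by (intro cleared_indep[OF ctx ind cl])
  moreover have "qcomm sc (\<lambda>i j. q i powi (2 * c i j)) ?g"
    unfolding qcomm_def power_int_double[OF q]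
  proof (intro allI)
    fix i j
    \<comment> \<open>The scalar \<open>d\<close> of \<open>quotient_qcomm\<close> is
      \<open>q i powi a i j\<close>. It occurs in both mixed relations because \<open>q_sym\<close>
      identifies it with \<open>q j powi a j i\<close>.\<close>
    show "?g i * ?g j = sc (q i powi c i j * q i powi c i j) * (?g j * ?g i)"
      using rel(3)[of j i] q_sym[of i j]
      by (intro quotient_qcomm[OF sc nz(1) nz(1) qn qn[of i "a i j"] rel(1) rel(2) rel(3)]) simp
  qed
  ultimately show ?thesis unfolding torus_frame_def using sc E free q by blast
qed

text \<open>In the case \<open>eps = - 1\<close> of \<open>phi\<close> the product stands to the
  left of the generator. Moved to the right it becomes \<open>Pz\<close> with a negative
  exponent.\<close>

lemma inverse_Pn_shift:
  assumes sc: "scalars sc" and Y: "central Y" and r: "regular sc Y x"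
    and u: "x * u = u * (sc (q powi (- 2 * int n)) * x)" "u \<noteq> 0"
  shows "inverse (Pn sc q Y n x) * u = u * Pz sc q Y (- int n) x"
proof (cases "n = 0")
  case False
  let ?b = "q powi (- 2 * int n)"
  have e: "Pz sc q Y (- int n) x = inverse (Pn sc q Y n (sc ?b * x))"
    using False by (simp add: Pz_def)
  have p: "Pn sc q Y n x * u = u * Pn sc q Y n (sc ?b * x)"
    using Pz_shift[OF sc r Y u, of q "int n"] by (simp add: Pz_def)
  have nz: "Pn sc q Y n x \<noteq> 0" "Pn sc q Y n (sc ?b * x) \<noteq> 0"
    by (rule Pn_nonzero[OF sc r] Pn_nonzero[OF sc regular_scale[OF sc r]])+
  have "u * inverse (Pn sc q Y n (sc ?b * x)) = inverse (Pn sc q Y n x) * (Pn sc q Y n x * u) * inverse (Pn sc q Y n (sc ?b * x))"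
    using nz(1) by (simp add: mult.assoc[symmetric])
  also have "\<dots> = inverse (Pn sc q Y n x) * u"
    unfolding p using nz(2) by (simp add: mult.assoc)
  finally show ?thesis unfolding e by (rule sym)
qed simp

context
  fixes sc :: "'f::field \<Rightarrow> 'a" and E :: "'y::ab_group_add \<Rightarrow> 'a" and g :: "'i::finite \<Rightarrow> 'a"
    and q :: "'i \<Rightarrow> 'f" and c n :: "'i \<Rightarrow> 'i \<Rightarrow> int"
  assumes frame: "torus_frame sc E g q c" and c: "\<And>i. c i i = 0" and n: "\<And>i. n i i = 1"
begin

private lemmas fsc = frame_sc[OF frame] and fEE = frame_E[OF frame] and fsubK = frame_subfield[OF frame]
private lemmas fK = subfieldD[OF fsubK fsc]

text \<open>The two maps are conjugations by opposite powers. As \<open>\<phi>\<close> multiplies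
  \<open>g i\<close> by \<open>E \<nu>\<close>, \<open>Pz_invert\<close> makes the factors
  contributed by the two maps cancel; this yields bijectivity of \<open>gamma\<close>.\<close>

lemma gamma_inverse:
  assumes \<phi>: "qhom sc (torus_field sc E g) \<phi>" "\<And>\<kappa>. \<phi> (E \<kappa>) = E \<kappa>"
      "\<And>j. \<phi> (g j) = E (zsmul (n i j) \<nu>) * (g j * Pz sc (q i) (E \<nu>) (c i j) (g i))"
    and \<psi>: "qhom sc (torus_field sc E g) \<psi>" "\<And>\<kappa>. \<psi> (E \<kappa>) = E \<kappa>"
      "\<And>j. \<psi> (g j) = E (zsmul (n i j) (- \<nu>)) * (g j * Pz sc (q i) (E (- \<nu>)) (c i j) (g i))"
    and x: "x \<in> torus_field sc E g"
  shows "\<phi> (\<psi> x) = x"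
proof -
  note h = qhomD[OF \<phi>(1) fsubK fsc]
  note mem = frame_E_in[OF frame] frame_g_in[OF frame]
  have id: "qhom sc (torus_field sc E g) (\<lambda>x. x)" by (simp add: qhom_def)
  have "(\<phi> \<circ> \<psi>) x = x"
  proof (rule torus_hom_unique[OF frame qhom_comp[OF \<phi>(1) \<psi>(1)] id _ _ x])
    show "(\<phi> \<circ> \<psi>) (E \<kappa>) = E \<kappa>" for \<kappa> by (simp add: \<phi>(2) \<psi>(2))
    fix j
    let ?P = "Pz sc (q i) (E \<nu>) (c i j) (g i)" and ?P' = "Pz sc (q i) (E (- \<nu>)) (c i j) (g i)"
    have gi: "\<phi> (g i) = E \<nu> * g i" unfolding \<phi>(3) c n by simp
    have "\<phi> ?P' = Pz sc (q i) (E (- \<nu>)) (c i j) (E \<nu> * g i)"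
      using qhom_Pz(1)[OF \<phi>(1) fsubK fsc mem(2) mem(1)] by (simp add: \<phi>(2) gi)
    also have "\<dots> = inverse ?P"
      unfolding lattice_unitsD(5)[OF fEE]
      by (rule Pz_invert[OF fsc lattice_unitsD(3)[OF fEE] lattice_unitsD(4)[OF fEE] frame_regular[OF frame]])
    finally have P': "\<phi> ?P' = inverse ?P" .
    have nzP: "?P \<noteq> 0" by (rule Pz_nonzero[OF fsc frame_regular[OF frame]])
    have "\<phi> (\<psi> (g j)) = E (zsmul (n i j) (- \<nu>)) * (\<phi> (g j) * inverse ?P)"
      unfolding \<psi>(3) by (simp add: h mem fK frame_Pz_in[OF frame] \<phi>(2) P')
    also have "\<dots> = (E (zsmul (n i j) (- \<nu>)) * E (zsmul (n i j) \<nu>)) * g j"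
      unfolding \<phi>(3) using nzP by (simp add: mult.assoc)
    also have "\<dots> = g j"
      unfolding lattice_unitsD(2)[OF fEE, symmetric] by (simp add: lattice_unitsD(1)[OF fEE])
    finally show "(\<phi> \<circ> \<psi>) (g j) = g j" by simp
  qed
  then show ?thesis by simp
qed

end

end

text \<open>The class of division rings needs operations that are total on a type. A bijection from
  the carrier onto a whole type supplies them, with zero as the inverse of zero.\<close>

lemma skew_field_transport:
  fixes K :: "('k, 'm) ring_scheme" (structure) and \<beta> :: "'k \<Rightarrow> 'n"
  assumes K: "ring K" "\<one> \<noteq> \<zero>" "Units K = carrier K - {\<zero>}" and \<beta>: "bij_betw \<beta> (carrier K) UNIV"
  obtains dv iv ti pl mi um where "class.division_ring dv iv (\<beta> \<one>) ti pl (\<beta> \<zero>) mi um"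
    "\<And>x y. x \<in> carrier K \<Longrightarrow> y \<in> carrier K \<Longrightarrow> \<beta> (x \<oplus> y) = pl (\<beta> x) (\<beta> y)"
    "\<And>x y. x \<in> carrier K \<Longrightarrow> y \<in> carrier K \<Longrightarrow> \<beta> (x \<otimes> y) = ti (\<beta> x) (\<beta> y)"
proof -
  interpret K: ring K by (rule K(1))
  define k where "k = the_inv_into (carrier K) \<beta>"
  have inj: "inj_on \<beta> (carrier K)" and im: "\<beta> ` carrier K = UNIV" using \<beta> by (auto simp: bij_betw_def)
  have kb: "k (\<beta> x) = x" if "x \<in> carrier K" for x
    unfolding k_def by (rule the_inv_into_f_f[OF inj that])
  have kc: "k a \<in> carrier K" for a
    unfolding k_def by (rule the_inv_into_into[OF inj]) (simp_all add: im)
  have bk: "\<beta> (k a) = a" for a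
    unfolding k_def by (rule f_the_inv_into_f[OF inj]) (simp add: im)
  define pl where "pl a b = \<beta> (k a \<oplus> k b)" for a b
  define ti where "ti a b = \<beta> (k a \<otimes> k b)" for a b
  define um where "um a = \<beta> (\<ominus> k a)" for a
  define mi where "mi a b = pl a (um b)" for a b
  define iv where "iv a = (if k a = \<zero> then \<beta> \<zero> else \<beta> (inv k a))" for a
  define dv where "dv a b = ti a (iv b)" for a b
  have b0: "\<beta> x = \<beta> y \<longleftrightarrow> x = y" if "x \<in> carrier K" "y \<in> carrier K" for x y
    using inj_onD[OF inj _ that] by auto
  have nz: "a \<noteq> \<beta> \<zero> \<longleftrightarrow> k a \<noteq> \<zero>" for a using kb[of "\<zero>"] bk[of a] by auto
  have un: "k a \<in> Units K" if "k a \<noteq> \<zero>" for a using K(3) kc that by auto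
  note defs = pl_def ti_def um_def mi_def dv_def
  have "class.division_ring dv iv (\<beta> \<one>) ti pl (\<beta> \<zero>) mi um"
  proof unfold_locales
    fix a b c :: 'n
    show "ti (ti a b) c = ti a (ti b c)" by (simp add: defs kb kc K.m_assoc)
    show "pl (pl a b) c = pl a (pl b c)" by (simp add: defs kb kc K.a_assoc)
    show "pl a b = pl b a" by (simp add: defs kb kc K.a_comm)
    show "ti (\<beta> \<one>) a = a" "ti a (\<beta> \<one>) = a" "pl (\<beta> \<zero>) a = a"
      by (simp_all add: defs kb kc bk)
    show "pl (um a) a = \<beta> \<zero>" by (simp add: defs kb kc K.l_neg)
    show "mi a b = pl a (um b)" by (simp add: mi_def)
    show "ti (pl a b) c = pl (ti a c) (ti b c)" by (simp add: defs kb kc K.l_distr)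
    show "ti a (pl b c) = pl (ti a b) (ti a c)" by (simp add: defs kb kc K.r_distr)
    show "\<beta> \<zero> \<noteq> \<beta> \<one>" using K(2) by (simp add: b0)
    show "a \<noteq> \<beta> \<zero> \<Longrightarrow> ti (iv a) a = \<beta> \<one>" "a \<noteq> \<beta> \<zero> \<Longrightarrow> ti a (iv a) = \<beta> \<one>"
      unfolding nz using un[of a] by (simp_all add: ti_def iv_def kb)
    show "dv a b = ti a (iv b)" by (simp add: dv_def)
    show "iv (\<beta> \<zero>) = \<beta> \<zero>" by (simp add: iv_def kb)
  qed
  moreover have "\<beta> (x \<oplus> y) = pl (\<beta> x) (\<beta> y)" "\<beta> (x \<otimes> y) = ti (\<beta> x) (\<beta> y)"
    if "x \<in> carrier K" "y \<in> carrier K" for x y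
    using that by (simp_all add: defs kb)
  ultimately show thesis by (rule that)
qed

lemma skew_field_countable:
  assumes "skew_field_of_fractions A Q \<iota>" "countable (carrier A)"
  shows "countable (carrier Q)"
proof (rule countable_subset)
  show "carrier Q \<subseteq> (\<lambda>(a, b). \<iota> a \<otimes>\<^bsub>Q\<^esub> inv\<^bsub>Q\<^esub> \<iota> b) ` (carrier A \<times> carrier A)"
  proof
    fix x assume "x \<in> carrier Q"
    then obtain a b where "a \<in> carrier A" "b \<in> carrier A" "x = \<iota> a \<otimes>\<^bsub>Q\<^esub> inv\<^bsub>Q\<^esub> \<iota> b"
      using assms(1) unfolding skew_field_of_fractions_def by blast
    then show "x \<in> (\<lambda>(a, b). \<iota> a \<otimes>\<^bsub>Q\<^esub> inv\<^bsub>Q\<^esub> \<iota> b) ` (carrier A \<times> carrier A)" by auto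
  qed
qed (intro countable_image countable_SIGMA assms(2))

lemma assoc_algebra_infinite:
  fixes A :: "('f::field, 'a) module" (structure)
  assumes A: "assoc_algebra A" "\<one> \<noteq> \<zero>" and f: "infinite (UNIV :: 'f set)"
  shows "infinite (carrier A)" "c \<odot> \<one> = \<zero> \<longleftrightarrow> c = 0" (is ?R1)
proof -
  interpret A: ring A by (rule assoc_algebraD(1)[OF A(1)])
  note AD = assoc_algebraD[OF A(1)]
  have z: "0 \<odot> x = \<zero>" if "x \<in> carrier A" for x
    using AD(5)[OF that, of 0 0] AD(2)[OF that, of 0] by (metis A.add.l_cancel_one add_0)
  have z': "c \<odot> \<zero> = \<zero>" for c
    using AD(4)[of "\<zero>" c 0] z[of "\<zero>"] by simp
  have nz: "c = 0" if "c \<odot> \<one> = \<zero>" for c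
  proof (rule ccontr)
    assume c: "c \<noteq> 0"
    have "\<one> = (inverse c * c) \<odot> \<one>" using c by (simp add: AD(3))
    also have "\<dots> = \<zero>" by (simp add: AD(4) that z')
    finally show False using A(2) by simp
  qed
  then show ?R1 for c using z by auto
  have "inj (\<lambda>c. c \<odot> \<one>)"
  proof (rule injI)
    fix b c assume e: "b \<odot> \<one> = c \<odot> \<one>"
    have "(b - c) \<odot> \<one> \<oplus> c \<odot> \<one> = b \<odot> \<one>"
      using AD(5)[of "\<one>" "b - c" c] by simp
    then have "(b - c) \<odot> \<one> = \<zero>"
      unfolding e using A.add.r_cancel_one[of "c \<odot> \<one>" "(b - c) \<odot> \<one>"] AD(2) by simp
    then have "b - c = 0" by (rule nz)
    then show "b = c" by simp
  qed
  then have "infinite (range (\<lambda>c. c \<odot> \<one>))" using f finite_imageD by blast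
  moreover have "range (\<lambda>c. c \<odot> \<one>) \<subseteq> carrier A" using AD(2) by auto
  ultimately show "infinite (carrier A)" using infinite_super by blast
qed

lemma qi_nonzero: "qi D i \<noteq> 0"
  by (simp add: qi_def qpow_def qroot_nonzero power_int_eq_0_iff)

lemma qi_sym:
  fixes D :: "('i::finite, 'y::ab_group_add, 'x) weyl_data"
  assumes "symmetrized_by (cartan D) (symm D)"
  shows "qi D i powi cartan D i j = qi D j powi cartan D j i"
  unfolding dint_qi power_int_mult[symmetric] dint_sym(1)[OF assms, of i j] ..

lemma qi_powi_eq_one:
  fixes D :: "('i::finite, 'y::ab_group_add, 'x) weyl_data"
  assumes "symmetrized_by (cartan D) (symm D)" "qi D i powi k = 1"
  shows "k = 0"
proof -
  have "qroot powi (dint D i * k) = 1" using assms(2) unfolding dint_qi power_int_mult .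
  then have "dint D i * k = 0" by (rule qroot_powi_eq_one)
  then show "k = 0" using dint_sym(2)[OF assms(1), of i] by simp
qed

text \<open>The map \<beta> turns \<open>Q\<close> into a division ring on a full type, so that the
  results proved for the class become available for it under the prefix \<open>N\<close>.\<close>

locale weyl_torus =
  fixes D :: "('i::finite, 'y::ab_group_add, 'x::ab_group_add) weyl_data"
    and Q :: "(qfield, 'k) module" (structure) and \<iota> :: "('i, 'y) atilde \<Rightarrow> 'k"
    and \<beta> :: "'k \<Rightarrow> 'n" and dv iv ti pl mi um
  assumes gcm: "gcm (cartan D)"
    and symz: "symmetrized_by (cartan D) (symm D)"
    and datum: "root_datum D"
    and signs: "sign_system (cartan D) (eps D)"
    and sf: "skew_field_of_fractions (Atilde D) Q \<iota>"
    and bij: "bij_betw \<beta> (carrier Q) UNIV"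
    and dr: "class.division_ring dv iv (\<beta> \<one>) ti pl (\<beta> \<zero>) mi um"
    and \<beta>_add: "\<And>x y. x \<in> carrier Q \<Longrightarrow> y \<in> carrier Q \<Longrightarrow> \<beta> (x \<oplus> y) = pl (\<beta> x) (\<beta> y)"
    and \<beta>_mult: "\<And>x y. x \<in> carrier Q \<Longrightarrow> y \<in> carrier Q \<Longrightarrow> \<beta> (x \<otimes> y) = ti (\<beta> x) (\<beta> y)"
begin

sublocale N: division_ring dv iv "\<beta> \<one>" ti pl "\<beta> \<zero>" mi um
  by (rule dr)

abbreviation "sc c \<equiv> \<beta> (c \<odot> \<one>)"
abbreviation "EE \<kappa> \<equiv> \<beta> (qexp D \<iota> \<kappa>)"
abbreviation "gg i \<equiv> \<beta> (gq D Q \<iota> i)"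

lemma Q_alg: "assoc_algebra Q" and Q_one: "\<one> \<noteq> \<zero>" and Q_units: "Units Q = carrier Q - {\<zero>}"
  and \<iota>_hom: "\<iota> \<in> alg_hom (Atilde D) Q" and \<iota>_inj: "inj_on \<iota> (carrier (Atilde D))"
  using sf unfolding skew_field_of_fractions_def by blast+

sublocale Q: ring Q by (rule assoc_algebraD(1)[OF Q_alg])
sublocale A: ring "Atilde D" by (rule assoc_algebraD(1)[OF assoc_algebra_Atilde])

lemma \<beta>_eq: "x \<in> carrier Q \<Longrightarrow> y \<in> carrier Q \<Longrightarrow> \<beta> x = \<beta> y \<longleftrightarrow> x = y"
  using bij unfolding bij_betw_def by (auto dest: inj_onD)

lemma \<beta>_cases: obtains x where "x \<in> carrier Q" "z = \<beta> x"
  using bij unfolding bij_betw_def by (metis UNIV_I imageE)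

lemma \<beta>_inv: "x \<in> carrier Q \<Longrightarrow> x \<noteq> \<zero> \<Longrightarrow> \<beta> (inv x) = iv (\<beta> x)"
proof -
  assume x: "x \<in> carrier Q" "x \<noteq> \<zero>"
  then have u: "x \<in> Units Q" by (simp add: Q_units)
  have "ti (\<beta> x) (\<beta> (inv x)) = \<beta> \<one>"
    using \<beta>_mult[OF x(1) Q.Units_inv_closed[OF u]] u by simp
  then show ?thesis by (rule N.inverse_unique[symmetric])
qed

lemma \<iota>_closed: "X \<in> carrier (Atilde D) \<Longrightarrow> \<iota> X \<in> carrier Q"
  by (rule alg_homD(1)[OF \<iota>_hom])

lemma \<iota>_zero: "\<iota> \<zero>\<^bsub>Atilde D\<^esub> = \<zero>"
proof -
  interpret h: ring_hom_ring "Atilde D" Q \<iota>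
    using \<iota>_hom by (intro ring_hom_ringI2 A.ring_axioms Q.ring_axioms) (auto simp: alg_hom_def)
  show ?thesis by (rule h.hom_zero)
qed

lemma \<beta>\<iota>_mult: "X \<in> carrier (Atilde D) \<Longrightarrow> Y \<in> carrier (Atilde D) \<Longrightarrow> \<beta> (\<iota> (X \<otimes>\<^bsub>Atilde D\<^esub> Y)) = ti (\<beta> (\<iota> X)) (\<beta> (\<iota> Y))"
  by (simp only: alg_homD(2)[OF \<iota>_hom] \<beta>_mult \<iota>_closed)

lemma \<beta>\<iota>_add: "X \<in> carrier (Atilde D) \<Longrightarrow> Y \<in> carrier (Atilde D) \<Longrightarrow> \<beta> (\<iota> (X \<oplus>\<^bsub>Atilde D\<^esub> Y)) = pl (\<beta> (\<iota> X)) (\<beta> (\<iota> Y))"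
  by (simp only: alg_homD(3)[OF \<iota>_hom] \<beta>_add \<iota>_closed)

lemma sc_closed: "c \<odot> \<one> \<in> carrier Q"
  by (rule assoc_algebraD(2)[OF Q_alg Q.one_closed])

lemma \<beta>_smult: "x \<in> carrier Q \<Longrightarrow> \<beta> (c \<odot> x) = ti (sc c) (\<beta> x)"
  by (subst smult_as_mult[OF Q_alg], assumption, rule \<beta>_mult[OF sc_closed])

lemma \<beta>\<iota>_smult: "X \<in> carrier (Atilde D) \<Longrightarrow> \<beta> (\<iota> (c \<odot>\<^bsub>Atilde D\<^esub> X)) = ti (sc c) (\<beta> (\<iota> X))"
  by (simp only: alg_homD(5)[OF \<iota>_hom] \<beta>_smult \<iota>_closed)

lemma scalars_sc: "N.scalars sc"
  unfolding N.scalars_def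
proof (intro conjI allI)
  note AD = assoc_algebraD[OF Q_alg]
  fix a b :: qfield
  show "sc (a + b) = pl (sc a) (sc b)"
    unfolding AD(5)[OF Q.one_closed] by (rule \<beta>_add[OF sc_closed sc_closed])
  show "sc (a * b) = ti (sc a) (sc b)"
    unfolding AD(4)[OF Q.one_closed] by (rule \<beta>_smult[OF sc_closed])
  show "sc 1 = \<beta> \<one>" by (simp only: AD(3) Q.one_closed)
  show "N.central (sc a)"
    unfolding N.central_def
  proof
    fix z obtain x where x: "x \<in> carrier Q" "z = \<beta> x" by (rule \<beta>_cases)
    have "(a \<odot> \<one>) \<otimes> x = x \<otimes> (a \<odot> \<one>)"
      using x by (simp add: AD(7,8))
    then show "ti (sc a) z = ti z (sc a)" unfolding x(2) by (metis \<beta>_mult sc_closed x(1))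
  qed
qed

lemma E_et: "qexp D \<iota> \<kappa> = \<iota> (et D \<kappa>)" by (simp add: qexp_def et_def)

text \<open>The relations give commutation with the image of \<open>Atilde D\<close> only. Every
  element of \<open>Q\<close> is a fraction of such elements, and commuting with a nonzero element
  entails commuting with its inverse.\<close>

lemma lattice_units_E: "N.lattice_units EE"
  unfolding N.lattice_units_def
proof (intro conjI allI)
  note R = Atilde_relations[OF datum]
  show "EE 0 = \<beta> \<one>" unfolding E_et R(4) alg_homD(4)[OF \<iota>_hom] ..
  show "EE (\<kappa> + \<mu>) = ti (EE \<kappa>) (EE \<mu>)" for \<kappa> \<mu>
    unfolding E_et by (simp only: \<beta>\<iota>_mult[symmetric] Atilde_closed R(5))
  show "N.central (EE \<kappa>)" for \<kappa>
    unfolding N.central_def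
  proof
    fix z obtain x where x: "x \<in> carrier Q" "z = \<beta> x" by (rule \<beta>_cases)
    obtain a b where ab: "a \<in> carrier (Atilde D)" "b \<in> carrier (Atilde D)" "b \<noteq> \<zero>\<^bsub>Atilde D\<^esub>" "x = \<iota> a \<otimes> inv \<iota> b"
      using sf x(1) unfolding skew_field_of_fractions_def by blast
    have nb: "\<iota> b \<noteq> \<zero>" using inj_onD[OF \<iota>_inj _ ab(2) A.zero_closed] ab(3) \<iota>_zero by metis
    then have "\<iota> b \<in> Units Q" using Q_units \<iota>_closed[OF ab(2)] by simp
    then have z: "z = ti (\<beta> (\<iota> a)) (iv (\<beta> (\<iota> b)))"
      unfolding x(2) ab(4) by (simp only: \<beta>_mult \<iota>_closed ab(1,2) Q.Units_inv_closed \<beta>_inv[OF \<iota>_closed[OF ab(2)] nb])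
    have c: "ti (EE \<kappa>) (\<beta> (\<iota> X)) = ti (\<beta> (\<iota> X)) (EE \<kappa>)" if "X \<in> carrier (Atilde D)" for X
      unfolding E_et using R(6)[OF that, of \<kappa>] by (metis \<beta>\<iota>_mult that Atilde_closed(3))
    have "\<beta> (\<iota> b) \<noteq> \<beta> \<zero>" using \<beta>_eq[OF \<iota>_closed[OF ab(2)] Q.zero_closed] nb by simp
    then have "ti (EE \<kappa>) (iv (\<beta> (\<iota> b))) = ti (iv (\<beta> (\<iota> b))) (EE \<kappa>)"
      using c[OF ab(2)] by (metis N.mult.assoc N.left_inverse N.right_inverse N.mult_1_left N.mult_1_right)
    then show "ti (EE \<kappa>) z = ti z (EE \<kappa>)"
      unfolding z using c[OF ab(1)] by (metis N.mult.assoc)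
  qed
qed

lemma graded_nonzero:
  assumes H: "H \<in> alg_hom (Atilde D) op_algebra" and X: "X \<in> carrier (Atilde D)" "H X = wshift c v"
  shows "\<iota> X \<noteq> \<zero>"
proof
  assume "\<iota> X = \<zero>"
  then have "X = \<zero>\<^bsub>Atilde D\<^esub>" by (intro inj_onD[OF \<iota>_inj _ X(1) A.zero_closed]) (simp add: \<iota>_zero)
  moreover have "H \<zero>\<^bsub>Atilde D\<^esub> = (\<lambda>\<psi> w. 0)"
    using alg_homD(3)[OF H A.zero_closed A.zero_closed] by (simp add: op_algebra_simps fun_eq_iff)
  ultimately have "wshift c v (\<lambda>_. 1) 0 = 0" using X(2) by metis
  then show False by (simp add: wshift_def qroot_nonzero)
qed

lemma xt_unit: "\<iota> (xt D i) \<in> Units Q"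
proof -
  obtain H where H: "H \<in> alg_hom (Atilde D) op_algebra"
    "\<And>i. \<exists>c. H (xt D i) = wshift c ((unitv i, 0, 0) :: ('i, 'y) wgt)"
    by (rule Atilde_hom[OF symz datum signs]) blast
  then have "\<iota> (xt D i) \<noteq> \<zero>" using graded_nonzero[OF H(1) Atilde_closed(1)] by blast
  then show ?thesis by (simp add: Q_units \<iota>_closed Atilde_closed)
qed

text \<open>Homogeneity is tested in the shift representation \<open>H\<close>. A linear relation in
  \<open>Q\<close> between homogeneous elements comes, by injectivity of \<open>\<iota>\<close>,
  from one in \<open>Atilde D\<close>, and \<open>H\<close> maps it to a relation between weighted
  shifts with distinct translations.\<close>

lemma frame: "N.torus_frame sc EE gg (qi D) (\<lambda>i j. - eps D i j * cartan D i j)"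
proof -
  note R = Atilde_relations[OF datum]
  note cl = Atilde_closed[of D]
  obtain H where H: "H \<in> alg_hom (Atilde D) op_algebra"
    "\<And>i. \<exists>c. H (xt D i) = wshift c ((unitv i, 0, 0) :: ('i, 'y) wgt)" "\<And>i. \<exists>c. H (yt D i) = wshift c (0, unitv i, 0)"
    "\<And>\<kappa>. H (et D \<kappa>) = wshift (\<lambda>_. 0) (0, 0, \<kappa>)"
    by (rule Atilde_hom[OF symz datum signs]) blast
  note HD = alg_homD[OF H(1), unfolded op_algebra_simps]
  define P where "P z v \<longleftrightarrow> (\<exists>X\<in>carrier (Atilde D). \<exists>a c. a \<noteq> 0 \<and> z = \<beta> (\<iota> X) \<and> H X = (\<lambda>\<psi> w. a * wshift c v \<psi> w))"
    for z and v :: "('i, 'y) wgt"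
  have H0: "H \<zero>\<^bsub>Atilde D\<^esub> = (\<lambda>\<psi> w. 0)"
    using HD(3)[OF A.zero_closed A.zero_closed] by (simp add: fun_eq_iff)
  have nz: "\<beta> (\<iota> X) \<noteq> \<beta> \<zero>" if "X \<in> carrier (Atilde D)" "H X = wshift c v" for X c and v :: "('i, 'y) wgt"
    using graded_nonzero[OF H(1) that] \<beta>_eq[OF \<iota>_closed[OF that(1)] Q.zero_closed] by simp
  have Pw: "P (\<beta> (\<iota> X)) v" if "X \<in> carrier (Atilde D)" "H X = wshift c v" for X c v
    unfolding P_def using that by (intro bexI[of _ X] exI[of _ 1] exI[of _ c]) simp_all
  have "N.torus_frame sc EE (\<lambda>i. ti (iv (\<beta> (\<iota> (xt D i)))) (\<beta> (\<iota> (yt D i)))) (qi D) (\<lambda>i j. - eps D i j * cartan D i j)"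
  proof (rule N.graded_torus_frame[where P = P and a = "cartan D"])
    show "N.scalars sc" "N.lattice_units EE" by (rule scalars_sc lattice_units_E)+
    show "fg_free TYPE('y)" using datum by (simp add: root_datum_def)
    show "qi D i \<noteq> 0" for i by (rule qi_nonzero)
    show "qi D i powi cartan D i j = qi D j powi cartan D j i" for i j by (rule qi_sym[OF symz])
    show "\<beta> (\<iota> (xt D i)) \<noteq> \<beta> \<zero>" "\<beta> (\<iota> (yt D i)) \<noteq> \<beta> \<zero>" for i
      using nz[OF cl(1)] nz[OF cl(2)] H(2,3)[of i] by blast+
    show "P (\<beta> (\<iota> (xt D i))) (unitv i, 0, 0)" "P (\<beta> (\<iota> (yt D i))) (0, unitv i, 0)" "P (EE \<kappa>) (0, 0, \<kappa>)" for i \<kappa>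
      using Pw[OF cl(1)] Pw[OF cl(2)] Pw[OF cl(3) H(4)] H(2,3)[of i] unfolding E_et by blast+
    show "ti (\<beta> (\<iota> (xt D i))) (\<beta> (\<iota> (xt D j))) = ti (sc (qi D i powi (- eps D i j * cartan D i j)))
        (ti (\<beta> (\<iota> (xt D j))) (\<beta> (\<iota> (xt D i))))" for i j
      by (simp only: \<beta>\<iota>_mult[symmetric] \<beta>\<iota>_smult[symmetric] cl A.m_closed R(1)[of i j])
    show "ti (\<beta> (\<iota> (yt D i))) (\<beta> (\<iota> (yt D j))) = ti (sc (qi D i powi (- eps D i j * cartan D i j)))
        (ti (\<beta> (\<iota> (yt D j))) (\<beta> (\<iota> (yt D i))))" for i j
      by (simp only: \<beta>\<iota>_mult[symmetric] \<beta>\<iota>_smult[symmetric] cl A.m_closed R(2)[of i j])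
    show "ti (\<beta> (\<iota> (yt D j))) (\<beta> (\<iota> (xt D i))) = ti (sc (qi D j powi cartan D j i))
        (ti (\<beta> (\<iota> (xt D i))) (\<beta> (\<iota> (yt D j))))" for i j
      by (simp only: \<beta>\<iota>_mult[symmetric] \<beta>\<iota>_smult[symmetric] cl A.m_closed R(3))
    show "P (ti x y) (v + w)" if "P x v" "P y w" for x y v w
    proof -
      obtain X a c Y b d where X: "X \<in> carrier (Atilde D)" "a \<noteq> 0" "x = \<beta> (\<iota> X)" "H X = (\<lambda>\<psi> w. a * wshift c v \<psi> w)"
        and Y: "Y \<in> carrier (Atilde D)" "b \<noteq> 0" "y = \<beta> (\<iota> Y)" "H Y = (\<lambda>\<psi> u. b * wshift d w \<psi> u)"
        using \<open>P x v\<close> \<open>P y w\<close> unfolding P_def by blast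
      have "H X \<circ> H Y = (\<lambda>\<psi> u. (a * b) * (wshift c v \<circ> wshift d w) \<psi> u)"
        unfolding X(4) Y(4) by (simp add: wshift_def fun_eq_iff)
      then show ?thesis
        unfolding P_def wshift_comp using X Y \<beta>\<iota>_mult[OF X(1) Y(1)] HD(2)[OF X(1) Y(1)] A.m_closed[OF X(1) Y(1)]
        by (intro bexI[of _ "X \<otimes>\<^bsub>Atilde D\<^esub> Y"] exI[of _ "a * b"] exI[of _ "\<lambda>w. c w + d (w - v)"]) simp_all
    qed
    show "P (sc c) 0" if "c \<noteq> 0" for c
    proof -
      have "\<beta> (\<iota> (c \<odot>\<^bsub>Atilde D\<^esub> \<one>\<^bsub>Atilde D\<^esub>)) = sc c"
        by (simp only: alg_homD(5)[OF \<iota>_hom] A.one_closed alg_homD(4)[OF \<iota>_hom])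
      moreover have "H (c \<odot>\<^bsub>Atilde D\<^esub> \<one>\<^bsub>Atilde D\<^esub>) = (\<lambda>\<psi> w. c * wshift (\<lambda>_. 0) 0 \<psi> w)"
        by (simp add: HD(4,5) wshift_id)
      ultimately show ?thesis
        unfolding P_def using that assoc_algebraD(2)[OF assoc_algebra_Atilde A.one_closed, of c]
        by (intro bexI[of _ "c \<odot>\<^bsub>Atilde D\<^esub> \<one>\<^bsub>Atilde D\<^esub>"] exI[of _ c] exI[of _ "\<lambda>_. 0"]) simp_all
    qed
    fix S :: "(('i \<Rightarrow> nat) \<times> 'y) set" and z v and \<alpha> :: "_ \<Rightarrow> qfield"
    assume S: "finite S" and v: "inj_on v S" and P: "\<And>s. s \<in> S \<Longrightarrow> P (z s) (v s)"
      and eq: "N.sum (\<lambda>s. ti (sc (\<alpha> s)) (z s)) S = \<beta> \<zero>"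
    have "\<forall>s\<in>S. \<exists>X a c. X \<in> carrier (Atilde D) \<and> a \<noteq> 0 \<and> z s = \<beta> (\<iota> X) \<and> H X = (\<lambda>\<psi> w. a * wshift c (v s) \<psi> w)"
      using P unfolding P_def by blast
    then obtain X where "\<forall>s\<in>S. \<exists>a c. X s \<in> carrier (Atilde D) \<and> a \<noteq> 0 \<and> z s = \<beta> (\<iota> (X s)) \<and>
        H (X s) = (\<lambda>\<psi> w. a * wshift c (v s) \<psi> w)" by (rule bchoice[THEN exE])
    then obtain a where "\<forall>s\<in>S. \<exists>c. X s \<in> carrier (Atilde D) \<and> a s \<noteq> 0 \<and> z s = \<beta> (\<iota> (X s)) \<and>
        H (X s) = (\<lambda>\<psi> w. a s * wshift c (v s) \<psi> w)" by (rule bchoice[THEN exE])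
    then obtain c where "\<forall>s\<in>S. X s \<in> carrier (Atilde D) \<and> a s \<noteq> 0 \<and> z s = \<beta> (\<iota> (X s)) \<and>
        H (X s) = (\<lambda>\<psi> w. a s * wshift (c s) (v s) \<psi> w)" by (rule bchoice[THEN exE])
    then have X: "\<And>s. s \<in> S \<Longrightarrow> X s \<in> carrier (Atilde D)" "\<And>s. s \<in> S \<Longrightarrow> a s \<noteq> 0"
      "\<And>s. s \<in> S \<Longrightarrow> z s = \<beta> (\<iota> (X s))" "\<And>s. s \<in> S \<Longrightarrow> H (X s) = (\<lambda>\<psi> w. a s * wshift (c s) (v s) \<psi> w)"
      by (blast dest: bspec)+
    have "\<exists>Y\<in>carrier (Atilde D). \<beta> (\<iota> Y) = N.sum (\<lambda>s. ti (sc (\<alpha> s)) (z s)) S \<and>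
        H Y = (\<lambda>\<psi> w. \<Sum>s\<in>S. (\<alpha> s * a s) * wshift (c s) (v s) \<psi> w)"
      using S X(1,3,4)
    proof (induction S)
      case empty
      then show ?case using H0 \<iota>_zero by (intro bexI[of _ "\<zero>\<^bsub>Atilde D\<^esub>"]) simp_all
    next
      case (insert t S)
      have "\<exists>Y\<in>carrier (Atilde D). \<beta> (\<iota> Y) = N.sum (\<lambda>s. ti (sc (\<alpha> s)) (z s)) S \<and>
        H Y = (\<lambda>\<psi> w. \<Sum>s\<in>S. (\<alpha> s * a s) * wshift (c s) (v s) \<psi> w)"
        by (rule insert.IH; rule insert.prems, erule insertI2)
      then obtain Y where Y: "Y \<in> carrier (Atilde D)" "\<beta> (\<iota> Y) = N.sum (\<lambda>s. ti (sc (\<alpha> s)) (z s)) S"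
        "H Y = (\<lambda>\<psi> w. \<Sum>s\<in>S. (\<alpha> s * a s) * wshift (c s) (v s) \<psi> w)"
        by (elim bexE conjE)
      have t: "X t \<in> carrier (Atilde D)" "z t = \<beta> (\<iota> (X t))" "H (X t) = (\<lambda>\<psi> w. a t * wshift (c t) (v t) \<psi> w)"
        by (rule insert.prems[OF insertI1])+
      have tc: "\<alpha> t \<odot>\<^bsub>Atilde D\<^esub> X t \<in> carrier (Atilde D)" by (rule assoc_algebraD(2)[OF assoc_algebra_Atilde t(1)])
      show ?case
      proof (rule bexI[of _ "\<alpha> t \<odot>\<^bsub>Atilde D\<^esub> X t \<oplus>\<^bsub>Atilde D\<^esub> Y"])
        show "\<alpha> t \<odot>\<^bsub>Atilde D\<^esub> X t \<oplus>\<^bsub>Atilde D\<^esub> Y \<in> carrier (Atilde D)" using tc Y(1) by simp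
        show "\<beta> (\<iota> (\<alpha> t \<odot>\<^bsub>Atilde D\<^esub> X t \<oplus>\<^bsub>Atilde D\<^esub> Y)) = N.sum (\<lambda>s. ti (sc (\<alpha> s)) (z s)) (insert t S) \<and>
          H (\<alpha> t \<odot>\<^bsub>Atilde D\<^esub> X t \<oplus>\<^bsub>Atilde D\<^esub> Y) = (\<lambda>\<psi> w. \<Sum>s\<in>insert t S. (\<alpha> s * a s) * wshift (c s) (v s) \<psi> w)"
          using insert(1,2) by (simp add: \<beta>\<iota>_add tc Y \<beta>\<iota>_smult t(1) t(2) HD(3,5) t(3) mult.assoc)
      qed
    qed
    then obtain Y where Y: "Y \<in> carrier (Atilde D)" "\<beta> (\<iota> Y) = \<beta> \<zero>"
      "H Y = (\<lambda>\<psi> w. \<Sum>s\<in>S. (\<alpha> s * a s) * wshift (c s) (v s) \<psi> w)"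
      unfolding eq by blast
    have "\<iota> Y = \<iota> \<zero>\<^bsub>Atilde D\<^esub>" using Y(2) by (simp only: \<beta>_eq \<iota>_closed Y(1) Q.zero_closed \<iota>_zero)
    then have "Y = \<zero>\<^bsub>Atilde D\<^esub>" by (rule inj_onD[OF \<iota>_inj _ Y(1) A.zero_closed])
    then have "(\<lambda>\<psi> w. \<Sum>s\<in>S. (\<alpha> s * a s) * wshift (c s) (v s) \<psi> w) = (\<lambda>\<psi> w. 0)" using Y(3) H0 by simp
    then have "\<alpha> s * a s = 0" if "s \<in> S" for s by (rule wshift_indep[OF S v _ that])
    then show "\<forall>s\<in>S. \<alpha> s = 0" using X(2) by auto
  qed
  moreover have "gg i = ti (iv (\<beta> (\<iota> (xt D i)))) (\<beta> (\<iota> (yt D i)))" for i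
  proof -
    have n: "\<iota> (xt D i) \<noteq> \<zero>" and "\<iota> (xt D i) \<in> Units Q" using xt_unit[of i] by (simp_all add: Q_units)
    then show ?thesis
      unfolding gq_def xt_def[symmetric] yt_def[symmetric]
      by (simp only: \<beta>_mult \<iota>_closed cl Q.Units_inv_closed \<beta>_inv[OF \<iota>_closed[OF cl(1)] n])
  qed
  ultimately show ?thesis by simp
qed

section \<open>Two descriptions of Q(A_q) and the transfer of automorphisms\<close>

abbreviation "KK \<equiv> N.torus_field sc EE gg"
abbreviation "QA \<equiv> QAq D Q \<iota>"

lemmas fsub = N.subfieldD[OF N.frame_subfield[OF frame] scalars_sc]

lemma E_closed: "qexp D \<iota> \<kappa> \<in> carrier Q"
  unfolding E_et by (rule \<iota>_closed[OF Atilde_closed(3)])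

lemma g_closed: "gq D Q \<iota> i \<in> carrier Q"
  unfolding gq_def xt_def[symmetric] yt_def[symmetric]
  by (intro Q.m_closed Q.Units_inv_closed[OF xt_unit] \<iota>_closed Atilde_closed)

lemma gens_closed: "range (gq D Q \<iota>) \<union> range (qexp D \<iota>) \<subseteq> carrier Q"
  using g_closed E_closed by auto

lemma Aq_alg: "assoc_algebra (Aq D Q \<iota>)"
  unfolding Aq_def by (rule assoc_algebra_generated[OF Q_alg gens_closed])

lemma Aq_sub: "carrier (Aq D Q \<iota>) \<subseteq> carrier Q"
  unfolding Aq_def by (rule generated_subalgebra_subset[OF Q_alg gens_closed])

lemma Aq_gens: "gq D Q \<iota> i \<in> carrier (Aq D Q \<iota>)" "qexp D \<iota> \<kappa> \<in> carrier (Aq D Q \<iota>)"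
  using generated_subalgebra_incl[OF Q_alg gens_closed] unfolding Aq_def by auto

lemmas Aq_ops = generated_subalgebra_simps[of Q "range (gq D Q \<iota>) \<union> range (qexp D \<iota>)", folded Aq_def]

lemma \<beta>_uminus: "x \<in> carrier Q \<Longrightarrow> \<beta> (\<ominus> x) = um (\<beta> x)"
proof -
  assume x: "x \<in> carrier Q"
  have "pl (\<beta> x) (\<beta> (\<ominus> x)) = \<beta> \<zero>"
    using \<beta>_add[OF x Q.a_inv_closed[OF x]] x by (simp add: Q.r_neg)
  then show ?thesis by (rule N.minus_unique[symmetric])
qed

lemma Aq_in_KK: "x \<in> carrier (Aq D Q \<iota>) \<Longrightarrow> \<beta> x \<in> KK"
proof -
  let ?H = "range (gq D Q \<iota>) \<union> range (qexp D \<iota>) \<union> {c \<odot> \<one> | c. True}"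
  assume "x \<in> carrier (Aq D Q \<iota>)"
  then have "x \<in> generate_ring Q ?H" by (simp add: Aq_def generated_subalgebra_def)
  then have "x \<in> carrier Q \<and> \<beta> x \<in> KK"
  proof (induction rule: generate_ring.induct)
    case one then show ?case using fsub(7) by simp
  next
    case (incl h) then show ?case
      using g_closed E_closed sc_closed N.frame_g_in[OF frame] N.frame_E_in[OF frame] fsub(5) by auto
  next
    case (a_inv h) then show ?case using fsub(3) by (simp add: \<beta>_uminus)
  next
    case (eng_add h h') then show ?case using fsub(1) by (simp add: \<beta>_add)
  next
    case (eng_mult h h') then show ?case using fsub(2) by (simp add: \<beta>_mult)
  qed
  then show ?thesis by blast
qed

lemma lspan_in_Aq: "z \<in> N.lspan sc (N.tmon EE gg) UNIV \<Longrightarrow> z \<in> \<beta> ` carrier (Aq D Q \<iota>)"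
proof -
  interpret B: ring "Aq D Q \<iota>" by (rule assoc_algebraD(1)[OF Aq_alg])
  let ?B = "\<beta> ` carrier (Aq D Q \<iota>)"
  have z: "\<beta> \<zero> \<in> ?B" and o: "\<beta> \<one> \<in> ?B" using B.zero_closed B.one_closed unfolding Aq_ops by blast+
  have add: "pl x y \<in> ?B" and mult: "ti x y \<in> ?B" if xy: "x \<in> ?B" "y \<in> ?B" for x y
  proof -
    obtain u v where u: "u \<in> carrier (Aq D Q \<iota>)" "x = \<beta> u" and v: "v \<in> carrier (Aq D Q \<iota>)" "y = \<beta> v"
      using xy by blast
    have e: "\<beta> (u \<oplus> v) = pl x y" "\<beta> (u \<otimes> v) = ti x y"
      using u v Aq_sub by (simp_all add: \<beta>_add \<beta>_mult subset_iff)
    have "u \<oplus> v \<in> carrier (Aq D Q \<iota>)" "u \<otimes> v \<in> carrier (Aq D Q \<iota>)"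
      using B.a_closed[OF u(1) v(1)] B.m_closed[OF u(1) v(1)] unfolding Aq_ops .
    then show "pl x y \<in> ?B" "ti x y \<in> ?B" unfolding e[symmetric] by - (rule imageI, assumption)+
  qed
  have sc: "sc c \<in> ?B" for c
    using assoc_algebraD(2)[OF Aq_alg B.one_closed, of c] unfolding Aq_ops by blast
  have pow: "N.power x n \<in> ?B" if "x \<in> ?B" for x n
  proof (induction n)
    case (Suc n) then show ?case unfolding N.power_Suc by (rule mult[OF that])
  qed (simp only: N.power_0 o)
  have gm: "N.gmon gg xs m \<in> ?B" for xs m
  proof (induction xs)
    case (Cons i xs)
    have "gg i \<in> ?B" using Aq_gens(1) by blast
    then show ?case unfolding N.gmon_Cons by (intro mult pow Cons)
  qed (simp only: N.gmon_def foldr.simps id_apply o)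
  have tm: "N.tmon EE gg \<gamma> \<in> ?B" for \<gamma>
  proof -
    obtain m \<kappa> where \<gamma>: "\<gamma> = (m, \<kappa>)" by (cases \<gamma>)
    have "EE \<kappa> \<in> ?B" using Aq_gens(2) by blast
    then show ?thesis unfolding N.tmon_def \<gamma> prod.case by (intro mult gm)
  qed
  assume "z \<in> N.lspan sc (N.tmon EE gg) UNIV"
  then obtain T c where T: "finite T" "z = N.sum (\<lambda>\<gamma>. ti (sc (c \<gamma>)) (N.tmon EE gg \<gamma>)) T"
    unfolding N.lspan_def by blast
  show ?thesis unfolding T(2) using T(1)
  proof (induction T)
    case (insert \<gamma> T)
    then show ?case unfolding N.sum.insert[OF insert(1,2)] by (intro add mult sc tm)
  qed (simp only: N.sum.empty z)
qed

lemma QA_ops: "mult QA = mult Q" "one QA = one Q" "zero QA = zero Q" "add QA = add Q" "smult QA = smult Q"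
  by (simp_all add: QAq_def)

lemma QA_sub: "x \<in> carrier QA \<Longrightarrow> x \<in> carrier Q"
proof -
  assume "x \<in> carrier QA"
  then obtain a b where ab: "a \<in> carrier (Aq D Q \<iota>)" "b \<in> carrier (Aq D Q \<iota>) - {\<zero>}" "x = a \<otimes> inv b"
    unfolding QAq_def by auto
  then have "b \<in> Units Q" "a \<in> carrier Q" using Aq_sub Q_units by auto
  then show ?thesis unfolding ab(3) by (intro Q.m_closed Q.Units_inv_closed)
qed

text \<open>The generated algebra lies in the skew field \<open>KK\<close> because the generators
  do; conversely the span of the monomials lies in the generated algebra. So both have the same
  fractions.\<close>

lemma QA_iff: "x \<in> carrier Q \<Longrightarrow> x \<in> carrier QA \<longleftrightarrow> \<beta> x \<in> KK"
proof
  assume x: "x \<in> carrier Q"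
  show "\<beta> x \<in> KK" if xQ: "x \<in> carrier QA"
  proof -
    obtain a b where ab: "a \<in> carrier (Aq D Q \<iota>)" "b \<in> carrier (Aq D Q \<iota>)" "b \<noteq> \<zero>" "x = a \<otimes> inv b"
      using xQ unfolding QAq_def by auto
    have c: "a \<in> carrier Q" "b \<in> carrier Q" using ab(1,2) Aq_sub by auto
    then have "b \<in> Units Q" using ab(3) Q_units by auto
    then have "\<beta> x = ti (\<beta> a) (iv (\<beta> b))"
      unfolding ab(4) by (simp only: \<beta>_mult c Q.Units_inv_closed \<beta>_inv[OF c(2) ab(3)])
    then show ?thesis using fsub(2)[OF Aq_in_KK[OF ab(1)] fsub(4)[OF Aq_in_KK[OF ab(2)]]] by simp
  qed
  show "x \<in> carrier QA" if xK: "\<beta> x \<in> KK"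
  proof -
    obtain a b where ab: "a \<in> carrier (Aq D Q \<iota>)" "b \<in> carrier (Aq D Q \<iota>)" "\<beta> b \<noteq> \<beta> \<zero>" "\<beta> x = ti (\<beta> a) (iv (\<beta> b))"
      using xK lspan_in_Aq unfolding N.torus_field_def N.fracs_def by blast
    have c: "a \<in> carrier Q" "b \<in> carrier Q" "b \<noteq> \<zero>" using ab(1-3) Aq_sub by auto
    then have u: "b \<in> Units Q" using Q_units by auto
    then have "\<beta> x = \<beta> (a \<otimes> inv b)"
      unfolding ab(4) by (simp only: \<beta>_mult c Q.Units_inv_closed \<beta>_inv[OF c(2,3)])
    then have "x = a \<otimes> inv b"
      using \<beta>_eq[OF x Q.m_closed[OF c(1) Q.Units_inv_closed[OF u]]] by simp
    then show ?thesis unfolding QAq_def using ab(1,2) c(3) by auto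
  qed
qed

lemma QA_gens: "gq D Q \<iota> i \<in> carrier QA" "qexp D \<iota> \<kappa> \<in> carrier QA"
  by (simp_all add: QA_iff g_closed E_closed N.frame_g_in[OF frame] N.frame_E_in[OF frame])

lemma QA_KK: "x \<in> carrier QA \<Longrightarrow> \<beta> x \<in> KK"
  using QA_iff[OF QA_sub] by blast

lemma QA_closed: "x \<in> carrier QA \<Longrightarrow> y \<in> carrier QA \<Longrightarrow> x \<oplus> y \<in> carrier QA"
  "x \<in> carrier QA \<Longrightarrow> y \<in> carrier QA \<Longrightarrow> x \<otimes> y \<in> carrier QA"
  "x \<in> carrier QA \<Longrightarrow> k \<odot> x \<in> carrier QA" "\<one> \<in> carrier QA"
proof -
  show "x \<oplus> y \<in> carrier QA" "x \<otimes> y \<in> carrier QA" if "x \<in> carrier QA" "y \<in> carrier QA"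
    using that QA_KK QA_sub by (simp_all add: QA_iff \<beta>_add \<beta>_mult fsub)
  show "k \<odot> x \<in> carrier QA" if "x \<in> carrier QA"
    using that QA_KK QA_sub assoc_algebraD(2)[OF Q_alg, of x k] by (simp add: QA_iff \<beta>_smult[of x k] fsub)
  show "\<one> \<in> carrier QA" by (simp add: QA_iff fsub)
qed

lemma alg_autI:
  assumes "bij_betw h (carrier QA) (carrier QA)" "h \<in> extensional (carrier QA)" "h \<one> = \<one>"
    "\<And>x y. x \<in> carrier QA \<Longrightarrow> y \<in> carrier QA \<Longrightarrow> h (x \<oplus> y) = h x \<oplus> h y"
    "\<And>x y. x \<in> carrier QA \<Longrightarrow> y \<in> carrier QA \<Longrightarrow> h (x \<otimes> y) = h x \<otimes> h y"
    "\<And>x k. x \<in> carrier QA \<Longrightarrow> h (k \<odot> x) = k \<odot> h x"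
  shows "h \<in> alg_aut QA"
  unfolding alg_aut_def alg_hom_def Bij_def
proof (intro IntI CollectI conjI ring_hom_memI allI ballI)
  show "h x \<in> carrier QA" if "x \<in> carrier QA" for x using assms(1) that by (auto simp: bij_betw_def)
qed (simp_all add: QA_ops assms)

lemma alg_autD:
  assumes "h \<in> alg_aut QA"
  shows "bij_betw h (carrier QA) (carrier QA)" "h \<in> extensional (carrier QA)" "h \<one> = \<one>"
    "x \<in> carrier QA \<Longrightarrow> y \<in> carrier QA \<Longrightarrow> h (x \<oplus> y) = h x \<oplus> h y"
    "x \<in> carrier QA \<Longrightarrow> y \<in> carrier QA \<Longrightarrow> h (x \<otimes> y) = h x \<otimes> h y"
    "x \<in> carrier QA \<Longrightarrow> h (k \<odot> x) = k \<odot> h x"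
    "x \<in> carrier QA \<Longrightarrow> h x \<in> carrier QA"
proof -
  have hom: "h \<in> alg_hom QA QA" and b: "h \<in> Bij (carrier QA)" using assms by (simp_all add: alg_aut_def)
  show "bij_betw h (carrier QA) (carrier QA)" "h \<in> extensional (carrier QA)" using b by (simp_all add: Bij_def)
  note h = alg_homD[OF hom, unfolded QA_ops]
  show "h \<one> = \<one>" by (rule h(4))
  show "x \<in> carrier QA \<Longrightarrow> y \<in> carrier QA \<Longrightarrow> h (x \<oplus> y) = h x \<oplus> h y" by (rule h(3))
  show "x \<in> carrier QA \<Longrightarrow> y \<in> carrier QA \<Longrightarrow> h (x \<otimes> y) = h x \<otimes> h y" by (rule h(2))
  show "x \<in> carrier QA \<Longrightarrow> h (k \<odot> x) = k \<odot> h x" by (rule h(5))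
  show "x \<in> carrier QA \<Longrightarrow> h x \<in> carrier QA" by (rule h(1))
qed

text \<open>The restriction matters: elements of \<open>alg_aut\<close> are extensional, and this
  makes an automorphism with given values on the generators unique as a function.\<close>

definition lift_map :: "('n \<Rightarrow> 'n) \<Rightarrow> 'k \<Rightarrow> 'k" where
  "lift_map \<phi> = restrict (\<lambda>x. the_inv_into (carrier Q) \<beta> (\<phi> (\<beta> x))) (carrier QA)"

definition push_map :: "('k \<Rightarrow> 'k) \<Rightarrow> 'n \<Rightarrow> 'n" where
  "push_map h z = \<beta> (h (the_inv_into (carrier Q) \<beta> z))"

lemma \<beta>_inv_into: "\<beta> (the_inv_into (carrier Q) \<beta> z) = z" "the_inv_into (carrier Q) \<beta> z \<in> carrier Q"
  "x \<in> carrier Q \<Longrightarrow> the_inv_into (carrier Q) \<beta> (\<beta> x) = x"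
  using bij the_inv_into_into[of \<beta> "carrier Q" z "carrier Q"] f_the_inv_into_f[of \<beta> "carrier Q" z] the_inv_into_f_f[of \<beta> "carrier Q" x]
  unfolding bij_betw_def by auto

lemma \<beta>_lift_map: "x \<in> carrier QA \<Longrightarrow> \<beta> (lift_map \<phi> x) = \<phi> (\<beta> x)"
  by (simp add: lift_map_def \<beta>_inv_into)

lemma push_map: "x \<in> carrier Q \<Longrightarrow> push_map h (\<beta> x) = \<beta> (h x)"
  by (simp add: push_map_def \<beta>_inv_into)

lemma lift_map_closed: "N.qhom sc KK \<phi> \<Longrightarrow> x \<in> carrier QA \<Longrightarrow> lift_map \<phi> x \<in> carrier QA"
  using N.qhomD(1)[OF _ N.frame_subfield[OF frame] scalars_sc, of \<phi> "\<beta> x"] QA_KK[of x]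
  by (subst QA_iff) (simp_all add: \<beta>_lift_map, simp add: lift_map_def \<beta>_inv_into)

lemma lift_map_aut:
  assumes "N.qhom sc KK \<phi>" "N.qhom sc KK \<psi>" "\<And>z. z \<in> KK \<Longrightarrow> \<phi> (\<psi> z) = z" "\<And>z. z \<in> KK \<Longrightarrow> \<psi> (\<phi> z) = z"
  shows "lift_map \<phi> \<in> alg_aut QA"
proof (rule alg_autI)
  note h = N.qhomD[OF assms(1) N.frame_subfield[OF frame] scalars_sc]
  note cl = lift_map_closed[OF assms(1)] lift_map_closed[OF assms(2)]
  have eqI: "x = y" if "\<beta> x = \<beta> y" "x \<in> carrier Q" "y \<in> carrier Q" for x y
    by (rule iffD1[OF \<beta>_eq[OF that(2,3)] that(1)])
  have "lift_map \<phi> (lift_map \<psi> x) = x" "lift_map \<psi> (lift_map \<phi> x) = x" if "x \<in> carrier QA" for x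
    by (rule eqI; simp add: \<beta>_lift_map cl QA_sub QA_KK assms(3,4) that)+
  then show "bij_betw (lift_map \<phi>) (carrier QA) (carrier QA)"
    using cl by (intro bij_betw_byWitness[where f' = "lift_map \<psi>"]) auto
  show "lift_map \<phi> \<in> extensional (carrier QA)" by (simp add: lift_map_def)
  show "lift_map \<phi> \<one> = \<one>" by (rule eqI) (simp_all add: \<beta>_lift_map QA_closed h cl QA_sub)
  fix x assume x: "x \<in> carrier QA"
  note xK = QA_KK[OF x] and xQ = QA_sub[OF cl(1)[OF x]]
  have "\<beta> (lift_map \<phi> (k \<odot> x)) = ti (sc k) (\<beta> (lift_map \<phi> x))" for k
    by (simp only: \<beta>_lift_map QA_closed x \<beta>_smult[OF QA_sub[OF x]] h(3)[OF fsub(5) xK] h(4))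
  then show "lift_map \<phi> (k \<odot> x) = k \<odot> lift_map \<phi> x" for k
    by (intro eqI QA_sub[OF cl(1)] QA_closed x assoc_algebraD(2)[OF Q_alg xQ]) (simp only: \<beta>_smult[OF xQ])
  fix y assume y: "y \<in> carrier QA"
  note yK = QA_KK[OF y] and yQ = QA_sub[OF cl(1)[OF y]]
  show "lift_map \<phi> (x \<otimes> y) = lift_map \<phi> x \<otimes> lift_map \<phi> y" "lift_map \<phi> (x \<oplus> y) = lift_map \<phi> x \<oplus> lift_map \<phi> y"
    using x y xQ yQ xK yK QA_sub by (simp_all add: eqI \<beta>_lift_map QA_closed \<beta>_mult \<beta>_add cl h)
qed

lemma alg_aut_push:
  assumes "h \<in> alg_aut QA"
  shows "N.qhom sc KK (push_map h)"
  unfolding N.qhom_def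
proof (intro conjI ballI allI)
  note h = alg_autD[OF assms] and p = push_map[OF QA_sub]
  have cases: "\<exists>x\<in>carrier QA. z = \<beta> x" if zK: "z \<in> KK" for z
  proof -
    obtain x where x: "x \<in> carrier Q" "z = \<beta> x" by (rule \<beta>_cases)
    then show ?thesis using zK QA_iff[OF x(1)] by blast
  qed
  show "push_map h (sc c) = sc c" for c
    using h(6)[OF QA_closed(4), of c] h(3) by (simp only: push_map[OF sc_closed])
  fix z assume "z \<in> KK"
  then obtain x where x: "x \<in> carrier QA" "z = \<beta> x" using cases by blast
  show "push_map h z \<in> KK" unfolding x(2) p[OF x(1)] by (rule QA_KK[OF h(7)[OF x(1)]])
  fix w assume "w \<in> KK"
  then obtain y where y: "y \<in> carrier QA" "w = \<beta> y" using cases by blast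
  note xy = x(1) y(1) QA_sub[OF x(1)] QA_sub[OF y(1)] QA_sub[OF h(7)[OF x(1)]] QA_sub[OF h(7)[OF y(1)]]
  show "push_map h (pl z w) = pl (push_map h z) (push_map h w)"
    unfolding x(2) y(2) \<beta>_add[OF xy(3,4), symmetric] p[OF QA_closed(1)[OF xy(1,2)]] p[OF xy(1)] p[OF xy(2)] h(4)[OF xy(1,2)]
    by (rule \<beta>_add[OF xy(5,6)])
  show "push_map h (ti z w) = ti (push_map h z) (push_map h w)"
    unfolding x(2) y(2) \<beta>_mult[OF xy(3,4), symmetric] p[OF QA_closed(2)[OF xy(1,2)]] p[OF xy(1)] p[OF xy(2)] h(5)[OF xy(1,2)]
    by (rule \<beta>_mult[OF xy(5,6)])
qed

lemma alg_aut_eqI: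
  assumes h: "h \<in> alg_aut QA" "h' \<in> alg_aut QA"
    and eq: "\<And>\<kappa>. h (qexp D \<iota> \<kappa>) = h' (qexp D \<iota> \<kappa>)" "\<And>j. h (gq D Q \<iota> j) = h' (gq D Q \<iota> j)"
  shows "h = h'"
proof (rule extensionalityI[OF alg_autD(2)[OF h(1)] alg_autD(2)[OF h(2)]])
  fix x assume x: "x \<in> carrier QA"
  have "push_map h (\<beta> x) = push_map h' (\<beta> x)"
    by (rule N.torus_hom_unique[OF frame alg_aut_push[OF h(1)] alg_aut_push[OF h(2)] _ _ QA_KK[OF x]])
      (simp_all only: push_map[OF E_closed] push_map[OF g_closed] eq)
  then have "\<beta> (h x) = \<beta> (h' x)" by (simp only: push_map[OF QA_sub[OF x]])
  then show "h x = h' x"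
    using \<beta>_eq[OF QA_sub[OF alg_autD(7)[OF h(1) x]] QA_sub[OF alg_autD(7)[OF h(2) x]]] by simp
qed

text \<open>Justifies the definite descriptions in \<open>s_tilde\<close> and \<open>gamma\<close>:
  the automorphism lifted from \<phi> has the required values, and \<open>alg_aut_eqI\<close> gives
  uniqueness. The second map \<psi> provides the inverse.\<close>

lemma the_automorphism:
  assumes \<phi>: "N.qhom sc KK \<phi>" "N.qhom sc KK \<psi>" "\<And>z. z \<in> KK \<Longrightarrow> \<phi> (\<psi> z) = z" "\<And>z. z \<in> KK \<Longrightarrow> \<psi> (\<phi> z) = z"
    and e: "\<And>\<kappa>. e \<kappa> \<in> carrier Q" "\<And>\<kappa>. \<phi> (EE \<kappa>) = \<beta> (e \<kappa>)" and G: "\<And>j. G j \<in> carrier Q" "\<And>j. \<phi> (gg j) = \<beta> (G j)"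
    and P: "\<And>h. P h \<longleftrightarrow> h \<in> alg_aut QA \<and> (\<forall>\<kappa>. h (qexp D \<iota> \<kappa>) = e \<kappa>) \<and> (\<forall>j. h (gq D Q \<iota> j) = G j)"
  shows "P (THE h. P h)"
proof (rule theI[of P "lift_map \<phi>"])
  have aut: "lift_map \<phi> \<in> alg_aut QA" by (rule lift_map_aut[OF \<phi>])
  note cl = QA_sub[OF lift_map_closed[OF \<phi>(1)]]
  have v: "lift_map \<phi> (qexp D \<iota> \<kappa>) = e \<kappa>" "lift_map \<phi> (gq D Q \<iota> j) = G j" for \<kappa> j
    by (rule iffD1[OF \<beta>_eq[OF cl[OF QA_gens(2)] e(1)]], simp only: \<beta>_lift_map QA_gens e(2))
      (rule iffD1[OF \<beta>_eq[OF cl[OF QA_gens(1)] G(1)]], simp only: \<beta>_lift_map QA_gens G(2))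
  show "P (lift_map \<phi>)" unfolding P using aut v by blast
  show "h = lift_map \<phi>" if "P h" for h
    using that unfolding P by (intro alg_aut_eqI aut) (simp_all only: v)
qed

abbreviation "cc i j \<equiv> - eps D i j * cartan D i j"
abbreviation "nn i j \<equiv> (if i = j then 1 else if eps D i j = - 1 then cartan D i j else 0)"
abbreviation "gval i \<nu> j \<equiv> ti (EE (zsmul (nn i j) \<nu>)) (ti (gg j) (N.Pz sc (qi D i) (EE \<nu>) (cc i j) (gg i)))"
text \<open>The exponent of q_i^(-2 \<kappa>), since an element of \<open>'y\<close> stands for its
  d-th part: q_i^\<kappa> is \<open>qexp\<close> at
  \<open>zsmul (dint D i) \<kappa>\<close>.\<close>

abbreviation "nu i \<kappa> \<equiv> zsmul (- 2 * dint D i) \<kappa>"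

lemma signs_cases: "if i \<noteq> j \<and> cartan D i j \<noteq> 0 then (eps D i j = 1 \<or> eps D i j = - 1) \<and> eps D j i = - eps D i j
    else eps D i j = 0"
  using signs unfolding sign_system_def by blast

lemma eps_diag: "eps D i i = 0" using signs_cases[of i i] by simp

lemma E_mult: "qexp D \<iota> \<kappa> \<otimes> qexp D \<iota> \<mu> = qexp D \<iota> (\<kappa> + \<mu>)" and E_zero: "qexp D \<iota> 0 = \<one>"
  unfolding E_et by (simp_all only: alg_homD(2)[OF \<iota>_hom, symmetric] Atilde_closed Atilde_relations(4,5)[OF datum] alg_homD(4)[OF \<iota>_hom])

lemma E_inv: "inv qexp D \<iota> \<kappa> = qexp D \<iota> (- \<kappa>)"
  by (rule Q.inv_unique'[symmetric]) (simp_all add: E_closed E_mult E_zero)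

lemma E_int_pow: "qexp D \<iota> \<kappa> [^] (n :: int) = qexp D \<iota> (zsmul n \<kappa>)"
proof -
  have nat: "qexp D \<iota> \<kappa> [^] (n :: nat) = qexp D \<iota> (zsmul (int n) \<kappa>)" for n
    by (induction n) (simp_all add: E_zero E_mult zmod.scale_left_distrib add.commute)
  show ?thesis
    unfolding int_pow_def2 using nat[of "nat n"] nat[of "nat (- n)"] by (simp add: E_inv)
qed

lemma qiexp_dint: "qiexp D \<iota> i \<kappa> = qexp D \<iota> (zsmul (dint D i) \<kappa>)"
  by (simp add: qiexp_def dint_dsmul)

lemma qiexp_pow: "qiexp D \<iota> i \<kappa> [^] (- 2 :: int) = qexp D \<iota> (nu i \<kappa>)"
  "qiexp D \<iota> i \<kappa> [^] (2 * (- cartan D i j)) = qexp D \<iota> (zsmul (cartan D i j) (nu i \<kappa>))"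
  by (simp_all only: qiexp_dint E_int_pow zmod.scale_scale mult.assoc)
    (simp only: mult.commute mult.left_commute mult_minus_left mult_minus_right)

lemma \<beta>_one_plus:
  assumes "y \<in> carrier Q"
  shows "one_plus D Q i t y \<in> carrier Q" "\<beta> (one_plus D Q i t y) = pl (\<beta> \<one>) (ti (sc (qi D i ^ (2 * t))) (\<beta> y))" (is ?R1)
proof -
  have c: "(qi D i ^ (2 * t)) \<odot> y \<in> carrier Q" by (rule assoc_algebraD(2)[OF Q_alg assms])
  show "one_plus D Q i t y \<in> carrier Q" unfolding one_plus_def by (rule Q.a_closed[OF Q.one_closed c])
  show ?R1
    unfolding one_plus_def \<beta>_add[OF Q.one_closed c] \<beta>_smult[OF assms] ..
qed

lemma \<beta>_ratio_prod:
  assumes "\<And>t. u t \<in> carrier Q" "\<And>t. v t \<in> carrier Q" "\<And>t. \<beta> (v t) \<noteq> \<beta> \<zero>"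
  shows "ratio_prod Q k u v \<in> carrier Q \<and>
    \<beta> (ratio_prod Q k u v) = foldr (\<lambda>t z. ti (ti (\<beta> (u t)) (iv (\<beta> (v t)))) z) [0..<k] (\<beta> \<one>)"
proof -
  have nz: "v t \<noteq> \<zero>" for t using assms(3)[of t] by auto
  have un: "v t \<in> Units Q" for t using nz assms(2) Q_units by simp
  have c: "inv v t \<in> carrier Q" "u t \<otimes> inv v t \<in> carrier Q" for t
    using Q.Units_inv_closed[OF un] assms(1) by simp_all
  have "foldr (\<lambda>\<nu> y. (u \<nu> \<otimes> inv v \<nu>) \<otimes> y) xs \<one> \<in> carrier Q \<and>
    \<beta> (foldr (\<lambda>\<nu> y. (u \<nu> \<otimes> inv v \<nu>) \<otimes> y) xs \<one>) =
      foldr (\<lambda>t z. ti (ti (\<beta> (u t)) (iv (\<beta> (v t)))) z) xs (\<beta> \<one>)" for xs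
    by (induction xs) (simp_all add: c \<beta>_mult assms(1) \<beta>_inv[OF assms(2) nz])
  then show ?thesis unfolding ratio_prod_def .
qed

lemma \<beta>_ratio:
  fixes \<nu> :: 'y and i :: 'i and k :: nat
  defines "u \<equiv> \<lambda>t. one_plus D Q i t (gq D Q \<iota> i)" and "v \<equiv> \<lambda>t. one_plus D Q i t (qexp D \<iota> \<nu> \<otimes> gq D Q \<iota> i)"
  shows "ratio_prod Q k u v \<in> carrier Q" "\<beta> (ratio_prod Q k u v) = N.Pn sc (qi D i) (EE \<nu>) k (gg i)"
    and "ratio_prod Q k v u \<in> carrier Q" "\<beta> (ratio_prod Q k v u) = iv (N.Pn sc (qi D i) (EE \<nu>) k (gg i))" (is ?R1)
proof -
  have cE: "N.central (EE \<kappa>)" for \<kappa> by (rule N.lattice_unitsD(3)[OF lattice_units_E])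
  have cu: "u t \<in> carrier Q" and cv: "v t \<in> carrier Q" for t
    unfolding u_def v_def by (intro \<beta>_one_plus(1) Q.m_closed g_closed E_closed)+
  define x where "x t = ti (sc (qi D i ^ (2 * t))) (gg i)" for t
  have bu: "\<beta> (u t) = pl (\<beta> \<one>) (x t)" for t
    unfolding u_def x_def by (rule \<beta>_one_plus(2)[OF g_closed])
  have bv: "\<beta> (v t) = pl (\<beta> \<one>) (ti (EE \<nu>) (x t))" for t
    unfolding v_def x_def \<beta>_one_plus(2)[OF Q.m_closed[OF E_closed g_closed]] \<beta>_mult[OF E_closed g_closed]
    by (simp only: N.central_left_comm[OF cE])
  have reg: "N.regular sc (EE \<nu>) (gg i)" by (rule N.frame_regular[OF frame])
  have nz: "\<beta> (u t) \<noteq> \<beta> \<zero>" "\<beta> (v t) \<noteq> \<beta> \<zero>" for t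
    using reg unfolding bu bv x_def N.regular_def by blast+
  have Th: "ti (\<beta> (u t)) (iv (\<beta> (v t))) = N.Th (EE \<nu>) (ti (sc (qi D i ^ (2 * t))) (gg i))" for t
    unfolding bu bv N.Th_def x_def ..
  have x': "ti (sc (qi D i ^ (2 * t))) (ti (EE \<nu>) (gg i)) = ti (EE \<nu>) (x t)" for t
    unfolding x_def by (rule N.central_left_comm[OF cE])
  have Th': "ti (\<beta> (v t)) (iv (\<beta> (u t))) = N.Th (iv (EE \<nu>)) (ti (sc (qi D i ^ (2 * t))) (ti (EE \<nu>) (gg i)))" for t
    unfolding bu bv N.Th_def x'
    using N.lattice_unitsD(4)[OF lattice_units_E, of \<nu>] by (simp add: N.mult.assoc[symmetric])
  note r = \<beta>_ratio_prod[of u v, OF cu cv nz(2), of k] and r' = \<beta>_ratio_prod[of v u, OF cv cu nz(1), of k]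
  show "ratio_prod Q k u v \<in> carrier Q" "\<beta> (ratio_prod Q k u v) = N.Pn sc (qi D i) (EE \<nu>) k (gg i)"
    using r unfolding Th N.Pn_def by blast+
  show "ratio_prod Q k v u \<in> carrier Q" using r' by blast
  have "\<beta> (ratio_prod Q k v u) = N.Pn sc (qi D i) (iv (EE \<nu>)) k (ti (EE \<nu>) (gg i))"
    using r' unfolding Th' N.Pn_def by blast
  also have "\<dots> = iv (N.Pn sc (qi D i) (EE \<nu>) k (gg i))"
    by (rule N.Pn_invert[OF scalars_sc cE N.lattice_unitsD(4)[OF lattice_units_E] reg])
  finally show ?R1 .
qed

text \<open>All cases of \<open>phi\<close> are instances of the single formula \<open>gval\<close>,
  so no case distinction by signs is needed for \<open>gamma\<close>. For \<open>eps = - 1\<close>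
  the exponent 2 (- a_ij) of x becomes a_ij times \<nu>, and \<open>inverse_Pn_shift\<close> moves
  the product to the right of the generator.\<close>

lemma generator_values:
  fixes \<nu> :: 'y and i j :: 'i
  defines "u \<equiv> \<lambda>t. one_plus D Q i t (gq D Q \<iota> i)" and "v \<equiv> \<lambda>t. one_plus D Q i t (qexp D \<iota> \<nu> \<otimes> gq D Q \<iota> i)"
    and "k \<equiv> nat (- cartan D i j)"
  shows "i = j \<Longrightarrow> \<beta> (qexp D \<iota> \<nu> \<otimes> gq D Q \<iota> i) = gval i \<nu> j"
    and "eps D i j = 1 \<Longrightarrow> \<beta> (gq D Q \<iota> j \<otimes> ratio_prod Q k u v) = gval i \<nu> j"
    and "eps D i j = - 1 \<Longrightarrow>
      \<beta> (qexp D \<iota> (zsmul (cartan D i j) \<nu>) \<otimes> ratio_prod Q k v u \<otimes> gq D Q \<iota> j) = gval i \<nu> j"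
    and "i \<noteq> j \<Longrightarrow> eps D i j = 0 \<Longrightarrow> gg j = gval i \<nu> j"
proof -
  note r = \<beta>_ratio[where \<nu> = \<nu> and i = i and k = k, folded u_def v_def]
  have neg: "cartan D i j \<le> 0" if "i \<noteq> j" using gcm that by (auto simp: gcm_def)
  have E0: "EE 0 = \<beta> \<one>" by (simp add: E_zero)
  show "\<beta> (qexp D \<iota> \<nu> \<otimes> gq D Q \<iota> i) = gval i \<nu> j" if "i = j"
    using that by (simp add: \<beta>_mult E_closed g_closed eps_diag)
  show "\<beta> (gq D Q \<iota> j \<otimes> ratio_prod Q k u v) = gval i \<nu> j" if e: "eps D i j = 1"
  proof -
    have ij: "i \<noteq> j" using e eps_diag[of i] by auto
    then have "N.Pz sc (qi D i) (EE \<nu>) (cc i j) (gg i) = N.Pn sc (qi D i) (EE \<nu>) k (gg i)"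
      using e neg by (simp add: N.Pz_def k_def)
    then show ?thesis using ij e by (simp add: \<beta>_mult g_closed r(1,2) E0)
  qed
  show "\<beta> (qexp D \<iota> (zsmul (cartan D i j) \<nu>) \<otimes> ratio_prod Q k v u \<otimes> gq D Q \<iota> j) = gval i \<nu> j"
    if e: "eps D i j = - 1"
  proof -
    have ij: "i \<noteq> j" using e eps_diag[of i] by auto
    then have k: "- int k = cc i j" "- 2 * int k = 2 * cc i j" using e neg by (simp_all add: k_def)
    have "ti (gg i) (gg j) = ti (gg j) (ti (sc (qi D i powi (- 2 * int k))) (gg i))"
      unfolding k(2) N.sc_left_comm[OF scalars_sc] by (rule N.frame_comm[OF frame])
    then have "ti (iv (N.Pn sc (qi D i) (EE \<nu>) k (gg i))) (gg j) = ti (gg j) (N.Pz sc (qi D i) (EE \<nu>) (cc i j) (gg i))"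
      unfolding k(1)[symmetric]
      by (intro N.inverse_Pn_shift[OF scalars_sc N.lattice_unitsD(3)[OF lattice_units_E] N.frame_regular[OF frame]]
          N.frame_g_nonzero[OF frame])
    then show ?thesis
      using ij e by (simp add: \<beta>_mult g_closed E_closed r(3,4) N.mult.assoc)
  qed
  show "gg j = gval i \<nu> j" if "i \<noteq> j" "eps D i j = 0"
    using that by (simp add: E0)
qed

lemma phi_value:
  "phi D Q \<iota> i j (qiexp D \<iota> i \<kappa>) \<in> carrier Q" "\<beta> (phi D Q \<iota> i j (qiexp D \<iota> i \<kappa>)) = gval i (nu i \<kappa>) j"
proof -
  note gv = generator_values[where \<nu> = "nu i \<kappa>" and i = i and j = j]
  note cl = E_closed g_closed \<beta>_ratio(1,3) Q.m_closed
  have e: "eps D i j = 1 \<or> eps D i j = - 1 \<or> eps D i j = 0" using signs_cases[of i j] by (auto split: if_splits)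
  consider "i = j" | "i \<noteq> j" "eps D i j = 1" | "i \<noteq> j" "eps D i j \<noteq> 1" "eps D i j = - 1"
    | "i \<noteq> j" "eps D i j \<noteq> 1" "eps D i j \<noteq> - 1" "eps D i j = 0"
    using e by fastforce
  then have "phi D Q \<iota> i j (qiexp D \<iota> i \<kappa>) \<in> carrier Q \<and> \<beta> (phi D Q \<iota> i j (qiexp D \<iota> i \<kappa>)) = gval i (nu i \<kappa>) j"
  proof cases
    case 1 show ?thesis unfolding phi_def Let_def qiexp_pow if_P[OF 1]
      by (intro conjI cl gv(1)[unfolded if_P[OF 1]] 1)
  next
    case 2 show ?thesis unfolding phi_def Let_def qiexp_pow if_not_P[OF 2(1)] if_P[OF 2(2)]
      by (intro conjI cl gv(2)[unfolded if_not_P[OF 2(1)]] 2)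
  next
    case 3 show ?thesis unfolding phi_def Let_def qiexp_pow if_not_P[OF 3(1)] if_not_P[OF 3(2)] if_P[OF 3(3)]
      by (intro conjI cl gv(3)[unfolded if_not_P[OF 3(1)] if_P[OF 3(3)]] 3)
  next
    case 4 show ?thesis unfolding phi_def Let_def qiexp_pow if_not_P[OF 4(1)] if_not_P[OF 4(2)] if_not_P[OF 4(3)]
      by (intro conjI cl gv(4)[unfolded if_not_P[OF 4(1)] if_not_P[OF 4(3)]] 4)
  qed
  then show "phi D Q \<iota> i j (qiexp D \<iota> i \<kappa>) \<in> carrier Q" "\<beta> (phi D Q \<iota> i j (qiexp D \<iota> i \<kappa>)) = gval i (nu i \<kappa>) j"
    by (rule conjunct1, rule conjunct2)
qed

lemma gamma_map:
  "\<exists>\<phi>. N.qhom sc KK \<phi> \<and> (\<forall>\<kappa>. \<phi> (EE \<kappa>) = EE \<kappa>) \<and> (\<forall>j. \<phi> (gg j) = gval i \<nu> j)"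
  by (rule N.gamma_exists[OF frame, where n = "\<lambda>j. nn i j"])

lemma
  shows gamma_aut: "gamma D Q \<iota> i \<kappa> \<in> alg_aut QA"
    and gamma_E: "gamma D Q \<iota> i \<kappa> (qexp D \<iota> \<mu>) = qexp D \<iota> \<mu>"
    and gamma_g: "\<beta> (gamma D Q \<iota> i \<kappa> (gq D Q \<iota> j)) = gval i (nu i \<kappa>) j"
proof -
  let ?\<nu> = "nu i \<kappa>"
  obtain \<phi> where "N.qhom sc KK \<phi> \<and> (\<forall>\<kappa>. \<phi> (EE \<kappa>) = EE \<kappa>) \<and> (\<forall>j. \<phi> (gg j) = gval i ?\<nu> j)"
    using gamma_map by (rule exE)
  note \<phi> = conjunct1[OF this] spec[OF conjunct1[OF conjunct2[OF this]]] spec[OF conjunct2[OF conjunct2[OF this]]]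
  \<comment> \<open>Conjugation by the opposite power, the candidate for the inverse.\<close>
  obtain \<psi> where "N.qhom sc KK \<psi> \<and> (\<forall>\<kappa>. \<psi> (EE \<kappa>) = EE \<kappa>) \<and> (\<forall>j. \<psi> (gg j) = gval i (- ?\<nu>) j)"
    using gamma_map by (rule exE)
  note \<psi> = conjunct1[OF this] spec[OF conjunct1[OF conjunct2[OF this]]] spec[OF conjunct2[OF conjunct2[OF this]]]
  have c0: "cc i i = 0" for i by (simp add: eps_diag)
  note inverse = N.gamma_inverse[OF frame c0, where n = "\<lambda>i j. nn i j" and i = i]
  have inv: "\<phi> (\<psi> z) = z" if z: "z \<in> KK" for z
    by (rule inverse[where \<nu> = ?\<nu>]) (rule refl if_P \<phi> \<psi> z)+
  have inv': "\<psi> (\<phi> z) = z" if z: "z \<in> KK" for z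
    by (rule inverse[where \<nu> = "- ?\<nu>"], unfold minus_minus) (rule refl if_P \<phi> \<psi> z)+
  let ?h = "gamma D Q \<iota> i \<kappa>"
  have "?h \<in> alg_aut QA \<and> (\<forall>\<mu>. ?h (qexp D \<iota> \<mu>) = qexp D \<iota> \<mu>) \<and>
      (\<forall>j. ?h (gq D Q \<iota> j) = phi D Q \<iota> i j (qiexp D \<iota> i \<kappa>))"
    unfolding gamma_def
    by (rule the_automorphism[OF \<phi>(1) \<psi>(1) inv inv' E_closed \<phi>(2) phi_value(1)]) (simp_all only: phi_value(2) \<phi>(3))
  note P = this
  show "?h \<in> alg_aut QA" by (rule conjunct1[OF P])
  show "?h (qexp D \<iota> \<mu>) = qexp D \<iota> \<mu>" by (rule spec[OF conjunct1[OF conjunct2[OF P]]])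
  show "\<beta> (?h (gq D Q \<iota> j)) = gval i ?\<nu> j"
    unfolding spec[OF conjunct2[OF conjunct2[OF P]], of j] by (rule phi_value(2))
qed

abbreviation "rf i \<kappa> \<equiv> reflection D i \<kappa>"

lemma rf_add: "rf i (\<kappa> + \<mu>) = rf i \<kappa> + rf i \<mu>" and rf_rf: "rf i (rf i \<kappa>) = \<kappa>"
proof -
  have a: "additive (\<lambda>\<kappa>. pairing D \<kappa> (sroot D i))" by (rule additive.intro) (rule pairing_add[OF datum])
  have p: "pairing D (coroot D i) (sroot D i) = 2"
    using gcm by (simp add: pairing_coroot[OF datum] gcm_def)
  show "rf i (\<kappa> + \<mu>) = rf i \<kappa> + rf i \<mu>"
    by (simp add: reflection_zsmul pairing_add[OF datum] zmod.scale_left_distrib)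
  show "rf i (rf i \<kappa>) = \<kappa>"
    using reflection_braid(5)[OF a p a p, of \<kappa>] by (simp add: reflection_zsmul)
qed

lemma
  shows s_aut: "s_tilde D Q \<iota> i \<in> alg_aut QA"
    and s_E: "s_tilde D Q \<iota> i (qexp D \<iota> \<mu>) = qexp D \<iota> (rf i \<mu>)"
    and s_g: "s_tilde D Q \<iota> i (gq D Q \<iota> j) = gq D Q \<iota> j"
proof -
  have "inj (rf i)" by (rule inj_on_inverseI[where g = "rf i"]) (rule rf_rf)
  then obtain \<phi> where \<phi>: "N.qhom sc KK \<phi>" "\<And>\<kappa>. \<phi> (EE \<kappa>) = EE (rf i \<kappa>)" "\<And>j. \<phi> (gg j) = gg j"
    using N.lattice_hom_exists[OF frame, of "rf i", OF rf_add] by blast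
  have id: "N.qhom sc KK (\<lambda>x. x)" by (simp add: N.qhom_def)
  have inv: "\<phi> (\<phi> z) = z" if "z \<in> KK" for z
    using N.torus_hom_unique[OF frame N.qhom_comp[OF \<phi>(1) \<phi>(1)] id _ _ that] by (simp add: \<phi> rf_rf)
  let ?h = "s_tilde D Q \<iota> i"
  have P: "?h \<in> alg_aut QA \<and> (\<forall>j. ?h (gq D Q \<iota> j) = gq D Q \<iota> j) \<and> (\<forall>\<kappa>. ?h (qexp D \<iota> \<kappa>) = qexp D \<iota> (rf i \<kappa>))"
    unfolding s_tilde_def
    by (rule the_automorphism[OF \<phi>(1) \<phi>(1) inv inv E_closed \<phi>(2) g_closed \<phi>(3)])
      (assumption | rule conj_cong[OF refl conj_commute])+
  show "?h \<in> alg_aut QA" by (rule conjunct1[OF P])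
  show "?h (qexp D \<iota> \<mu>) = qexp D \<iota> (rf i \<mu>)" by (rule spec[OF conjunct2[OF conjunct2[OF P]]])
  show "?h (gq D Q \<iota> j) = gq D Q \<iota> j" by (rule spec[OF conjunct1[OF conjunct2[OF P]]])
qed

end

section \<open>The action of the Weyl group\<close>

lemma word_class_eq: "word_class R v = word_class R w \<longleftrightarrow> word_eq R v w"
  unfolding word_class_def by (auto intro: word_refl word_sym word_trans dest: word_sym)

lemma presented_group_mult:
  "word_class R v \<otimes>\<^bsub>presented_group R\<^esub> word_class R w = word_class R (v @ w)"
proof -
  have "word_class R (v' @ w') = word_class R (v @ w)" if "v' \<in> word_class R v" "w' \<in> word_class R w" for v' w'
    using that word_cong[of R v v' w w'] unfolding word_class_eq by (auto simp: word_class_def intro: word_sym)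
  moreover have "v \<in> word_class R v" "w \<in> word_class R w" by (simp_all add: word_class_def word_refl)
  ultimately have "(\<Union>v'\<in>word_class R v. \<Union>w'\<in>word_class R w. word_class R (v' @ w')) = word_class R (v @ w)"
    by blast
  then show ?thesis by (simp add: presented_group_def)
qed

lemma presented_group_simps:
  "carrier (presented_group R) = range (word_class R)" "\<one>\<^bsub>presented_group R\<^esub> = word_class R []"
  by (simp_all add: presented_group_def)

lemma group_presented: "group (presented_group R)"
proof (rule groupI)
  fix x y z
  assume "x \<in> carrier (presented_group R)" then obtain u where x: "x = word_class R u" by (auto simp: presented_group_simps)
  assume "y \<in> carrier (presented_group R)" then obtain v where y: "y = word_class R v" by (auto simp: presented_group_simps)
  show "x \<otimes>\<^bsub>presented_group R\<^esub> y \<in> carrier (presented_group R)"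
    unfolding x y presented_group_mult by (simp add: presented_group_simps)
  assume "z \<in> carrier (presented_group R)" then obtain w where z: "z = word_class R w" by (auto simp: presented_group_simps)
  show "x \<otimes>\<^bsub>presented_group R\<^esub> y \<otimes>\<^bsub>presented_group R\<^esub> z = x \<otimes>\<^bsub>presented_group R\<^esub> (y \<otimes>\<^bsub>presented_group R\<^esub> z)"
    unfolding x y z presented_group_mult by simp
next
  fix x assume "x \<in> carrier (presented_group R)" then obtain u where x: "x = word_class R u" by (auto simp: presented_group_simps)
  show "\<one>\<^bsub>presented_group R\<^esub> \<otimes>\<^bsub>presented_group R\<^esub> x = x" unfolding x presented_group_simps presented_group_mult by simp
  have "word_eq R (rev (map (\<lambda>(g, b). (g, \<not> b)) u) @ u) []"
  proof (induction u)
    case (Cons a u)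
    obtain g b where a: "a = (g, b)" by (cases a)
    have "word_eq R ([(g, \<not> b), (g, \<not> (\<not> b))] @ u) ([] @ u)" by (intro word_cong word_cancel word_refl)
    then have "word_eq R (rev (map (\<lambda>(g, b). (g, \<not> b)) u) @ ([(g, \<not> b), (g, b)] @ u)) (rev (map (\<lambda>(g, b). (g, \<not> b)) u) @ u)"
      by (intro word_cong word_refl) simp
    from word_trans[OF this Cons] show ?case by (simp add: a)
  qed (simp add: word_refl)
  then show "\<exists>y\<in>carrier (presented_group R). y \<otimes>\<^bsub>presented_group R\<^esub> x = \<one>\<^bsub>presented_group R\<^esub>"
    by (intro bexI[of _ "word_class R (rev (map (\<lambda>(g, b). (g, \<not> b)) u))"])
      (simp_all add: x presented_group_mult presented_group_simps(2) word_class_eq, simp add: presented_group_simps)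
qed (simp_all add: presented_group_simps)

text \<open>Both letters of an involutive generator act in the same way, so the inverses of the generators need
  no separate treatment.\<close>

definition word_act :: "('i \<Rightarrow> 'k \<Rightarrow> 'k) \<Rightarrow> ('i \<times> bool) list \<Rightarrow> 'k \<Rightarrow> 'k" where
  "word_act S w x = foldr (\<lambda>l. S (fst l)) w x"

lemma word_act_simps [simp]: "word_act S [] x = x" "word_act S (l # w) x = S (fst l) (word_act S w x)"
  "word_act S (v @ w) x = word_act S v (word_act S w x)"
  by (simp_all add: word_act_def)

lemma word_act_eq:
  assumes S: "\<And>i x. x \<in> K \<Longrightarrow> S i x \<in> K" "\<And>i x. x \<in> K \<Longrightarrow> S i (S i x) = x"
    and R: "\<And>v w x. (v, w) \<in> R \<Longrightarrow> x \<in> K \<Longrightarrow> word_act S v x = word_act S w x"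
  shows "word_eq R v w \<Longrightarrow> x \<in> K \<Longrightarrow> word_act S v x = word_act S w x"
proof (induction arbitrary: x rule: word_eq.induct)
  case (word_cong v w v' w')
  have "word_act S u x \<in> K" if "x \<in> K" for u x using that by (induction u) (simp_all add: S)
  then show ?case using word_cong by simp
qed (simp_all add: S R)

lemma weyl_involution: "word_eq (weyl_relations C) [(i, b)] [(i, True)]"
proof (cases b)
  case False
  let ?R = "weyl_relations C"
  have "word_eq ?R ([(i, False)] @ [(i, True), (i, True)]) ([(i, False)] @ [])"
    by (intro word_cong word_refl word_rel) (auto simp: weyl_relations_def)
  moreover have "word_eq ?R ([(i, False), (i, \<not> False)] @ [(i, True)]) ([] @ [(i, True)])"
    by (intro word_cong word_refl word_cancel)
  ultimately show ?thesis using False by (auto intro: word_trans word_sym)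
qed (simp add: word_refl)

text \<open>Since the generators are involutions, the letters for their inverses can be replaced by
  the generators themselves, so multiplication by generators on the left reaches every
  element.\<close>

lemma weyl_group_induct:
  assumes "X \<in> carrier (weyl_group C)" and one: "P \<one>\<^bsub>weyl_group C\<^esub>"
    and step: "\<And>i X. X \<in> carrier (weyl_group C) \<Longrightarrow> P X \<Longrightarrow> P (weyl_gen C i \<otimes>\<^bsub>weyl_group C\<^esub> X)"
  shows "P X"
proof -
  have "P (word_class (weyl_relations C) w)" for w
  proof (induction w)
    case Nil then show ?case using one by (simp add: weyl_group_def presented_group_simps)
  next
    case (Cons l w)
    obtain i b where l: "l = (i, b)" by (cases l)
    have "word_eq (weyl_relations C) ([(i, b)] @ w) ([(i, True)] @ w)"
      by (intro word_cong word_refl weyl_involution)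
    then have "word_class (weyl_relations C) (l # w) = weyl_gen C i \<otimes>\<^bsub>weyl_group C\<^esub> word_class (weyl_relations C) w"
      unfolding weyl_group_def weyl_gen_def presented_group_mult word_class_eq l by simp
    then show ?case using step[OF _ Cons] by (simp add: weyl_group_def presented_group_simps)
  qed
  then show ?thesis using assms(1) by (auto simp: weyl_group_def presented_group_simps)
qed

lemma algebra_action_mult:
  assumes "algebra_action (weyl_group C) A \<rho>" "X \<in> carrier (weyl_group C)" "Y \<in> carrier (weyl_group C)"
  shows "\<rho> (X \<otimes>\<^bsub>weyl_group C\<^esub> Y) = compose (carrier A) (\<rho> X) (\<rho> Y)"
proof -
  have "group_action (weyl_group C) (carrier A) \<rho>" using assms(1) by (simp add: algebra_action_def)
  then interpret group_hom "weyl_group C" "BijGroup (carrier A)" \<rho> by (rule group_action.group_hom)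
  have "\<rho> X \<in> Bij (carrier A)" "\<rho> Y \<in> Bij (carrier A)"
    using assms unfolding algebra_action_def alg_aut_def by auto
  then show ?thesis
    using hom_mult[OF assms(2,3)] by (simp add: BijGroup_def)
qed

lemma algebra_action_one:
  assumes "algebra_action (weyl_group C) A \<rho>"
  shows "\<rho> \<one>\<^bsub>weyl_group C\<^esub> = (\<lambda>x\<in>carrier A. x)"
proof -
  have "group_action (weyl_group C) (carrier A) \<rho>" using assms by (simp add: algebra_action_def)
  then interpret group_hom "weyl_group C" "BijGroup (carrier A)" \<rho> by (rule group_action.group_hom)
  show ?thesis using hom_one by (simp add: BijGroup_def)
qed

lemma weyl_gen_closed: "weyl_gen C i \<in> carrier (weyl_group C)"
  by (simp add: weyl_gen_def weyl_group_def presented_group_simps)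

lemma weyl_action_unique:
  assumes "algebra_action (weyl_group C) A \<rho>" "algebra_action (weyl_group C) A \<rho>'"
    "\<And>i. \<rho> (weyl_gen C i) = \<rho>' (weyl_gen C i)"
  shows "\<rho> = \<rho>'"
proof (rule extensionalityI)
  show "\<rho> \<in> extensional (carrier (weyl_group C))" "\<rho>' \<in> extensional (carrier (weyl_group C))"
    using assms(1,2) by (simp_all add: algebra_action_def)
  fix X assume "X \<in> carrier (weyl_group C)"
  then show "\<rho> X = \<rho>' X"
  proof (rule weyl_group_induct)
    show "\<rho> \<one>\<^bsub>weyl_group C\<^esub> = \<rho>' \<one>\<^bsub>weyl_group C\<^esub>"
      unfolding algebra_action_one[OF assms(1)] algebra_action_one[OF assms(2)] ..
    fix i X assume X: "X \<in> carrier (weyl_group C)" and eq: "\<rho> X = \<rho>' X"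
    show "\<rho> (weyl_gen C i \<otimes>\<^bsub>weyl_group C\<^esub> X) = \<rho>' (weyl_gen C i \<otimes>\<^bsub>weyl_group C\<^esub> X)"
      unfolding algebra_action_mult[OF assms(1) weyl_gen_closed X] algebra_action_mult[OF assms(2) weyl_gen_closed X] assms(3) eq ..
  qed
qed

text \<open>By \<open>word_act_eq\<close> words that are equal in the group act equally, so the
  action of an arbitrarily chosen word depends on its class only. Action maps are restricted to the
  carrier to match the composition of \<open>BijGroup\<close>.\<close>

lemma weyl_action_exists:
  fixes A :: "('f, 'k) module"
  assumes S: "\<And>i. S i \<in> alg_aut A" "\<And>i x. x \<in> carrier A \<Longrightarrow> S i (S i x) = x"
    and comp: "\<And>h h'. h \<in> alg_aut A \<Longrightarrow> h' \<in> alg_aut A \<Longrightarrow> compose (carrier A) h h' \<in> alg_aut A"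
    and id: "(\<lambda>x\<in>carrier A. x) \<in> alg_aut A"
    and R: "\<And>v w x. (v, w) \<in> weyl_relations C \<Longrightarrow> x \<in> carrier A \<Longrightarrow> word_act S v x = word_act S w x"
  shows "\<exists>\<rho>. algebra_action (weyl_group C) A \<rho> \<and> (\<forall>i. \<rho> (weyl_gen C i) = S i)"
proof -
  let ?R = "weyl_relations C"
  have ext: "S i \<in> extensional (carrier A)" and cl: "x \<in> carrier A \<Longrightarrow> S i x \<in> carrier A" for i x
    using S(1)[of i] by (auto simp: alg_aut_def Bij_def bij_betw_def)
  have wcl: "x \<in> carrier A \<Longrightarrow> word_act S w x \<in> carrier A" for w x by (induction w) (simp_all add: cl)
  define W where "W w = restrict (word_act S w) (carrier A)" for w
  have W0: "W [] = (\<lambda>x\<in>carrier A. x)" by (simp add: W_def restrict_def fun_eq_iff)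
  have W1: "W [(i, b)] = S i" for i b
    using ext by (intro extensionalityI[of _ "carrier A"]) (simp_all add: W_def)
  have Wapp: "W (v @ w) = compose (carrier A) (W v) (W w)" for v w
    by (simp add: W_def compose_def restrict_def fun_eq_iff wcl)
  have Waut: "W w \<in> alg_aut A" for w
  proof (induction w)
    case Nil show ?case unfolding W0 by (rule id)
  next
    case (Cons l w)
    obtain i b where "l = (i, b)" by (cases l)
    then have "W (l # w) = compose (carrier A) (S i) (W w)" using Wapp[of "[l]" w] W1 by simp
    then show ?case using comp[OF S(1) Cons] by simp
  qed
  have Weq: "W v = W w" if "word_eq ?R v w" for v w
    using word_act_eq[of "carrier A" S ?R, OF cl S(2) R that] by (simp add: W_def restrict_def fun_eq_iff)
  define \<rho> where "\<rho> = (\<lambda>X\<in>carrier (weyl_group C). W (SOME w. X = word_class ?R w))"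
  have \<rho>: "\<rho> (word_class ?R w) = W w" for w
  proof -
    have "word_class ?R w = word_class ?R (SOME v. word_class ?R w = word_class ?R v)"
      by (rule someI[of "\<lambda>v. word_class ?R w = word_class ?R v" w]) (rule refl)
    then have "W (SOME v. word_class ?R w = word_class ?R v) = W w"
      unfolding word_class_eq by (rule Weq[OF word_sym])
    then show ?thesis by (simp add: \<rho>_def weyl_group_def presented_group_simps)
  qed
  have WB: "W w \<in> Bij (carrier A)" for w using Waut[of w] by (simp add: alg_aut_def)
  have "\<rho> \<in> hom (weyl_group C) (BijGroup (carrier A))"
    unfolding weyl_group_def
    by (rule homI) (auto simp: presented_group_simps presented_group_mult \<rho> BijGroup_def WB Wapp)
  then have "group_action (weyl_group C) (carrier A) \<rho>"
    unfolding group_action_def group_hom_def group_hom_axioms_def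
    by (simp add: group_BijGroup group_presented weyl_group_def)
  moreover have "\<rho> X \<in> alg_aut A" if "X \<in> carrier (weyl_group C)" for X
    using that Waut by (auto simp: weyl_group_def presented_group_simps \<rho>)
  moreover have "\<rho> \<in> extensional (carrier (weyl_group C))" by (simp add: \<rho>_def)
  ultimately have "algebra_action (weyl_group C) A \<rho>" unfolding algebra_action_def by blast
  moreover have "\<rho> (weyl_gen C i) = S i" for i unfolding weyl_gen_def \<rho> W1 ..
  ultimately show ?thesis by blast
qed

section \<open>The automorphisms S_i satisfy the relations of the Weyl group\<close>

context weyl_torus begin

lemma compose_aut:
  assumes "h \<in> alg_aut QA" "h' \<in> alg_aut QA"
  shows "compose (carrier QA) h h' \<in> alg_aut QA"
proof (rule alg_autI)
  note h = alg_autD[OF assms(1)] and h' = alg_autD[OF assms(2)]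
  show "bij_betw (compose (carrier QA) h h') (carrier QA) (carrier QA)"
    by (rule bij_betw_compose[OF h'(1) h(1)])
qed (simp_all add: compose_eq QA_closed alg_autD[OF assms(1)] alg_autD[OF assms(2)])

lemma id_aut: "(\<lambda>x\<in>carrier QA. x) \<in> alg_aut QA"
proof (rule alg_autI)
  show "bij_betw (\<lambda>x\<in>carrier QA. x) (carrier QA) (carrier QA)"
    by (rule bij_betw_byWitness[where f' = "\<lambda>x. x"]) auto
qed (simp_all add: QA_closed)

lemma rf_coroot: "rf i (zsmul n (coroot D i)) = zsmul (- n) (coroot D i)"
proof -
  have "cartan D i i = 2" using gcm by (simp add: gcm_def)
  then show ?thesis
    by (simp add: reflection_zsmul pairing_zsmul[OF datum] pairing_coroot[OF datum] flip: zmod.scale_left_diff_distrib)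
qed

abbreviation "SS i \<equiv> S_aut D Q \<iota> i"

lemma S_aut_aut: "SS i \<in> alg_aut QA"
  unfolding S_aut_def by (rule compose_aut[OF s_aut gamma_aut])

lemma S_E: "SS i (qexp D \<iota> \<kappa>) = qexp D \<iota> (rf i \<kappa>)"
  unfolding S_aut_def compose_eq[OF QA_gens(2)] gamma_E by (rule s_E)

text \<open>\<open>s_tilde\<close> fixes the \<open>gq\<close> and reflects the lattice, so it turns
  the exponent minus coroot in the formula of \<open>gamma\<close> into plus coroot. For the same
  reason the two expressions for \<open>S_aut\<close> agree on generators.\<close>

lemma S_g: "\<beta> (SS i (gq D Q \<iota> j)) = gval i (nu i (coroot D i)) j"
proof -
  let ?\<alpha> = "coroot D i"
  note q = alg_aut_push[OF s_aut, of i]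
  note h = N.qhomD[OF q N.frame_subfield[OF frame] scalars_sc]
  note fi = N.frame_E_in[OF frame] N.frame_g_in[OF frame] N.frame_Pz_in[OF frame]
  have pE: "push_map (s_tilde D Q \<iota> i) (EE \<kappa>) = EE (rf i \<kappa>)" for \<kappa>
    unfolding push_map[OF E_closed] s_E ..
  have pg: "push_map (s_tilde D Q \<iota> i) (gg j) = gg j" for j
    unfolding push_map[OF g_closed] s_g ..
  have nu: "nu i (- ?\<alpha>) = zsmul (2 * dint D i) ?\<alpha>" by simp
  have rn: "rf i (zsmul k (zsmul (2 * dint D i) ?\<alpha>)) = zsmul k (nu i ?\<alpha>)" for k
    unfolding zmod.scale_scale rf_coroot by simp
  have "\<beta> (SS i (gq D Q \<iota> j)) = push_map (s_tilde D Q \<iota> i) (\<beta> (gamma D Q \<iota> i (- ?\<alpha>) (gq D Q \<iota> j)))"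
    unfolding S_aut_def compose_eq[OF QA_gens(1)]
    by (rule push_map[symmetric, OF QA_sub[OF alg_autD(7)[OF gamma_aut QA_gens(1)]]])
  also have "\<dots> = push_map (s_tilde D Q \<iota> i) (gval i (zsmul (2 * dint D i) ?\<alpha>) j)"
    unfolding gamma_g nu ..
  also have "\<dots> = ti (EE (rf i (zsmul (nn i j) (zsmul (2 * dint D i) ?\<alpha>))))
      (ti (gg j) (N.Pz sc (qi D i) (EE (rf i (zsmul (2 * dint D i) ?\<alpha>))) (cc i j) (gg i)))"
    unfolding h(3)[OF fi(1) fsub(2)[OF fi(2) fi(3)]] h(3)[OF fi(2) fi(3)] pE pg
      N.qhom_Pz(1)[OF q N.frame_subfield[OF frame] scalars_sc fi(2) fi(1)] ..
  also have "rf i (zsmul (2 * dint D i) ?\<alpha>) = nu i ?\<alpha>" using rn[of 1] by simp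
  also have "rf i (zsmul (nn i j) (zsmul (2 * dint D i) ?\<alpha>)) = zsmul (nn i j) (nu i ?\<alpha>)" by (rule rn)
  finally show ?thesis .
qed

lemma S_other: "SS i = compose (carrier QA) (gamma D Q \<iota> i (coroot D i)) (s_tilde D Q \<iota> i)"
proof (rule alg_aut_eqI[OF S_aut_aut compose_aut[OF gamma_aut s_aut]])
  show "SS i (qexp D \<iota> \<kappa>) = compose (carrier QA) (gamma D Q \<iota> i (coroot D i)) (s_tilde D Q \<iota> i) (qexp D \<iota> \<kappa>)" for \<kappa>
    unfolding S_E compose_eq[OF QA_gens(2)] s_E gamma_E ..
  fix j
  have "SS i (gq D Q \<iota> j) \<in> carrier Q" "gamma D Q \<iota> i (coroot D i) (gq D Q \<iota> j) \<in> carrier Q"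
    by (intro QA_sub alg_autD(7)[OF S_aut_aut] alg_autD(7)[OF gamma_aut] QA_gens)+
  then show "SS i (gq D Q \<iota> j) = compose (carrier QA) (gamma D Q \<iota> i (coroot D i)) (s_tilde D Q \<iota> i) (gq D Q \<iota> j)"
    unfolding compose_eq[OF QA_gens(1)] s_g using iffD1[OF \<beta>_eq] S_g gamma_g by metis
qed

lemma S_phi: "SS i (gq D Q \<iota> j) = phi D Q \<iota> i j (qiexp D \<iota> i (coroot D i))"
proof (rule iffD1[OF \<beta>_eq[OF _ phi_value(1)]])
  show "SS i (gq D Q \<iota> j) \<in> carrier Q" by (intro QA_sub alg_autD(7)[OF S_aut_aut] QA_gens)
  show "\<beta> (SS i (gq D Q \<iota> j)) = \<beta> (phi D Q \<iota> i j (qiexp D \<iota> i (coroot D i)))" unfolding S_g phi_value(2) ..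
qed

text \<open>For a sign system the four clauses exclude each other and exhaust all pairs, as
  \<open>cartan D i i = 2\<close> separates the last two. The conjunction of implications is then
  the nested case distinction in \<open>phi\<close>.\<close>

lemma explicit_formulae_iff:
  "explicit_formulae D Q \<iota> \<sigma> \<longleftrightarrow> (\<forall>i j. \<sigma> i (gq D Q \<iota> j) = phi D Q \<iota> i j (qiexp D \<iota> i (coroot D i))) \<and>
     (\<forall>i \<kappa>. \<sigma> i (qexp D \<iota> \<kappa>) = qexp D \<iota> (rf i \<kappa>))"
proof -
  have "(eps D i j = 1 \<longrightarrow> s = a) \<and> (eps D i j = - 1 \<longrightarrow> s = b) \<and> (i = j \<longrightarrow> s = c) \<and> (cartan D i j = 0 \<longrightarrow> s = d) \<longleftrightarrow>
      s = (if i = j then c else if eps D i j = 1 then a else if eps D i j = - 1 then b else d)" for i j and s a b c d :: 'k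
  proof -
    have "cartan D i i = 2" using gcm by (simp add: gcm_def)
    then show ?thesis using signs_cases[of i j] eps_diag[of i] by (auto split: if_splits)
  qed
  then show ?thesis unfolding explicit_formulae_def phi_def Let_def by (simp only:)
qed

lemma explicit_S: "explicit_formulae D Q \<iota> (S_aut D Q \<iota>)"
  unfolding explicit_formulae_iff using S_phi S_E by blast

lemma explicit_unique:
  assumes "explicit_formulae D Q \<iota> \<sigma>" "\<And>i. \<sigma> i \<in> alg_aut QA"
  shows "\<sigma> i = SS i"
proof (rule alg_aut_eqI[OF assms(2) S_aut_aut])
  show "\<sigma> i (qexp D \<iota> \<kappa>) = SS i (qexp D \<iota> \<kappa>)" for \<kappa>
    using assms(1) unfolding explicit_formulae_iff S_E by blast
  show "\<sigma> i (gq D Q \<iota> j) = SS i (gq D Q \<iota> j)" for j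
    using assms(1) unfolding explicit_formulae_iff S_phi by blast
qed

abbreviation "TT i \<equiv> push_map (SS i)"

lemma T_facts:
  "N.qhom sc KK (TT i)" "TT i (EE \<kappa>) = EE (rf i \<kappa>)" "TT i (gg j) = gval i (nu i (coroot D i)) j"
  by (rule alg_aut_push[OF S_aut_aut]) (simp_all only: push_map[OF E_closed] push_map[OF g_closed] S_E S_g)

lemma weyl_args:
  "qi D i powi cartan D i j = qi D j powi cartan D j i" "qi D i powi k = 1 \<Longrightarrow> k = 0" "cc i j = - eps D i j * cartan D i j"
  "nn i j = (if i = j then 1 else if eps D i j = - 1 then cartan D i j else 0)"
  "additive (\<lambda>\<kappa>. pairing D \<kappa> (sroot D i))" "pairing D (coroot D j) (sroot D i) = cartan D j i"
  "nu i (coroot D i) = zsmul (- 2 * dint D i) (coroot D i)"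
  "(- 2 * dint D j) * cartan D j i = (- 2 * dint D i) * cartan D i j"
  "rf i \<kappa> = \<kappa> - zsmul (pairing D \<kappa> (sroot D i)) (coroot D i)"
proof -
  show "qi D i powi cartan D i j = qi D j powi cartan D j i" by (rule qi_sym[OF symz])
  show "qi D i powi k = 1 \<Longrightarrow> k = 0" by (rule qi_powi_eq_one[OF symz])
  show "additive (\<lambda>\<kappa>. pairing D \<kappa> (sroot D i))" by (rule additive.intro) (rule pairing_add[OF datum])
  show "pairing D (coroot D j) (sroot D i) = cartan D j i" by (rule pairing_coroot[OF datum])
  show "(- 2 * dint D j) * cartan D j i = (- 2 * dint D i) * cartan D i j"
    using dint_sym(1)[OF symz, of i j] by (simp add: mult.assoc)
  show "rf i \<kappa> = \<kappa> - zsmul (pairing D \<kappa> (sroot D i)) (coroot D i)" by (rule reflection_zsmul)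
qed (rule refl)+

lemma T_involution: "z \<in> KK \<Longrightarrow> TT i (TT i z) = z"
  by (rule N.S_involution[where S = "\<lambda>i. TT i" and s = "\<lambda>i \<kappa>. rf i \<kappa>" and n = "\<lambda>i j. nn i j" and \<mu> = "\<lambda>i. nu i (coroot D i)"
    and f = "\<lambda>i \<kappa>. pairing D \<kappa> (sroot D i)" and h = "coroot D", OF frame gcm signs weyl_args T_facts]; assumption)

lemma T_commute: "cartan D i j = 0 \<Longrightarrow> i \<noteq> j \<Longrightarrow> z \<in> KK \<Longrightarrow> TT i (TT j z) = TT j (TT i z)"
  by (rule N.S_commute[where S = "\<lambda>i. TT i" and s = "\<lambda>i \<kappa>. rf i \<kappa>" and n = "\<lambda>i j. nn i j" and \<mu> = "\<lambda>i. nu i (coroot D i)"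
    and f = "\<lambda>i \<kappa>. pairing D \<kappa> (sroot D i)" and h = "coroot D", OF frame gcm signs weyl_args T_facts]; assumption)

lemma T_braid:
  assumes "i \<noteq> j" "z \<in> KK"
  shows "cartan D i j * cartan D j i = 1 \<Longrightarrow> TT i (TT j (TT i z)) = TT j (TT i (TT j z))"
    and "cartan D i j * cartan D j i = 2 \<Longrightarrow> TT i (TT j (TT i (TT j z))) = TT j (TT i (TT j (TT i z)))"
    and "cartan D i j * cartan D j i = 3 \<Longrightarrow>
      TT i (TT j (TT i (TT j (TT i (TT j z))))) = TT j (TT i (TT j (TT i (TT j (TT i z)))))"
proof -
  note b = N.S_braid[where S = "\<lambda>i. TT i" and s = "\<lambda>i \<kappa>. rf i \<kappa>" and n = "\<lambda>i j. nn i j" and \<mu> = "\<lambda>i. nu i (coroot D i)"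
    and f = "\<lambda>i \<kappa>. pairing D \<kappa> (sroot D i)" and h = "coroot D", OF frame gcm signs weyl_args T_facts]
  show "cartan D i j * cartan D j i = 1 \<Longrightarrow> TT i (TT j (TT i z)) = TT j (TT i (TT j z))"
    by (rule b(1); (assumption | rule assms))
  show "cartan D i j * cartan D j i = 2 \<Longrightarrow> TT i (TT j (TT i (TT j z))) = TT j (TT i (TT j (TT i z)))"
    by (rule b(2); (assumption | rule assms))
  show "cartan D i j * cartan D j i = 3 \<Longrightarrow>
      TT i (TT j (TT i (TT j (TT i (TT j z))))) = TT j (TT i (TT j (TT i (TT j (TT i z)))))"
    by (rule b(3); (assumption | rule assms))
qed

lemma S_closed: "x \<in> carrier QA \<Longrightarrow> SS i x \<in> carrier QA"
  by (rule alg_autD(7)[OF S_aut_aut])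

lemma word_act_push: "x \<in> carrier QA \<Longrightarrow> word_act (S_aut D Q \<iota>) w x \<in> carrier QA \<and>
    \<beta> (word_act (S_aut D Q \<iota>) w x) = word_act (\<lambda>i. TT i) w (\<beta> x)"
proof (induction w)
  case (Cons l w)
  then show ?case using push_map[OF QA_sub, of "word_act (S_aut D Q \<iota>) w x" "SS (fst l)"] S_closed by simp
qed simp

lemma word_act_eqI:
  assumes "x \<in> carrier QA" "word_act (\<lambda>i. TT i) v (\<beta> x) = word_act (\<lambda>i. TT i) w (\<beta> x)"
  shows "word_act (S_aut D Q \<iota>) v x = word_act (S_aut D Q \<iota>) w x"
  using word_act_push[OF assms(1), of v] word_act_push[OF assms(1), of w] assms(2) \<beta>_eq[OF QA_sub QA_sub] by metis

lemma S_S: "x \<in> carrier QA \<Longrightarrow> SS i (SS i x) = x"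
  using word_act_eqI[of x "[(i, True), (i, True)]" "[]"] T_involution[OF QA_KK, of x i] by simp

lemma weyl_relations_hold:
  assumes vw: "(v, w) \<in> weyl_relations (cartan D)" and x: "x \<in> carrier QA"
  shows "word_act (S_aut D Q \<iota>) v x = word_act (S_aut D Q \<iota>) w x"
proof (rule word_act_eqI[OF x])
  note K = QA_KK[OF x]
  consider i where "v = [(i, True), (i, True)]" "w = []"
    | i j where "i \<noteq> j" "cartan D i j * cartan D j i = 0" "v = [(i, True), (j, True)]" "w = [(j, True), (i, True)]"
    | i j where "i \<noteq> j" "cartan D i j * cartan D j i = 1" "v = [(i, True), (j, True), (i, True)]" "w = [(j, True), (i, True), (j, True)]"
    | i j where "i \<noteq> j" "cartan D i j * cartan D j i = 2" "v = concat (replicate 2 [(i, True), (j, True)])" "w = concat (replicate 2 [(j, True), (i, True)])"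
    | i j where "i \<noteq> j" "cartan D i j * cartan D j i = 3" "v = concat (replicate 3 [(i, True), (j, True)])" "w = concat (replicate 3 [(j, True), (i, True)])"
    using vw unfolding weyl_relations_def Let_def by blast
  then show "word_act (\<lambda>i. TT i) v (\<beta> x) = word_act (\<lambda>i. TT i) w (\<beta> x)"
  proof cases
    case (1 i) then show ?thesis using T_involution[OF K, of i] by simp
  next
    case (2 i j)
    then have "cartan D i j = 0" using gcm unfolding gcm_def by (metis mult_eq_0_iff)
    then show ?thesis using T_commute[OF \<open>cartan D i j = 0\<close> 2(1) K] 2(3,4) by simp
  next
    case (3 i j) then show ?thesis using T_braid(1)[OF 3(1) K] by simp
  next
    case (4 i j) then show ?thesis using T_braid(2)[OF 4(1) K] by (simp add: numeral_eq_Suc)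
  next
    case (5 i j) then show ?thesis using T_braid(3)[OF 5(1) K] by (simp add: numeral_eq_Suc)
  qed
qed

lemma weyl_group_action:
  "\<exists>!\<rho>. algebra_action (weyl_group (cartan D)) QA \<rho> \<and> (\<forall>i. \<rho> (weyl_gen (cartan D) i) = SS i)"
proof (rule ex_ex1I)
  show "\<exists>\<rho>. algebra_action (weyl_group (cartan D)) QA \<rho> \<and> (\<forall>i. \<rho> (weyl_gen (cartan D) i) = SS i)"
    by (rule weyl_action_exists; (rule S_aut_aut id_aut | rule S_S compose_aut weyl_relations_hold; assumption))
  show "\<rho> = \<rho>'"
    if r: "algebra_action (weyl_group (cartan D)) QA \<rho> \<and> (\<forall>i. \<rho> (weyl_gen (cartan D) i) = SS i)"
      "algebra_action (weyl_group (cartan D)) QA \<rho>' \<and> (\<forall>i. \<rho>' (weyl_gen (cartan D) i) = SS i)" for \<rho> \<rho>'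
  proof (rule weyl_action_unique[OF conjunct1[OF r(1)] conjunct1[OF r(2)]])
    show "\<rho> (weyl_gen (cartan D) i) = \<rho>' (weyl_gen (cartan D) i)" for i
      unfolding spec[OF conjunct2[OF r(1)]] spec[OF conjunct2[OF r(2)]] ..
  qed
qed

text \<open>An automorphism is determined by its values on the generators, so an action satisfies
  the formulae exactly when its generators act as the \<open>S_aut\<close>; unique existence then
  carries over from \<open>weyl_group_action\<close>.\<close>

lemma explicit_action_iff:
  assumes "algebra_action (weyl_group (cartan D)) QA \<rho>"
  shows "explicit_formulae D Q \<iota> (\<lambda>i. \<rho> (weyl_gen (cartan D) i)) \<longleftrightarrow> (\<forall>i. \<rho> (weyl_gen (cartan D) i) = SS i)"
proof
  have aut: "\<rho> (weyl_gen (cartan D) i) \<in> alg_aut QA" for i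
    by (rule bspec[OF conjunct2[OF conjunct2[OF assms[unfolded algebra_action_def]]] weyl_gen_closed])
  show "\<forall>i. \<rho> (weyl_gen (cartan D) i) = SS i" if "explicit_formulae D Q \<iota> (\<lambda>i. \<rho> (weyl_gen (cartan D) i))"
    by (rule allI) (rule explicit_unique[of "\<lambda>i. \<rho> (weyl_gen (cartan D) i)", OF that aut])
  show "explicit_formulae D Q \<iota> (\<lambda>i. \<rho> (weyl_gen (cartan D) i))" if e: "\<forall>i. \<rho> (weyl_gen (cartan D) i) = SS i"
    unfolding spec[OF e] by (rule explicit_S)
qed

lemma conclusion:
  "(\<forall>i. S_aut D Q \<iota> i =
            compose (carrier (QAq D Q \<iota>)) (gamma D Q \<iota> i (coroot D i)) (s_tilde D Q \<iota> i)) \<and>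
         (\<forall>i. S_aut D Q \<iota> i \<in> alg_aut (QAq D Q \<iota>)) \<and>
         explicit_formulae D Q \<iota> (S_aut D Q \<iota>) \<and>
         (\<exists>!\<rho>. algebra_action (weyl_group (cartan D)) (QAq D Q \<iota>) \<rho> \<and>
            (\<forall>i. \<rho> (weyl_gen (cartan D) i) = S_aut D Q \<iota> i)) \<and>
         (\<exists>!\<rho>. algebra_action (weyl_group (cartan D)) (QAq D Q \<iota>) \<rho> \<and>
            explicit_formulae D Q \<iota> (\<lambda>i. \<rho> (weyl_gen (cartan D) i)))"
proof (intro conjI allI)
  show "\<exists>!\<rho>. algebra_action (weyl_group (cartan D)) QA \<rho> \<and> explicit_formulae D Q \<iota> (\<lambda>i. \<rho> (weyl_gen (cartan D) i))"
    using weyl_group_action by (simp only: explicit_action_iff cong: conj_cong)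
qed (rule S_other S_aut_aut explicit_S weyl_group_action)+

end

theorem theorem5p2:
  fixes D :: "('i::finite, 'y::ab_group_add, 'x::ab_group_add) weyl_data"
    and Q :: "(qfield, 'k) module"
    and \<iota> :: "('i, 'y) atilde \<Rightarrow> 'k"
  assumes "gcm (cartan D)"
    and "symmetrized_by (cartan D) (symm D)"
    and "root_datum D"
    and "sign_system (cartan D) (eps D)"
    and "skew_field_of_fractions (Atilde D) Q \<iota>"
  shows "(\<forall>i. S_aut D Q \<iota> i =
            compose (carrier (QAq D Q \<iota>)) (gamma D Q \<iota> i (coroot D i)) (s_tilde D Q \<iota> i)) \<and>
         (\<forall>i. S_aut D Q \<iota> i \<in> alg_aut (QAq D Q \<iota>)) \<and>
         explicit_formulae D Q \<iota> (S_aut D Q \<iota>) \<and>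
         (\<exists>!\<rho>. algebra_action (weyl_group (cartan D)) (QAq D Q \<iota>) \<rho> \<and>
            (\<forall>i. \<rho> (weyl_gen (cartan D) i) = S_aut D Q \<iota> i)) \<and>
         (\<exists>!\<rho>. algebra_action (weyl_group (cartan D)) (QAq D Q \<iota>) \<rho> \<and>
            explicit_formulae D Q \<iota> (\<lambda>i. \<rho> (weyl_gen (cartan D) i)))"
proof -
  note sf = assms(5)[unfolded skew_field_of_fractions_def]
  have Q: "assoc_algebra Q" "\<one>\<^bsub>Q\<^esub> \<noteq> \<zero>\<^bsub>Q\<^esub>" "Units Q = carrier Q - {\<zero>\<^bsub>Q\<^esub>}" using sf by blast+
  have "fg_free TYPE('y)" using assms(3) by (simp add: root_datum_def)
  then have "countable (carrier Q)" by (rule skew_field_countable[OF assms(5) countable_Atilde])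
  \<comment> \<open>\<open>to_nat_on\<close> maps onto all natural numbers only for an infinite
    countable set; the scalars already make the carrier infinite.\<close>
  moreover have "infinite (carrier Q)" by (rule assoc_algebra_infinite(1)[OF Q(1,2) infinite_qfield])
  ultimately have \<beta>: "bij_betw (to_nat_on (carrier Q)) (carrier Q) UNIV" by (rule to_nat_on_infinite)
  show ?thesis
  proof (rule skew_field_transport[OF assoc_algebraD(1)[OF Q(1)] Q(2,3) \<beta>])
    fix dv iv ti pl mi um
    assume t: "class.division_ring dv iv (to_nat_on (carrier Q) \<one>\<^bsub>Q\<^esub>) ti pl (to_nat_on (carrier Q) \<zero>\<^bsub>Q\<^esub>) mi um"
      "\<And>x y. x \<in> carrier Q \<Longrightarrow> y \<in> carrier Q \<Longrightarrow> to_nat_on (carrier Q) (x \<oplus>\<^bsub>Q\<^esub> y) = pl (to_nat_on (carrier Q) x) (to_nat_on (carrier Q) y)"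
      "\<And>x y. x \<in> carrier Q \<Longrightarrow> y \<in> carrier Q \<Longrightarrow> to_nat_on (carrier Q) (x \<otimes>\<^bsub>Q\<^esub> y) = ti (to_nat_on (carrier Q) x) (to_nat_on (carrier Q) y)"
    show ?thesis
      by (rule weyl_torus.conclusion, rule weyl_torus.intro) (rule assms \<beta> t; assumption)+
  qed
qed

end
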